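(* Let $(M,\mathcal{O})$ be a formal manifold, let $\mathcal{F}$ be a sheaf of $\mathcal{O}$-modules, let $E$ be a quasi-complete LCS, and let $\{U_\gamma\}_{\gamma\in\Gamma}$ be an open cover of $M$. Then the linear map $$\bigoplus_{\gamma\in\Gamma}\mathrm{D}_c^{-\infty}(U_\gamma;\mathcal{F};E)\to\mathrm{D}_c^{-\infty}(M;\mathcal{F};E),\qquad\{\eta_\gamma\}_{\gamma\in\Gamma}\mapsto\sum_{\gamma\in\Gamma}\mathrm{ext}_{M,U_\gamma}(\eta_\gamma)$$ is continuous, open and surjective.
   Context: Formal manifolds. For a smooth manifold $N$ and $k\in\mathbb{N}$, $N^{(k)}$ is the locally ringed space $(N,\mathcal{O}_N^{(k)})$ over $\mathrm{Spec}(\mathbb{C})$ with $\mathcal{O}_N^{(k)}(U)=\mathrm{C}^\infty(U)[[y_1,\dots,y_k]]$ (complex-valued smooth functions). A formal manifold is a locally ringed space $(M,\mathcal{O})$ over $\mathrm{Spec}(\mathbb{C})$ with $M$ paracompact Hausdorff such that every point has an open neighborhood $U$ with $(U,\mathcal{O}|_U)\cong(\mathbb{R}^n)^{(k)}$ for some $n,k\in\mathbb{N}$. For $f\in\mathcal{O}(U)$, $f(a)\in\mathbb{C}$ is the residue of the germ of $f$ at $a$; $\underline{\mathcal{O}}$ is the quotient of $\mathcal{O}$ by the ideal sheaf of sections $f$ with $f(a)=0$ for all $a$, and $(M,\underline{\mathcal{O}})$ is a smooth manifold with its sheaf of complex-valued smooth functions. LCS. An LCS is a locally convex topological vector space over $\mathbb{C}$,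 possibly non-Hausdorff; (quasi-)complete LCS are by convention Hausdorff. $\mathcal{L}_b(X,Y)$ is the space of continuous linear maps with the strong topology (uniform convergence on bounded sets). Inductive limits and direct sums are in the category of LCS. Smooth topology. A $\mathbb{C}$-linear sheaf homomorphism $D:\mathcal{F}|_U\to\underline{\mathcal{O}}|_U$ has order $\le r$ if for every open $W\subset U$ and $f_0,\dots,f_r\in\mathcal{O}(W)$, $[\cdots[[D|_W,f_0],f_1],\dots,f_r]=0$, where $[D,f]=D\circ f-f\circ D$; it is a differential operator if it is locally of finite order. $\mathrm{Diff}_c(\mathcal{F}|_U,\underline{\mathcal{O}}|_U)$ is the space of differential operators with compact support (complement of the largest open set on which $D$ is zero). $\mathcal{F}(U)$ has the topology defined by the seminorms $|u|_D=\sup_{a\in U}|(D(u))(a)|$, $D\in\mathrm{Diff}_c(\mathcal{F}|_U,\underline{\mathcal{O}}|_U)$. Distributions. For $K\subset U$ compact, $\mathcal{F}_K(U)\subset\mathcal{F}(U)$ is the subspace of sections supported in $K$ (subspace topology); $\mathcal{F}_c(U)=\varinjlim_K\mathcal{F}_K(U)$. $\mathrm{D}^{-\infty}(U;\mathcal{F};E)=\mathcal{L}_b(\mathcal{F}_c(U),E)$; together with the transposes of extension by zero as restriction maps, this is a sheaf in $U$. $\mathrm{D}_K^{-\infty}(U;\mathcal{F};E)$ is the subspace of sections of this sheaf over $U$ supported in the compact set $K$ (subspace topology), and $\mathrm{D}_c^{-\infty}(U;\mathcal{F};E)=\varinjlim_K\mathrm{D}_K^{-\infty}(U;\mathcal{F};E)$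 has the inductive limit topology. $\mathrm{ext}_{M,U}:\mathrm{D}_c^{-\infty}(U;\mathcal{F};E)\to\mathrm{D}_c^{-\infty}(M;\mathcal{F};E)$ is extension by zero of compactly supported sections of this sheaf. *)

theory Defs
  imports "HOL-Analysis.Analysis" "HOL-Algebra.Algebra" "HOL-Algebra.Algebraic_Closure_Type" "HOL-Library.Multiset"
begin

section \<open>Complex vector spaces and locally convex spaces\<close>

abbreviation complex_field :: "complex ring" ("\<C>") where
  "\<C> \<equiv> ring_of_type_algebra"

definition linear_map ::
  "(complex, 'v, 'm) module_scheme \<Rightarrow> (complex, 'w, 'n) module_scheme \<Rightarrow> ('v \<Rightarrow> 'w) \<Rightarrow> bool" where
  "linear_map V W f \<longleftrightarrow>
     f \<in> carrier V \<rightarrow> carrier W \<and>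
     (\<forall>x\<in>carrier V. \<forall>y\<in>carrier V. f (x \<oplus>\<^bsub>V\<^esub> y) = f x \<oplus>\<^bsub>W\<^esub> f y) \<and>
     (\<forall>c. \<forall>x\<in>carrier V. f (c \<odot>\<^bsub>V\<^esub> x) = c \<odot>\<^bsub>W\<^esub> f x)"

record 'v tvs = "(complex, 'v) module" +
  top_of :: "'v topology"

text \<open>The ring operations \<open>mult\<close> and \<open>one\<close> that a record of type \<^typ>\<open>'v tvs\<close> inherits from
  \<open>module\<close> play no role for modules.\<close>

definition with_topology :: "(complex, 'v) module \<Rightarrow> 'v topology \<Rightarrow> 'v tvs" where
  "with_topology M T = module.extend M (tvs.fields T)"

definition convex_in :: "(complex, 'v, 'm) module_scheme \<Rightarrow> 'v set \<Rightarrow> bool" where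
  "convex_in V C \<longleftrightarrow>
     (\<forall>x\<in>C. \<forall>y\<in>C. \<forall>t. 0 \<le> t \<and> t \<le> 1 \<longrightarrow>
        complex_of_real (1 - t) \<odot>\<^bsub>V\<^esub> x \<oplus>\<^bsub>V\<^esub> complex_of_real t \<odot>\<^bsub>V\<^esub> y \<in> C)"

definition lc_topology :: "(complex, 'v, 'm) module_scheme \<Rightarrow> 'v topology \<Rightarrow> bool" where
  "lc_topology V T \<longleftrightarrow>
     topspace T = carrier V \<and>
     continuous_map (prod_topology T T) T (\<lambda>(x, y). x \<oplus>\<^bsub>V\<^esub> y) \<and>
     continuous_map (prod_topology euclidean T) T (\<lambda>(c, x). c \<odot>\<^bsub>V\<^esub> x) \<and>
     (\<forall>N. openin T N \<and> \<zero>\<^bsub>V\<^esub> \<in> N \<longrightarrow>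
        (\<exists>C. openin T C \<and> \<zero>\<^bsub>V\<^esub> \<in> C \<and> C \<subseteq> N \<and> convex_in V C))"

definition lcs :: "'v tvs \<Rightarrow> bool" where
  "lcs V \<longleftrightarrow> Module.module \<C> V \<and> lc_topology V (top_of V)"

definition bounded_in :: "'v tvs \<Rightarrow> 'v set \<Rightarrow> bool" where
  "bounded_in V B \<longleftrightarrow>
     B \<subseteq> carrier V \<and>
     (\<forall>N. openin (top_of V) N \<and> \<zero>\<^bsub>V\<^esub> \<in> N \<longrightarrow>
        (\<exists>r>0. \<forall>c. r \<le> cmod c \<longrightarrow> B \<subseteq> (\<lambda>x. c \<odot>\<^bsub>V\<^esub> x) ` N))"

definition cauchy_filter_in :: "'v tvs \<Rightarrow> 'v filter \<Rightarrow> bool" where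
  "cauchy_filter_in V \<Phi> \<longleftrightarrow>
     (\<forall>N. openin (top_of V) N \<and> \<zero>\<^bsub>V\<^esub> \<in> N \<longrightarrow>
        (\<exists>A\<subseteq>carrier V. (\<forall>\<^sub>F x in \<Phi>. x \<in> A) \<and> (\<forall>x\<in>A. \<forall>y\<in>A. x \<ominus>\<^bsub>V\<^esub> y \<in> N)))"

definition quasi_complete_lcs :: "'v tvs \<Rightarrow> bool" where
  "quasi_complete_lcs V \<longleftrightarrow>
     lcs V \<and> Hausdorff_space (top_of V) \<and>
     (\<forall>B. closedin (top_of V) B \<and> bounded_in V B \<longrightarrow>
        (\<forall>\<Phi>. \<Phi> \<noteq> bot \<and> (\<forall>\<^sub>F x in \<Phi>. x \<in> B) \<and> cauchy_filter_in V \<Phi> \<longrightarrow>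
           (\<exists>l\<in>B. limitin (top_of V) (\<lambda>x. x) l \<Phi>)))"

text \<open>The translation invariant topology for which the filter base \<open>\<N>\<close> is a base of
  neighbourhoods of zero.\<close>

definition nhds_topology :: "(complex, 'v, 'm) module_scheme \<Rightarrow> 'v set set \<Rightarrow> 'v topology" where
  "nhds_topology M \<N> =
     topology (\<lambda>S. S \<subseteq> carrier M \<and> (\<forall>x\<in>S. \<exists>N\<in>\<N>. {y \<in> carrier M. y \<ominus>\<^bsub>M\<^esub> x \<in> N} \<subseteq> S))"

lemma openin_nhds_topology:
  assumes "\<And>A B. A \<in> \<N> \<Longrightarrow> B \<in> \<N> \<Longrightarrow> \<exists>C\<in>\<N>. C \<subseteq> A \<inter> B"
  shows "openin (nhds_topology V \<N>) S \<longleftrightarrow>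
    S \<subseteq> carrier V \<and> (\<forall>x\<in>S. \<exists>N\<in>\<N>. {y \<in> carrier V. y \<ominus>\<^bsub>V\<^esub> x \<in> N} \<subseteq> S)"
proof -
  let ?P = "\<lambda>S. S \<subseteq> carrier V \<and> (\<forall>x\<in>S. \<exists>N\<in>\<N>. {y \<in> carrier V. y \<ominus>\<^bsub>V\<^esub> x \<in> N} \<subseteq> S)"
  have "?P (S \<inter> T)" if S: "?P S" and T: "?P T" for S T
  proof (intro conjI ballI)
    fix x assume "x \<in> S \<inter> T"
    then obtain A B where A: "A \<in> \<N>" "{y \<in> carrier V. y \<ominus>\<^bsub>V\<^esub> x \<in> A} \<subseteq> S"
      and B: "B \<in> \<N>" "{y \<in> carrier V. y \<ominus>\<^bsub>V\<^esub> x \<in> B} \<subseteq> T" using S T by blast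
    obtain C where "C \<in> \<N>" "C \<subseteq> A \<inter> B" using assms[OF A(1) B(1)] by blast
    then show "\<exists>N\<in>\<N>. {y \<in> carrier V. y \<ominus>\<^bsub>V\<^esub> x \<in> N} \<subseteq> S \<inter> T" using A B by (intro bexI[of _ C]) auto
  qed (use S in auto)
  moreover have "?P (\<Union>\<K>)" if \<K>: "\<forall>K\<in>\<K>. ?P K" for \<K>
  proof (intro conjI ballI)
    fix x assume "x \<in> \<Union>\<K>"
    then obtain K where K: "K \<in> \<K>" "x \<in> K" by blast
    then obtain N where "N \<in> \<N>" "{y \<in> carrier V. y \<ominus>\<^bsub>V\<^esub> x \<in> N} \<subseteq> K" using \<K> by blast
    then show "\<exists>N\<in>\<N>. {y \<in> carrier V. y \<ominus>\<^bsub>V\<^esub> x \<in> N} \<subseteq> \<Union>\<K>" using K by (intro bexI[of _ N]) auto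
  qed (use \<K> in auto)
  ultimately have "istopology ?P" unfolding istopology_def by blast
  then show ?thesis unfolding nhds_topology_def by (simp add: topology_inverse')
qed

definition seminorm_nhds ::
  "(complex, 'v, 'm) module_scheme \<Rightarrow> ('v \<Rightarrow> real) set \<Rightarrow> 'v set set" where
  "seminorm_nhds M P =
     {{x \<in> carrier M. \<forall>p\<in>Q. p x < \<epsilon>} | Q \<epsilon>. finite Q \<and> Q \<subseteq> P \<and> 0 < \<epsilon>}"

lemma seminorm_nhds_base:
  assumes "A \<in> seminorm_nhds V P" "B \<in> seminorm_nhds V P"
  shows "\<exists>C\<in>seminorm_nhds V P. C \<subseteq> A \<inter> B"
proof -
  obtain Q d R e where Q: "A = {x \<in> carrier V. \<forall>p\<in>Q. p x < d}" "finite Q" "Q \<subseteq> P" "0 < d"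
    and R: "B = {x \<in> carrier V. \<forall>p\<in>R. p x < e}" "finite R" "R \<subseteq> P" "0 < e"
    using assms unfolding seminorm_nhds_def by blast
  have "{x \<in> carrier V. \<forall>p\<in>Q \<union> R. p x < min d e} \<in> seminorm_nhds V P"
    unfolding seminorm_nhds_def using Q R
    by (intro CollectI exI[of _ "Q \<union> R"] exI[of _ "min d e"]) auto
  then show ?thesis unfolding Q(1) R(1) by (rule bexI[rotated]) auto
qed

definition seminorm_topology ::
  "(complex, 'v, 'm) module_scheme \<Rightarrow> ('v \<Rightarrow> real) set \<Rightarrow> 'v topology" where
  "seminorm_topology M P = nhds_topology M (seminorm_nhds M P)"

text \<open>The finest locally convex topology on \<open>M\<close> for which all maps \<open>f i\<close> are continuous: the
  supremum of all locally convex topologies with this property.\<close>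

definition lc_final_topology ::
  "(complex, 'v, 'm) module_scheme \<Rightarrow> 'i set \<Rightarrow> ('i \<Rightarrow> 'x topology) \<Rightarrow> ('i \<Rightarrow> 'x \<Rightarrow> 'v) \<Rightarrow> 'v topology"
  where
  "lc_final_topology M I T f =
     topology_generated_by
       {S. \<exists>\<tau>. lc_topology M \<tau> \<and> (\<forall>i\<in>I. continuous_map (T i) \<tau> (f i)) \<and> openin \<tau> S}"

lemma lc_topology_indiscrete:
  assumes "Module.module \<C> V"
  shows "lc_topology V (topology_generated_by {carrier V})"
proof -
  interpret Module.module \<C> V by fact
  let ?T = "topology_generated_by {carrier V}"
  have C: "carrier (\<C>) = UNIV" by (simp add: ring_of_type_algebra_def)
  have sp: "topspace ?T = carrier V" by simp
  have op: "U = {} \<or> U = carrier V" if "openin ?T U" for U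
    using that[unfolded openin_topology_generated_by_iff]
    by (induction rule: generate_topology_on.induct) (blast, blast, blast, blast)
  have cm: "continuous_map Z ?T f" if "f \<in> topspace Z \<rightarrow> carrier V" for Z :: "'z topology" and f
    unfolding continuous_map_def
  proof (intro conjI allI impI)
    fix U assume "openin ?T U"
    then consider "U = {}" | "U = carrier V" using op by blast
    then show "openin Z {x \<in> topspace Z. f x \<in> U}"
    proof cases
      case 2
      then have "{x \<in> topspace Z. f x \<in> U} = topspace Z" using that by auto
      then show ?thesis by simp
    qed simp
  qed (use that in simp)
  show ?thesis
    unfolding lc_topology_def
  proof (intro conjI allI impI)
    show "continuous_map (prod_topology ?T ?T) ?T (\<lambda>(x, y). x \<oplus>\<^bsub>V\<^esub> y)"
      by (rule cm) auto
    show "continuous_map (prod_topology euclidean ?T) ?T (\<lambda>(c, x). c \<odot>\<^bsub>V\<^esub> x)"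
      by (rule cm) (auto simp: C)
    fix N assume "openin ?T N \<and> \<zero>\<^bsub>V\<^esub> \<in> N"
    then have "openin ?T N" "N = carrier V" using op by auto
    then show "\<exists>C. openin ?T C \<and> \<zero>\<^bsub>V\<^esub> \<in> C \<and> C \<subseteq> N \<and> convex_in V C"
      by (intro exI[of _ N]) (auto simp: convex_in_def C)
  qed (rule sp)
qed

lemma lc_topology_final:
  fixes V :: "(complex, 'v) module"
  assumes "Module.module \<C> V" and f: "\<And>i. i \<in> I \<Longrightarrow> f i \<in> topspace (T i) \<rightarrow> carrier V"
  shows "lc_topology V (lc_final_topology V I T f)"
proof -
  interpret Module.module \<C> V by fact
  define \<T> where "\<T> = {\<tau>. lc_topology V \<tau> \<and> (\<forall>i\<in>I. continuous_map (T i) \<tau> (f i))}"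
  define \<S> where "\<S> = {S. \<exists>\<tau>\<in>\<T>. openin \<tau> S}"
  let ?F = "topology_generated_by \<S>"
  have F: "lc_final_topology V I T f = ?F"
    unfolding lc_final_topology_def \<S>_def \<T>_def
    by (rule arg_cong[where f = topology_generated_by]) blast
  have sp1: "topspace \<tau> = carrier V" if "\<tau> \<in> \<T>" for \<tau>
    using that by (auto simp: \<T>_def lc_topology_def)
  have ind: "topology_generated_by {carrier V} \<in> \<T>"
    unfolding \<T>_def
  proof (intro CollectI conjI ballI)
    show "lc_topology V (topology_generated_by {carrier V})" by (rule lc_topology_indiscrete) fact
    fix i assume "i \<in> I"
    then show "continuous_map (T i) (topology_generated_by {carrier V}) (f i)"
      using f by (intro continuous_on_generated_topo) (auto simp: vimage_def Int_def Pi_iff conj_commute cong: conj_cong)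
  qed
  have sp: "topspace ?F = carrier V"
  proof -
    have "\<Union>\<S> \<subseteq> carrier V" unfolding \<S>_def using sp1 openin_subset by fastforce
    moreover have "carrier V \<in> \<S>" unfolding \<S>_def using ind topology_generated_by_Basis[of "carrier V" "{carrier V}"] by blast
    ultimately show ?thesis by auto
  qed
  have fin: "openin ?F S" if "\<tau> \<in> \<T>" "openin \<tau> S" for \<tau> S
    using that by (intro topology_generated_by_Basis) (auto simp: \<S>_def)
  have idc: "continuous_map ?F \<tau> (\<lambda>x. x)" if "\<tau> \<in> \<T>" for \<tau>
    unfolding continuous_map_def
  proof (intro conjI allI impI)
    fix U assume U: "openin \<tau> U"
    then have "{x \<in> topspace ?F. x \<in> U} = U" using sp sp1[OF that] openin_subset by fastforce
    then show "openin ?F {x \<in> topspace ?F. x \<in> U}" using fin[OF that U] by simp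
  qed (use sp sp1[OF that] in auto)
  have into: "continuous_map Z ?F g" if "\<And>\<tau>. \<tau> \<in> \<T> \<Longrightarrow> continuous_map Z \<tau> g" for Z :: "'z topology" and g
  proof (rule continuous_on_generated_topo)
    fix U assume "U \<in> \<S>"
    then obtain \<tau> where "\<tau> \<in> \<T>" "openin \<tau> U" by (auto simp: \<S>_def)
    then have "openin Z {x \<in> topspace Z. g x \<in> U}" using that by (auto simp: continuous_map_def)
    then show "openin Z (g -` U \<inter> topspace Z)" by (simp add: vimage_def Int_def conj_commute)
  next
    have "g \<in> topspace Z \<rightarrow> carrier V" using that[OF ind] by (auto simp: continuous_map_def)
    then show "g ` topspace Z \<subseteq> \<Union>\<S>" using sp by auto
  qed
  have conv: "\<exists>C. openin ?F C \<and> \<zero>\<^bsub>V\<^esub> \<in> C \<and> C \<subseteq> N \<and> convex_in V C"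
    if "generate_topology_on \<S> N" "\<zero>\<^bsub>V\<^esub> \<in> N" for N
    using that
  proof (induction rule: generate_topology_on.induct)
    case (Int a b)
    then obtain A B where "openin ?F A \<and> \<zero>\<^bsub>V\<^esub> \<in> A \<and> A \<subseteq> a \<and> convex_in V A"
      "openin ?F B \<and> \<zero>\<^bsub>V\<^esub> \<in> B \<and> B \<subseteq> b \<and> convex_in V B" by auto
    then show ?case by (intro exI[of _ "A \<inter> B"]) (auto simp: convex_in_def)
  next
    case (UN K)
    then show ?case by (meson Union_iff Union_upper order_trans)
  next
    case (Basis s)
    then obtain \<tau> where \<tau>: "\<tau> \<in> \<T>" "openin \<tau> s" by (auto simp: \<S>_def)
    then have "lc_topology V \<tau>" by (auto simp: \<T>_def)
    then show ?case using \<tau> Basis(2) fin unfolding lc_topology_def by meson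
  qed simp
  have add: "continuous_map (prod_topology ?F ?F) ?F (\<lambda>(x, y). x \<oplus>\<^bsub>V\<^esub> y)"
  proof (rule into)
    fix \<tau> assume \<tau>: "\<tau> \<in> \<T>"
    then have c: "continuous_map (prod_topology \<tau> \<tau>) \<tau> (\<lambda>(x, y). x \<oplus>\<^bsub>V\<^esub> y)"
      by (auto simp: \<T>_def lc_topology_def)
    have "continuous_map (prod_topology ?F ?F) (prod_topology \<tau> \<tau>) (\<lambda>(x, y). (x, y))"
      using idc[OF \<tau>] by (subst continuous_map_prod_top) simp
    from continuous_map_compose[OF this c]
    show "continuous_map (prod_topology ?F ?F) \<tau> (\<lambda>(x, y). x \<oplus>\<^bsub>V\<^esub> y)"
      by (simp add: comp_def case_prod_unfold)
  qed
  have smult: "continuous_map (prod_topology euclidean ?F) ?F (\<lambda>(c, x). c \<odot>\<^bsub>V\<^esub> x)"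
  proof (rule into)
    fix \<tau> assume \<tau>: "\<tau> \<in> \<T>"
    then have c: "continuous_map (prod_topology euclidean \<tau>) \<tau> (\<lambda>(c, x). c \<odot>\<^bsub>V\<^esub> x)"
      by (auto simp: \<T>_def lc_topology_def)
    have "continuous_map (prod_topology euclidean ?F) (prod_topology euclidean \<tau>) (\<lambda>(x, y). (x, y))"
      using idc[OF \<tau>] by (subst continuous_map_prod_top) simp
    from continuous_map_compose[OF this c]
    show "continuous_map (prod_topology euclidean ?F) \<tau> (\<lambda>(c, x). c \<odot>\<^bsub>V\<^esub> x)"
      by (simp add: comp_def case_prod_unfold)
  qed
  show ?thesis
    unfolding F lc_topology_def
    using sp add smult conv by (auto simp: openin_topology_generated_by_iff)
qed

definition tvs_subspace :: "'v tvs \<Rightarrow> 'v set \<Rightarrow> 'v tvs" where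
  "tvs_subspace V A = V\<lparr>carrier := A, top_of := subtopology (top_of V) A\<rparr>"

text \<open>The inductive limit of an upwards directed family of subspaces of \<open>V\<close>; its underlying
  vector space is the union.\<close>

definition tvs_union :: "'v tvs \<Rightarrow> 'v set set \<Rightarrow> 'v tvs" where
  "tvs_union V \<A> =
     V\<lparr>carrier := \<Union>\<A>,
       top_of := lc_final_topology (V\<lparr>carrier := \<Union>\<A>\<rparr>) \<A>
                   (\<lambda>A. top_of (tvs_subspace V A)) (\<lambda>A x. x)\<rparr>"

definition direct_sum_module :: "'i set \<Rightarrow> ('i \<Rightarrow> 'v tvs) \<Rightarrow> (complex, 'i \<Rightarrow> 'v) module" where
  "direct_sum_module I V =
     \<lparr>carrier = {x \<in> (\<Pi>\<^sub>E i\<in>I. carrier (V i)). finite {i \<in> I. x i \<noteq> \<zero>\<^bsub>V i\<^esub>}},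
      monoid.mult = undefined, monoid.one = undefined,
      ring.zero = (\<lambda>i\<in>I. \<zero>\<^bsub>V i\<^esub>),
      ring.add = (\<lambda>x y. \<lambda>i\<in>I. x i \<oplus>\<^bsub>V i\<^esub> y i),
      module.smult = (\<lambda>c x. \<lambda>i\<in>I. c \<odot>\<^bsub>V i\<^esub> x i)\<rparr>"

definition direct_sum :: "'i set \<Rightarrow> ('i \<Rightarrow> 'v tvs) \<Rightarrow> ('i \<Rightarrow> 'v) tvs" where
  "direct_sum I V =
     with_topology (direct_sum_module I V)
       (lc_final_topology (direct_sum_module I V) I (\<lambda>i. top_of (V i))
          (\<lambda>i v. \<lambda>j\<in>I. if j = i then v else \<zero>\<^bsub>V j\<^esub>))"

text \<open>Continuous linear maps are represented by functions that are \<^const>\<open>undefined\<close> outside the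
  carrier of the domain.\<close>

definition continuous_linear_maps :: "'v tvs \<Rightarrow> 'w tvs \<Rightarrow> (complex, 'v \<Rightarrow> 'w) module" where
  "continuous_linear_maps V W =
     \<lparr>carrier = {\<eta> \<in> extensional (carrier V).
                   linear_map V W \<eta> \<and> continuous_map (top_of V) (top_of W) \<eta>},
      monoid.mult = undefined, monoid.one = undefined,
      ring.zero = (\<lambda>x\<in>carrier V. \<zero>\<^bsub>W\<^esub>),
      ring.add = (\<lambda>\<eta> \<theta>. \<lambda>x\<in>carrier V. \<eta> x \<oplus>\<^bsub>W\<^esub> \<theta> x),
      module.smult = (\<lambda>c \<eta>. \<lambda>x\<in>carrier V. c \<odot>\<^bsub>W\<^esub> \<eta> x)\<rparr>"

definition strong_nhds :: "'v tvs \<Rightarrow> 'w tvs \<Rightarrow> ('v \<Rightarrow> 'w) set set" where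
  "strong_nhds V W =
     {{\<eta> \<in> carrier (continuous_linear_maps V W). \<eta> ` B \<subseteq> N} | B N.
        bounded_in V B \<and> openin (top_of W) N \<and> \<zero>\<^bsub>W\<^esub> \<in> N}"

lemma strong_nhds_base:
  assumes "A \<in> strong_nhds V W" "B \<in> strong_nhds V W"
  shows "\<exists>C\<in>strong_nhds V W. C \<subseteq> A \<inter> B"
proof -
  obtain H N K L where H: "A = {\<eta> \<in> carrier (continuous_linear_maps V W). \<eta> ` H \<subseteq> N}"
      "bounded_in V H" "openin (top_of W) N" "\<zero>\<^bsub>W\<^esub> \<in> N"
    and K: "B = {\<eta> \<in> carrier (continuous_linear_maps V W). \<eta> ` K \<subseteq> L}"
      "bounded_in V K" "openin (top_of W) L" "\<zero>\<^bsub>W\<^esub> \<in> L"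
    using assms unfolding strong_nhds_def by blast
  have "bounded_in V (H \<union> K)"
    unfolding bounded_in_def
  proof (intro conjI allI impI)
    show "H \<union> K \<subseteq> carrier V" using H(2) K(2) by (auto simp: bounded_in_def)
    fix J assume "openin (top_of V) J \<and> \<zero>\<^bsub>V\<^esub> \<in> J"
    then obtain r s where "r > 0" "\<forall>c. r \<le> cmod c \<longrightarrow> H \<subseteq> (\<lambda>x. c \<odot>\<^bsub>V\<^esub> x) ` J"
      "s > 0" "\<forall>c. s \<le> cmod c \<longrightarrow> K \<subseteq> (\<lambda>x. c \<odot>\<^bsub>V\<^esub> x) ` J"
      using H(2) K(2) unfolding bounded_in_def by meson
    then show "\<exists>r>0. \<forall>c. r \<le> cmod c \<longrightarrow> H \<union> K \<subseteq> (\<lambda>x. c \<odot>\<^bsub>V\<^esub> x) ` J"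
      by (intro exI[of _ "max r s"]) auto
  qed
  then have "{\<eta> \<in> carrier (continuous_linear_maps V W). \<eta> ` (H \<union> K) \<subseteq> N \<inter> L} \<in> strong_nhds V W"
    unfolding strong_nhds_def using H K
    by (intro CollectI exI[of _ "H \<union> K"] exI[of _ "N \<inter> L"]) auto
  then show ?thesis unfolding H(1) K(1) by (rule bexI[rotated]) auto
qed

definition Lb :: "'v tvs \<Rightarrow> 'w tvs \<Rightarrow> ('v \<Rightarrow> 'w) tvs" where
  "Lb V W =
     with_topology (continuous_linear_maps V W)
       (nhds_topology (continuous_linear_maps V W) (strong_nhds V W))"


section \<open>Sheaves of modules and locally ringed spaces\<close>

record ('a, 'r, 's) presheaf =
  sec :: "'a set \<Rightarrow> ('r, 's) module"
  res :: "'a set \<Rightarrow> 'a set \<Rightarrow> 's \<Rightarrow> 's"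

text \<open>\<open>res P U V\<close> is the restriction map from sections over \<open>U\<close> to sections over \<open>V \<subseteq> U\<close>. The gluing
  axiom includes the empty cover of the empty set.\<close>

definition sheaf :: "'a topology \<Rightarrow> ('a, 'r, 's) presheaf \<Rightarrow> bool" where
  "sheaf M P \<longleftrightarrow>
     (\<forall>U. openin M U \<longrightarrow> abelian_group (sec P U)) \<and>
     (\<forall>U V. openin M U \<and> openin M V \<and> V \<subseteq> U \<longrightarrow>
        res P U V \<in> hom (add_monoid (sec P U)) (add_monoid (sec P V))) \<and>
     (\<forall>U. openin M U \<longrightarrow> (\<forall>s\<in>carrier (sec P U). res P U U s = s)) \<and>
     (\<forall>U V W. openin M U \<and> openin M V \<and> openin M W \<and> W \<subseteq> V \<and> V \<subseteq> U \<longrightarrow>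
        (\<forall>s\<in>carrier (sec P U). res P V W (res P U V s) = res P U W s)) \<and>
     (\<forall>\<V> t. (\<forall>V\<in>\<V>. openin M V \<and> t V \<in> carrier (sec P V)) \<and>
        (\<forall>V\<in>\<V>. \<forall>W\<in>\<V>. res P V (V \<inter> W) (t V) = res P W (V \<inter> W) (t W)) \<longrightarrow>
        (\<exists>!s. s \<in> carrier (sec P (\<Union>\<V>)) \<and> (\<forall>V\<in>\<V>. res P (\<Union>\<V>) V s = t V)))"

definition sheaf_of_complex_algebras :: "'a topology \<Rightarrow> ('a, complex, 'f) presheaf \<Rightarrow> bool" where
  "sheaf_of_complex_algebras M \<O> \<longleftrightarrow>
     sheaf M \<O> \<and>
     (\<forall>U. openin M U \<longrightarrow> Module.algebra \<C> (sec \<O> U)) \<and>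
     (\<forall>U V. openin M U \<and> openin M V \<and> V \<subseteq> U \<longrightarrow>
        res \<O> U V \<in> ring_hom (sec \<O> U) (sec \<O> V) \<and>
        linear_map (sec \<O> U) (sec \<O> V) (res \<O> U V))"

definition sheaf_of_modules ::
  "'a topology \<Rightarrow> ('a, complex, 'f) presheaf \<Rightarrow> ('a, 'f, 's) presheaf \<Rightarrow> bool" where
  "sheaf_of_modules M \<O> \<F> \<longleftrightarrow>
     sheaf M \<F> \<and>
     (\<forall>U. openin M U \<longrightarrow> Module.module (sec \<O> U) (sec \<F> U)) \<and>
     (\<forall>U V. openin M U \<and> openin M V \<and> V \<subseteq> U \<longrightarrow>
        (\<forall>f\<in>carrier (sec \<O> U). \<forall>s\<in>carrier (sec \<F> U).
           res \<F> U V (f \<odot>\<^bsub>sec \<F> U\<^esub> s) = res \<O> U V f \<odot>\<^bsub>sec \<F> V\<^esub> res \<F> U V s))"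

text \<open>A germ is an equivalence class of pairs of an open neighbourhood and a section over it.\<close>

definition germ ::
  "'a topology \<Rightarrow> ('a, 'r, 's) presheaf \<Rightarrow> 'a \<Rightarrow> 'a set \<Rightarrow> 's \<Rightarrow> ('a set \<times> 's) set" where
  "germ M P a U s =
     {(V, t). openin M V \<and> a \<in> V \<and> t \<in> carrier (sec P V) \<and>
        (\<exists>W. openin M W \<and> a \<in> W \<and> W \<subseteq> U \<inter> V \<and> res P U W s = res P V W t)}"

definition germ_op ::
  "'a topology \<Rightarrow> ('a, 'r, 's) presheaf \<Rightarrow> 'a \<Rightarrow> (('r, 's) module \<Rightarrow> 's \<Rightarrow> 's \<Rightarrow> 's) \<Rightarrow>
   ('a set \<times> 's) set \<Rightarrow> ('a set \<times> 's) set \<Rightarrow> ('a set \<times> 's) set" where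
  "germ_op M P a opr g h =
     (\<Union>(U, s)\<in>g. \<Union>(V, t)\<in>h.
        germ M P a (U \<inter> V) (opr (sec P (U \<inter> V)) (res P U (U \<inter> V) s) (res P V (U \<inter> V) t)))"

text \<open>As for the operations of a quotient ring, the unions in \<^const>\<open>germ_op\<close> are unions of equal
  sets.\<close>

definition stalk :: "'a topology \<Rightarrow> ('a, 'r, 's) presheaf \<Rightarrow> 'a \<Rightarrow> ('a set \<times> 's) set ring" where
  "stalk M P a =
     \<lparr>carrier = {germ M P a U s | U s. openin M U \<and> a \<in> U \<and> s \<in> carrier (sec P U)},
      monoid.mult = germ_op M P a monoid.mult,
      monoid.one = germ M P a (topspace M) (monoid.one (sec P (topspace M))),
      ring.zero = germ M P a (topspace M) (ring.zero (sec P (topspace M))),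
      ring.add = germ_op M P a ring.add\<rparr>"

definition local_ring :: "'r ring \<Rightarrow> bool" where
  "local_ring R \<longleftrightarrow> cring R \<and> (\<exists>!I. maximalideal I R)"

definition locally_ringed_space :: "'a topology \<Rightarrow> ('a, complex, 'f) presheaf \<Rightarrow> bool" where
  "locally_ringed_space M \<O> \<longleftrightarrow>
     sheaf_of_complex_algebras M \<O> \<and> (\<forall>a\<in>topspace M. local_ring (stalk M \<O> a))"

text \<open>An isomorphism of locally ringed spaces over the complex numbers from \<open>(M, \<O>)\<close> to \<open>(N, \<P>)\<close>: a
  homeomorphism \<open>\<phi>\<close> with an isomorphism \<open>\<psi>\<close> from \<open>\<P>\<close> to the direct image of \<open>\<O>\<close>; that \<open>\<psi>\<close> induces
  local homomorphisms on stalks is automatic for isomorphisms.\<close>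

definition isomorphic_ringed_spaces ::
  "'a topology \<Rightarrow> ('a, complex, 'f) presheaf \<Rightarrow> 'b topology \<Rightarrow> ('b, complex, 'g) presheaf \<Rightarrow> bool" where
  "isomorphic_ringed_spaces M \<O> N \<P> \<longleftrightarrow>
     (\<exists>\<phi> \<psi>. homeomorphic_map M N \<phi> \<and>
        (\<forall>W. openin N W \<longrightarrow>
           \<psi> W \<in> ring_iso (sec \<P> W) (sec \<O> {x \<in> topspace M. \<phi> x \<in> W}) \<and>
           linear_map (sec \<P> W) (sec \<O> {x \<in> topspace M. \<phi> x \<in> W}) (\<psi> W)) \<and>
        (\<forall>V W. openin N V \<and> openin N W \<and> V \<subseteq> W \<longrightarrow>
           (\<forall>f\<in>carrier (sec \<P> W).
              \<psi> V (res \<P> W V f) =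
              res \<O> {x \<in> topspace M. \<phi> x \<in> W} {x \<in> topspace M. \<phi> x \<in> V} (\<psi> W f))))"


section \<open>Formal manifolds\<close>

definition partial_deriv :: "nat \<Rightarrow> ((nat \<Rightarrow> real) \<Rightarrow> complex) \<Rightarrow> (nat \<Rightarrow> real) \<Rightarrow> complex" where
  "partial_deriv i f x = vector_derivative (\<lambda>t. f (x(i := t))) (at (x i))"

text \<open>\<open>C_diff n W m f\<close>: on the open subset \<open>W\<close> of \<^term>\<open>Euclidean_space n\<close>, all iterated partial
  derivatives of \<open>f\<close> up to order \<open>m\<close> exist and are continuous.\<close>

fun C_diff :: "nat \<Rightarrow> (nat \<Rightarrow> real) set \<Rightarrow> nat \<Rightarrow> ((nat \<Rightarrow> real) \<Rightarrow> complex) \<Rightarrow> bool" where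
  "C_diff n W 0 f \<longleftrightarrow> continuous_map (subtopology (Euclidean_space n) W) euclidean f"
| "C_diff n W (Suc m) f \<longleftrightarrow>
     continuous_map (subtopology (Euclidean_space n) W) euclidean f \<and>
     (\<forall>i<n. (\<forall>x\<in>W. (\<lambda>t. f (x(i := t))) differentiable (at (x i))) \<and>
            C_diff n W m (partial_deriv i f))"

definition smooth_functions :: "nat \<Rightarrow> (nat \<Rightarrow> real) set \<Rightarrow> ((nat \<Rightarrow> real) \<Rightarrow> complex) set" where
  "smooth_functions n W = {f \<in> extensional W. \<forall>m. C_diff n W m f}"

text \<open>Monomials in the variables \<open>y\<^sub>0, \<dots>, y\<^sub>k\<^sub>-\<^sub>1\<close> are multisets of variable indices. A formal
  power series is the family of its coefficients.\<close>

definition monomials :: "nat \<Rightarrow> nat multiset set" where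
  "monomials k = {J. set_mset J \<subseteq> {..<k}}"

definition coefficients ::
  "nat \<Rightarrow> 'x set \<Rightarrow> (nat multiset \<Rightarrow> 'x \<Rightarrow> complex) \<Rightarrow> nat multiset \<Rightarrow> 'x \<Rightarrow> complex" where
  "coefficients k W F = (\<lambda>J\<in>monomials k. \<lambda>x\<in>W. F J x)"

definition formal_model ::
  "nat \<Rightarrow> nat \<Rightarrow> (nat \<Rightarrow> real, complex, nat multiset \<Rightarrow> (nat \<Rightarrow> real) \<Rightarrow> complex) presheaf" where
  "formal_model n k =
     \<lparr>sec = (\<lambda>W.
        \<lparr>carrier = (\<Pi>\<^sub>E J\<in>monomials k. smooth_functions n W),
         monoid.mult = (\<lambda>F G. coefficients k W (\<lambda>J x. \<Sum>A | A \<subseteq># J. F A x * G (J - A) x)),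
         monoid.one = coefficients k W (\<lambda>J x. if J = {#} then 1 else 0),
         ring.zero = coefficients k W (\<lambda>J x. 0),
         ring.add = (\<lambda>F G. coefficients k W (\<lambda>J x. F J x + G J x)),
         module.smult = (\<lambda>c F. coefficients k W (\<lambda>J x. c * F J x))\<rparr>),
      res = (\<lambda>W V F. coefficients k V F)\<rparr>"

definition paracompact_space :: "'a topology \<Rightarrow> bool" where
  "paracompact_space M \<longleftrightarrow>
     (\<forall>\<U>. (\<forall>U\<in>\<U>. openin M U) \<and> \<Union>\<U> = topspace M \<longrightarrow>
        (\<exists>\<V>. (\<forall>V\<in>\<V>. openin M V \<and> (\<exists>U\<in>\<U>. V \<subseteq> U)) \<and> \<Union>\<V> = topspace M \<and>
              locally_finite_in M \<V>))"

definition formal_manifold :: "'a topology \<Rightarrow> ('a, complex, 'f) presheaf \<Rightarrow> bool" where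
  "formal_manifold M \<O> \<longleftrightarrow>
     locally_ringed_space M \<O> \<and> paracompact_space M \<and> Hausdorff_space M \<and>
     (\<forall>a\<in>topspace M. \<exists>U n k. openin M U \<and> a \<in> U \<and>
        isomorphic_ringed_spaces (subtopology M U) \<O> (Euclidean_space n) (formal_model n k))"

text \<open>The value at \<open>a\<close> of a section \<open>f\<close> over \<open>U\<close>: the residue class of its germ, as an element of
  the residue field, which on a formal manifold is \<open>\<C>\<close>.\<close>

definition value_at ::
  "'a topology \<Rightarrow> ('a, complex, 'f) presheaf \<Rightarrow> 'a set \<Rightarrow> 'f \<Rightarrow> 'a \<Rightarrow> complex" where
  "value_at M \<O> U f a =
     (THE c. (THE I. maximalideal I (stalk M \<O> a)) +>\<^bsub>stalk M \<O> a\<^esub> germ M \<O> a U f =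
             (THE I. maximalideal I (stalk M \<O> a)) +>\<^bsub>stalk M \<O> a\<^esub>
               germ M \<O> a U (c \<odot>\<^bsub>sec \<O> U\<^esub> \<one>\<^bsub>sec \<O> U\<^esub>))"

text \<open>The quotient of \<open>\<O>\<close> by the ideal sheaf of sections all of whose values vanish. That ideal
  sheaf is the kernel of the evaluation homomorphism from \<open>\<O>\<close> to the sheaf of all complex functions,
  so the quotient sheaf is the image of evaluation: its sections are the functions
  that locally are of the form \<open>a \<mapsto> f(a)\<close>. It is a sheaf of \<open>\<O>\<close>-modules.\<close>

definition reduced_sheaf ::
  "'a topology \<Rightarrow> ('a, complex, 'f) presheaf \<Rightarrow> ('a, 'f, 'a \<Rightarrow> complex) presheaf" where
  "reduced_sheaf M \<O> =
     \<lparr>sec = (\<lambda>U.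
        \<lparr>carrier = {g \<in> extensional U. \<forall>a\<in>U. \<exists>V f. openin M V \<and> a \<in> V \<and> V \<subseteq> U \<and>
                      f \<in> carrier (sec \<O> V) \<and> (\<forall>b\<in>V. g b = value_at M \<O> V f b)},
         monoid.mult = (\<lambda>g h. \<lambda>a\<in>U. g a * h a),
         monoid.one = (\<lambda>a\<in>U. 1),
         ring.zero = (\<lambda>a\<in>U. 0),
         ring.add = (\<lambda>g h. \<lambda>a\<in>U. g a + h a),
         module.smult = (\<lambda>f g. \<lambda>a\<in>U. value_at M \<O> U f a * g a)\<rparr>),
      res = (\<lambda>U V g. restrict g V)\<rparr>"


section \<open>Differential operators and the smooth topology\<close>

text \<open>Sections of a sheaf of \<open>\<O>\<close>-modules as a complex vector space.\<close>

definition complex_sections ::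
  "('a, complex, 'f) presheaf \<Rightarrow> ('a, 'f, 's) presheaf \<Rightarrow> 'a set \<Rightarrow> (complex, 's) module" where
  "complex_sections \<O> \<F> U =
     \<lparr>carrier = carrier (sec \<F> U), monoid.mult = monoid.mult (sec \<F> U), monoid.one = monoid.one (sec \<F> U),
      ring.zero = ring.zero (sec \<F> U), ring.add = ring.add (sec \<F> U),
      module.smult = (\<lambda>c s. (c \<odot>\<^bsub>sec \<O> U\<^esub> \<one>\<^bsub>sec \<O> U\<^esub>) \<odot>\<^bsub>sec \<F> U\<^esub> s)\<rparr>"

definition linear_sheaf_hom ::
  "'a topology \<Rightarrow> ('a, complex, 'f) presheaf \<Rightarrow> ('a, 'f, 's) presheaf \<Rightarrow> ('a, 'f, 't) presheaf \<Rightarrow>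
   'a set \<Rightarrow> ('a set \<Rightarrow> 's \<Rightarrow> 't) \<Rightarrow> bool" where
  "linear_sheaf_hom M \<O> \<F> \<G> U D \<longleftrightarrow>
     (\<forall>W. openin M W \<and> W \<subseteq> U \<longrightarrow>
        linear_map (complex_sections \<O> \<F> W) (complex_sections \<O> \<G> W) (D W)) \<and>
     (\<forall>V W. openin M V \<and> openin M W \<and> V \<subseteq> W \<and> W \<subseteq> U \<longrightarrow>
        (\<forall>s\<in>carrier (sec \<F> W). D V (res \<F> W V s) = res \<G> W V (D W s)))"

text \<open>The commutator \<open>[D|\<^sub>W, f]\<close> with \<open>f \<in> \<O>(W)\<close>, as a family of maps indexed by the open subsets
  \<open>V\<close> of \<open>W\<close>.\<close>

definition commutator_with ::
  "('a, complex, 'f) presheaf \<Rightarrow> ('a, 'f, 's) presheaf \<Rightarrow> ('a, 'f, 't) presheaf \<Rightarrow>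
   'a set \<Rightarrow> ('a set \<Rightarrow> 's \<Rightarrow> 't) \<Rightarrow> 'f \<Rightarrow> ('a set \<Rightarrow> 's \<Rightarrow> 't)" where
  "commutator_with \<O> \<F> \<G> W D f =
     (\<lambda>V s. D V (res \<O> W V f \<odot>\<^bsub>sec \<F> V\<^esub> s) \<ominus>\<^bsub>sec \<G> V\<^esub> res \<O> W V f \<odot>\<^bsub>sec \<G> V\<^esub> D V s)"

definition zero_on ::
  "'a topology \<Rightarrow> ('a, 'f, 's) presheaf \<Rightarrow> ('a, 'f, 't) presheaf \<Rightarrow> 'a set \<Rightarrow>
   ('a set \<Rightarrow> 's \<Rightarrow> 't) \<Rightarrow> bool" where
  "zero_on M \<F> \<G> W D \<longleftrightarrow>
     (\<forall>V. openin M V \<and> V \<subseteq> W \<longrightarrow> (\<forall>s\<in>carrier (sec \<F> V). D V s = \<zero>\<^bsub>sec \<G> V\<^esub>))"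

definition order_le ::
  "'a topology \<Rightarrow> ('a, complex, 'f) presheaf \<Rightarrow> ('a, 'f, 's) presheaf \<Rightarrow> ('a, 'f, 't) presheaf \<Rightarrow>
   'a set \<Rightarrow> ('a set \<Rightarrow> 's \<Rightarrow> 't) \<Rightarrow> nat \<Rightarrow> bool" where
  "order_le M \<O> \<F> \<G> U D r \<longleftrightarrow>
     (\<forall>W fs. openin M W \<and> W \<subseteq> U \<and> length fs = Suc r \<and> set fs \<subseteq> carrier (sec \<O> W) \<longrightarrow>
        zero_on M \<F> \<G> W (foldl (commutator_with \<O> \<F> \<G> W) D fs))"

definition differential_operator ::
  "'a topology \<Rightarrow> ('a, complex, 'f) presheaf \<Rightarrow> ('a, 'f, 's) presheaf \<Rightarrow> ('a, 'f, 't) presheaf \<Rightarrow>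
   'a set \<Rightarrow> ('a set \<Rightarrow> 's \<Rightarrow> 't) \<Rightarrow> bool" where
  "differential_operator M \<O> \<F> \<G> U D \<longleftrightarrow>
     linear_sheaf_hom M \<O> \<F> \<G> U D \<and>
     (\<forall>a\<in>U. \<exists>V r. openin M V \<and> a \<in> V \<and> V \<subseteq> U \<and> order_le M \<O> \<F> \<G> V D r)"

definition operator_support ::
  "'a topology \<Rightarrow> ('a, 'f, 's) presheaf \<Rightarrow> ('a, 'f, 't) presheaf \<Rightarrow> 'a set \<Rightarrow>
   ('a set \<Rightarrow> 's \<Rightarrow> 't) \<Rightarrow> 'a set" where
  "operator_support M \<F> \<G> U D = U - \<Union>{V. openin M V \<and> V \<subseteq> U \<and> zero_on M \<F> \<G> V D}"

definition Diff_c ::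
  "'a topology \<Rightarrow> ('a, complex, 'f) presheaf \<Rightarrow> ('a, 'f, 's) presheaf \<Rightarrow> ('a, 'f, 't) presheaf \<Rightarrow>
   'a set \<Rightarrow> ('a set \<Rightarrow> 's \<Rightarrow> 't) set" where
  "Diff_c M \<O> \<F> \<G> U =
     {D. differential_operator M \<O> \<F> \<G> U D \<and> compactin M (operator_support M \<F> \<G> U D)}"

text \<open>Inserting \<open>0\<close> makes the supremum of non-negative numbers zero for empty \<open>U\<close>.\<close>

definition diff_seminorm :: "'a set \<Rightarrow> ('a set \<Rightarrow> 's \<Rightarrow> 'a \<Rightarrow> complex) \<Rightarrow> 's \<Rightarrow> real" where
  "diff_seminorm U D u = Sup (insert 0 ((\<lambda>a. cmod (D U u a)) ` U))"

definition smooth_sections ::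
  "'a topology \<Rightarrow> ('a, complex, 'f) presheaf \<Rightarrow> ('a, 'f, 's) presheaf \<Rightarrow> 'a set \<Rightarrow> 's tvs" where
  "smooth_sections M \<O> \<F> U =
     with_topology (complex_sections \<O> \<F> U)
       (seminorm_topology (complex_sections \<O> \<F> U)
          (diff_seminorm U ` Diff_c M \<O> \<F> (reduced_sheaf M \<O>) U))"


section \<open>Supports and distributions\<close>

definition support :: "'a topology \<Rightarrow> ('a, 'r, 's) presheaf \<Rightarrow> 'a set \<Rightarrow> 's \<Rightarrow> 'a set" where
  "support M P U s = U - \<Union>{V. openin M V \<and> V \<subseteq> U \<and> res P U V s = \<zero>\<^bsub>sec P V\<^esub>}"

definition supported_in ::
  "'a topology \<Rightarrow> ('a, 'r, 's) presheaf \<Rightarrow> 'a set \<Rightarrow> 'a set \<Rightarrow> 's set" where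
  "supported_in M P U K = {s \<in> carrier (sec P U). support M P U s \<subseteq> K}"

text \<open>For \<open>V\<close> a topology on the sections of \<open>P\<close> over \<open>U\<close>: the inductive limit, over all compact
  subsets \<open>K\<close> of \<open>U\<close>, of the subspaces of sections supported in \<open>K\<close>.\<close>

definition compactly_supported ::
  "'a topology \<Rightarrow> ('a, 'r, 's) presheaf \<Rightarrow> 'a set \<Rightarrow> 's tvs \<Rightarrow> 's tvs" where
  "compactly_supported M P U V =
     tvs_union V {supported_in M P U K | K. compactin M K \<and> K \<subseteq> U}"

text \<open>Extension by zero, from \<open>V\<close> to \<open>U \<supseteq> V\<close>, of a section whose support is closed in \<open>U\<close>.\<close>

definition ext_by_zero ::
  "'a topology \<Rightarrow> ('a, 'r, 's) presheaf \<Rightarrow> 'a set \<Rightarrow> 'a set \<Rightarrow> 's \<Rightarrow> 's" where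
  "ext_by_zero M P U V s =
     (THE t. t \<in> carrier (sec P U) \<and> res P U V t = s \<and>
        res P U (U - support M P V s) t = \<zero>\<^bsub>sec P (U - support M P V s)\<^esub>)"

definition smooth_sections_c ::
  "'a topology \<Rightarrow> ('a, complex, 'f) presheaf \<Rightarrow> ('a, 'f, 's) presheaf \<Rightarrow> 'a set \<Rightarrow> 's tvs" where
  "smooth_sections_c M \<O> \<F> U = compactly_supported M \<F> U (smooth_sections M \<O> \<F> U)"

definition distributions ::
  "'a topology \<Rightarrow> ('a, complex, 'f) presheaf \<Rightarrow> ('a, 'f, 's) presheaf \<Rightarrow> 'e tvs \<Rightarrow> 'a set \<Rightarrow>
   ('s \<Rightarrow> 'e) tvs" where
  "distributions M \<O> \<F> E U = Lb (smooth_sections_c M \<O> \<F> U) E"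

definition distribution_sheaf ::
  "'a topology \<Rightarrow> ('a, complex, 'f) presheaf \<Rightarrow> ('a, 'f, 's) presheaf \<Rightarrow> 'e tvs \<Rightarrow>
   ('a, complex, 's \<Rightarrow> 'e) presheaf" where
  "distribution_sheaf M \<O> \<F> E =
     \<lparr>sec = (\<lambda>U. module.truncate (distributions M \<O> \<F> E U)),
      res = (\<lambda>U V \<eta>. \<lambda>s\<in>carrier (smooth_sections_c M \<O> \<F> V). \<eta> (ext_by_zero M \<F> U V s))\<rparr>"

definition distributions_c ::
  "'a topology \<Rightarrow> ('a, complex, 'f) presheaf \<Rightarrow> ('a, 'f, 's) presheaf \<Rightarrow> 'e tvs \<Rightarrow> 'a set \<Rightarrow>
   ('s \<Rightarrow> 'e) tvs" where
  "distributions_c M \<O> \<F> E U =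
     compactly_supported M (distribution_sheaf M \<O> \<F> E) U (distributions M \<O> \<F> E U)"

definition dist_ext ::
  "'a topology \<Rightarrow> ('a, complex, 'f) presheaf \<Rightarrow> ('a, 'f, 's) presheaf \<Rightarrow> 'e tvs \<Rightarrow>
   'a set \<Rightarrow> 'a set \<Rightarrow> ('s \<Rightarrow> 'e) \<Rightarrow> ('s \<Rightarrow> 'e)" where
  "dist_ext M \<O> \<F> E U V = ext_by_zero M (distribution_sheaf M \<O> \<F> E) U V"

text \<open>The map \<open>{\<eta>\<^sub>\<gamma>} \<mapsto> \<Sum> ext(\<eta>\<^sub>\<gamma>)\<close>; only the finitely many indices with \<open>\<eta>\<^sub>\<gamma> \<noteq> 0\<close> are summed over, since
  \<^const>\<open>finsum\<close> is zero for infinite index sets.\<close>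

definition sum_of_extensions ::
  "'a topology \<Rightarrow> ('a, complex, 'f) presheaf \<Rightarrow> ('a, 'f, 's) presheaf \<Rightarrow> 'e tvs \<Rightarrow>
   'i set \<Rightarrow> ('i \<Rightarrow> 'a set) \<Rightarrow> ('i \<Rightarrow> 's \<Rightarrow> 'e) \<Rightarrow> ('s \<Rightarrow> 'e)" where
  "sum_of_extensions M \<O> \<F> E \<Gamma> U \<eta> =
     (\<Oplus>\<^bsub>distributions_c M \<O> \<F> E (topspace M)\<^esub>
        \<gamma>\<in>{\<gamma>\<in>\<Gamma>. \<eta> \<gamma> \<noteq> \<zero>\<^bsub>distributions_c M \<O> \<F> E (U \<gamma>)\<^esub>}.
          dist_ext M \<O> \<F> E (topspace M) (U \<gamma>) (\<eta> \<gamma>))"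

end

theory Submission
  imports Defs
begin

text \<open>Cutoff sections and finite partitions of unity near compact sets exist, because they do in the
  formal charts. Cutting off with them makes extension by zero and the restriction of
  \<open>\<phi> s\<close> to \<open>V\<close>, for \<open>\<phi>\<close> compactly supported in \<open>V\<close>, continuous between spaces of compactly
  supported sections, since a compactly supported differential operator on \<open>V\<close> extends by zero. All
  maps between spaces of distributions that occur are transposes of such maps. Near a compact set
  \<open>K\<close> take a partition of unity \<open>\<phi>\<^sub>1, \<dots>, \<phi>\<^sub>m\<close> subordinate to the cover. Then
  \<open>\<eta> \<mapsto> (\<phi>\<^sub>i \<eta>)\<^sub>i\<close> is a continuous right inverse of the sum of extensions over the distributions
  supported in \<open>K\<close>. This gives surjectivity, and it shows that the quotient
  topology on the target is coarser than its inductive limit topology, that is, openness.\<close>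

section \<open>Modules over the complex field as records\<close>

section \<open>Complex vector spaces\<close>

text \<open>\<open>\<F>\<close> is an arbitrary sheaf of modules, so its spaces of sections need not
  be complete or metrizable, and no open mapping theorem applies. Openness has to come from explicit
  continuous right inverses. A finite partition of unity serves one \<open>K\<close> only; this
  suffices because the inductive limit topology is tested on one compact set at a time. Each right
  inverse is defined and continuous on all of \<open>Dist \<Omega>\<close>; only the identity
  \<open>\<Phi> (\<Psi> \<eta>) = \<eta>\<close> is confined to distributions supported in
  \<open>K\<close>. The only handle on sections is multiplication by global functions. Continuity
  between spaces of sections therefore always comes from an equality of seminorms: the pullback of
  the seminorm of a compactly supported operator is the seminorm of another one, composed with a
  multiplication or extended by zero. On the dual side a cutoff is moved to the test section, and
  supports of distributions are controlled by pairing with test sections that vanish near a compact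
  set.\<close>

lemma complex_field_simps [simp]:
  "carrier \<C> = UNIV" "\<one>\<^bsub>\<C>\<^esub> = 1" "\<zero>\<^bsub>\<C>\<^esub> = 0" "x \<oplus>\<^bsub>\<C>\<^esub> y = x + y" "x \<otimes>\<^bsub>\<C>\<^esub> y = x * y"
  by (simp_all add: ring_of_type_algebra_def)

text \<open>The module axioms involve only the carrier, addition, zero and scalar multiplication.
  Attaching a topology or truncating a record changes other fields, and the module structure is
  carried across here.\<close>

lemma module_transfer:
  fixes V :: "(complex, 'v, 'm) module_scheme" and V' :: "(complex, 'v, 'n) module_scheme"
  assumes V: "Module.module \<C> V" and eq: "carrier V' = carrier V" "ring.add V' = ring.add V"
    "ring.zero V' = ring.zero V" "module.smult V' = module.smult V"
  shows "Module.module \<C> V'"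
proof -
  interpret Module.module \<C> V by fact
  show ?thesis
  proof (rule moduleI)
    show "abelian_group V'"
    proof (rule abelian_groupI)
      fix x assume "x \<in> carrier V'"
      then show "\<exists>y\<in>carrier V'. y \<oplus>\<^bsub>V'\<^esub> x = \<zero>\<^bsub>V'\<^esub>"
        using M.l_neg[of x] by (intro bexI[of _ "\<ominus>\<^bsub>V\<^esub> x"]) (auto simp: eq)
    qed (use M.a_assoc M.a_comm in \<open>auto simp: eq\<close>)
  qed (use R.is_cring smult_closed smult_l_distr smult_r_distr smult_assoc1 smult_one in \<open>auto simp: eq\<close>)
qed

text \<open>The multiple of \<open>x\<close> by \<open>- 1\<close> serves as its additive inverse,
  so the group axioms for negatives reduce to one identity about scalars.\<close>

lemma complex_moduleI:
  fixes V :: "(complex, 'v, 'm) module_scheme"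
  assumes "\<And>x y. x \<in> carrier V \<Longrightarrow> y \<in> carrier V \<Longrightarrow> x \<oplus>\<^bsub>V\<^esub> y \<in> carrier V"
    and "\<zero>\<^bsub>V\<^esub> \<in> carrier V"
    and "\<And>c x. x \<in> carrier V \<Longrightarrow> c \<odot>\<^bsub>V\<^esub> x \<in> carrier V"
    and "\<And>x y z. x \<in> carrier V \<Longrightarrow> y \<in> carrier V \<Longrightarrow> z \<in> carrier V \<Longrightarrow>
           (x \<oplus>\<^bsub>V\<^esub> y) \<oplus>\<^bsub>V\<^esub> z = x \<oplus>\<^bsub>V\<^esub> (y \<oplus>\<^bsub>V\<^esub> z)"
    and "\<And>x y. x \<in> carrier V \<Longrightarrow> y \<in> carrier V \<Longrightarrow> x \<oplus>\<^bsub>V\<^esub> y = y \<oplus>\<^bsub>V\<^esub> x"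
    and "\<And>x. x \<in> carrier V \<Longrightarrow> \<zero>\<^bsub>V\<^esub> \<oplus>\<^bsub>V\<^esub> x = x"
    and "\<And>x. x \<in> carrier V \<Longrightarrow> (- 1) \<odot>\<^bsub>V\<^esub> x \<oplus>\<^bsub>V\<^esub> x = \<zero>\<^bsub>V\<^esub>"
    and "\<And>a b x. x \<in> carrier V \<Longrightarrow> (a + b) \<odot>\<^bsub>V\<^esub> x = a \<odot>\<^bsub>V\<^esub> x \<oplus>\<^bsub>V\<^esub> b \<odot>\<^bsub>V\<^esub> x"
    and "\<And>a x y. x \<in> carrier V \<Longrightarrow> y \<in> carrier V \<Longrightarrow> a \<odot>\<^bsub>V\<^esub> (x \<oplus>\<^bsub>V\<^esub> y) = a \<odot>\<^bsub>V\<^esub> x \<oplus>\<^bsub>V\<^esub> a \<odot>\<^bsub>V\<^esub> y"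
    and "\<And>a b x. x \<in> carrier V \<Longrightarrow> (a * b) \<odot>\<^bsub>V\<^esub> x = a \<odot>\<^bsub>V\<^esub> (b \<odot>\<^bsub>V\<^esub> x)"
    and "\<And>x. x \<in> carrier V \<Longrightarrow> 1 \<odot>\<^bsub>V\<^esub> x = x"
  shows "Module.module \<C> V"
proof (rule moduleI)
  show "cring \<C>" by (rule cring_from_type_algebra)
  show "abelian_group V"
  proof (rule abelian_groupI)
    fix x assume "x \<in> carrier V"
    then show "\<exists>y\<in>carrier V. y \<oplus>\<^bsub>V\<^esub> x = \<zero>\<^bsub>V\<^esub>" using assms(3,7) by (intro bexI[of _ "(- 1) \<odot>\<^bsub>V\<^esub> x"])
  qed (fact assms)+
qed (simp_all add: assms(3,8-11))

lemma complex_submoduleI: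
  fixes V :: "(complex, 'v, 'm) module_scheme"
  assumes V: "Module.module \<C> V" and H: "H \<subseteq> carrier V" "\<zero>\<^bsub>V\<^esub> \<in> H"
    "\<And>x y. x \<in> H \<Longrightarrow> y \<in> H \<Longrightarrow> x \<oplus>\<^bsub>V\<^esub> y \<in> H" "\<And>c x. x \<in> H \<Longrightarrow> c \<odot>\<^bsub>V\<^esub> x \<in> H"
  shows "Module.module \<C> (V\<lparr>carrier := H\<rparr>)"
proof -
  interpret Module.module \<C> V by fact
  have "submodule H \<C> V"
  proof (rule submoduleI)
    fix x assume "x \<in> H"
    then have "(\<ominus>\<^bsub>\<C>\<^esub> \<one>\<^bsub>\<C>\<^esub>) \<odot>\<^bsub>V\<^esub> x \<in> H" "x \<in> carrier V" using H by auto
    then show "\<ominus>\<^bsub>V\<^esub> x \<in> H" using smult_l_minus[of "\<one>\<^bsub>\<C>\<^esub>" x] smult_one[of x] by simp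
  qed (use H in auto)
  from submodule.submodule_is_module[OF this V] show ?thesis .
qed

lemma complex_minus_eq:
  fixes V :: "(complex, 'v, 'm) module_scheme"
  assumes V: "Module.module \<C> V" and x: "x \<in> carrier V"
  shows "\<ominus>\<^bsub>V\<^esub> x = (- 1) \<odot>\<^bsub>V\<^esub> x"
proof -
  interpret Module.module \<C> V by fact
  have "(- 1) \<odot>\<^bsub>V\<^esub> x \<oplus>\<^bsub>V\<^esub> x = (- 1 + 1) \<odot>\<^bsub>V\<^esub> x"
    using smult_l_distr[of "- 1" 1 x] smult_one[of x] x by simp
  also have "\<dots> = \<zero>\<^bsub>V\<^esub>" using smult_l_null[of x] x by simp
  finally show ?thesis using x smult_closed[of "- 1" x] by (intro M.minus_equality) auto
qed

lemma complex_smult_closed: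
  fixes V :: "(complex, 'v, 'm) module_scheme"
  assumes "Module.module \<C> V" and "x \<in> carrier V"
  shows "c \<odot>\<^bsub>V\<^esub> x \<in> carrier V"
  using Module.module.smult_closed[OF assms(1), of c x] assms(2) by simp

lemma linear_mapI:
  assumes "\<And>x. x \<in> carrier V \<Longrightarrow> f x \<in> carrier W"
    and "\<And>x y. x \<in> carrier V \<Longrightarrow> y \<in> carrier V \<Longrightarrow> f (x \<oplus>\<^bsub>V\<^esub> y) = f x \<oplus>\<^bsub>W\<^esub> f y"
    and "\<And>c x. x \<in> carrier V \<Longrightarrow> f (c \<odot>\<^bsub>V\<^esub> x) = c \<odot>\<^bsub>W\<^esub> f x"
  shows "linear_map V W f"
  using assms by (auto simp: linear_map_def)

lemma linear_mapD:
  assumes "linear_map V W f"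
  shows "x \<in> carrier V \<Longrightarrow> f x \<in> carrier W"
    and "x \<in> carrier V \<Longrightarrow> y \<in> carrier V \<Longrightarrow> f (x \<oplus>\<^bsub>V\<^esub> y) = f x \<oplus>\<^bsub>W\<^esub> f y"
    and "x \<in> carrier V \<Longrightarrow> f (c \<odot>\<^bsub>V\<^esub> x) = c \<odot>\<^bsub>W\<^esub> f x"
  using assms by (auto simp: linear_map_def)

lemma linear_map_zero:
  assumes "Module.module \<C> V" "Module.module \<C> W" "linear_map V W f"
  shows "f \<zero>\<^bsub>V\<^esub> = \<zero>\<^bsub>W\<^esub>"
proof -
  interpret V: Module.module \<C> V by fact
  interpret W: Module.module \<C> W by fact
  have "f \<zero>\<^bsub>V\<^esub> = f (0 \<odot>\<^bsub>V\<^esub> \<zero>\<^bsub>V\<^esub>)" using V.smult_r_null[of 0] by simp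
  also have "\<dots> = 0 \<odot>\<^bsub>W\<^esub> f \<zero>\<^bsub>V\<^esub>" by (rule linear_mapD(3)[OF assms(3)]) simp
  also have "\<dots> = \<zero>\<^bsub>W\<^esub>" using W.smult_l_null[of "f \<zero>\<^bsub>V\<^esub>"] linear_mapD(1)[OF assms(3), of "\<zero>\<^bsub>V\<^esub>"] by simp
  finally show ?thesis .
qed

lemma linear_map_minus:
  assumes "Module.module \<C> V" "Module.module \<C> W" "linear_map V W f" "x \<in> carrier V" "y \<in> carrier V"
  shows "f (x \<ominus>\<^bsub>V\<^esub> y) = f x \<ominus>\<^bsub>W\<^esub> f y"
proof -
  interpret V: Module.module \<C> V by fact
  interpret W: Module.module \<C> W by fact
  have "(- 1) \<odot>\<^bsub>V\<^esub> y \<in> carrier V" using V.smult_closed[of "- 1" y] assms(5) by simp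
  then show ?thesis
    unfolding a_minus_def using assms
    by (simp add: complex_minus_eq linear_mapD[OF assms(3)])
qed

lemma linear_map_comp:
  "linear_map V W f \<Longrightarrow> linear_map W Z g \<Longrightarrow> linear_map V Z (\<lambda>x. g (f x))"
  by (intro linear_mapI) (simp_all add: linear_mapD)

text \<open>Sums and multiples stay in the carrier of a module, so agreement there is enough. This
  allows a linear map to be replaced by its extensional restriction.\<close>

lemma linear_map_cong:
  assumes "linear_map V W f" "\<And>x. x \<in> carrier V \<Longrightarrow> f x = g x" "Module.module \<C> V"
  shows "linear_map V W g"
proof -
  interpret Module.module \<C> V by fact
  have "c \<odot>\<^bsub>V\<^esub> x \<in> carrier V" if "x \<in> carrier V" for c x using smult_closed[of c x] that by simp
  then show ?thesis
    using assms(2) linear_mapD[OF assms(1)] by (intro linear_mapI) (metis M.add.m_closed)+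
qed


section \<open>Locally convex topologies: pullbacks, suprema, quotients and inductive limits\<close>

section \<open>Locally convex topologies\<close>

lemma lc_topologyD:
  assumes "lc_topology V T"
  shows "topspace T = carrier V"
    and "continuous_map (prod_topology T T) T (\<lambda>(x, y). x \<oplus>\<^bsub>V\<^esub> y)"
    and "continuous_map (prod_topology euclidean T) T (\<lambda>(c, x). c \<odot>\<^bsub>V\<^esub> x)"
    and "openin T N \<Longrightarrow> \<zero>\<^bsub>V\<^esub> \<in> N \<Longrightarrow>
      \<exists>C. openin T C \<and> \<zero>\<^bsub>V\<^esub> \<in> C \<and> C \<subseteq> N \<and> convex_in V C"
  using assms by (auto simp: lc_topology_def)

lemma lc_topology_transfer:
  assumes "carrier V' = carrier V" "ring.add V' = ring.add V" "ring.zero V' = ring.zero V" "module.smult V' = module.smult V"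
  shows "lc_topology V' T \<longleftrightarrow> lc_topology V T"
  using assms by (simp add: lc_topology_def convex_in_def)

lemma continuous_map_lc_add:
  assumes "lc_topology V T" "continuous_map Z T f" "continuous_map Z T g"
  shows "continuous_map Z T (\<lambda>z. f z \<oplus>\<^bsub>V\<^esub> g z)"
proof -
  have "continuous_map Z (prod_topology T T) (\<lambda>z. (f z, g z))"
    using assms by (simp add: continuous_map_pairedI)
  from continuous_map_compose[OF this lc_topologyD(2)[OF assms(1)]] show ?thesis by (simp add: comp_def)
qed

lemma continuous_map_lc_smult:
  assumes "lc_topology V T" "continuous_map Z euclidean f" "continuous_map Z T g"
  shows "continuous_map Z T (\<lambda>z. f z \<odot>\<^bsub>V\<^esub> g z)"
proof -
  have "continuous_map Z (prod_topology euclidean T) (\<lambda>z. (f z, g z))"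
    using assms by (simp add: continuous_map_pairedI)
  from continuous_map_compose[OF this lc_topologyD(3)[OF assms(1)]] show ?thesis by (simp add: comp_def)
qed

text \<open>Preimages of open sets form a locally convex topology because \<open>g\<close> commutes
  with the operations and pulls convex sets back to convex sets. This topology is a competitor in
  the supremum that defines \<open>lc_final_topology\<close>, which is how the universal property is
  reached.\<close>

lemma lc_topology_pullback:
  fixes g :: "'v \<Rightarrow> 'w"
  assumes V: "Module.module \<C> V" and W: "Module.module \<C> W" and T: "lc_topology W T"
    and g: "linear_map V W g"
  shows "lc_topology V (pullback_topology (carrier V) g T)"
proof -
  interpret V: Module.module \<C> V by fact
  let ?P = "pullback_topology (carrier V) g T"
  have sm: "c \<odot>\<^bsub>V\<^esub> x \<in> carrier V" if "x \<in> carrier V" for c x using V.smult_closed[of c x] that by simp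
  have sp: "topspace ?P = carrier V"
    using linear_mapD(1)[OF g] lc_topologyD(1)[OF T] by (auto simp: topspace_pullback_topology)
  have gc: "continuous_map ?P T g"
    using continuous_map_pullback[OF continuous_map_id] by (simp add: comp_def id_def)
  have fst: "continuous_map (prod_topology Z1 Z2) Z1 (\<lambda>z. fst z)"
    and snd: "continuous_map (prod_topology Z1 Z2) Z2 (\<lambda>z. snd z)"
    for Z1 :: "'z1 topology" and Z2 :: "'z2 topology"
    by (auto simp: continuous_map_fst continuous_map_snd)
  have "continuous_map (prod_topology ?P ?P) T (\<lambda>z. g (fst z) \<oplus>\<^bsub>W\<^esub> g (snd z))"
    by (intro continuous_map_lc_add[OF T] continuous_map_compose[OF fst gc, unfolded comp_def]
        continuous_map_compose[OF snd gc, unfolded comp_def])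
  then have "continuous_map (prod_topology ?P ?P) T (g \<circ> (\<lambda>(x, y). x \<oplus>\<^bsub>V\<^esub> y))"
    by (rule continuous_map_eq) (use linear_mapD(2)[OF g] sp in auto)
  then have add: "continuous_map (prod_topology ?P ?P) ?P (\<lambda>(x, y). x \<oplus>\<^bsub>V\<^esub> y)"
    by (rule continuous_map_pullback') (use sp in auto)
  have "continuous_map (prod_topology euclidean ?P) T (\<lambda>z. fst z \<odot>\<^bsub>W\<^esub> g (snd z))"
    by (intro continuous_map_lc_smult[OF T] fst continuous_map_compose[OF snd gc, unfolded comp_def])
  then have "continuous_map (prod_topology euclidean ?P) T (g \<circ> (\<lambda>(c, x). c \<odot>\<^bsub>V\<^esub> x))"
    by (rule continuous_map_eq) (use linear_mapD(3)[OF g] sp in auto)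
  then have smult: "continuous_map (prod_topology euclidean ?P) ?P (\<lambda>(c, x). c \<odot>\<^bsub>V\<^esub> x)"
    by (rule continuous_map_pullback') (use sp sm in auto)
  have "\<exists>C. openin ?P C \<and> \<zero>\<^bsub>V\<^esub> \<in> C \<and> C \<subseteq> N \<and> convex_in V C"
    if N: "openin ?P N" "\<zero>\<^bsub>V\<^esub> \<in> N" for N
  proof -
    obtain G where G: "openin T G" "N = g -` G \<inter> carrier V"
      using N(1) by (auto simp: openin_pullback_topology)
    then have "\<zero>\<^bsub>W\<^esub> \<in> G" using N(2) linear_map_zero[OF V W g] by auto
    then obtain C where C: "openin T C" "\<zero>\<^bsub>W\<^esub> \<in> C" "C \<subseteq> G" "convex_in W C"
      using lc_topologyD(4)[OF T G(1)] by auto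
    have "convex_in V (g -` C \<inter> carrier V)"
      using C(4) linear_mapD[OF g] sm unfolding convex_in_def by auto
    then show ?thesis
      using C G linear_map_zero[OF V W g]
      by (intro exI[of _ "g -` C \<inter> carrier V"]) (auto simp: openin_pullback_topology)
  qed
  then show ?thesis unfolding lc_topology_def using sp add smult by blast
qed

text \<open>Extends the result for plain module records to extended ones such as \<open>tvs\<close>:
  truncation does not change which topologies are locally convex, hence not their supremum.\<close>

lemma lc_topology_final_scheme:
  fixes V :: "(complex, 'v, 'm) module_scheme"
  assumes V: "Module.module \<C> V" and f: "\<And>i. i \<in> I \<Longrightarrow> f i \<in> topspace (T i) \<rightarrow> carrier V"
  shows "lc_topology V (lc_final_topology V I T f)"
proof -
  let ?V = "module.truncate V"
  have "Module.module \<C> ?V" using V by (rule module_transfer) (simp_all add: module.truncate_def)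
  then have "lc_topology ?V (lc_final_topology ?V I T f)"
    by (rule lc_topology_final) (use f in \<open>simp add: module.truncate_def\<close>)
  moreover have "lc_topology ?V \<tau> = lc_topology V \<tau>" for \<tau>
    by (rule lc_topology_transfer) (simp_all add: module.truncate_def)
  ultimately show ?thesis by (simp add: lc_final_topology_def)
qed

text \<open>A supremum is finer than each of its members. Openness in an inductive limit is shown in
  this way: by naming a locally convex topology, continuous along all legs, in which the set is
  already open.\<close>

lemma openin_lc_final_topologyI:
  assumes "lc_topology V \<tau>" "\<And>i. i \<in> I \<Longrightarrow> continuous_map (T i) \<tau> (f i)" "openin \<tau> S"
  shows "openin (lc_final_topology V I T f) S"
  unfolding lc_final_topology_def using assms by (intro topology_generated_by_Basis) blast

lemma continuous_map_lc_final_leg: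
  fixes V :: "(complex, 'v, 'm) module_scheme"
  assumes "Module.module \<C> V" and f: "\<And>i. i \<in> I \<Longrightarrow> f i \<in> topspace (T i) \<rightarrow> carrier V" and i: "i \<in> I"
  shows "continuous_map (T i) (lc_final_topology V I T f) (f i)"
  unfolding lc_final_topology_def
proof (rule continuous_on_generated_topo)
  fix S assume "S \<in> {S. \<exists>\<tau>. lc_topology V \<tau> \<and> (\<forall>i\<in>I. continuous_map (T i) \<tau> (f i)) \<and> openin \<tau> S}"
  then obtain \<tau> where "continuous_map (T i) \<tau> (f i)" "openin \<tau> S" using i by auto
  then show "openin (T i) (f i -` S \<inter> topspace (T i))"
    by (simp add: continuous_map_def vimage_def Int_def conj_commute)
next
  have "topspace (lc_final_topology V I T f) = carrier V"
    using lc_topologyD(1)[OF lc_topology_final_scheme[OF assms(1) f]] .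
  then show "f i ` topspace (T i) \<subseteq> \<Union> {S. \<exists>\<tau>. lc_topology V \<tau> \<and> (\<forall>i\<in>I. continuous_map (T i) \<tau> (f i)) \<and> openin \<tau> S}"
    using f[OF i] unfolding lc_final_topology_def by (simp add: Pi_iff image_subset_iff)
qed

text \<open>The pullback of \<open>T'\<close> along \<open>g\<close> is locally convex and makes
  every \<open>f i\<close> continuous, so it is coarser than the final topology.\<close>

lemma continuous_map_from_lc_final:
  fixes V :: "(complex, 'v, 'm) module_scheme"
  assumes V: "Module.module \<C> V" and W: "Module.module \<C> W" and T': "lc_topology W T'"
    and g: "linear_map V W g" and f: "\<And>i. i \<in> I \<Longrightarrow> f i \<in> topspace (T i) \<rightarrow> carrier V"
    and c: "\<And>i. i \<in> I \<Longrightarrow> continuous_map (T i) T' (\<lambda>x. g (f i x))"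
  shows "continuous_map (lc_final_topology V I T f) T' g"
proof -
  let ?P = "pullback_topology (carrier V) g T'"
  have sp: "topspace (lc_final_topology V I T f) = carrier V"
    by (rule lc_topologyD(1)[OF lc_topology_final_scheme[OF V f]])
  have "openin (lc_final_topology V I T f) S" if "openin ?P S" for S
  proof (rule openin_lc_final_topologyI[OF lc_topology_pullback[OF V W T' g] _ that])
    fix i assume "i \<in> I"
    then show "continuous_map (T i) ?P (f i)"
      using c f by (intro continuous_map_pullback') (auto simp: comp_def)
  qed
  then have "openin (lc_final_topology V I T f) {x \<in> carrier V. g x \<in> S}" if "openin T' S" for S
    using that by (auto simp: openin_pullback_topology vimage_def Int_def conj_commute)
  then show ?thesis
    using linear_mapD(1)[OF g] lc_topologyD(1)[OF T'] by (auto simp: continuous_map_def sp)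
qed

lemma openin_translate:
  assumes V: "Module.module \<C> V" and T: "lc_topology V T" and a: "a \<in> carrier V" and S: "openin T S"
  shows "openin T {x \<in> carrier V. x \<oplus>\<^bsub>V\<^esub> a \<in> S}"
proof -
  have "continuous_map T T (\<lambda>x. x \<oplus>\<^bsub>V\<^esub> a)"
    using T a by (intro continuous_map_lc_add[OF T]) (auto simp: lc_topologyD(1) continuous_map_id[unfolded id_def])
  then show ?thesis using S lc_topologyD(1)[OF T] by (auto simp: continuous_map_def)
qed

text \<open>The quotient topology in the sense of topological spaces, with no convexity built in.
  For a linear surjection it is already locally convex, which is proved next.\<close>

definition lc_quotient_topology ::
  "(complex, 'v, 'm) module_scheme \<Rightarrow> (complex, 'w, 'n) module_scheme \<Rightarrow> 'v topology \<Rightarrow> ('v \<Rightarrow> 'w) \<Rightarrow> 'w topology" where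
  "lc_quotient_topology V W T g = topology (\<lambda>S. S \<subseteq> carrier W \<and> openin T {x \<in> carrier V. g x \<in> S})"

text \<open>Everything rests on openness of \<open>g\<close>: since open sets have open images,
  continuity of the operations and small convex neighbourhoods can be pushed forward along
  \<open>g\<close>.\<close>

lemma lc_quotient:
  assumes V: "Module.module \<C> V" and W: "Module.module \<C> W" and T: "lc_topology V T"
    and g: "linear_map V W g" and surj: "g ` carrier V = carrier W"
  shows openin_lc_quotient_topology: "openin (lc_quotient_topology V W T g) S \<longleftrightarrow>
      S \<subseteq> carrier W \<and> openin T {x \<in> carrier V. g x \<in> S}"
    and lc_topology_quotient: "lc_topology W (lc_quotient_topology V W T g)"
    and continuous_map_lc_quotient: "continuous_map T (lc_quotient_topology V W T g) g"
    and open_map_lc_quotient: "open_map T (lc_quotient_topology V W T g) g"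
proof -
  interpret V: Module.module \<C> V by fact
  interpret W: Module.module \<C> W by fact
  let ?Q = "lc_quotient_topology V W T g"
  have spT: "topspace T = carrier V" by (rule lc_topologyD(1)[OF T])
  have gV: "g x \<in> carrier W" if "x \<in> carrier V" for x using linear_mapD(1)[OF g that] .
  have smV: "c \<odot>\<^bsub>V\<^esub> x \<in> carrier V" if "x \<in> carrier V" for c x using V.smult_closed[of c x] that by simp
  have smW: "c \<odot>\<^bsub>W\<^esub> x \<in> carrier W" if "x \<in> carrier W" for c x using W.smult_closed[of c x] that by simp
  have "istopology (\<lambda>S. S \<subseteq> carrier W \<and> openin T {x \<in> carrier V. g x \<in> S})"
    unfolding istopology_def
  proof (intro conjI allI impI)
    fix A B assume "A \<subseteq> carrier W \<and> openin T {x \<in> carrier V. g x \<in> A}"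
      "B \<subseteq> carrier W \<and> openin T {x \<in> carrier V. g x \<in> B}"
    then have "openin T ({x \<in> carrier V. g x \<in> A} \<inter> {x \<in> carrier V. g x \<in> B})" by blast
    also have "{x \<in> carrier V. g x \<in> A} \<inter> {x \<in> carrier V. g x \<in> B} = {x \<in> carrier V. g x \<in> A \<inter> B}" by blast
    finally show "openin T {x \<in> carrier V. g x \<in> A \<inter> B}" .
  next
    fix \<K> assume "\<forall>K\<in>\<K>. K \<subseteq> carrier W \<and> openin T {x \<in> carrier V. g x \<in> K}"
    then have "openin T (\<Union>K\<in>\<K>. {x \<in> carrier V. g x \<in> K})" by blast
    also have "(\<Union>K\<in>\<K>. {x \<in> carrier V. g x \<in> K}) = {x \<in> carrier V. g x \<in> \<Union>\<K>}" by blast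
    finally show "openin T {x \<in> carrier V. g x \<in> \<Union>\<K>}" .
  qed auto
  then show op: "openin ?Q S \<longleftrightarrow> S \<subseteq> carrier W \<and> openin T {x \<in> carrier V. g x \<in> S}" for S
    unfolding lc_quotient_topology_def by (simp add: topology_inverse')
  have sp: "topspace ?Q = carrier W"
  proof -
    have "{x \<in> carrier V. g x \<in> carrier W} = carrier V" using gV by auto
    then have "openin ?Q (carrier W)" using spT op by (metis openin_topspace order_refl)
    then show ?thesis using op by (metis openin_subset openin_topspace subset_antisym)
  qed
  show cont: "continuous_map T ?Q g"
    unfolding continuous_map_def using gV spT sp op by auto
  show om: "open_map T ?Q g"
    unfolding open_map_def
  proof (intro allI impI)
    fix S assume S: "openin T S"
    then have SV: "S \<subseteq> carrier V" using openin_subset spT by blast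
    define k where "k = {a \<in> carrier V. g a = \<zero>\<^bsub>W\<^esub>}"
    \<comment> \<open>The saturation of \<open>S\<close> is the union of its translates by the
      kernel: a point \<open>x\<close> with \<open>g x = g s\<close> is moved into \<open>S\<close>
      by the kernel element \<open>s - x\<close>.\<close>
    have "{x \<in> carrier V. g x \<in> g ` S} = (\<Union>a\<in>k. {x \<in> carrier V. x \<oplus>\<^bsub>V\<^esub> a \<in> S})" (is "?l = ?r")
    proof (intro equalityI subsetI)
      fix x assume "x \<in> ?l"
      then obtain s where s: "x \<in> carrier V" "s \<in> S" "g x = g s" by auto
      then have "s \<ominus>\<^bsub>V\<^esub> x \<in> k" and "x \<oplus>\<^bsub>V\<^esub> (s \<ominus>\<^bsub>V\<^esub> x) = s"
      proof -
        have sV: "s \<in> carrier V" using s SV by auto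
        show "s \<ominus>\<^bsub>V\<^esub> x \<in> k"
          using s sV linear_map_minus[OF V W g sV s(1)] gV by (auto simp: k_def a_minus_def W.M.r_neg)
        show "x \<oplus>\<^bsub>V\<^esub> (s \<ominus>\<^bsub>V\<^esub> x) = s"
          using s sV by (simp add: V.M.a_lcomm V.M.minus_eq V.M.r_neg)
      qed
      then show "x \<in> ?r" using s by (intro UN_I[of "s \<ominus>\<^bsub>V\<^esub> x"]) simp_all
    next
      fix x assume "x \<in> ?r"
      then obtain a where a: "x \<in> carrier V" "a \<in> carrier V" "g a = \<zero>\<^bsub>W\<^esub>" "x \<oplus>\<^bsub>V\<^esub> a \<in> S" by (auto simp: k_def)
      then have "g x = g (x \<oplus>\<^bsub>V\<^esub> a)" using linear_mapD[OF g] by simp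
      then show "x \<in> ?l" using a by auto
    qed
    moreover have "openin T ?r"
      using openin_translate[OF V T _ S] by (auto simp: k_def)
    ultimately show "openin ?Q (g ` S)" using op SV gV by auto
  qed
  have add: "continuous_map (prod_topology ?Q ?Q) ?Q (\<lambda>(x, y). x \<oplus>\<^bsub>W\<^esub> y)"
    unfolding continuous_map_def
  proof (intro conjI allI impI)
    fix N assume N: "openin ?Q N"
    then have "openin T {x \<in> carrier V. g x \<in> N}" using op by auto
    then have O: "openin (prod_topology T T) {z \<in> topspace (prod_topology T T). (\<lambda>(x, y). x \<oplus>\<^bsub>V\<^esub> y) z \<in> {x \<in> carrier V. g x \<in> N}}"
      using lc_topologyD(2)[OF T] by (auto simp: continuous_map_def)
    show "openin (prod_topology ?Q ?Q) {z \<in> topspace (prod_topology ?Q ?Q). (case z of (x, y) \<Rightarrow> x \<oplus>\<^bsub>W\<^esub> y) \<in> N}"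
      unfolding openin_prod_topology_alt
    proof (intro allI impI)
      fix u v assume "(u, v) \<in> {z \<in> topspace (prod_topology ?Q ?Q). (case z of (x, y) \<Rightarrow> x \<oplus>\<^bsub>W\<^esub> y) \<in> N}"
      then have uv: "u \<in> carrier W" "v \<in> carrier W" "u \<oplus>\<^bsub>W\<^esub> v \<in> N" using sp by auto
      \<comment> \<open>Openness around \<open>(u, v)\<close> is checked upstairs: both points are
        lifted along the surjection, a rectangle is chosen around the lifts, and its sides are
        mapped down by the open map \<open>g\<close>.\<close>
      then obtain x y where xy: "x \<in> carrier V" "y \<in> carrier V" "u = g x" "v = g y" using surj by (metis imageE)
      then have "(x, y) \<in> {z \<in> topspace (prod_topology T T). (\<lambda>(x, y). x \<oplus>\<^bsub>V\<^esub> y) z \<in> {x \<in> carrier V. g x \<in> N}}"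
        using uv spT linear_mapD(2)[OF g] by auto
      with O[unfolded openin_prod_topology_alt] obtain A B where AB: "openin T A" "openin T B" "x \<in> A" "y \<in> B"
        "A \<times> B \<subseteq> {z \<in> topspace (prod_topology T T). (\<lambda>(x, y). x \<oplus>\<^bsub>V\<^esub> y) z \<in> {x \<in> carrier V. g x \<in> N}}"
        by meson
      then have "A \<subseteq> carrier V" "B \<subseteq> carrier V" using openin_subset spT by blast+
      then have "g ` A \<times> g ` B \<subseteq> {z \<in> topspace (prod_topology ?Q ?Q). (case z of (x, y) \<Rightarrow> x \<oplus>\<^bsub>W\<^esub> y) \<in> N}"
        (is "_ \<subseteq> ?N")
      proof (intro subsetI)
        fix z assume "z \<in> g ` A \<times> g ` B"
        then obtain a b where z: "z = (g a, g b)" "a \<in> A" "b \<in> B" by blast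
        then have ab: "a \<in> carrier V" "b \<in> carrier V" "(a, b) \<in> A \<times> B"
          using \<open>A \<subseteq> carrier V\<close> \<open>B \<subseteq> carrier V\<close> by auto
        have "g (a \<oplus>\<^bsub>V\<^esub> b) \<in> N" using subsetD[OF AB(5) ab(3)] by simp
        then show "z \<in> ?N" using ab gV sp linear_mapD(2)[OF g] z(1) by simp
      qed
      then show "\<exists>U Va. openin ?Q U \<and> openin ?Q Va \<and> u \<in> U \<and> v \<in> Va \<and>
          U \<times> Va \<subseteq> {z \<in> topspace (prod_topology ?Q ?Q). (case z of (x, y) \<Rightarrow> x \<oplus>\<^bsub>W\<^esub> y) \<in> N}"
        using AB om xy unfolding open_map_def by blast
    qed
  qed (auto simp: sp)
  have smult: "continuous_map (prod_topology euclidean ?Q) ?Q (\<lambda>(c, x). c \<odot>\<^bsub>W\<^esub> x)"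
    unfolding continuous_map_def
  proof (intro conjI allI impI)
    fix N assume N: "openin ?Q N"
    let ?O = "{z \<in> topspace (prod_topology euclidean T). (\<lambda>(c, y). c \<odot>\<^bsub>V\<^esub> y) z \<in> {x \<in> carrier V. g x \<in> N}}"
    have "openin T {x \<in> carrier V. g x \<in> N}" using N op by auto
    then have O: "openin (prod_topology euclidean T) ?O"
      using lc_topologyD(3)[OF T] by (auto simp: continuous_map_def)
    show "openin (prod_topology euclidean ?Q) {z \<in> topspace (prod_topology euclidean ?Q). (case z of (x, y) \<Rightarrow> x \<odot>\<^bsub>W\<^esub> y) \<in> N}"
      unfolding openin_prod_topology_alt
    proof (intro allI impI)
      fix u v assume "(u, v) \<in> {z \<in> topspace (prod_topology euclidean ?Q). (case z of (x, y) \<Rightarrow> x \<odot>\<^bsub>W\<^esub> y) \<in> N}"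
      then have uv: "v \<in> carrier W" "u \<odot>\<^bsub>W\<^esub> v \<in> N" using sp by auto
      then obtain y where xy: "y \<in> carrier V" "v = g y" using surj by (metis imageE)
      then have "(u, y) \<in> ?O" using uv spT linear_mapD(3)[OF g] smV by auto
      with O[unfolded openin_prod_topology_alt] obtain A B where AB: "openin euclidean A" "openin T B" "u \<in> A" "y \<in> B"
        "A \<times> B \<subseteq> ?O"
        by meson
      then have "B \<subseteq> carrier V" using openin_subset spT by blast+
      then have "A \<times> g ` B \<subseteq> {z \<in> topspace (prod_topology euclidean ?Q). (case z of (x, y) \<Rightarrow> x \<odot>\<^bsub>W\<^esub> y) \<in> N}"
        (is "_ \<subseteq> ?N")
      proof (intro subsetI)
        fix z assume "z \<in> A \<times> g ` B"
        then obtain a b where z: "z = (a, g b)" "a \<in> A" "b \<in> B" by blast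
        then have ab: "b \<in> carrier V" "(a, b) \<in> A \<times> B"
          using \<open>B \<subseteq> carrier V\<close> by auto
        have "g (a \<odot>\<^bsub>V\<^esub> b) \<in> N" using subsetD[OF AB(5) ab(2)] by simp
        then show "z \<in> ?N" using ab gV sp linear_mapD(3)[OF g] z(1) by simp
      qed
      then show "\<exists>U Va. openin euclidean U \<and> openin ?Q Va \<and> u \<in> U \<and> v \<in> Va \<and>
          U \<times> Va \<subseteq> {z \<in> topspace (prod_topology euclidean ?Q). (case z of (x, y) \<Rightarrow> x \<odot>\<^bsub>W\<^esub> y) \<in> N}"
        using AB om xy unfolding open_map_def by blast
    qed
  qed (auto simp: sp smW)
  have conv: "\<exists>C. openin ?Q C \<and> \<zero>\<^bsub>W\<^esub> \<in> C \<and> C \<subseteq> N \<and> convex_in W C"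
    if N: "openin ?Q N" "\<zero>\<^bsub>W\<^esub> \<in> N" for N
  proof -
    have z: "g \<zero>\<^bsub>V\<^esub> = \<zero>\<^bsub>W\<^esub>" by (rule linear_map_zero[OF V W g])
    then obtain C where C: "openin T C" "\<zero>\<^bsub>V\<^esub> \<in> C" "C \<subseteq> {x \<in> carrier V. g x \<in> N}" "convex_in V C"
      using lc_topologyD(4)[OF T, of "{x \<in> carrier V. g x \<in> N}"] N op by auto
    have "convex_in W (g ` C)"
      unfolding convex_in_def
    proof (intro ballI allI impI)
      fix a b t assume ab: "a \<in> g ` C" "b \<in> g ` C" and t: "0 \<le> t \<and> t \<le> (1::real)"
      then obtain x y where xy: "a = g x" "b = g y" "x \<in> C" "y \<in> C" by auto
      then have "complex_of_real (1 - t) \<odot>\<^bsub>W\<^esub> a \<oplus>\<^bsub>W\<^esub> complex_of_real t \<odot>\<^bsub>W\<^esub> b =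
          g (complex_of_real (1 - t) \<odot>\<^bsub>V\<^esub> x \<oplus>\<^bsub>V\<^esub> complex_of_real t \<odot>\<^bsub>V\<^esub> y)"
        using C(3) smV linear_mapD[OF g] by (auto simp: subset_iff)
      also have "\<dots> \<in> g ` C" using xy t C(4) by (auto simp: convex_in_def)
      finally show "complex_of_real (1 - t) \<odot>\<^bsub>W\<^esub> a \<oplus>\<^bsub>W\<^esub> complex_of_real t \<odot>\<^bsub>W\<^esub> b \<in> g ` C" .
    qed
    moreover have "openin ?Q (g ` C)" using om C(1) by (auto simp: open_map_def)
    moreover have "\<zero>\<^bsub>W\<^esub> \<in> g ` C" using C(2) z by (metis imageI)
    ultimately show ?thesis using C(3) by (intro exI[of _ "g ` C"]) blast
  qed
  show "lc_topology W ?Q" unfolding lc_topology_def using sp add smult conv by blast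
qed


lemma with_topology_simps [simp]:
  "carrier (with_topology V T) = carrier V" "ring.add (with_topology V T) = ring.add V"
  "ring.zero (with_topology V T) = ring.zero V" "module.smult (with_topology V T) = module.smult V"
  "top_of (with_topology V T) = T"
  by (simp_all add: with_topology_def module.defs tvs.defs)

lemma module_with_topology: "Module.module \<C> V \<Longrightarrow> Module.module \<C> (with_topology V T)"
  by (rule module_transfer) simp_all

lemma lcsD: "lcs V \<Longrightarrow> Module.module \<C> V" "lcs V \<Longrightarrow> lc_topology V (top_of V)"
  "lcs V \<Longrightarrow> topspace (top_of V) = carrier V"
  by (simp_all add: lcs_def lc_topologyD(1))

lemma tvs_union_simps [simp]:
  "carrier (tvs_union V \<A>) = \<Union>\<A>" "ring.add (tvs_union V \<A>) = ring.add V"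
  "ring.zero (tvs_union V \<A>) = ring.zero V" "module.smult (tvs_union V \<A>) = module.smult V"
  by (simp_all add: tvs_union_def)

lemma module_tvs_union:
  assumes "Module.module \<C> V" "\<Union>\<A> \<subseteq> carrier V" "\<zero>\<^bsub>V\<^esub> \<in> \<Union>\<A>"
    "\<And>x y. x \<in> \<Union>\<A> \<Longrightarrow> y \<in> \<Union>\<A> \<Longrightarrow> x \<oplus>\<^bsub>V\<^esub> y \<in> \<Union>\<A>"
    "\<And>c x. x \<in> \<Union>\<A> \<Longrightarrow> c \<odot>\<^bsub>V\<^esub> x \<in> \<Union>\<A>"
  shows "Module.module \<C> (tvs_union V \<A>)"
proof -
  have "Module.module \<C> (V\<lparr>carrier := \<Union>\<A>\<rparr>)" by (rule complex_submoduleI) (use assms in blast)+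
  then show ?thesis by (rule module_transfer) simp_all
qed

text \<open>The definition refers to the record before its topology is set. A final topology reads
  only the algebraic fields, so the finished space may take the place of that record, and the
  statement is not circular.\<close>

lemma top_of_tvs_union:
  "top_of (tvs_union V \<A>) =
     lc_final_topology (tvs_union V \<A>) \<A> (\<lambda>A. subtopology (top_of V) A) (\<lambda>A x. x)"
proof -
  have *: "lc_topology (V\<lparr>carrier := \<Union>\<A>\<rparr>) \<tau> = lc_topology (tvs_union V \<A>) \<tau>" for \<tau>
    by (rule lc_topology_transfer) simp_all
  have "top_of (tvs_union V \<A>) =
      lc_final_topology (V\<lparr>carrier := \<Union>\<A>\<rparr>) \<A> (\<lambda>A. subtopology (top_of V) A) (\<lambda>A x. x)"
    by (simp add: tvs_union_def tvs_subspace_def)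
  then show ?thesis by (simp only: lc_final_topology_def *)
qed

lemma lcs_tvs_union:
  assumes "Module.module \<C> (tvs_union V \<A>)"
  shows "lcs (tvs_union V \<A>)"
proof -
  have "lc_topology (tvs_union V \<A>)
      (lc_final_topology (tvs_union V \<A>) \<A> (\<lambda>A. subtopology (top_of V) A) (\<lambda>A x. x))"
    by (rule lc_topology_final_scheme[OF assms]) auto
  then show ?thesis using assms by (simp add: lcs_def top_of_tvs_union[symmetric])
qed

text \<open>Landing in a single member of the family is what makes this work: there the subspace
  topology controls the map, and the inclusion of the member is a leg of the limit.\<close>

lemma continuous_map_into_tvs_union:
  assumes "Module.module \<C> (tvs_union V \<A>)" "A \<in> \<A>" "continuous_map Z (top_of V) f" "f \<in> topspace Z \<rightarrow> A"
  shows "continuous_map Z (top_of (tvs_union V \<A>)) f"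
proof -
  have "continuous_map (subtopology (top_of V) A) (top_of (tvs_union V \<A>)) (\<lambda>x. x)"
    unfolding top_of_tvs_union
    using continuous_map_lc_final_leg[OF assms(1), of \<A> "\<lambda>A x. x" "subtopology (top_of V)" A] assms(2)
    by auto
  moreover have "continuous_map Z (subtopology (top_of V) A) f"
    using assms by (auto simp: continuous_map_in_subtopology)
  ultimately show ?thesis using continuous_map_compose[of Z _ f _ "\<lambda>x. x"] by (simp add: comp_def)
qed

lemma continuous_map_from_tvs_union:
  assumes "Module.module \<C> (tvs_union V \<A>)" "lcs W" "linear_map (tvs_union V \<A>) W g"
    "\<And>A. A \<in> \<A> \<Longrightarrow> continuous_map (subtopology (top_of V) A) (top_of W) g"
  shows "continuous_map (top_of (tvs_union V \<A>)) (top_of W) g"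
  unfolding top_of_tvs_union
  by (rule continuous_map_from_lc_final) (use assms in \<open>auto simp: lcsD\<close>)


section \<open>Neighbourhood bases of zero and families of seminorms\<close>

section \<open>Topologies given by neighbourhoods of zero\<close>

lemma topspace_nhds_topology:
  assumes "\<And>A B. A \<in> \<N> \<Longrightarrow> B \<in> \<N> \<Longrightarrow> \<exists>C\<in>\<N>. C \<subseteq> A \<inter> B" "\<N> \<noteq> {}"
  shows "topspace (nhds_topology V \<N>) = carrier V"
proof (rule subset_antisym)
  have op: "openin (nhds_topology V \<N>) S \<longleftrightarrow>
      S \<subseteq> carrier V \<and> (\<forall>x\<in>S. \<exists>N\<in>\<N>. {y \<in> carrier V. y \<ominus>\<^bsub>V\<^esub> x \<in> N} \<subseteq> S)" for S
    by (rule openin_nhds_topology) (rule assms(1))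
  have "openin (nhds_topology V \<N>) (topspace (nhds_topology V \<N>))" by simp
  then show "topspace (nhds_topology V \<N>) \<subseteq> carrier V" unfolding op by blast
  have "openin (nhds_topology V \<N>) (carrier V)" unfolding op using assms(2) by blast
  then show "carrier V \<subseteq> topspace (nhds_topology V \<N>)" by (rule openin_subset)
qed

text \<open>Both topologies are translation invariant, so a linear map is checked at zero only; at
  \<open>x\<close> the identity \<open>g (y - x) = g y - g x\<close> does the rest. The members of
  the bases are not assumed open.\<close>

lemma continuous_map_nhds_topology:
  assumes V: "Module.module \<C> V" and W: "Module.module \<C> W" and g: "linear_map V W g"
    and b1: "\<And>A B. A \<in> \<N> \<Longrightarrow> B \<in> \<N> \<Longrightarrow> \<exists>C\<in>\<N>. C \<subseteq> A \<inter> B" and ne1: "\<N> \<noteq> {}"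
    and b2: "\<And>A B. A \<in> \<N>' \<Longrightarrow> B \<in> \<N>' \<Longrightarrow> \<exists>C\<in>\<N>'. C \<subseteq> A \<inter> B" and ne2: "\<N>' \<noteq> {}"
    and sub: "\<And>N'. N' \<in> \<N>' \<Longrightarrow> \<exists>N\<in>\<N>. \<forall>x\<in>carrier V \<inter> N. g x \<in> N'"
  shows "continuous_map (nhds_topology V \<N>) (nhds_topology W \<N>') g"
  unfolding continuous_map_def
proof (intro conjI allI impI)
  interpret V: Module.module \<C> V by fact
  have sp: "topspace (nhds_topology V \<N>) = carrier V" "topspace (nhds_topology W \<N>') = carrier W"
    using topspace_nhds_topology[OF b1 ne1] topspace_nhds_topology[OF b2 ne2] by auto
  show "g \<in> topspace (nhds_topology V \<N>) \<rightarrow> topspace (nhds_topology W \<N>')"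
    using linear_mapD(1)[OF g] by (auto simp: sp)
  fix S assume "openin (nhds_topology W \<N>') S"
  moreover have "openin (nhds_topology W \<N>') S \<longleftrightarrow>
      S \<subseteq> carrier W \<and> (\<forall>x\<in>S. \<exists>N\<in>\<N>'. {y \<in> carrier W. y \<ominus>\<^bsub>W\<^esub> x \<in> N} \<subseteq> S)"
    by (rule openin_nhds_topology) (rule b2)
  ultimately have S: "\<forall>x\<in>S. \<exists>N\<in>\<N>'. {y \<in> carrier W. y \<ominus>\<^bsub>W\<^esub> x \<in> N} \<subseteq> S" by blast
  have op: "openin (nhds_topology V \<N>) S' \<longleftrightarrow>
      S' \<subseteq> carrier V \<and> (\<forall>x\<in>S'. \<exists>N\<in>\<N>. {y \<in> carrier V. y \<ominus>\<^bsub>V\<^esub> x \<in> N} \<subseteq> S')" for S'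
    by (rule openin_nhds_topology) (rule b1)
  show "openin (nhds_topology V \<N>) {x \<in> topspace (nhds_topology V \<N>). g x \<in> S}"
    unfolding op sp
  proof (intro conjI ballI)
    fix x assume x: "x \<in> {x \<in> carrier V. g x \<in> S}"
    then obtain N' where N': "N' \<in> \<N>'" "{y \<in> carrier W. y \<ominus>\<^bsub>W\<^esub> g x \<in> N'} \<subseteq> S" using S by auto
    obtain N where N: "N \<in> \<N>" "\<forall>x\<in>carrier V \<inter> N. g x \<in> N'" using sub[OF N'(1)] by auto
    have "g y \<in> S" if y: "y \<in> carrier V" "y \<ominus>\<^bsub>V\<^esub> x \<in> N" for y
    proof -
      have "g y \<ominus>\<^bsub>W\<^esub> g x \<in> N'"
      proof -
        have xV: "x \<in> carrier V" using x by simp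
        then have "y \<ominus>\<^bsub>V\<^esub> x \<in> carrier V \<inter> N" using y by simp
        then have "g (y \<ominus>\<^bsub>V\<^esub> x) \<in> N'" using N(2) by blast
        then show ?thesis by (simp add: linear_map_minus[OF V W g y(1) xV])
      qed
      then show ?thesis using N'(2) linear_mapD(1)[OF g y(1)] by auto
    qed
    then show "\<exists>N\<in>\<N>. {y \<in> carrier V. y \<ominus>\<^bsub>V\<^esub> x \<in> N} \<subseteq> {x \<in> carrier V. g x \<in> S}"
      using N(1) by auto
  qed auto
qed

lemma seminorm_nhds_nonempty: "seminorm_nhds V P \<noteq> {}"
proof -
  have "{x \<in> carrier V. \<forall>p\<in>{}. p x < (1::real)} \<in> seminorm_nhds V P"
    unfolding seminorm_nhds_def by (intro CollectI exI[of _ "{}"] exI[of _ 1]) auto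
  then show ?thesis by blast
qed

text \<open>The maps in view pull each defining seminorm back to exactly one defining seminorm, so
  an equality is assumed in place of the usual domination by finitely many seminorms.\<close>

lemma continuous_map_seminorm_topology:
  assumes V: "Module.module \<C> V" and W: "Module.module \<C> W" and g: "linear_map V W g"
    and sub: "\<And>q. q \<in> Q \<Longrightarrow> \<exists>p\<in>P. \<forall>x\<in>carrier V. q (g x) = p x"
  shows "continuous_map (seminorm_topology V P) (seminorm_topology W Q) g"
  unfolding seminorm_topology_def
proof (rule continuous_map_nhds_topology[OF V W g])
  fix N' assume "N' \<in> seminorm_nhds W Q"
  then obtain R e where R: "N' = {x \<in> carrier W. \<forall>p\<in>R. p x < e}" "finite R" "R \<subseteq> Q" "0 < e"
    unfolding seminorm_nhds_def by blast
  obtain f where f: "\<And>q. q \<in> Q \<Longrightarrow> f q \<in> P" "\<And>q x. q \<in> Q \<Longrightarrow> x \<in> carrier V \<Longrightarrow> q (g x) = f q x"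
    using sub by metis
  have "{x \<in> carrier V. \<forall>p\<in>f ` R. p x < e} \<in> seminorm_nhds V P"
    unfolding seminorm_nhds_def using R f(1) by (intro CollectI exI[of _ "f ` R"] exI[of _ e]) auto
  then show "\<exists>N\<in>seminorm_nhds V P. \<forall>x\<in>carrier V \<inter> N. g x \<in> N'"
    by (rule bexI[rotated]) (use R f(2) linear_mapD(1)[OF g] in \<open>auto simp: subset_iff\<close>)
qed (erule (1) seminorm_nhds_base | rule seminorm_nhds_nonempty)+

lemma topspace_seminorm_topology [simp]: "topspace (seminorm_topology V P) = carrier V"
  unfolding seminorm_topology_def
  by (rule topspace_nhds_topology) (erule (1) seminorm_nhds_base | rule seminorm_nhds_nonempty)+


section \<open>Strong topologies and transposes\<close>

section \<open>Spaces of continuous linear maps\<close>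

lemma bounded_in_image:
  assumes V: "lcs V" and W: "lcs W" and g: "linear_map V W g"
    and c: "continuous_map (top_of V) (top_of W) g" and B: "bounded_in V B"
  shows "bounded_in W (g ` B)"
  unfolding bounded_in_def
proof (intro conjI allI impI)
  have BV: "B \<subseteq> carrier V" using B by (simp add: bounded_in_def)
  then show "g ` B \<subseteq> carrier W" using linear_mapD(1)[OF g] by auto
  fix N assume N: "openin (top_of W) N \<and> \<zero>\<^bsub>W\<^esub> \<in> N"
  interpret V: Module.module \<C> V using V by (rule lcsD)
  let ?N = "{x \<in> carrier V. g x \<in> N}"
  have "openin (top_of V) ?N" using c N lcsD(3)[OF V] by (auto simp: continuous_map_def)
  moreover have "\<zero>\<^bsub>V\<^esub> \<in> ?N" using N linear_map_zero[OF lcsD(1)[OF V] lcsD(1)[OF W] g] by simp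
  ultimately obtain r where r: "r > 0" "\<And>c. r \<le> cmod c \<Longrightarrow> B \<subseteq> (\<lambda>x. c \<odot>\<^bsub>V\<^esub> x) ` ?N"
    using B unfolding bounded_in_def by meson
  have "g ` B \<subseteq> (\<lambda>x. c \<odot>\<^bsub>W\<^esub> x) ` N" if c: "r \<le> cmod c" for c
  proof
    fix y assume "y \<in> g ` B"
    then obtain x where "x \<in> ?N" "y = g (c \<odot>\<^bsub>V\<^esub> x)" using r(2)[OF c] by blast
    then show "y \<in> (\<lambda>x. c \<odot>\<^bsub>W\<^esub> x) ` N" using linear_mapD(3)[OF g] by auto
  qed
  then show "\<exists>r>0. \<forall>c. r \<le> cmod c \<longrightarrow> g ` B \<subseteq> (\<lambda>x. c \<odot>\<^bsub>W\<^esub> x) ` N" using r(1) by blast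
qed

lemma continuous_linear_maps_simps:
  "\<eta> \<in> carrier (continuous_linear_maps V W) \<longleftrightarrow>
     \<eta> \<in> extensional (carrier V) \<and> linear_map V W \<eta> \<and> continuous_map (top_of V) (top_of W) \<eta>"
  "\<zero>\<^bsub>continuous_linear_maps V W\<^esub> = (\<lambda>x\<in>carrier V. \<zero>\<^bsub>W\<^esub>)"
  "\<eta> \<oplus>\<^bsub>continuous_linear_maps V W\<^esub> \<theta> = (\<lambda>x\<in>carrier V. \<eta> x \<oplus>\<^bsub>W\<^esub> \<theta> x)"
  "c \<odot>\<^bsub>continuous_linear_maps V W\<^esub> \<eta> = (\<lambda>x\<in>carrier V. c \<odot>\<^bsub>W\<^esub> \<eta> x)"
  by (simp_all add: continuous_linear_maps_def)

lemma continuous_linear_mapI: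
  assumes V: "lcs V" and f: "linear_map V W f" "continuous_map (top_of V) (top_of W) f"
  shows "(\<lambda>x\<in>carrier V. f x) \<in> carrier (continuous_linear_maps V W)"
  unfolding continuous_linear_maps_simps
proof (intro conjI)
  show "linear_map V W (\<lambda>x\<in>carrier V. f x)"
    by (rule linear_map_cong[OF f(1)]) (use lcsD[OF V] in auto)
  show "continuous_map (top_of V) (top_of W) (\<lambda>x\<in>carrier V. f x)"
    by (rule continuous_map_eq[OF f(2)]) (use lcsD[OF V] in auto)
qed auto

lemma module_continuous_linear_maps:
  assumes V: "lcs V" and W: "lcs W"
  shows "Module.module \<C> (continuous_linear_maps V W)"
proof -
  interpret V: Module.module \<C> V using V by (rule lcsD)
  interpret W: Module.module \<C> W using W by (rule lcsD)
  let ?L = "continuous_linear_maps V W"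
  have smV: "c \<odot>\<^bsub>V\<^esub> x \<in> carrier V" if "x \<in> carrier V" for c x using V.smult_closed[of c x] that by simp
  have smW: "c \<odot>\<^bsub>W\<^esub> x \<in> carrier W" if "x \<in> carrier W" for c x using W.smult_closed[of c x] that by simp
  have smrW: "c \<odot>\<^bsub>W\<^esub> (x \<oplus>\<^bsub>W\<^esub> y) = c \<odot>\<^bsub>W\<^esub> x \<oplus>\<^bsub>W\<^esub> c \<odot>\<^bsub>W\<^esub> y"
    if "x \<in> carrier W" "y \<in> carrier W" for c x y using W.smult_r_distr[of c x y] that by simp
  have smlW: "(c + d) \<odot>\<^bsub>W\<^esub> x = c \<odot>\<^bsub>W\<^esub> x \<oplus>\<^bsub>W\<^esub> d \<odot>\<^bsub>W\<^esub> x"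
    if "x \<in> carrier W" for c d x using W.smult_l_distr[of c d x] that by simp
  have smaW: "(c * d) \<odot>\<^bsub>W\<^esub> x = c \<odot>\<^bsub>W\<^esub> (d \<odot>\<^bsub>W\<^esub> x)"
    if "x \<in> carrier W" for c d x using W.smult_assoc1[of c d x] that by simp
  have smcW: "c \<odot>\<^bsub>W\<^esub> (d \<odot>\<^bsub>W\<^esub> x) = d \<odot>\<^bsub>W\<^esub> (c \<odot>\<^bsub>W\<^esub> x)" if "x \<in> carrier W" for c d x
    using smaW[OF that, of c d] smaW[OF that, of d c] by (simp add: mult.commute)
  have one: "1 \<odot>\<^bsub>W\<^esub> x = x" if "x \<in> carrier W" for x using W.smult_one[of x] that by simp
  have neg: "(- 1) \<odot>\<^bsub>W\<^esub> x \<oplus>\<^bsub>W\<^esub> x = \<zero>\<^bsub>W\<^esub>" if "x \<in> carrier W" for x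
    using complex_minus_eq[OF lcsD(1)[OF W] that] W.M.l_neg[OF that] by simp
  have z0: "c \<odot>\<^bsub>W\<^esub> \<zero>\<^bsub>W\<^esub> = \<zero>\<^bsub>W\<^esub>" for c using W.smult_r_null[of c] by simp
  have in_W: "\<eta> x \<in> carrier W" if "\<eta> \<in> carrier ?L" "x \<in> carrier V" for \<eta> x
    using that linear_mapD(1) by (auto simp: continuous_linear_maps_simps)
  have ext: "\<eta> \<in> extensional (carrier V)" if "\<eta> \<in> carrier ?L" for \<eta>
    using that by (auto simp: continuous_linear_maps_simps)
  note lin = linear_mapD(2,3)
  show ?thesis
  proof (rule complex_moduleI)
    show "\<zero>\<^bsub>?L\<^esub> \<in> carrier ?L"
      unfolding continuous_linear_maps_simps(2)
      by (rule continuous_linear_mapI[OF V]) (auto intro!: linear_mapI simp: z0 lcsD(3)[OF W])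
    fix \<eta> \<theta> assume \<eta>: "\<eta> \<in> carrier ?L" and \<theta>: "\<theta> \<in> carrier ?L"
    then show "\<eta> \<oplus>\<^bsub>?L\<^esub> \<theta> \<in> carrier ?L"
      unfolding continuous_linear_maps_simps(3)
    proof (intro continuous_linear_mapI[OF V] linear_mapI)
      show "continuous_map (top_of V) (top_of W) (\<lambda>x. \<eta> x \<oplus>\<^bsub>W\<^esub> \<theta> x)"
        using \<eta> \<theta> by (intro continuous_map_lc_add[OF lcsD(2)[OF W]]) (auto simp: continuous_linear_maps_simps)
    next
      fix x y assume xy: "x \<in> carrier V" "y \<in> carrier V"
      have "\<eta> (x \<oplus>\<^bsub>V\<^esub> y) = \<eta> x \<oplus>\<^bsub>W\<^esub> \<eta> y" "\<theta> (x \<oplus>\<^bsub>V\<^esub> y) = \<theta> x \<oplus>\<^bsub>W\<^esub> \<theta> y"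
        using \<eta> \<theta> xy by (simp_all add: continuous_linear_maps_simps lin)
      then show "\<eta> (x \<oplus>\<^bsub>V\<^esub> y) \<oplus>\<^bsub>W\<^esub> \<theta> (x \<oplus>\<^bsub>V\<^esub> y) = \<eta> x \<oplus>\<^bsub>W\<^esub> \<theta> x \<oplus>\<^bsub>W\<^esub> (\<eta> y \<oplus>\<^bsub>W\<^esub> \<theta> y)"
        using in_W[OF \<eta>] in_W[OF \<theta>] xy by (simp add: W.M.a_ac)
    next
      fix c x assume x: "x \<in> carrier V"
      have "\<eta> (c \<odot>\<^bsub>V\<^esub> x) = c \<odot>\<^bsub>W\<^esub> \<eta> x" "\<theta> (c \<odot>\<^bsub>V\<^esub> x) = c \<odot>\<^bsub>W\<^esub> \<theta> x"
        using \<eta> \<theta> x by (simp_all add: continuous_linear_maps_simps lin)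
      then show "\<eta> (c \<odot>\<^bsub>V\<^esub> x) \<oplus>\<^bsub>W\<^esub> \<theta> (c \<odot>\<^bsub>V\<^esub> x) = c \<odot>\<^bsub>W\<^esub> (\<eta> x \<oplus>\<^bsub>W\<^esub> \<theta> x)"
        using in_W[OF \<eta>] in_W[OF \<theta>] x smrW by simp
    qed (use in_W in auto)
    show "\<eta> \<oplus>\<^bsub>?L\<^esub> \<theta> = \<theta> \<oplus>\<^bsub>?L\<^esub> \<eta>"
      using in_W \<eta> \<theta> W.M.a_comm by (auto simp: continuous_linear_maps_simps)
    show "c \<odot>\<^bsub>?L\<^esub> (\<eta> \<oplus>\<^bsub>?L\<^esub> \<theta>) = c \<odot>\<^bsub>?L\<^esub> \<eta> \<oplus>\<^bsub>?L\<^esub> c \<odot>\<^bsub>?L\<^esub> \<theta>" for c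
      using in_W \<eta> \<theta> smrW by (auto simp: continuous_linear_maps_simps)
    show "\<eta> \<oplus>\<^bsub>?L\<^esub> \<theta> \<oplus>\<^bsub>?L\<^esub> \<iota> = \<eta> \<oplus>\<^bsub>?L\<^esub> (\<theta> \<oplus>\<^bsub>?L\<^esub> \<iota>)" if "\<iota> \<in> carrier ?L" for \<iota>
      using in_W \<eta> \<theta> that W.M.a_assoc by (auto simp: continuous_linear_maps_simps)
  next
    fix \<eta> and c assume \<eta>: "\<eta> \<in> carrier ?L"
    show "c \<odot>\<^bsub>?L\<^esub> \<eta> \<in> carrier ?L"
      unfolding continuous_linear_maps_simps(4)
    proof (intro continuous_linear_mapI[OF V] linear_mapI)
      show "continuous_map (top_of V) (top_of W) (\<lambda>x. c \<odot>\<^bsub>W\<^esub> \<eta> x)"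
        using \<eta> by (intro continuous_map_lc_smult[OF lcsD(2)[OF W]]) (auto simp: continuous_linear_maps_simps)
    next
      fix x y assume xy: "x \<in> carrier V" "y \<in> carrier V"
      have "\<eta> (x \<oplus>\<^bsub>V\<^esub> y) = \<eta> x \<oplus>\<^bsub>W\<^esub> \<eta> y"
        using \<eta> xy by (simp_all add: continuous_linear_maps_simps lin)
      then show "c \<odot>\<^bsub>W\<^esub> \<eta> (x \<oplus>\<^bsub>V\<^esub> y) = c \<odot>\<^bsub>W\<^esub> \<eta> x \<oplus>\<^bsub>W\<^esub> c \<odot>\<^bsub>W\<^esub> \<eta> y"
        using in_W[OF \<eta>] xy by (simp add: smrW)
    next
      fix d x assume x: "x \<in> carrier V"
      have "\<eta> (d \<odot>\<^bsub>V\<^esub> x) = d \<odot>\<^bsub>W\<^esub> \<eta> x"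
        using \<eta> x by (simp_all add: continuous_linear_maps_simps lin)
      then show "c \<odot>\<^bsub>W\<^esub> \<eta> (d \<odot>\<^bsub>V\<^esub> x) = d \<odot>\<^bsub>W\<^esub> (c \<odot>\<^bsub>W\<^esub> \<eta> x)"
        using in_W[OF \<eta>] x smcW by simp
    qed (use in_W \<eta> smW in auto)
    show "\<zero>\<^bsub>?L\<^esub> \<oplus>\<^bsub>?L\<^esub> \<eta> = \<eta>"
      using in_W[OF \<eta>] ext[OF \<eta>] by (auto simp: continuous_linear_maps_simps extensional_def fun_eq_iff)
    show "(- 1) \<odot>\<^bsub>?L\<^esub> \<eta> \<oplus>\<^bsub>?L\<^esub> \<eta> = \<zero>\<^bsub>?L\<^esub>"
      using in_W[OF \<eta>] neg by (auto simp: continuous_linear_maps_simps)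
    show "1 \<odot>\<^bsub>?L\<^esub> \<eta> = \<eta>"
      using in_W[OF \<eta>] ext[OF \<eta>] one by (auto simp: continuous_linear_maps_simps extensional_def fun_eq_iff)
    show "(a + b) \<odot>\<^bsub>?L\<^esub> \<eta> = a \<odot>\<^bsub>?L\<^esub> \<eta> \<oplus>\<^bsub>?L\<^esub> b \<odot>\<^bsub>?L\<^esub> \<eta>" for a b
      using in_W[OF \<eta>] smlW by (auto simp: continuous_linear_maps_simps)
    show "(a * b) \<odot>\<^bsub>?L\<^esub> \<eta> = a \<odot>\<^bsub>?L\<^esub> (b \<odot>\<^bsub>?L\<^esub> \<eta>)" for a b
      using in_W[OF \<eta>] smaW by (auto simp: continuous_linear_maps_simps)
  qed
qed

lemma Lb_simps [simp]:
  "carrier (Lb V W) = carrier (continuous_linear_maps V W)"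
  "ring.add (Lb V W) = ring.add (continuous_linear_maps V W)"
  "ring.zero (Lb V W) = ring.zero (continuous_linear_maps V W)"
  "module.smult (Lb V W) = module.smult (continuous_linear_maps V W)"
  by (simp_all add: Lb_def)

lemma module_Lb: "lcs V \<Longrightarrow> lcs W \<Longrightarrow> Module.module \<C> (Lb V W)"
  unfolding Lb_def by (intro module_with_topology module_continuous_linear_maps)

lemma strong_nhds_nonempty: "lcs W \<Longrightarrow> strong_nhds V W \<noteq> {}"
proof -
  assume W: "lcs W"
  interpret W: Module.module \<C> W using W by (rule lcsD)
  have "openin (top_of W) (carrier W) \<and> \<zero>\<^bsub>W\<^esub> \<in> carrier W \<and> bounded_in V {}"
    using lcsD(3)[OF W] openin_topspace[of "top_of W"] by (auto simp: bounded_in_def intro: exI[of _ 1])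
  then show ?thesis unfolding strong_nhds_def by blast
qed

lemma topspace_Lb: "lcs W \<Longrightarrow> topspace (top_of (Lb V W)) = carrier (continuous_linear_maps V W)"
  unfolding Lb_def with_topology_simps
  by (rule topspace_nhds_topology) (erule (1) strong_nhds_base | erule strong_nhds_nonempty)+

text \<open>Restricted to a carrier because continuous linear maps are represented by extensional
  functions; \<open>V'\<close> enters only through that carrier.\<close>

definition transpose_map :: "'u tvs \<Rightarrow> ('u \<Rightarrow> 'v) \<Rightarrow> ('v \<Rightarrow> 'w) \<Rightarrow> ('u \<Rightarrow> 'w)" where
  "transpose_map V' h \<eta> = (\<lambda>s\<in>carrier V'. \<eta> (h s))"

text \<open>The image of a bounded set \<open>B\<close> under \<open>h\<close> is bounded, and
  smallness of \<open>\<eta>\<close> on that image is the same as smallness of the transpose on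
  \<open>B\<close>.\<close>

lemma transpose_map:
  assumes V': "lcs V'" and V: "lcs V" and W: "lcs W" and h: "linear_map V' V h"
    and c: "continuous_map (top_of V') (top_of V) h"
  shows transpose_map_closed: "\<eta> \<in> carrier (continuous_linear_maps V W) \<Longrightarrow>
      transpose_map V' h \<eta> \<in> carrier (continuous_linear_maps V' W)"
    and linear_map_transpose: "linear_map (Lb V W) (Lb V' W) (transpose_map V' h)"
    and continuous_map_transpose:
      "continuous_map (top_of (Lb V W)) (top_of (Lb V' W)) (transpose_map V' h)"
proof -
  show cl: "transpose_map V' h \<eta> \<in> carrier (continuous_linear_maps V' W)"
    if "\<eta> \<in> carrier (continuous_linear_maps V W)" for \<eta>
    unfolding transpose_map_def
    by (rule continuous_linear_mapI[OF V'])
      (use that linear_map_comp[OF h] continuous_map_compose[OF c] in \<open>auto simp: continuous_linear_maps_simps comp_def\<close>)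
  show lin: "linear_map (Lb V W) (Lb V' W) (transpose_map V' h)"
    by (rule linear_mapI)
      (use cl linear_mapD(1)[OF h] in \<open>auto simp: continuous_linear_maps_simps transpose_map_def\<close>)
  show "continuous_map (top_of (Lb V W)) (top_of (Lb V' W)) (transpose_map V' h)"
    unfolding Lb_def with_topology_simps
  proof (rule continuous_map_nhds_topology)
    show "linear_map (continuous_linear_maps V W) (continuous_linear_maps V' W) (transpose_map V' h)"
      using lin by (simp add: linear_map_def)
    fix N assume "N \<in> strong_nhds V' W"
    then obtain B G where B: "bounded_in V' B" and G: "openin (top_of W) G" "\<zero>\<^bsub>W\<^esub> \<in> G"
      and N: "N = {\<eta> \<in> carrier (continuous_linear_maps V' W). \<eta> ` B \<subseteq> G}"
      unfolding strong_nhds_def by blast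
    have "bounded_in V (h ` B)" by (rule bounded_in_image[OF V' V h c B])
    then have "{\<eta> \<in> carrier (continuous_linear_maps V W). \<eta> ` h ` B \<subseteq> G} \<in> strong_nhds V W"
      unfolding strong_nhds_def using G by blast
    moreover have "transpose_map V' h \<eta> \<in> N"
      if "\<eta> \<in> {\<eta> \<in> carrier (continuous_linear_maps V W). \<eta> ` h ` B \<subseteq> G}" for \<eta>
      using that cl[of \<eta>] B by (auto simp: N transpose_map_def bounded_in_def)
    ultimately show "\<exists>N'\<in>strong_nhds V W. \<forall>x\<in>carrier (continuous_linear_maps V W) \<inter> N'. transpose_map V' h x \<in> N"
      by blast
  qed (erule (1) strong_nhds_base
      | rule strong_nhds_nonempty[OF W] module_continuous_linear_maps[OF V W] module_continuous_linear_maps[OF V' W])+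
qed


section \<open>Locally convex direct sums and their universal property\<close>

section \<open>Direct sums\<close>

lemma direct_sum_simps [simp]:
  "carrier (direct_sum I V) = {x \<in> (\<Pi>\<^sub>E i\<in>I. carrier (V i)). finite {i \<in> I. x i \<noteq> \<zero>\<^bsub>V i\<^esub>}}"
  "\<zero>\<^bsub>direct_sum I V\<^esub> = (\<lambda>i\<in>I. \<zero>\<^bsub>V i\<^esub>)"
  "x \<oplus>\<^bsub>direct_sum I V\<^esub> y = (\<lambda>i\<in>I. x i \<oplus>\<^bsub>V i\<^esub> y i)"
  "c \<odot>\<^bsub>direct_sum I V\<^esub> x = (\<lambda>i\<in>I. c \<odot>\<^bsub>V i\<^esub> x i)"
  by (simp_all add: direct_sum_def direct_sum_module_def)

definition direct_sum_inj :: "'i set \<Rightarrow> ('i \<Rightarrow> 'v tvs) \<Rightarrow> 'i \<Rightarrow> 'v \<Rightarrow> 'i \<Rightarrow> 'v" where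
  "direct_sum_inj I V i v = (\<lambda>j\<in>I. if j = i then v else \<zero>\<^bsub>V j\<^esub>)"

lemma module_direct_sum:
  assumes V: "\<And>i. i \<in> I \<Longrightarrow> Module.module \<C> (V i)"
  shows "Module.module \<C> (direct_sum I V)"
proof -
  have add: "x \<oplus>\<^bsub>V i\<^esub> y \<in> carrier (V i)" "x \<oplus>\<^bsub>V i\<^esub> y = y \<oplus>\<^bsub>V i\<^esub> x"
    if "i \<in> I" "x \<in> carrier (V i)" "y \<in> carrier (V i)" for i x y
  proof -
    interpret Module.module \<C> "V i" using V that by blast
    show "x \<oplus>\<^bsub>V i\<^esub> y \<in> carrier (V i)" "x \<oplus>\<^bsub>V i\<^esub> y = y \<oplus>\<^bsub>V i\<^esub> x"
      using that M.a_comm[of x y] by auto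
  qed
  have zero: "\<zero>\<^bsub>V i\<^esub> \<in> carrier (V i)" "\<zero>\<^bsub>V i\<^esub> \<oplus>\<^bsub>V i\<^esub> \<zero>\<^bsub>V i\<^esub> = \<zero>\<^bsub>V i\<^esub>" if "i \<in> I" for i
  proof -
    interpret Module.module \<C> "V i" using V that by blast
    show "\<zero>\<^bsub>V i\<^esub> \<in> carrier (V i)" "\<zero>\<^bsub>V i\<^esub> \<oplus>\<^bsub>V i\<^esub> \<zero>\<^bsub>V i\<^esub> = \<zero>\<^bsub>V i\<^esub>" by auto
  qed
  have neg: "\<zero>\<^bsub>V i\<^esub> \<oplus>\<^bsub>V i\<^esub> x = x" "(- 1) \<odot>\<^bsub>V i\<^esub> x \<oplus>\<^bsub>V i\<^esub> x = \<zero>\<^bsub>V i\<^esub>"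
    if "i \<in> I" "x \<in> carrier (V i)" for i x
  proof -
    interpret Module.module \<C> "V i" using V that by blast
    show "\<zero>\<^bsub>V i\<^esub> \<oplus>\<^bsub>V i\<^esub> x = x" "(- 1) \<odot>\<^bsub>V i\<^esub> x \<oplus>\<^bsub>V i\<^esub> x = \<zero>\<^bsub>V i\<^esub>"
      using that complex_minus_eq[OF V[OF that(1)] that(2)] M.l_neg[of x] by auto
  qed
  have assoc: "x \<oplus>\<^bsub>V i\<^esub> y \<oplus>\<^bsub>V i\<^esub> z = x \<oplus>\<^bsub>V i\<^esub> (y \<oplus>\<^bsub>V i\<^esub> z)"
    if "i \<in> I" "x \<in> carrier (V i)" "y \<in> carrier (V i)" "z \<in> carrier (V i)" for i x y z
  proof -
    interpret Module.module \<C> "V i" using V that by blast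
    show ?thesis using that M.a_assoc by auto
  qed
  have sm: "c \<odot>\<^bsub>V i\<^esub> x \<in> carrier (V i)" "1 \<odot>\<^bsub>V i\<^esub> x = x" "c \<odot>\<^bsub>V i\<^esub> \<zero>\<^bsub>V i\<^esub> = \<zero>\<^bsub>V i\<^esub>"
      "(c + d) \<odot>\<^bsub>V i\<^esub> x = c \<odot>\<^bsub>V i\<^esub> x \<oplus>\<^bsub>V i\<^esub> d \<odot>\<^bsub>V i\<^esub> x"
      "(c * d) \<odot>\<^bsub>V i\<^esub> x = c \<odot>\<^bsub>V i\<^esub> (d \<odot>\<^bsub>V i\<^esub> x)"
      "c \<odot>\<^bsub>V i\<^esub> (x \<oplus>\<^bsub>V i\<^esub> y) = c \<odot>\<^bsub>V i\<^esub> x \<oplus>\<^bsub>V i\<^esub> c \<odot>\<^bsub>V i\<^esub> y"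
    if "i \<in> I" "x \<in> carrier (V i)" "y \<in> carrier (V i)" for i x y c d
  proof -
    interpret Module.module \<C> "V i" using V that by blast
    show "c \<odot>\<^bsub>V i\<^esub> x \<in> carrier (V i)" "1 \<odot>\<^bsub>V i\<^esub> x = x" "c \<odot>\<^bsub>V i\<^esub> \<zero>\<^bsub>V i\<^esub> = \<zero>\<^bsub>V i\<^esub>"
      "(c + d) \<odot>\<^bsub>V i\<^esub> x = c \<odot>\<^bsub>V i\<^esub> x \<oplus>\<^bsub>V i\<^esub> d \<odot>\<^bsub>V i\<^esub> x"
      "(c * d) \<odot>\<^bsub>V i\<^esub> x = c \<odot>\<^bsub>V i\<^esub> (d \<odot>\<^bsub>V i\<^esub> x)"
      "c \<odot>\<^bsub>V i\<^esub> (x \<oplus>\<^bsub>V i\<^esub> y) = c \<odot>\<^bsub>V i\<^esub> x \<oplus>\<^bsub>V i\<^esub> c \<odot>\<^bsub>V i\<^esub> y"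
      using that smult_closed[of c x] smult_one[of x] smult_r_null[of c] smult_l_distr[of c d x]
        smult_assoc1[of c d x] smult_r_distr[of c x y] by simp_all
  qed
  show ?thesis
  proof (rule complex_moduleI)
    fix x y assume xy: "x \<in> carrier (direct_sum I V)" "y \<in> carrier (direct_sum I V)"
    have "{i \<in> I. x i \<oplus>\<^bsub>V i\<^esub> y i \<noteq> \<zero>\<^bsub>V i\<^esub>} \<subseteq> {i \<in> I. x i \<noteq> \<zero>\<^bsub>V i\<^esub>} \<union> {i \<in> I. y i \<noteq> \<zero>\<^bsub>V i\<^esub>}"
      using zero xy by auto
    then have "finite {i \<in> I. x i \<oplus>\<^bsub>V i\<^esub> y i \<noteq> \<zero>\<^bsub>V i\<^esub>}" using xy by (auto intro: finite_subset)
    then show "x \<oplus>\<^bsub>direct_sum I V\<^esub> y \<in> carrier (direct_sum I V)"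
      using xy add(1) by (auto simp: PiE_iff cong: conj_cong)
  next
    fix c x assume x: "x \<in> carrier (direct_sum I V)"
    have "{i \<in> I. c \<odot>\<^bsub>V i\<^esub> x i \<noteq> \<zero>\<^bsub>V i\<^esub>} \<subseteq> {i \<in> I. x i \<noteq> \<zero>\<^bsub>V i\<^esub>}"
      using sm(3) x by (auto simp: PiE_iff)
    then have "finite {i \<in> I. c \<odot>\<^bsub>V i\<^esub> x i \<noteq> \<zero>\<^bsub>V i\<^esub>}" using x by (auto intro: finite_subset)
    then show "c \<odot>\<^bsub>direct_sum I V\<^esub> x \<in> carrier (direct_sum I V)"
      using x sm(1) by (auto simp: PiE_iff cong: conj_cong)
  next
    show "\<zero>\<^bsub>direct_sum I V\<^esub> \<in> carrier (direct_sum I V)"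
      using zero by (auto simp: PiE_iff cong: conj_cong)
  next
    fix x y z assume x: "x \<in> carrier (direct_sum I V)" "y \<in> carrier (direct_sum I V)" "z \<in> carrier (direct_sum I V)"
    then show "x \<oplus>\<^bsub>direct_sum I V\<^esub> y \<oplus>\<^bsub>direct_sum I V\<^esub> z = x \<oplus>\<^bsub>direct_sum I V\<^esub> (y \<oplus>\<^bsub>direct_sum I V\<^esub> z)"
      using assoc by (auto simp: PiE_iff fun_eq_iff)
  qed (auto simp: PiE_iff extensional_def fun_eq_iff add(2) neg sm)
qed

lemma direct_sum_inj_closed:
  assumes "\<And>i. i \<in> I \<Longrightarrow> Module.module \<C> (V i)" "i \<in> I" "v \<in> carrier (V i)"
  shows "direct_sum_inj I V i v \<in> carrier (direct_sum I V)"
proof -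
  have z: "\<zero>\<^bsub>V i\<^esub> \<in> carrier (V i)" if "i \<in> I" for i
  proof -
    interpret Module.module \<C> "V i" using assms that by blast
    show ?thesis by simp
  qed
  have "{j \<in> I. direct_sum_inj I V i v j \<noteq> \<zero>\<^bsub>V j\<^esub>} \<subseteq> {i}" by (auto simp: direct_sum_inj_def)
  then have "finite {j \<in> I. direct_sum_inj I V i v j \<noteq> \<zero>\<^bsub>V j\<^esub>}" by (rule finite_subset) simp
  moreover have "direct_sum_inj I V i v \<in> (\<Pi>\<^sub>E i\<in>I. carrier (V i))"
    using assms(3) z by (auto simp: direct_sum_inj_def PiE_iff)
  ultimately show ?thesis by simp
qed

text \<open>As for \<open>tvs_union\<close>, the final topology reads only the algebraic fields, so
  the underlying module may be exchanged for the finished space.\<close>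

lemma top_of_direct_sum:
  "top_of (direct_sum I V) = lc_final_topology (direct_sum I V) I (\<lambda>i. top_of (V i)) (direct_sum_inj I V)"
proof -
  have *: "lc_topology (direct_sum_module I V) \<tau> = lc_topology (direct_sum I V) \<tau>" for \<tau>
    by (rule lc_topology_transfer) (simp_all add: direct_sum_def)
  have "direct_sum_inj I V = (\<lambda>i v. \<lambda>j\<in>I. if j = i then v else \<zero>\<^bsub>V j\<^esub>)"
    by (simp add: direct_sum_inj_def fun_eq_iff)
  then have "top_of (direct_sum I V) =
      lc_final_topology (direct_sum_module I V) I (\<lambda>i. top_of (V i)) (direct_sum_inj I V)"
    by (simp add: direct_sum_def)
  then show ?thesis by (simp only: lc_final_topology_def *)
qed

lemma direct_sum_inj_topspace:
  assumes V: "\<And>i. i \<in> I \<Longrightarrow> lcs (V i)" and i: "i \<in> I"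
  shows "direct_sum_inj I V i \<in> topspace (top_of (V i)) \<rightarrow> carrier (direct_sum I V)"
  using direct_sum_inj_closed[of I V i, OF lcsD(1)[OF V] i] lcsD(3)[OF V[OF i]]
  by (simp del: direct_sum_simps add: Pi_iff)

lemma lcs_direct_sum:
  assumes V: "\<And>i. i \<in> I \<Longrightarrow> lcs (V i)"
  shows "lcs (direct_sum I V)"
  unfolding lcs_def
proof
  show m: "Module.module \<C> (direct_sum I V)" by (rule module_direct_sum) (use V lcsD in blast)
  show "lc_topology (direct_sum I V) (top_of (direct_sum I V))"
    unfolding top_of_direct_sum
    by (rule lc_topology_final_scheme[OF m direct_sum_inj_topspace[OF V]])
qed

lemma continuous_map_direct_sum_inj:
  assumes V: "\<And>i. i \<in> I \<Longrightarrow> lcs (V i)" and i: "i \<in> I"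
  shows "continuous_map (top_of (V i)) (top_of (direct_sum I V)) (direct_sum_inj I V i)"
  unfolding top_of_direct_sum
  by (rule continuous_map_lc_final_leg[OF lcsD(1)[OF lcs_direct_sum[OF V]] direct_sum_inj_topspace[OF V] i])

lemma continuous_map_from_direct_sum:
  assumes V: "\<And>i. i \<in> I \<Longrightarrow> lcs (V i)" and W: "lcs W" and g: "linear_map (direct_sum I V) W g"
    and c: "\<And>i. i \<in> I \<Longrightarrow> continuous_map (top_of (V i)) (top_of W) (\<lambda>v. g (direct_sum_inj I V i v))"
  shows "continuous_map (top_of (direct_sum I V)) (top_of W) g"
  unfolding top_of_direct_sum
proof (rule continuous_map_from_lc_final)
  show "Module.module \<C> (direct_sum I V)" by (rule lcsD(1)[OF lcs_direct_sum[OF V]])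
  fix i assume i: "i \<in> I"
  show "direct_sum_inj I V i \<in> topspace (top_of (V i)) \<rightarrow> carrier (direct_sum I V)"
    by (rule direct_sum_inj_topspace[OF V i])
  show "continuous_map (top_of (V i)) (top_of W) (\<lambda>v. g (direct_sum_inj I V i v))" by (rule c[OF i])
qed (rule lcsD(1)[OF W] lcsD(2)[OF W] g)+


section \<open>Locality, gluing, supports and extension by zero\<close>

section \<open>Sheaves\<close>

lemma sheafD:
  assumes "sheaf M P"
  shows "openin M U \<Longrightarrow> abelian_group (sec P U)"
    and "openin M U \<Longrightarrow> openin M V \<Longrightarrow> V \<subseteq> U \<Longrightarrow>
      res P U V \<in> hom (add_monoid (sec P U)) (add_monoid (sec P V))"
    and "openin M U \<Longrightarrow> s \<in> carrier (sec P U) \<Longrightarrow> res P U U s = s"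
    and "openin M U \<Longrightarrow> openin M V \<Longrightarrow> openin M W \<Longrightarrow> W \<subseteq> V \<Longrightarrow> V \<subseteq> U \<Longrightarrow> s \<in> carrier (sec P U) \<Longrightarrow>
      res P V W (res P U V s) = res P U W s"
    and "(\<And>V. V \<in> \<V> \<Longrightarrow> openin M V) \<Longrightarrow> (\<And>V. V \<in> \<V> \<Longrightarrow> t V \<in> carrier (sec P V)) \<Longrightarrow>
      (\<And>V W. V \<in> \<V> \<Longrightarrow> W \<in> \<V> \<Longrightarrow> res P V (V \<inter> W) (t V) = res P W (V \<inter> W) (t W)) \<Longrightarrow>
      \<exists>!s. s \<in> carrier (sec P (\<Union>\<V>)) \<and> (\<forall>V\<in>\<V>. res P (\<Union>\<V>) V s = t V)"
proof -
  show "(\<And>V. V \<in> \<V> \<Longrightarrow> openin M V) \<Longrightarrow> (\<And>V. V \<in> \<V> \<Longrightarrow> t V \<in> carrier (sec P V)) \<Longrightarrow>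
      (\<And>V W. V \<in> \<V> \<Longrightarrow> W \<in> \<V> \<Longrightarrow> res P V (V \<inter> W) (t V) = res P W (V \<inter> W) (t W)) \<Longrightarrow>
      \<exists>!s. s \<in> carrier (sec P (\<Union>\<V>)) \<and> (\<forall>V\<in>\<V>. res P (\<Union>\<V>) V s = t V)"
  proof -
    have "\<forall>\<V> t. (\<forall>V\<in>\<V>. openin M V \<and> t V \<in> carrier (sec P V)) \<and>
        (\<forall>V\<in>\<V>. \<forall>W\<in>\<V>. res P V (V \<inter> W) (t V) = res P W (V \<inter> W) (t W)) \<longrightarrow>
        (\<exists>!s. s \<in> carrier (sec P (\<Union>\<V>)) \<and> (\<forall>V\<in>\<V>. res P (\<Union>\<V>) V s = t V))"
      using assms unfolding sheaf_def by (elim conjE)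
    from this[THEN spec, THEN spec, of \<V> t] show "(\<And>V. V \<in> \<V> \<Longrightarrow> openin M V) \<Longrightarrow> (\<And>V. V \<in> \<V> \<Longrightarrow> t V \<in> carrier (sec P V)) \<Longrightarrow>
      (\<And>V W. V \<in> \<V> \<Longrightarrow> W \<in> \<V> \<Longrightarrow> res P V (V \<inter> W) (t V) = res P W (V \<inter> W) (t W)) \<Longrightarrow>
      \<exists>!s. s \<in> carrier (sec P (\<Union>\<V>)) \<and> (\<forall>V\<in>\<V>. res P (\<Union>\<V>) V s = t V)" by blast
  qed
qed (use assms in \<open>auto simp: sheaf_def\<close>)

lemma sheaf_res:
  assumes "sheaf M P" "openin M U" "openin M V" "V \<subseteq> U"
  shows res_closed: "s \<in> carrier (sec P U) \<Longrightarrow> res P U V s \<in> carrier (sec P V)"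
    and res_add: "s \<in> carrier (sec P U) \<Longrightarrow> t \<in> carrier (sec P U) \<Longrightarrow>
      res P U V (s \<oplus>\<^bsub>sec P U\<^esub> t) = res P U V s \<oplus>\<^bsub>sec P V\<^esub> res P U V t"
    and res_zero: "res P U V \<zero>\<^bsub>sec P U\<^esub> = \<zero>\<^bsub>sec P V\<^esub>"
proof -
  note h = sheafD(2)[OF assms]
  show cl: "s \<in> carrier (sec P U) \<Longrightarrow> res P U V s \<in> carrier (sec P V)" for s
    using h by (auto simp: hom_def)
  show add: "s \<in> carrier (sec P U) \<Longrightarrow> t \<in> carrier (sec P U) \<Longrightarrow>
      res P U V (s \<oplus>\<^bsub>sec P U\<^esub> t) = res P U V s \<oplus>\<^bsub>sec P V\<^esub> res P U V t" for s t
    using h by (auto simp: hom_def)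
  interpret U: abelian_group "sec P U" using sheafD(1)[OF assms(1,2)] .
  interpret V: abelian_group "sec P V" using sheafD(1)[OF assms(1,3)] .
  have "res P U V \<zero>\<^bsub>sec P U\<^esub> \<oplus>\<^bsub>sec P V\<^esub> res P U V \<zero>\<^bsub>sec P U\<^esub> = res P U V \<zero>\<^bsub>sec P U\<^esub>"
    using add[of "\<zero>\<^bsub>sec P U\<^esub>" "\<zero>\<^bsub>sec P U\<^esub>"] by simp
  then show "res P U V \<zero>\<^bsub>sec P U\<^esub> = \<zero>\<^bsub>sec P V\<^esub>"
    using cl[of "\<zero>\<^bsub>sec P U\<^esub>"] V.add.r_cancel_one' by fastforce
qed

text \<open>Uniqueness in the gluing axiom, applied to the family of restrictions of
  \<open>s\<close>: both \<open>s\<close> and \<open>t\<close> glue this family.\<close>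

lemma sheaf_locality:
  assumes P: "sheaf M P" and \<V>: "\<And>V. V \<in> \<V> \<Longrightarrow> openin M V" "\<Union>\<V> = U"
    and st: "s \<in> carrier (sec P U)" "t \<in> carrier (sec P U)"
    and eq: "\<And>V. V \<in> \<V> \<Longrightarrow> res P U V s = res P U V t"
  shows "s = t"
proof -
  have U: "openin M U" using \<V> by blast
  have "\<exists>!r. r \<in> carrier (sec P (\<Union>\<V>)) \<and> (\<forall>V\<in>\<V>. res P (\<Union>\<V>) V r = res P U V s)"
  proof (rule sheafD(5)[OF P \<V>(1)])
    show "res P U V s \<in> carrier (sec P V)" if "V \<in> \<V>" for V
      by (rule res_closed[OF P U \<V>(1)[OF that]]) (use that \<V>(2) st in auto)
    fix V W assume VW: "V \<in> \<V>" "W \<in> \<V>"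
    then have o: "openin M V" "openin M W" "openin M (V \<inter> W)" "V \<subseteq> U" "W \<subseteq> U" using \<V> by auto
    show "res P V (V \<inter> W) (res P U V s) = res P W (V \<inter> W) (res P U W s)"
      using sheafD(4)[OF P U o(1,3) _ o(4) st(1)] sheafD(4)[OF P U o(2,3) _ o(5) st(1)] by simp
  qed simp
  then show ?thesis using st eq \<V>(2) by metis
qed

lemma sheaf_locality2:
  assumes P: "sheaf M P" and A: "openin M A" and B: "openin M B" and U: "U = A \<union> B"
    and st: "s \<in> carrier (sec P U)" "t \<in> carrier (sec P U)"
    and eq: "res P U A s = res P U A t" "res P U B s = res P U B t"
  shows "s = t"
  by (rule sheaf_locality[OF P, of "{A, B}" U]) (use assms in auto)

lemma sheaf_glue2:
  assumes P: "sheaf M P" and A: "openin M A" and B: "openin M B"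
    and a: "a \<in> carrier (sec P A)" and b: "b \<in> carrier (sec P B)"
    and ab: "res P A (A \<inter> B) a = res P B (A \<inter> B) b"
  obtains s where "s \<in> carrier (sec P (A \<union> B))" "res P (A \<union> B) A s = a" "res P (A \<union> B) B s = b"
\<comment> \<open>The gluing axiom indexes a family by the open sets themselves, so two sections
  over the same set cannot be separate members; that case is settled directly.\<close>
proof (cases "A = B")
  case True
  then have "a = b" using ab sheafD(3)[OF P A a] sheafD(3)[OF P B b] by simp
  then show ?thesis using that[of a] a b True sheafD(3)[OF P A a] by simp
next
  case False
  have "\<exists>!s. s \<in> carrier (sec P (\<Union>{A, B})) \<and> (\<forall>V\<in>{A, B}. res P (\<Union>{A, B}) V s = (if V = A then a else b))"
    by (rule sheafD(5)[OF P]) (use A B a b ab False in \<open>auto simp: Int_commute\<close>)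
  then show ?thesis using that False by auto
qed

text \<open>The open sets on which \<open>s\<close> vanishes cover \<open>U - K\<close>, and
  locality makes \<open>s\<close> vanish on their union. Supports can then be handled through
  vanishing on the complement of any convenient set that contains them.\<close>

lemma mem_supported_in_iff:
  assumes P: "sheaf M P" and U: "openin M U" and UK: "openin M (U - K)"
  shows "s \<in> supported_in M P U K \<longleftrightarrow>
    s \<in> carrier (sec P U) \<and> res P U (U - K) s = \<zero>\<^bsub>sec P (U - K)\<^esub>"
proof (intro iffI conjI)
  assume s: "s \<in> supported_in M P U K"
  then show sU: "s \<in> carrier (sec P U)" by (simp add: supported_in_def)
  define \<V> where "\<V> = {V. openin M V \<and> V \<subseteq> U - K \<and> res P U V s = \<zero>\<^bsub>sec P V\<^esub>}"
  have un: "\<Union>\<V> = U - K"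
  proof (intro subset_antisym subsetI)
    fix x assume x: "x \<in> U - K"
    then have "x \<notin> support M P U s" using s by (auto simp: supported_in_def)
    then obtain V where V: "openin M V" "V \<subseteq> U" "x \<in> V" "res P U V s = \<zero>\<^bsub>sec P V\<^esub>"
      using x by (auto simp: support_def)
    have o: "openin M (V \<inter> (U - K))" using V UK by auto
    have "res P U (V \<inter> (U - K)) s = res P V (V \<inter> (U - K)) (res P U V s)"
      using sheafD(4)[OF P U V(1) o _ V(2) sU] by simp
    also have "\<dots> = \<zero>\<^bsub>sec P (V \<inter> (U - K))\<^esub>"
      using V res_zero[OF P V(1) o] by simp
    finally show "x \<in> \<Union>\<V>" using o x V by (auto simp: \<V>_def)
  qed (auto simp: \<V>_def)
  show "res P U (U - K) s = \<zero>\<^bsub>sec P (U - K)\<^esub>"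
  proof (rule sheaf_locality[OF P _ un])
    interpret abelian_group "sec P (U - K)" using sheafD(1)[OF P UK] .
    show "\<zero>\<^bsub>sec P (U - K)\<^esub> \<in> carrier (sec P (U - K))" by simp
    show "res P U (U - K) s \<in> carrier (sec P (U - K))" by (rule res_closed[OF P U UK _ sU]) auto
    fix V assume V: "V \<in> \<V>"
    then show "openin M V" by (simp add: \<V>_def)
    then show "res P (U - K) V (res P U (U - K) s) = res P (U - K) V \<zero>\<^bsub>sec P (U - K)\<^esub>"
      using V sheafD(4)[OF P U UK _ _ _ sU] res_zero[OF P UK] by (auto simp: \<V>_def)
  qed
next
  assume "s \<in> carrier (sec P U) \<and> res P U (U - K) s = \<zero>\<^bsub>sec P (U - K)\<^esub>"
  then show "s \<in> supported_in M P U K" using UK by (auto simp: supported_in_def support_def)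
qed

lemma openin_complement_support: "openin M (V - support M P V s)"
proof -
  have "V - support M P V s = \<Union>{W. openin M W \<and> W \<subseteq> V \<and> res P V W s = \<zero>\<^bsub>sec P W\<^esub>}"
    by (auto simp: support_def)
  then show ?thesis by auto
qed

text \<open>The description in \<open>ext_by_zero\<close> uses the exact support \<open>S\<close>. A
  larger set \<open>K\<close> inside \<open>V\<close> with open complement determines the same
  extension, because \<open>U - S\<close> is covered by \<open>U - K\<close> and
  \<open>V - S\<close>; so a compact set at hand can stand in for the support.\<close>

lemma ext_by_zero_eqI:
  assumes P: "sheaf M P" and U: "openin M U" and V: "openin M V" "V \<subseteq> U"
    and K: "K \<subseteq> V" "openin M (U - K)" and t: "t \<in> carrier (sec P U)"
    and ts: "res P U V t = s" and tz: "res P U (U - K) t = \<zero>\<^bsub>sec P (U - K)\<^esub>"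
  shows "ext_by_zero M P U V s = t"
proof -
  define S where "S = support M P V s"
  have s: "s \<in> carrier (sec P V)" using res_closed[OF P U V t] ts by simp
  have VK: "openin M (V - K)"
  proof -
    have "V - K = V \<inter> (U - K)" using V by auto
    then show ?thesis using V K by auto
  qed
  have sVK: "V - K \<subseteq> U - K" using V by blast
  have VS: "openin M (V - S)" unfolding S_def by (rule openin_complement_support)
  have US: "U - S = (U - K) \<union> (V - S)" if "S \<subseteq> K" using that K V by auto
  have "res P V (V - K) s = res P U (V - K) t"
    using sheafD(4)[OF P U V(1) VK _ V(2) t] ts by simp
  also have "\<dots> = res P (U - K) (V - K) (res P U (U - K) t)"
    using sheafD(4)[OF P U K(2) VK sVK _ t] by auto
  also have "\<dots> = \<zero>\<^bsub>sec P (V - K)\<^esub>" using res_zero[OF P K(2) VK sVK] by (simp add: tz)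
  finally have "s \<in> supported_in M P V K" using mem_supported_in_iff[OF P V(1) VK] s by simp
  then have SK: "S \<subseteq> K" by (simp add: supported_in_def S_def)
  note US = US[OF SK]
  have USo: "openin M (U - S)" unfolding US using K VS by auto
  have "s \<in> supported_in M P V S" using s by (simp add: supported_in_def S_def)
  then have sz: "res P V (V - S) s = \<zero>\<^bsub>sec P (V - S)\<^esub>" using mem_supported_in_iff[OF P V(1) VS] by simp
  show ?thesis
    unfolding ext_by_zero_def S_def[symmetric]
  proof (rule the_equality)
    have "res P U (U - S) t = \<zero>\<^bsub>sec P (U - S)\<^esub>"
    proof (rule sheaf_locality2[OF P K(2) VS US])
      interpret abelian_group "sec P (U - S)" using sheafD(1)[OF P USo] .
      show "\<zero>\<^bsub>sec P (U - S)\<^esub> \<in> carrier (sec P (U - S))" by simp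
      show "res P U (U - S) t \<in> carrier (sec P (U - S))" by (rule res_closed[OF P U USo _ t]) auto
      have sub: "U - K \<subseteq> U - S" "V - S \<subseteq> U - S" using US by auto
      show "res P (U - S) (U - K) (res P U (U - S) t) = res P (U - S) (U - K) \<zero>\<^bsub>sec P (U - S)\<^esub>"
        using sheafD(4)[OF P U USo K(2) sub(1) _ t] res_zero[OF P USo K(2) sub(1)] tz by auto
      have "res P U (V - S) t = res P V (V - S) s"
        using sheafD(4)[OF P U V(1) VS _ V(2) t] ts by auto
      then show "res P (U - S) (V - S) (res P U (U - S) t) = res P (U - S) (V - S) \<zero>\<^bsub>sec P (U - S)\<^esub>"
        using sheafD(4)[OF P U USo VS sub(2) _ t] res_zero[OF P USo VS sub(2)] sz by auto
    qed
    then show "t \<in> carrier (sec P U) \<and> res P U V t = s \<and> res P U (U - S) t = \<zero>\<^bsub>sec P (U - S)\<^esub>"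
      using t ts by simp
    fix t' assume t': "t' \<in> carrier (sec P U) \<and> res P U V t' = s \<and> res P U (U - S) t' = \<zero>\<^bsub>sec P (U - S)\<^esub>"
    show "t' = t"
    proof (rule sheaf_locality2[OF P V(1) K(2)])
      show "U = V \<union> (U - K)" using V K by auto
      have sub: "U - K \<subseteq> U - S" using SK by auto
      show "res P U (U - K) t' = res P U (U - K) t"
        using sheafD(4)[OF P U USo K(2) sub, of t'] res_zero[OF P USo K(2) sub] t' tz by auto
    qed (use t t' ts in auto)
  qed
qed

text \<open>The sets \<open>V\<close> and \<open>U - K\<close> cover \<open>U\<close>, and
  \<open>s\<close> agrees with the zero section on the overlap \<open>V - K\<close>; the two
  glue.\<close>

lemma ext_by_zero_props:
  assumes P: "sheaf M P" and U: "openin M U" and V: "openin M V" "V \<subseteq> U"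
    and K: "K \<subseteq> V" "openin M (U - K)" and s: "s \<in> carrier (sec P V)"
    and sz: "res P V (V - K) s = \<zero>\<^bsub>sec P (V - K)\<^esub>"
  shows ext_by_zero_closed: "ext_by_zero M P U V s \<in> carrier (sec P U)"
    and res_ext_by_zero: "res P U V (ext_by_zero M P U V s) = s"
    and ext_by_zero_vanishes: "res P U (U - K) (ext_by_zero M P U V s) = \<zero>\<^bsub>sec P (U - K)\<^esub>"
proof -
  have eq: "V \<inter> (U - K) = V - K" "V \<union> (U - K) = U" using V K by auto
  have VK: "openin M (V - K)" unfolding eq(1)[symmetric] using V K by auto
  have sVK: "V - K \<subseteq> U - K" using V by blast
  interpret abelian_group "sec P (U - K)" using sheafD(1)[OF P K(2)] .
  obtain t where "t \<in> carrier (sec P (V \<union> (U - K)))" "res P (V \<union> (U - K)) V t = s"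
    "res P (V \<union> (U - K)) (U - K) t = \<zero>\<^bsub>sec P (U - K)\<^esub>"
    by (rule sheaf_glue2[OF P V(1) K(2) s, of "\<zero>\<^bsub>sec P (U - K)\<^esub>"])
      (use res_zero[OF P K(2) VK sVK] V sz in \<open>auto simp: eq\<close>)
  then have t: "t \<in> carrier (sec P U)" "res P U V t = s" "res P U (U - K) t = \<zero>\<^bsub>sec P (U - K)\<^esub>"
    by (simp_all only: eq)
  from ext_by_zero_eqI[OF P U V K this]
  show "ext_by_zero M P U V s \<in> carrier (sec P U)" "res P U V (ext_by_zero M P U V s) = s"
    "res P U (U - K) (ext_by_zero M P U V s) = \<zero>\<^bsub>sec P (U - K)\<^esub>" using t by simp_all
qed


section \<open>Cutoff sections and partitions of unity near compact sets\<close>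

section \<open>Cutoff sections\<close>

text \<open>Vanishing is recorded by restriction to the complement of a compact \<open>C\<close>, so
  no support has to be computed. The section is global, which lets one \<open>\<phi>\<close> act on
  sections over every open set.\<close>

definition cutoff_in :: "'a topology \<Rightarrow> ('a, complex, 'f) presheaf \<Rightarrow> 'a set \<Rightarrow> 'f \<Rightarrow> bool" where
  "cutoff_in M \<O> V \<phi> \<longleftrightarrow> \<phi> \<in> carrier (sec \<O> (topspace M)) \<and>
     (\<exists>C. compactin M C \<and> C \<subseteq> V \<and>
        res \<O> (topspace M) (topspace M - C) \<phi> = \<zero>\<^bsub>sec \<O> (topspace M - C)\<^esub>)"

text \<open>A finite sum of cutoff sections described without an index set: statements about
  partitions of unity become inductions that add one summand at a time, and a member of
  \<open>\<V>\<close> may occur repeatedly.\<close>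

inductive subordinate_sum ::
  "'a topology \<Rightarrow> ('a, complex, 'f) presheaf \<Rightarrow> 'a set set \<Rightarrow> 'f \<Rightarrow> bool" for M \<O> \<V> where
  zero: "subordinate_sum M \<O> \<V> \<zero>\<^bsub>sec \<O> (topspace M)\<^esub>"
| add: "subordinate_sum M \<O> \<V> \<rho> \<Longrightarrow> V \<in> \<V> \<Longrightarrow> cutoff_in M \<O> V \<phi> \<Longrightarrow>
    subordinate_sum M \<O> \<V> (\<rho> \<oplus>\<^bsub>sec \<O> (topspace M)\<^esub> \<phi>)"

text \<open>Existence of bump sections is isolated as an assumption, which separates sheaf theory
  and functional analysis from the work in charts. Formal manifolds satisfy it by
  \<open>formal_manifold_bump\<close>.\<close>

locale cutoff_space =
  fixes M :: "'a topology" and \<O> :: "('a, complex, 'f) presheaf"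
  assumes algebras: "sheaf_of_complex_algebras M \<O>"
    and Hausdorff: "Hausdorff_space M"
    and bump: "\<And>U a. openin M U \<Longrightarrow> a \<in> U \<Longrightarrow>
      \<exists>\<phi> W. cutoff_in M \<O> U \<phi> \<and> openin M W \<and> a \<in> W \<and> res \<O> (topspace M) W \<phi> = \<one>\<^bsub>sec \<O> W\<^esub>"
begin

abbreviation total ("\<Omega>") where "\<Omega> \<equiv> topspace M"

lemma sheaf_O: "sheaf M \<O>" using algebras by (simp add: sheaf_of_complex_algebras_def)

lemma algebra_O: "openin M U \<Longrightarrow> Module.algebra \<C> (sec \<O> U)"
  using algebras by (simp add: sheaf_of_complex_algebras_def)

lemma cring_O: "openin M U \<Longrightarrow> cring (sec \<O> U)"
  using algebra_O Module.algebra.M_cring by blast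

lemma res_O_hom: "openin M U \<Longrightarrow> openin M V \<Longrightarrow> V \<subseteq> U \<Longrightarrow> res \<O> U V \<in> ring_hom (sec \<O> U) (sec \<O> V)"
  using algebras by (simp add: sheaf_of_complex_algebras_def)

lemma res_O_linear: "openin M U \<Longrightarrow> openin M V \<Longrightarrow> V \<subseteq> U \<Longrightarrow> linear_map (sec \<O> U) (sec \<O> V) (res \<O> U V)"
  using algebras by (simp add: sheaf_of_complex_algebras_def)

lemmas res_O_closed = res_closed[OF sheaf_O]
lemmas res_O_zero = res_zero[OF sheaf_O]
lemmas res_O_comp = sheafD(4)[OF sheaf_O]

lemma openin_total [simp, intro]: "openin M \<Omega>" by simp

lemma subset_total: "openin M U \<Longrightarrow> U \<subseteq> \<Omega>" by (rule openin_subset)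

lemma openin_minus_compact: "openin M U \<Longrightarrow> compactin M K \<Longrightarrow> openin M (U - K)"
  using compactin_imp_closedin[OF Hausdorff] by (simp add: openin_diff)

lemma cutoff_in_closed: "cutoff_in M \<O> V \<phi> \<Longrightarrow> \<phi> \<in> carrier (sec \<O> \<Omega>)"
  by (simp add: cutoff_in_def)

lemma res_total_vanish_mono:
  assumes "\<phi> \<in> carrier (sec \<O> \<Omega>)" "compactin M C" "res \<O> \<Omega> (\<Omega> - C) \<phi> = \<zero>\<^bsub>sec \<O> (\<Omega> - C)\<^esub>"
    "openin M W" "W \<inter> C = {}"
  shows "res \<O> \<Omega> W \<phi> = \<zero>\<^bsub>sec \<O> W\<^esub>"
proof -
  have XC: "openin M (\<Omega> - C)" by (rule openin_minus_compact[OF openin_total assms(2)])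
  have W: "W \<subseteq> \<Omega> - C" using assms subset_total by auto
  show ?thesis using res_O_comp[OF openin_total XC assms(4) W _ assms(1)] assms res_O_zero[OF XC assms(4) W] by auto
qed

lemma cutoff_in_add:
  assumes "cutoff_in M \<O> V \<phi>" "cutoff_in M \<O> V \<rho>"
  shows "cutoff_in M \<O> V (\<phi> \<oplus>\<^bsub>sec \<O> \<Omega>\<^esub> \<rho>)"
proof -
  interpret cring "sec \<O> \<Omega>" by (rule cring_O) simp
  from assms obtain C D where C: "compactin M C" "C \<subseteq> V" "res \<O> \<Omega> (\<Omega> - C) \<phi> = \<zero>\<^bsub>sec \<O> (\<Omega> - C)\<^esub>"
    and D: "compactin M D" "D \<subseteq> V" "res \<O> \<Omega> (\<Omega> - D) \<rho> = \<zero>\<^bsub>sec \<O> (\<Omega> - D)\<^esub>"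
    by (auto simp: cutoff_in_def)
  have c: "\<phi> \<in> carrier (sec \<O> \<Omega>)" "\<rho> \<in> carrier (sec \<O> \<Omega>)" using assms by (auto simp: cutoff_in_def)
  have CD: "compactin M (C \<union> D)" using C D by (simp add: compactin_Un)
  then have o: "openin M (\<Omega> - (C \<union> D))" by (simp add: openin_minus_compact)
  interpret W: cring "sec \<O> (\<Omega> - (C \<union> D))" by (rule cring_O) fact
  have "res \<O> \<Omega> (\<Omega> - (C \<union> D)) (\<phi> \<oplus>\<^bsub>sec \<O> \<Omega>\<^esub> \<rho>) = \<zero>\<^bsub>sec \<O> (\<Omega> - (C \<union> D))\<^esub>"
    using res_add[OF sheaf_O openin_total o _ c] res_total_vanish_mono[OF c(1) C(1,3) o] res_total_vanish_mono[OF c(2) D(1,3) o]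
    by (simp add: disjoint_iff)
  then show ?thesis unfolding cutoff_in_def using c CD C D by (intro conjI exI[of _ "C \<union> D"]) auto
qed

lemma cutoff_in_mult:
  assumes "cutoff_in M \<O> V \<phi>" "\<rho> \<in> carrier (sec \<O> \<Omega>)"
  shows "cutoff_in M \<O> V (\<rho> \<otimes>\<^bsub>sec \<O> \<Omega>\<^esub> \<phi>)"
proof -
  interpret cring "sec \<O> \<Omega>" by (rule cring_O) simp
  from assms obtain C where C: "compactin M C" "C \<subseteq> V" "res \<O> \<Omega> (\<Omega> - C) \<phi> = \<zero>\<^bsub>sec \<O> (\<Omega> - C)\<^esub>"
    and c: "\<phi> \<in> carrier (sec \<O> \<Omega>)"
    by (auto simp: cutoff_in_def)
  have o: "openin M (\<Omega> - C)" using C by (simp add: openin_minus_compact)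
  interpret W: cring "sec \<O> (\<Omega> - C)" by (rule cring_O) fact
  have "res \<O> \<Omega> (\<Omega> - C) (\<rho> \<otimes>\<^bsub>sec \<O> \<Omega>\<^esub> \<phi>) = \<zero>\<^bsub>sec \<O> (\<Omega> - C)\<^esub>"
    using ring_hom_mult[OF res_O_hom[OF openin_total o] assms(2) c] C(3) res_O_closed[OF openin_total o _ assms(2)] by auto
  then show ?thesis unfolding cutoff_in_def using c assms C by auto
qed

lemma subordinate_sum_closed: "subordinate_sum M \<O> \<V> \<rho> \<Longrightarrow> \<rho> \<in> carrier (sec \<O> \<Omega>)"
proof (induction rule: subordinate_sum.induct)
  case zero
  interpret cring "sec \<O> \<Omega>" by (rule cring_O) simp
  show ?case by simp
next
  case (add \<rho> V \<phi>)
  interpret cring "sec \<O> \<Omega>" by (rule cring_O) simp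
  show ?case using add cutoff_in_closed by blast
qed

lemma subordinate_sum_cutoff: "subordinate_sum M \<O> {V} \<rho> \<Longrightarrow> cutoff_in M \<O> V \<rho>"
proof (induction rule: subordinate_sum.induct)
  case zero
  interpret cring "sec \<O> \<Omega>" by (rule cring_O) simp
  show ?case unfolding cutoff_in_def using res_O_zero[OF openin_total openin_total] by (auto intro!: exI[of _ "{}"])
next
  case (add \<rho> W \<phi>)
  then show ?case using cutoff_in_add by blast
qed

text \<open>Without division: if \<open>\<rho>\<close> is \<open>1\<close> on some sets and \<open>\<phi>\<close> is \<open>1\<close> on another one, then
  \<open>\<rho> + (1 - \<rho>) \<phi>\<close> is \<open>1\<close> on all of them.\<close>

lemma partition_of_unity_near_compact:
  assumes K: "compactin M K" and \<V>: "\<And>V. V \<in> \<V> \<Longrightarrow> openin M V" "K \<subseteq> \<Union>\<V>"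
  obtains \<rho> W where "subordinate_sum M \<O> \<V> \<rho>" "openin M W" "K \<subseteq> W" "res \<O> \<Omega> W \<rho> = \<one>\<^bsub>sec \<O> W\<^esub>"
proof -
  interpret R: cring "sec \<O> \<Omega>" by (rule cring_O) simp
  have "\<forall>a\<in>K. \<exists>V \<phi> W. V \<in> \<V> \<and> cutoff_in M \<O> V \<phi> \<and> openin M W \<and> a \<in> W \<and> res \<O> \<Omega> W \<phi> = \<one>\<^bsub>sec \<O> W\<^esub>"
    using bump \<V> by (metis UnionE subsetD)
  then obtain V \<phi> W where sel: "\<And>a. a \<in> K \<Longrightarrow> V a \<in> \<V>" "\<And>a. a \<in> K \<Longrightarrow> cutoff_in M \<O> (V a) (\<phi> a)"
    "\<And>a. a \<in> K \<Longrightarrow> openin M (W a)" "\<And>a. a \<in> K \<Longrightarrow> a \<in> W a" "\<And>a. a \<in> K \<Longrightarrow> res \<O> \<Omega> (W a) (\<phi> a) = \<one>\<^bsub>sec \<O> (W a)\<^esub>"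
    by metis
  have "K \<subseteq> \<Union>(W ` K)" using sel(4) by auto
  then obtain \<G> where "finite \<G>" "\<G> \<subseteq> W ` K" "K \<subseteq> \<Union>\<G>"
    using compactinD[OF K, of "W ` K"] sel(3) by auto
  then obtain A where A: "finite A" "A \<subseteq> K" "K \<subseteq> \<Union>(W ` A)"
    by (metis finite_subset_image)
  have "\<exists>\<rho>. subordinate_sum M \<O> \<V> \<rho> \<and> (\<forall>a\<in>A. res \<O> \<Omega> (W a) \<rho> = \<one>\<^bsub>sec \<O> (W a)\<^esub>)"
    using A(1,2)
  proof (induction A)
    case empty
    show ?case using subordinate_sum.zero by auto
  next
    case (insert a A)
    then obtain \<rho> where \<rho>: "subordinate_sum M \<O> \<V> \<rho>" "\<And>b. b \<in> A \<Longrightarrow> res \<O> \<Omega> (W b) \<rho> = \<one>\<^bsub>sec \<O> (W b)\<^esub>"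
      by auto
    note rc = subordinate_sum_closed[OF \<rho>(1)]
    have a: "a \<in> K" using insert by auto
    note cc = cutoff_in_closed[OF sel(2)[OF a]]
    let ?m = "(\<one>\<^bsub>sec \<O> \<Omega>\<^esub> \<ominus>\<^bsub>sec \<O> \<Omega>\<^esub> \<rho>) \<otimes>\<^bsub>sec \<O> \<Omega>\<^esub> \<phi> a"
    have mc: "cutoff_in M \<O> (V a) ?m" using cutoff_in_mult[OF sel(2)[OF a]] rc by simp
    have s: "subordinate_sum M \<O> \<V> (\<rho> \<oplus>\<^bsub>sec \<O> \<Omega>\<^esub> ?m)"
      by (rule subordinate_sum.add[OF \<rho>(1) sel(1)[OF a] mc])
    have "res \<O> \<Omega> (W b) (\<rho> \<oplus>\<^bsub>sec \<O> \<Omega>\<^esub> ?m) = \<one>\<^bsub>sec \<O> (W b)\<^esub>" if b: "b \<in> insert a A" for b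
    proof -
      have bK: "b \<in> K" using b insert by auto
      note o = sel(3)[OF bK]
      interpret W: cring "sec \<O> (W b)" by (rule cring_O) fact
      interpret h: ring_hom_cring "sec \<O> \<Omega>" "sec \<O> (W b)" "res \<O> \<Omega> (W b)"
        by (intro ring_hom_cring.intro ring_hom_cring_axioms.intro res_O_hom R.is_cring W.is_cring openin_total o subset_total)
      have eq: "res \<O> \<Omega> (W b) (\<rho> \<oplus>\<^bsub>sec \<O> \<Omega>\<^esub> ?m) = res \<O> \<Omega> (W b) \<rho> \<oplus>\<^bsub>sec \<O> (W b)\<^esub>
          (\<one>\<^bsub>sec \<O> (W b)\<^esub> \<ominus>\<^bsub>sec \<O> (W b)\<^esub> res \<O> \<Omega> (W b) \<rho>) \<otimes>\<^bsub>sec \<O> (W b)\<^esub> res \<O> \<Omega> (W b) (\<phi> a)"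
        using rc cc by (simp add: a_minus_def)
      have cl: "res \<O> \<Omega> (W b) \<rho> \<in> carrier (sec \<O> (W b))" "res \<O> \<Omega> (W b) (\<phi> a) \<in> carrier (sec \<O> (W b))"
        using rc cc by auto
      show ?thesis
      proof (cases "b \<in> A")
        case True
        then show ?thesis unfolding eq \<rho>(2)[OF True] using cl by (simp add: a_minus_def W.r_neg)
      next
        case False
        then have "res \<O> \<Omega> (W b) (\<phi> a) = \<one>\<^bsub>sec \<O> (W b)\<^esub>" using b sel(5)[OF a] by auto
        then show ?thesis unfolding eq using cl
          by (simp add: a_minus_def W.a_lcomm[of "res \<O> \<Omega> (W b) \<rho>"] W.r_neg)
      qed
    qed
    with s show ?case by blast
  qed
  then obtain \<rho> where \<rho>: "subordinate_sum M \<O> \<V> \<rho>" "\<And>a. a \<in> A \<Longrightarrow> res \<O> \<Omega> (W a) \<rho> = \<one>\<^bsub>sec \<O> (W a)\<^esub>" by auto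
  note rc = subordinate_sum_closed[OF \<rho>(1)]
  let ?W = "\<Union>(W ` A)"
  have o: "openin M ?W" using sel(3) A(2) by auto
  interpret W: cring "sec \<O> ?W" by (rule cring_O) fact
  \<comment> \<open>\<open>\<rho>\<close> is \<open>1\<close> on each \<open>W a\<close>, hence by
    locality on their union, which is the required neighbourhood of \<open>K\<close>.\<close>
  have "res \<O> \<Omega> ?W \<rho> = \<one>\<^bsub>sec \<O> ?W\<^esub>"
  proof (rule sheaf_locality[OF sheaf_O _ refl])
    fix V assume "V \<in> W ` A"
    then obtain a where a: "a \<in> A" "V = W a" by auto
    show oV: "openin M V" using a A sel(3) by auto
    have sub: "V \<subseteq> ?W" using a by auto
    show "res \<O> ?W V (res \<O> \<Omega> ?W \<rho>) = res \<O> ?W V \<one>\<^bsub>sec \<O> ?W\<^esub>"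
      using res_O_comp[OF openin_total o oV sub subset_total[OF o] rc] ring_hom_one[OF res_O_hom[OF o oV sub]] \<rho>(2)[OF a(1)] a(2)
      by simp
  qed (use res_O_closed[OF openin_total o subset_total[OF o] rc] in auto)
  then show thesis using that \<rho>(1) o A(3) by blast
qed

text \<open>For the cover by the single set \<open>U\<close> every subordinate sum is itself a
  cutoff in \<open>U\<close>.\<close>

lemma cutoff:
  assumes "compactin M K" "openin M U" "K \<subseteq> U"
  obtains \<phi> W where "cutoff_in M \<O> U \<phi>" "openin M W" "K \<subseteq> W" "res \<O> \<Omega> W \<phi> = \<one>\<^bsub>sec \<O> W\<^esub>"
proof -
  obtain \<rho> W where "subordinate_sum M \<O> {U} \<rho>" "openin M W" "K \<subseteq> W" "res \<O> \<Omega> W \<rho> = \<one>\<^bsub>sec \<O> W\<^esub>"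
    by (rule partition_of_unity_near_compact[OF assms(1), of "{U}"]) (use assms in auto)
  then show thesis using that subordinate_sum_cutoff by blast
qed

end


section \<open>Germs, constants and the value of the zero section\<close>

section \<open>Values of sections\<close>

lemma algebra_const:
  assumes "Module.algebra \<C> A"
  shows algebra_const_closed: "c \<odot>\<^bsub>A\<^esub> \<one>\<^bsub>A\<^esub> \<in> carrier A"
    and algebra_const_add: "(c + d) \<odot>\<^bsub>A\<^esub> \<one>\<^bsub>A\<^esub> = c \<odot>\<^bsub>A\<^esub> \<one>\<^bsub>A\<^esub> \<oplus>\<^bsub>A\<^esub> d \<odot>\<^bsub>A\<^esub> \<one>\<^bsub>A\<^esub>"
    and algebra_const_mult: "(c * d) \<odot>\<^bsub>A\<^esub> \<one>\<^bsub>A\<^esub> = (c \<odot>\<^bsub>A\<^esub> \<one>\<^bsub>A\<^esub>) \<otimes>\<^bsub>A\<^esub> (d \<odot>\<^bsub>A\<^esub> \<one>\<^bsub>A\<^esub>)"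
    and algebra_const_one: "1 \<odot>\<^bsub>A\<^esub> \<one>\<^bsub>A\<^esub> = \<one>\<^bsub>A\<^esub>"
    and algebra_const_zero: "0 \<odot>\<^bsub>A\<^esub> \<one>\<^bsub>A\<^esub> = \<zero>\<^bsub>A\<^esub>"
proof -
  interpret A: Module.algebra \<C> A by fact
  interpret M: cring A by (rule A.M_cring)
  show cl: "c \<odot>\<^bsub>A\<^esub> \<one>\<^bsub>A\<^esub> \<in> carrier A" for c using A.smult_closed[of c "\<one>\<^bsub>A\<^esub>"] by simp
  show "(c + d) \<odot>\<^bsub>A\<^esub> \<one>\<^bsub>A\<^esub> = c \<odot>\<^bsub>A\<^esub> \<one>\<^bsub>A\<^esub> \<oplus>\<^bsub>A\<^esub> d \<odot>\<^bsub>A\<^esub> \<one>\<^bsub>A\<^esub>"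
    using A.smult_l_distr[of c d "\<one>\<^bsub>A\<^esub>"] by simp
  show "1 \<odot>\<^bsub>A\<^esub> \<one>\<^bsub>A\<^esub> = \<one>\<^bsub>A\<^esub>" using A.smult_one[of "\<one>\<^bsub>A\<^esub>"] by simp
  show "0 \<odot>\<^bsub>A\<^esub> \<one>\<^bsub>A\<^esub> = \<zero>\<^bsub>A\<^esub>" using A.smult_l_null[of "\<one>\<^bsub>A\<^esub>"] by simp
  show "(c * d) \<odot>\<^bsub>A\<^esub> \<one>\<^bsub>A\<^esub> = (c \<odot>\<^bsub>A\<^esub> \<one>\<^bsub>A\<^esub>) \<otimes>\<^bsub>A\<^esub> (d \<odot>\<^bsub>A\<^esub> \<one>\<^bsub>A\<^esub>)"
    using A.smult_assoc1[of c d "\<one>\<^bsub>A\<^esub>"] A.smult_assoc2[of c "\<one>\<^bsub>A\<^esub>" "d \<odot>\<^bsub>A\<^esub> \<one>\<^bsub>A\<^esub>"] cl by simp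
qed

text \<open>Agreement on one neighbourhood \<open>W\<close> is enough: a pair that agrees with the
  first section on \<open>W'\<close> agrees with the second one on the intersection of
  \<open>W\<close> and \<open>W'\<close>.\<close>

lemma germ_eqI:
  assumes P: "sheaf M P" and U: "openin M U" and V: "openin M V"
    and st: "s \<in> carrier (sec P U)" "t \<in> carrier (sec P V)"
    and W: "openin M W" "a \<in> W" "W \<subseteq> U \<inter> V" "res P U W s = res P V W t"
  shows "germ M P a U s = germ M P a V t"
proof -
  have "germ M P a U s \<subseteq> germ M P a V t"
    if U: "openin M U" and V: "openin M V" and st: "s \<in> carrier (sec P U)" "t \<in> carrier (sec P V)"
    and W: "W \<subseteq> U \<inter> V" "res P U W s = res P V W t" for U V s t
  proof
    fix p assume "p \<in> germ M P a U s"
    then obtain V' t' W' where p: "p = (V', t')" and t': "openin M V'" "a \<in> V'" "t' \<in> carrier (sec P V')"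
      and W': "openin M W'" "a \<in> W'" "W' \<subseteq> U \<inter> V'" "res P U W' s = res P V' W' t'"
      by (auto simp: germ_def)
    have o: "openin M (W \<inter> W')" using \<open>openin M W\<close> W' by auto
    have "res P V (W \<inter> W') t = res P W (W \<inter> W') (res P V W t)"
      using sheafD(4)[OF P V \<open>openin M W\<close> o _ _ st(2)] W by auto
    also have "\<dots> = res P U (W \<inter> W') s"
      using sheafD(4)[OF P U \<open>openin M W\<close> o _ _ st(1)] W by auto
    also have "\<dots> = res P W' (W \<inter> W') (res P U W' s)"
      using sheafD(4)[OF P U W'(1) o _ _ st(1)] W' by auto
    also have "\<dots> = res P V' (W \<inter> W') t'"
      using sheafD(4)[OF P t'(1) W'(1) o _ _ t'(3)] W' by auto
    finally show "p \<in> germ M P a V t"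
      unfolding germ_def p using t' o W W' \<open>a \<in> W\<close> by blast
  qed
  from this[OF U V st W(3,4)] this[OF V U st(2,1)] W(3,4) show ?thesis by (metis inf_commute subset_antisym)
qed

lemma germ_restrict:
  assumes "sheaf M P" "openin M U" "openin M V" "V \<subseteq> U" "a \<in> V" "s \<in> carrier (sec P U)"
  shows "germ M P a V (res P U V s) = germ M P a U s"
proof (rule germ_eqI[of M P V U _ _ V a])
  show "res P U V s \<in> carrier (sec P V)" by (rule res_closed) (use assms in auto)
  then show "res P V V (res P U V s) = res P U V s" by (rule sheafD(3)[OF assms(1,3)])
qed (use assms in auto)

lemma mem_germ_self:
  assumes "openin M U" "a \<in> U" "s \<in> carrier (sec P U)"
  shows "(U, s) \<in> germ M P a U s"
  using assms by (auto simp: germ_def)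

text \<open>\<open>germ_op\<close> is a union over all representatives. For an operation that is
  closed and commutes with restriction, all representatives give the same germ, so the union
  collapses to the germ computed from the given ones.\<close>

lemma germ_op_germ:
  assumes P: "sheaf M P" and U: "openin M U" "a \<in> U" "s \<in> carrier (sec P U)"
    and V: "openin M V" "a \<in> V" "t \<in> carrier (sec P V)"
    and op_closed: "\<And>W x y. openin M W \<Longrightarrow> x \<in> carrier (sec P W) \<Longrightarrow> y \<in> carrier (sec P W) \<Longrightarrow>
      opr (sec P W) x y \<in> carrier (sec P W)"
    and op_res: "\<And>W W' x y. openin M W \<Longrightarrow> openin M W' \<Longrightarrow> W' \<subseteq> W \<Longrightarrow> x \<in> carrier (sec P W) \<Longrightarrow>
      y \<in> carrier (sec P W) \<Longrightarrow> res P W W' (opr (sec P W) x y) = opr (sec P W') (res P W W' x) (res P W W' y)"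
  shows "germ_op M P a opr (germ M P a U s) (germ M P a V t) =
    germ M P a (U \<inter> V) (opr (sec P (U \<inter> V)) (res P U (U \<inter> V) s) (res P V (U \<inter> V) t))"
proof -
  have eq: "germ M P a (U' \<inter> V') (opr (sec P (U' \<inter> V')) (res P U' (U' \<inter> V') s') (res P V' (U' \<inter> V') t')) =
      germ M P a (U \<inter> V) (opr (sec P (U \<inter> V)) (res P U (U \<inter> V) s) (res P V (U \<inter> V) t))"
    if s': "(U', s') \<in> germ M P a U s" and t': "(V', t') \<in> germ M P a V t" for U' V' s' t'
  proof -
    from s' obtain A where A: "openin M A" "a \<in> A" "A \<subseteq> U \<inter> U'" "res P U A s = res P U' A s'"
      and U': "openin M U'" "s' \<in> carrier (sec P U')" by (auto simp: germ_def)
    from t' obtain B where B: "openin M B" "a \<in> B" "B \<subseteq> V \<inter> V'" "res P V B t = res P V' B t'"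
      and V': "openin M V'" "t' \<in> carrier (sec P V')" by (auto simp: germ_def)
    have o: "openin M (A \<inter> B)" "openin M (U \<inter> V)" "openin M (U' \<inter> V')" using A B U V U' V' by auto
    have rs: "res P U (A \<inter> B) s = res P U' (A \<inter> B) s'"
    proof -
      have "res P U (A \<inter> B) s = res P A (A \<inter> B) (res P U A s)"
        using sheafD(4)[OF P U(1) A(1) o(1) _ _ U(3)] A by auto
      also have "\<dots> = res P U' (A \<inter> B) s'"
        using sheafD(4)[OF P U'(1) A(1) o(1) _ _ U'(2)] A by auto
      finally show ?thesis .
    qed
    have rt: "res P V (A \<inter> B) t = res P V' (A \<inter> B) t'"
    proof -
      have "res P V (A \<inter> B) t = res P B (A \<inter> B) (res P V B t)"
        using sheafD(4)[OF P V(1) B(1) o(1) _ _ V(3)] B by auto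
      also have "\<dots> = res P V' (A \<inter> B) t'"
        using sheafD(4)[OF P V'(1) B(1) o(1) _ _ V'(2)] B by auto
      finally show ?thesis .
    qed
    have c: "res P U (U \<inter> V) s \<in> carrier (sec P (U \<inter> V))" "res P V (U \<inter> V) t \<in> carrier (sec P (U \<inter> V))"
      "res P U' (U' \<inter> V') s' \<in> carrier (sec P (U' \<inter> V'))" "res P V' (U' \<inter> V') t' \<in> carrier (sec P (U' \<inter> V'))"
      using res_closed[OF P U(1) o(2) _ U(3)] res_closed[OF P V(1) o(2) _ V(3)]
        res_closed[OF P U'(1) o(3) _ U'(2)] res_closed[OF P V'(1) o(3) _ V'(2)] by auto
    have sub: "A \<inter> B \<subseteq> U \<inter> V" "A \<inter> B \<subseteq> U' \<inter> V'" using A B by auto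
    show ?thesis
    proof (rule germ_eqI[OF P o(3,2) _ _ o(1)])
      show "res P (U' \<inter> V') (A \<inter> B) (opr (sec P (U' \<inter> V')) (res P U' (U' \<inter> V') s') (res P V' (U' \<inter> V') t')) =
        res P (U \<inter> V) (A \<inter> B) (opr (sec P (U \<inter> V)) (res P U (U \<inter> V) s) (res P V (U \<inter> V) t))"
        using op_res[OF o(3,1) sub(2) c(3,4)] op_res[OF o(2,1) sub(1) c(1,2)] rs rt
          sheafD(4)[OF P U(1) o(2) o(1) sub(1) _ U(3)] sheafD(4)[OF P V(1) o(2) o(1) sub(1) _ V(3)]
          sheafD(4)[OF P U'(1) o(3) o(1) sub(2) _ U'(2)] sheafD(4)[OF P V'(1) o(3) o(1) sub(2) _ V'(2)]
        by simp
    qed (use op_closed[OF o(2) c(1,2)] op_closed[OF o(3) c(3,4)] A B sub in auto)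
  qed
  let ?g = "germ M P a (U \<inter> V) (opr (sec P (U \<inter> V)) (res P U (U \<inter> V) s) (res P V (U \<inter> V) t))"
  have "x \<in> ?g" if "x \<in> germ_op M P a opr (germ M P a U s) (germ M P a V t)" for x
    using that eq unfolding germ_op_def by blast
  moreover have "x \<in> germ_op M P a opr (germ M P a U s) (germ M P a V t)" if "x \<in> ?g" for x
    unfolding germ_op_def
    by (rule UN_I[OF mem_germ_self[OF U]], simp only: prod.case, rule UN_I[OF mem_germ_self[OF V]], simp add: that)
  ultimately show ?thesis by blast
qed

text \<open>Apart from the stalk, \<open>value_at\<close> reads only the germ of \<open>f\<close>
  and the germs of the constants, and restriction preserves both.\<close>

lemma value_at_restrict:
  assumes A: "sheaf_of_complex_algebras M \<O>" and U: "openin M U" and V: "openin M V" "V \<subseteq> U" "a \<in> V"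
    and f: "f \<in> carrier (sec \<O> U)"
  shows "value_at M \<O> V (res \<O> U V f) a = value_at M \<O> U f a"
proof -
  have P: "sheaf M \<O>" using A by (simp add: sheaf_of_complex_algebras_def)
  have "res \<O> U V (c \<odot>\<^bsub>sec \<O> U\<^esub> \<one>\<^bsub>sec \<O> U\<^esub>) = c \<odot>\<^bsub>sec \<O> V\<^esub> \<one>\<^bsub>sec \<O> V\<^esub>" for c
  proof -
    have h: "res \<O> U V \<in> ring_hom (sec \<O> U) (sec \<O> V)" "linear_map (sec \<O> U) (sec \<O> V) (res \<O> U V)"
      and alg: "Module.algebra \<C> (sec \<O> U)"
      using A U V by (auto simp: sheaf_of_complex_algebras_def)
    interpret cring "sec \<O> U" by (rule Module.algebra.M_cring[OF alg])
    show ?thesis using linear_mapD(3)[OF h(2), of "\<one>\<^bsub>sec \<O> U\<^esub>" c] ring_hom_one[OF h(1)] by simp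
  qed
  then have "germ M \<O> a V (c \<odot>\<^bsub>sec \<O> V\<^esub> \<one>\<^bsub>sec \<O> V\<^esub>) = germ M \<O> a U (c \<odot>\<^bsub>sec \<O> U\<^esub> \<one>\<^bsub>sec \<O> U\<^esub>)" for c
    using germ_restrict[OF P U V, of "c \<odot>\<^bsub>sec \<O> U\<^esub> \<one>\<^bsub>sec \<O> U\<^esub>"] algebra_const_closed[of "sec \<O> U"] A U
    by (simp add: sheaf_of_complex_algebras_def)
  then show ?thesis unfolding value_at_def germ_restrict[OF P U V f] by simp
qed

text \<open>Nonzero constants are units, so they are not in the maximal ideal.\<close>

lemma value_at_zero:
  assumes L: "locally_ringed_space M \<O>" and U: "openin M U" "a \<in> U"
  shows "value_at M \<O> U \<zero>\<^bsub>sec \<O> U\<^esub> a = 0"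
proof -
  have A: "sheaf_of_complex_algebras M \<O>" using L by (simp add: locally_ringed_space_def)
  then have P: "sheaf M \<O>" and alg: "\<And>U. openin M U \<Longrightarrow> Module.algebra \<C> (sec \<O> U)"
    and hom: "\<And>U V. openin M U \<Longrightarrow> openin M V \<Longrightarrow> V \<subseteq> U \<Longrightarrow> res \<O> U V \<in> ring_hom (sec \<O> U) (sec \<O> V)"
    by (auto simp: sheaf_of_complex_algebras_def)
  have cr: "cring (sec \<O> W)" if "openin M W" for W by (rule Module.algebra.M_cring[OF alg[OF that]])
  let ?R = "stalk M \<O> a" and ?c = "\<lambda>c. germ M \<O> a U (c \<odot>\<^bsub>sec \<O> U\<^esub> \<one>\<^bsub>sec \<O> U\<^esub>)"
  have a: "a \<in> topspace M" using U openin_subset by auto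
  have "local_ring ?R" using L a by (auto simp: locally_ringed_space_def)
  then have R: "cring ?R" and ex: "\<exists>!I. maximalideal I ?R" by (auto simp: local_ring_def)
  define I where "I = (THE I. maximalideal I ?R)"
  have I: "maximalideal I ?R" unfolding I_def by (rule theI'[OF ex])
  interpret R: cring ?R by fact
  interpret I: maximalideal I ?R by fact
  have cc: "c \<odot>\<^bsub>sec \<O> U\<^esub> \<one>\<^bsub>sec \<O> U\<^esub> \<in> carrier (sec \<O> U)" for c by (rule algebra_const_closed[OF alg[OF U(1)]])
  have cR: "?c c \<in> carrier ?R" for c unfolding stalk_def using U cc by auto
  have sU: "U \<subseteq> topspace M" using U openin_subset by auto
  interpret X: cring "sec \<O> (topspace M)" by (rule cr) simp
  interpret U: cring "sec \<O> U" by (rule cr) fact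
  have c1: "?c 1 = \<one>\<^bsub>?R\<^esub>"
    using germ_restrict[OF P openin_topspace U(1) sU U(2) X.one_closed] ring_hom_one[OF hom[OF openin_topspace U(1) sU]]
      algebra_const_one[OF alg[OF U(1)]] by (simp add: stalk_def)
  have c0: "germ M \<O> a U \<zero>\<^bsub>sec \<O> U\<^esub> = \<zero>\<^bsub>?R\<^esub>"
    using germ_restrict[OF P openin_topspace U(1) sU U(2) X.zero_closed] res_zero[OF P openin_topspace U(1) sU]
    by (simp add: stalk_def)
  have mult: "?c c \<otimes>\<^bsub>?R\<^esub> ?c d = ?c (c * d)" for c d
  proof -
    have "?c c \<otimes>\<^bsub>?R\<^esub> ?c d = germ_op M \<O> a monoid.mult (?c c) (?c d)" by (simp add: stalk_def)
    also have "\<dots> = germ M \<O> a (U \<inter> U) (res \<O> U (U \<inter> U) (c \<odot>\<^bsub>sec \<O> U\<^esub> \<one>\<^bsub>sec \<O> U\<^esub>) \<otimes>\<^bsub>sec \<O> (U \<inter> U)\<^esub>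
        res \<O> U (U \<inter> U) (d \<odot>\<^bsub>sec \<O> U\<^esub> \<one>\<^bsub>sec \<O> U\<^esub>))"
    proof (rule germ_op_germ[OF P U cc U cc])
      fix W x y assume W: "openin M W" "x \<in> carrier (sec \<O> W)" "y \<in> carrier (sec \<O> W)"
      then interpret cring "sec \<O> W" by (intro cr)
      show "x \<otimes>\<^bsub>sec \<O> W\<^esub> y \<in> carrier (sec \<O> W)" using W by simp
    qed (rule ring_hom_mult[OF hom])
    also have "\<dots> = ?c (c * d)"
      using sheafD(3)[OF P U(1) cc] algebra_const_mult[OF alg[OF U(1)]] by simp
    finally show ?thesis .
  qed
  have notin: "?c c \<notin> I" if "c \<noteq> 0" for c
  proof
    assume "?c c \<in> I"
    then have "?c (1 / c) \<otimes>\<^bsub>?R\<^esub> ?c c \<in> I" by (rule I.I_l_closed[OF _ cR])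
    then have "\<one>\<^bsub>?R\<^esub> \<in> I" using that c1 by (simp add: mult)
    then show False using I.one_imp_carrier I.I_notcarr by simp
  qed
  show ?thesis
    unfolding value_at_def I_def[symmetric]
  proof (rule the_equality)
    show "I +>\<^bsub>?R\<^esub> germ M \<O> a U \<zero>\<^bsub>sec \<O> U\<^esub> = I +>\<^bsub>?R\<^esub> ?c 0"
      using algebra_const_zero[OF alg[OF U(1)]] by simp
    \<comment> \<open>\<open>value_at\<close> is a definite description, so uniqueness matters: a
      constant in the coset of zero has its germ in \<open>I\<close>, which leaves only
      \<open>c = 0\<close>.\<close>
    fix c assume "I +>\<^bsub>?R\<^esub> germ M \<O> a U \<zero>\<^bsub>sec \<O> U\<^esub> = I +>\<^bsub>?R\<^esub> ?c c"
    then have "?c c \<in> I +>\<^bsub>?R\<^esub> \<zero>\<^bsub>?R\<^esub>" using I.a_rcos_self[OF cR, of c] c0 by simp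
    then have "?c c \<in> I" using R.a_coset_add_zero[OF I.a_subset] by simp
    then show "c = 0" using notin by blast
  qed
qed


section \<open>The action of global functions on sections of a sheaf of modules\<close>

section \<open>Sections of a sheaf of modules\<close>

text \<open>The assumption on values makes the zero function a section of the reduced sheaf, as
  extension of operators by zero requires.\<close>

locale section_space = cutoff_space M \<O> for M :: "'a topology" and \<O> :: "('a, complex, 'f) presheaf" +
  fixes \<F> :: "('a, 'f, 's) presheaf"
  assumes modules: "sheaf_of_modules M \<O> \<F>"
    and value_zero: "\<And>U a. openin M U \<Longrightarrow> a \<in> U \<Longrightarrow> value_at M \<O> U \<zero>\<^bsub>sec \<O> U\<^esub> a = 0"
begin

lemma sheaf_F: "sheaf M \<F>" using modules by (simp add: sheaf_of_modules_def)

lemma module_F: "openin M U \<Longrightarrow> Module.module (sec \<O> U) (sec \<F> U)"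
  using modules by (simp add: sheaf_of_modules_def)

lemma res_smult: "openin M U \<Longrightarrow> openin M V \<Longrightarrow> V \<subseteq> U \<Longrightarrow> f \<in> carrier (sec \<O> U) \<Longrightarrow> s \<in> carrier (sec \<F> U) \<Longrightarrow>
    res \<F> U V (f \<odot>\<^bsub>sec \<F> U\<^esub> s) = res \<O> U V f \<odot>\<^bsub>sec \<F> V\<^esub> res \<F> U V s"
  using modules by (simp add: sheaf_of_modules_def)

lemmas res_F_closed = res_closed[OF sheaf_F]
lemmas res_F_zero = res_zero[OF sheaf_F]
lemmas res_F_add = res_add[OF sheaf_F]
lemmas res_F_id = sheafD(3)[OF sheaf_F]
lemmas res_F_comp = sheafD(4)[OF sheaf_F]

lemma abelian_monoid_F: "openin M U \<Longrightarrow> abelian_monoid (sec \<F> U)"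
  by (rule abelian_group.axioms(1)[OF sheafD(1)[OF sheaf_F]])

lemmas zero_F = abelian_monoid.zero_closed[OF abelian_monoid_F]

lemmas add_F = abelian_monoid.a_closed[OF abelian_monoid_F]

lemma zero_add_zero_F: "openin M U \<Longrightarrow> \<zero>\<^bsub>sec \<F> U\<^esub> \<oplus>\<^bsub>sec \<F> U\<^esub> \<zero>\<^bsub>sec \<F> U\<^esub> = \<zero>\<^bsub>sec \<F> U\<^esub>"
  by (rule abelian_monoid.l_zero[OF abelian_monoid_F zero_F])

lemma smult_F: "openin M U \<Longrightarrow> f \<in> carrier (sec \<O> U) \<Longrightarrow> s \<in> carrier (sec \<F> U) \<Longrightarrow> f \<odot>\<^bsub>sec \<F> U\<^esub> s \<in> carrier (sec \<F> U)"
  by (rule Module.module.smult_closed[OF module_F])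

lemma res_F_vanish_mono:
  assumes "openin M U" "openin M W" "openin M V" "V \<subseteq> W" "W \<subseteq> U" "s \<in> carrier (sec \<F> U)"
    "res \<F> U W s = \<zero>\<^bsub>sec \<F> W\<^esub>"
  shows "res \<F> U V s = \<zero>\<^bsub>sec \<F> V\<^esub>"
  using res_F_comp[OF assms(1,2,3,4,5,6)] res_F_zero[OF assms(2,3,4)] assms(7) by simp

text \<open>\<open>U\<close> is an explicit argument because a section does not determine the open
  set over which it is taken.\<close>

definition act :: "'a set \<Rightarrow> 'f \<Rightarrow> 's \<Rightarrow> 's" where
  "act U \<phi> s = res \<O> \<Omega> U \<phi> \<odot>\<^bsub>sec \<F> U\<^esub> s"

lemma res_\<Omega>: "openin M U \<Longrightarrow> \<phi> \<in> carrier (sec \<O> \<Omega>) \<Longrightarrow> res \<O> \<Omega> U \<phi> \<in> carrier (sec \<O> U)"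
  by (rule res_O_closed[OF openin_total _ subset_total])

lemma act_closed: "openin M U \<Longrightarrow> \<phi> \<in> carrier (sec \<O> \<Omega>) \<Longrightarrow> s \<in> carrier (sec \<F> U) \<Longrightarrow> act U \<phi> s \<in> carrier (sec \<F> U)"
  unfolding act_def by (intro smult_F res_\<Omega>)

lemma act_add: "openin M U \<Longrightarrow> \<phi> \<in> carrier (sec \<O> \<Omega>) \<Longrightarrow> s \<in> carrier (sec \<F> U) \<Longrightarrow> t \<in> carrier (sec \<F> U) \<Longrightarrow>
    act U \<phi> (s \<oplus>\<^bsub>sec \<F> U\<^esub> t) = act U \<phi> s \<oplus>\<^bsub>sec \<F> U\<^esub> act U \<phi> t"
  unfolding act_def by (rule Module.module.smult_r_distr[OF module_F]) (auto intro: res_\<Omega>)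

lemma act_add_left: "openin M U \<Longrightarrow> \<phi> \<in> carrier (sec \<O> \<Omega>) \<Longrightarrow> \<rho> \<in> carrier (sec \<O> \<Omega>) \<Longrightarrow> s \<in> carrier (sec \<F> U) \<Longrightarrow>
    act U (\<phi> \<oplus>\<^bsub>sec \<O> \<Omega>\<^esub> \<rho>) s = act U \<phi> s \<oplus>\<^bsub>sec \<F> U\<^esub> act U \<rho> s"
  unfolding act_def
  by (simp add: res_add[OF sheaf_O openin_total _ subset_total] Module.module.smult_l_distr[OF module_F] res_\<Omega>)

lemma act_zero_left: "openin M U \<Longrightarrow> s \<in> carrier (sec \<F> U) \<Longrightarrow> act U \<zero>\<^bsub>sec \<O> \<Omega>\<^esub> s = \<zero>\<^bsub>sec \<F> U\<^esub>"
  unfolding act_def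
  by (simp add: res_O_zero[OF openin_total _ subset_total] Module.module.smult_l_null[OF module_F])

lemma act_smult:
  assumes "openin M U" "\<phi> \<in> carrier (sec \<O> \<Omega>)" "f \<in> carrier (sec \<O> U)" "s \<in> carrier (sec \<F> U)"
  shows "act U \<phi> (f \<odot>\<^bsub>sec \<F> U\<^esub> s) = f \<odot>\<^bsub>sec \<F> U\<^esub> act U \<phi> s"
proof -
  interpret Module.module "sec \<O> U" "sec \<F> U" by (rule module_F) fact
  note r = res_\<Omega>[OF assms(1,2)]
  show ?thesis unfolding act_def
    using smult_assoc1[OF r assms(3,4)] smult_assoc1[OF assms(3) r assms(4)] R.m_comm[OF r assms(3)] by simp
qed

lemma res_act:
  assumes "openin M U" "openin M V" "V \<subseteq> U" "\<phi> \<in> carrier (sec \<O> \<Omega>)" "s \<in> carrier (sec \<F> U)"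
  shows "res \<F> U V (act U \<phi> s) = act V \<phi> (res \<F> U V s)"
  unfolding act_def
  using res_smult[OF assms(1-3) res_\<Omega>[OF assms(1,4)] assms(5)]
    res_O_comp[OF openin_total assms(1,2,3) subset_total[OF assms(1)] assms(4)] by simp

lemma act_eq_zero:
  assumes "openin M U" "res \<O> \<Omega> U \<phi> = \<zero>\<^bsub>sec \<O> U\<^esub>" "s \<in> carrier (sec \<F> U)"
  shows "act U \<phi> s = \<zero>\<^bsub>sec \<F> U\<^esub>"
  unfolding act_def assms(2) by (rule Module.module.smult_l_null[OF module_F[OF assms(1)] assms(3)])

lemma act_of_zero:
  assumes "openin M U" "\<phi> \<in> carrier (sec \<O> \<Omega>)"
  shows "act U \<phi> \<zero>\<^bsub>sec \<F> U\<^esub> = \<zero>\<^bsub>sec \<F> U\<^esub>"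
  unfolding act_def by (rule Module.module.smult_r_null[OF module_F[OF assms(1)] res_\<Omega>[OF assms]])

text \<open>On \<open>U \<inter> W\<close> the function is \<open>1\<close>, on \<open>U - K\<close>
  both sides vanish, and these two open sets cover \<open>U\<close>.\<close>

lemma act_eq_self:
  assumes U: "openin M U" and \<phi>: "\<phi> \<in> carrier (sec \<O> \<Omega>)" and W: "openin M W" "res \<O> \<Omega> W \<phi> = \<one>\<^bsub>sec \<O> W\<^esub>"
    and K: "compactin M K" "K \<subseteq> W" and s: "s \<in> carrier (sec \<F> U)" "res \<F> U (U - K) s = \<zero>\<^bsub>sec \<F> (U - K)\<^esub>"
  shows "act U \<phi> s = s"
proof (rule sheaf_locality2[OF sheaf_F, of "U \<inter> W" "U - K"])
  show UW: "openin M (U \<inter> W)" and UK: "openin M (U - K)" using U W openin_minus_compact[OF U K(1)] by auto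
  show "U = U \<inter> W \<union> (U - K)" using K by auto
  show "act U \<phi> s \<in> carrier (sec \<F> U)" by (rule act_closed[OF U \<phi> s(1)])
  have "res \<O> \<Omega> (U \<inter> W) \<phi> = \<one>\<^bsub>sec \<O> (U \<inter> W)\<^esub>"
    using res_O_comp[OF openin_total W(1) UW _ subset_total[OF W(1)] \<phi>] W(2) ring_hom_one[OF res_O_hom[OF W(1) UW]] by simp
  then show "res \<F> U (U \<inter> W) (act U \<phi> s) = res \<F> U (U \<inter> W) s"
    using res_act[OF U UW _ \<phi> s(1)] Module.module.smult_one[OF module_F[OF UW] res_F_closed[OF U UW _ s(1)]]
    by (simp add: act_def)
  show "res \<F> U (U - K) (act U \<phi> s) = res \<F> U (U - K) s"
    using res_act[OF U UK _ \<phi> s(1)] act_of_zero[OF UK \<phi>] s(2) by simp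
qed (rule s)

lemma act_vanishes:
  assumes U: "openin M U" and \<phi>: "\<phi> \<in> carrier (sec \<O> \<Omega>)" and C: "compactin M C"
    "res \<O> \<Omega> (\<Omega> - C) \<phi> = \<zero>\<^bsub>sec \<O> (\<Omega> - C)\<^esub>" and s: "s \<in> carrier (sec \<F> U)"
  shows "res \<F> U (U - C) (act U \<phi> s) = \<zero>\<^bsub>sec \<F> (U - C)\<^esub>"
proof -
  have o: "openin M (U - C)" by (rule openin_minus_compact[OF U C(1)])
  have "res \<O> \<Omega> (U - C) \<phi> = \<zero>\<^bsub>sec \<O> (U - C)\<^esub>" by (rule res_total_vanish_mono[OF \<phi> C o]) auto
  then show ?thesis
    using res_act[OF U o _ \<phi> s] act_eq_zero[OF o _ res_F_closed[OF U o _ s]] by simp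
qed

lemma act_preserves_vanishing:
  assumes U: "openin M U" "openin M W" "W \<subseteq> U" and \<phi>: "\<phi> \<in> carrier (sec \<O> \<Omega>)" and s: "s \<in> carrier (sec \<F> U)"
    "res \<F> U W s = \<zero>\<^bsub>sec \<F> W\<^esub>"
  shows "res \<F> U W (act U \<phi> s) = \<zero>\<^bsub>sec \<F> W\<^esub>"
  using res_act[OF U \<phi> s(1)] act_of_zero[OF U(2) \<phi>] s(2) by simp

lemma complex_sections_simps [simp]:
  "carrier (complex_sections \<O> \<F>' U) = carrier (sec \<F>' U)"
  "ring.add (complex_sections \<O> \<F>' U) = ring.add (sec \<F>' U)"
  "ring.zero (complex_sections \<O> \<F>' U) = ring.zero (sec \<F>' U)"
  "c \<odot>\<^bsub>complex_sections \<O> \<F>' U\<^esub> s = (c \<odot>\<^bsub>sec \<O> U\<^esub> \<one>\<^bsub>sec \<O> U\<^esub>) \<odot>\<^bsub>sec \<F>' U\<^esub> s"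
  by (simp_all add: complex_sections_def)

abbreviation const :: "'a set \<Rightarrow> complex \<Rightarrow> 'f" where
  "const U c \<equiv> c \<odot>\<^bsub>sec \<O> U\<^esub> \<one>\<^bsub>sec \<O> U\<^esub>"

lemma const_closed: "openin M U \<Longrightarrow> const U c \<in> carrier (sec \<O> U)"
  by (rule algebra_const_closed[OF algebra_O])

lemma res_const:
  assumes "openin M U" "openin M V" "V \<subseteq> U"
  shows "res \<O> U V (const U c) = const V c"
proof -
  interpret cring "sec \<O> U" by (rule cring_O) fact
  show ?thesis
    using linear_mapD(3)[OF res_O_linear[OF assms], of "\<one>\<^bsub>sec \<O> U\<^esub>" c] ring_hom_one[OF res_O_hom[OF assms]] by simp
qed

lemma module_complex_sections: "openin M U \<Longrightarrow> Module.module \<C> (complex_sections \<O> \<F> U)"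
proof -
  assume U: "openin M U"
  interpret Module.module "sec \<O> U" "sec \<F> U" by (rule module_F) fact
  note alg = algebra_O[OF U]
  note cc = const_closed[OF U]
  show ?thesis
  proof (rule moduleI[OF _ abelian_groupI])
    fix x assume "x \<in> carrier (complex_sections \<O> \<F> U)"
    then show "\<exists>y\<in>carrier (complex_sections \<O> \<F> U). y \<oplus>\<^bsub>complex_sections \<O> \<F> U\<^esub> x = \<zero>\<^bsub>complex_sections \<O> \<F> U\<^esub>"
      using M.l_neg[of x] by (intro bexI[of _ "\<ominus>\<^bsub>sec \<F> U\<^esub> x"]) auto
  next
    show "cring \<C>" by (rule cring_from_type_algebra)
  qed (use cc algebra_const_one[OF alg] in \<open>auto simp: M.a_ac algebra_const_add[OF alg] algebra_const_mult[OF alg]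
      smult_l_distr smult_r_distr smult_assoc1\<close>)
qed

lemma linear_map_act:
  assumes "openin M U" "\<phi> \<in> carrier (sec \<O> \<Omega>)"
  shows "linear_map (complex_sections \<O> \<F> U) (complex_sections \<O> \<F> U) (act U \<phi>)"
  by (rule linear_mapI) (use assms in \<open>simp_all add: act_closed act_add act_smult const_closed\<close>)

lemma linear_map_res:
  assumes "openin M U" "openin M V" "V \<subseteq> U"
  shows "linear_map (complex_sections \<O> \<F> U) (complex_sections \<O> \<F> V) (res \<F> U V)"
  by (rule linear_mapI)
    (use assms in \<open>simp_all add: res_F_closed res_F_add res_smult const_closed res_const\<close>)


section \<open>Differential operators into the reduced sheaf: multiplication, restriction, extension
  by zero\<close>

section \<open>Differential operators\<close>

abbreviation red :: "('a, 'f, 'a \<Rightarrow> complex) presheaf" where "red \<equiv> reduced_sheaf M \<O>"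

lemma red_simps [simp]:
  "\<zero>\<^bsub>sec red U\<^esub> = (\<lambda>a\<in>U. 0)"
  "g \<oplus>\<^bsub>sec red U\<^esub> h = (\<lambda>a\<in>U. g a + h a)"
  "f \<odot>\<^bsub>sec red U\<^esub> g = (\<lambda>a\<in>U. value_at M \<O> U f a * g a)"
  "res red U V g = restrict g V"
  by (simp_all add: reduced_sheaf_def)

lemma red_extensional: "g \<in> carrier (sec red U) \<Longrightarrow> g \<in> extensional U"
  by (simp add: reduced_sheaf_def)

text \<open>To be locally a value function is a local condition, and functions glue by themselves,
  so membership may be checked near each point.\<close>

lemma red_localI:
  assumes "g \<in> extensional U"
    "\<And>a. a \<in> U \<Longrightarrow> \<exists>V. openin M V \<and> a \<in> V \<and> V \<subseteq> U \<and> restrict g V \<in> carrier (sec red V)"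
  shows "g \<in> carrier (sec red U)"
proof -
  have "\<exists>V f. openin M V \<and> a \<in> V \<and> V \<subseteq> U \<and> f \<in> carrier (sec \<O> V) \<and> (\<forall>b\<in>V. g b = value_at M \<O> V f b)"
    if a: "a \<in> U" for a
  proof -
    obtain V where V: "openin M V" "a \<in> V" "V \<subseteq> U" "restrict g V \<in> carrier (sec red V)" using assms(2)[OF a] by auto
    then obtain V' f where V': "openin M V'" "a \<in> V'" "V' \<subseteq> V" "f \<in> carrier (sec \<O> V')"
      "\<forall>b\<in>V'. restrict g V b = value_at M \<O> V' f b"
      unfolding reduced_sheaf_def by auto
    have "g b = value_at M \<O> V' f b" if b: "b \<in> V'" for b
    proof -
      have "restrict g V b = g b" using subsetD[OF V'(3) b] by simp
      then show ?thesis using V'(5) b by metis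
    qed
    then show ?thesis using V V'(1-4) by (intro exI[of _ V'] exI[of _ f]) blast
  qed
  then show ?thesis using assms(1) by (simp add: reduced_sheaf_def)
qed

lemma red_zero: "openin M U \<Longrightarrow> (\<lambda>a\<in>U. 0) \<in> carrier (sec red U)"
proof -
  assume U: "openin M U"
  interpret cring "sec \<O> U" by (rule cring_O) fact
  have "\<exists>V f. openin M V \<and> a \<in> V \<and> V \<subseteq> U \<and> f \<in> carrier (sec \<O> V) \<and> (\<forall>b\<in>V. (\<lambda>a\<in>U. 0) b = value_at M \<O> V f b)"
    if a: "a \<in> U" for a
    using U a value_zero[OF U] zero_closed by (intro exI[of _ U] exI[of _ "\<zero>\<^bsub>sec \<O> U\<^esub>"]) simp
  then show ?thesis by (simp add: reduced_sheaf_def)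
qed

text \<open>\<open>a_inv\<close> is a definite description in a record whose group laws are not
  established here. The one difference that gets evaluated, in the commutators of an operator that
  is zero, is therefore computed by hand.\<close>

lemma red_zero_minus_zero: "openin M U \<Longrightarrow> (\<lambda>a\<in>U. 0) \<ominus>\<^bsub>sec red U\<^esub> (\<lambda>a\<in>U. 0) = (\<lambda>a\<in>U. 0)"
proof -
  assume U: "openin M U"
  let ?z = "\<lambda>a\<in>U. 0::complex"
  have "a_inv (sec red U) ?z = ?z"
    unfolding a_inv_def m_inv_def
  proof (rule the_equality)
    show "?z \<in> carrier (add_monoid (sec red U)) \<and> ?z \<otimes>\<^bsub>add_monoid (sec red U)\<^esub> ?z = \<one>\<^bsub>add_monoid (sec red U)\<^esub> \<and>
        ?z \<otimes>\<^bsub>add_monoid (sec red U)\<^esub> ?z = \<one>\<^bsub>add_monoid (sec red U)\<^esub>"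
      using red_zero[OF U] by (auto simp: fun_eq_iff)
    fix y assume y: "y \<in> carrier (add_monoid (sec red U)) \<and> ?z \<otimes>\<^bsub>add_monoid (sec red U)\<^esub> y = \<one>\<^bsub>add_monoid (sec red U)\<^esub> \<and>
        y \<otimes>\<^bsub>add_monoid (sec red U)\<^esub> ?z = \<one>\<^bsub>add_monoid (sec red U)\<^esub>"
    then have "(\<lambda>a\<in>U. ?z a + y a) = ?z" "y \<in> extensional U" using red_extensional by auto
    then have "y a = 0" if "a \<in> U" for a using that by (metis (no_types, lifting) add_0 restrict_apply')
    then show "y = ?z" using \<open>y \<in> extensional U\<close> by (auto simp: fun_eq_iff extensional_def)
  qed
  then show ?thesis by (auto simp: a_minus_def fun_eq_iff)
qed

abbreviation diff_op :: "'a set \<Rightarrow> ('a set \<Rightarrow> 's \<Rightarrow> 'a \<Rightarrow> complex) \<Rightarrow> bool" where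
  "diff_op U D \<equiv> differential_operator M \<O> \<F> red U D"

lemma linear_sheaf_homD:
  assumes D: "linear_sheaf_hom M \<O> \<F> red U D" and W: "openin M W" "W \<subseteq> U"
  shows hom_closed: "s \<in> carrier (sec \<F> W) \<Longrightarrow> D W s \<in> carrier (sec red W)"
    and hom_extensional: "s \<in> carrier (sec \<F> W) \<Longrightarrow> D W s \<in> extensional W"
    and hom_add: "s \<in> carrier (sec \<F> W) \<Longrightarrow> t \<in> carrier (sec \<F> W) \<Longrightarrow> a \<in> W \<Longrightarrow>
      D W (s \<oplus>\<^bsub>sec \<F> W\<^esub> t) a = D W s a + D W t a"
    and hom_smult: "s \<in> carrier (sec \<F> W) \<Longrightarrow> a \<in> W \<Longrightarrow>
      D W (const W c \<odot>\<^bsub>sec \<F> W\<^esub> s) a = value_at M \<O> W (const W c) a * D W s a"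
    and hom_zero: "D W \<zero>\<^bsub>sec \<F> W\<^esub> = (\<lambda>a\<in>W. 0)"
    and hom_res: "openin M V \<Longrightarrow> V \<subseteq> W \<Longrightarrow> s \<in> carrier (sec \<F> W) \<Longrightarrow> a \<in> V \<Longrightarrow> D V (res \<F> W V s) a = D W s a"
proof -
  have l: "linear_map (complex_sections \<O> \<F> W) (complex_sections \<O> red W) (D W)"
    using D W by (simp add: linear_sheaf_hom_def)
  note ld = linear_mapD[OF l, simplified]
  show c: "s \<in> carrier (sec \<F> W) \<Longrightarrow> D W s \<in> carrier (sec red W)" for s by (rule ld(1))
  then show ext: "s \<in> carrier (sec \<F> W) \<Longrightarrow> D W s \<in> extensional W" for s by (rule red_extensional)
  show add: "s \<in> carrier (sec \<F> W) \<Longrightarrow> t \<in> carrier (sec \<F> W) \<Longrightarrow> a \<in> W \<Longrightarrow>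
      D W (s \<oplus>\<^bsub>sec \<F> W\<^esub> t) a = D W s a + D W t a" for s t a
    using ld(2) by simp
  show "s \<in> carrier (sec \<F> W) \<Longrightarrow> a \<in> W \<Longrightarrow>
      D W (const W c \<odot>\<^bsub>sec \<F> W\<^esub> s) a = value_at M \<O> W (const W c) a * D W s a"
    using ld(3) by simp
  have "D W \<zero>\<^bsub>sec \<F> W\<^esub> a = 0" if "a \<in> W" for a
    using add[OF zero_F[OF W(1)] zero_F[OF W(1)] that] zero_add_zero_F[OF W(1)] by simp
  then show "D W \<zero>\<^bsub>sec \<F> W\<^esub> = (\<lambda>a\<in>W. 0)"
    using ext[OF zero_F[OF W(1)]] by (auto simp: fun_eq_iff extensional_def)
  show "openin M V \<Longrightarrow> V \<subseteq> W \<Longrightarrow> s \<in> carrier (sec \<F> W) \<Longrightarrow> a \<in> V \<Longrightarrow> D V (res \<F> W V s) a = D W s a"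
    using D W by (simp add: linear_sheaf_hom_def)
qed

lemma linear_sheaf_homI:
  assumes "\<And>W s. openin M W \<Longrightarrow> W \<subseteq> U \<Longrightarrow> s \<in> carrier (sec \<F> W) \<Longrightarrow> D W s \<in> carrier (sec red W)"
    and "\<And>W s t a. openin M W \<Longrightarrow> W \<subseteq> U \<Longrightarrow> s \<in> carrier (sec \<F> W) \<Longrightarrow> t \<in> carrier (sec \<F> W) \<Longrightarrow> a \<in> W \<Longrightarrow>
      D W (s \<oplus>\<^bsub>sec \<F> W\<^esub> t) a = D W s a + D W t a"
    and "\<And>W s c a. openin M W \<Longrightarrow> W \<subseteq> U \<Longrightarrow> s \<in> carrier (sec \<F> W) \<Longrightarrow> a \<in> W \<Longrightarrow>
      D W (const W c \<odot>\<^bsub>sec \<F> W\<^esub> s) a = value_at M \<O> W (const W c) a * D W s a"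
    and "\<And>V W s a. openin M V \<Longrightarrow> openin M W \<Longrightarrow> V \<subseteq> W \<Longrightarrow> W \<subseteq> U \<Longrightarrow> s \<in> carrier (sec \<F> W) \<Longrightarrow> a \<in> V \<Longrightarrow>
      D V (res \<F> W V s) a = D W s a"
  shows "linear_sheaf_hom M \<O> \<F> red U D"
  unfolding linear_sheaf_hom_def
proof (intro conjI allI impI ballI)
  fix W assume W: "openin M W \<and> W \<subseteq> U"
  note ext = red_extensional[OF assms(1)]
  show "linear_map (complex_sections \<O> \<F> W) (complex_sections \<O> red W) (D W)"
  proof (rule linear_mapI, goal_cases)
    case (1 x)
    then show ?case using W assms(1) by simp
  next
    case (2 x y)
    then have "x \<oplus>\<^bsub>sec \<F> W\<^esub> y \<in> carrier (sec \<F> W)" using W add_F by auto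
    then have "D W (x \<oplus>\<^bsub>sec \<F> W\<^esub> y) \<in> extensional W" using ext W by blast
    then show ?case using W 2 assms(2)[of W x y] by (auto simp: fun_eq_iff extensional_def)
  next
    case (3 c x)
    then have "const W c \<odot>\<^bsub>sec \<F> W\<^esub> x \<in> carrier (sec \<F> W)" using W smult_F const_closed by auto
    then have "D W (const W c \<odot>\<^bsub>sec \<F> W\<^esub> x) \<in> extensional W" using ext W by blast
    then show ?case using W 3 assms(3)[of W x _ c] by (auto simp: fun_eq_iff extensional_def)
  qed
next
  fix V W s assume VW: "openin M V \<and> openin M W \<and> V \<subseteq> W \<and> W \<subseteq> U" and s: "s \<in> carrier (sec \<F> W)"
  have "res \<F> W V s \<in> carrier (sec \<F> V)" using VW s res_F_closed by auto
  then have "D V (res \<F> W V s) \<in> extensional V" using red_extensional[OF assms(1)] VW by blast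
  then show "D V (res \<F> W V s) = res red W V (D W s)"
    using VW s assms(4)[of V W s] by (auto simp: fun_eq_iff extensional_def)
qed

text \<open>An operator is a function on all sets and all elements, with arbitrary values away from
  open sets and sections. Equality of functions would be too strong; agreement on sections over open
  subsets of \<open>W\<close> is what commutators respect.\<close>

definition agree_on :: "'a set \<Rightarrow> ('a set \<Rightarrow> 's \<Rightarrow> 'a \<Rightarrow> complex) \<Rightarrow> ('a set \<Rightarrow> 's \<Rightarrow> 'a \<Rightarrow> complex) \<Rightarrow> bool" where
  "agree_on W D D' \<longleftrightarrow> (\<forall>V s. openin M V \<and> V \<subseteq> W \<and> s \<in> carrier (sec \<F> V) \<longrightarrow> D V s = D' V s)"

lemma agree_on_commutator:
  assumes "openin M W" "f \<in> carrier (sec \<O> W)" "agree_on W D D'"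
  shows "agree_on W (commutator_with \<O> \<F> red W D f) (commutator_with \<O> \<F> red W D' f)"
  unfolding agree_on_def
proof (intro allI impI)
  fix V s assume V: "openin M V \<and> V \<subseteq> W \<and> s \<in> carrier (sec \<F> V)"
  then have "res \<O> W V f \<odot>\<^bsub>sec \<F> V\<^esub> s \<in> carrier (sec \<F> V)"
    using smult_F res_O_closed assms by auto
  then show "commutator_with \<O> \<F> red W D f V s = commutator_with \<O> \<F> red W D' f V s"
    using V assms(3) unfolding commutator_with_def agree_on_def by metis
qed

lemma agree_on_commutators:
  assumes "openin M W" "set fs \<subseteq> carrier (sec \<O> W)" "agree_on W D D'"
  shows "agree_on W (foldl (commutator_with \<O> \<F> red W) D fs) (foldl (commutator_with \<O> \<F> red W) D' fs)"
  using assms by (induction fs arbitrary: D D') (auto intro: agree_on_commutator)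

text \<open>Multiplication by \<open>\<phi>\<close> commutes with multiplication by every
  \<open>f\<close>, so [D o \<phi>, f] = [D, f] o \<phi>. The operator is general in the induction
  because each step replaces it by a commutator.\<close>

lemma agree_on_commutators_act:
  assumes W: "openin M W" and \<phi>: "\<phi> \<in> carrier (sec \<O> \<Omega>)" and "set fs \<subseteq> carrier (sec \<O> W)"
  shows "agree_on W (foldl (commutator_with \<O> \<F> red W) (\<lambda>V s. D V (act V \<phi> s)) fs)
    (\<lambda>V s. foldl (commutator_with \<O> \<F> red W) D fs V (act V \<phi> s))"
  using assms(3)
proof (induction fs arbitrary: D)
  case Nil
  show ?case by (simp add: agree_on_def)
next
  case (Cons f fs)
  let ?c = "commutator_with \<O> \<F> red W"
  have f: "f \<in> carrier (sec \<O> W)" and fs: "set fs \<subseteq> carrier (sec \<O> W)" using Cons.prems by auto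
  have "agree_on W (?c (\<lambda>V s. D V (act V \<phi> s)) f) (\<lambda>V s. ?c D f V (act V \<phi> s))"
    unfolding agree_on_def commutator_with_def using act_smult \<phi> res_O_closed[OF W _ _ f] by auto
  then have "agree_on W (foldl ?c (?c (\<lambda>V s. D V (act V \<phi> s)) f) fs) (foldl ?c (\<lambda>V s. ?c D f V (act V \<phi> s)) fs)"
    by (rule agree_on_commutators[OF W fs])
  moreover note Cons.IH[OF fs, of "?c D f"]
  ultimately show ?case unfolding agree_on_def by simp
qed

lemma order_le_cong:
  assumes "agree_on V D D'" "order_le M \<O> \<F> red V D r"
  shows "order_le M \<O> \<F> red V D' r"
  unfolding order_le_def zero_on_def
proof (intro allI impI ballI)
  fix W fs V' s
  assume W: "openin M W \<and> W \<subseteq> V \<and> length fs = Suc r \<and> set fs \<subseteq> carrier (sec \<O> W)"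
    and V': "openin M V' \<and> V' \<subseteq> W" and s: "s \<in> carrier (sec \<F> V')"
  have "agree_on W D D'" using assms(1) W by (auto simp: agree_on_def)
  then have "agree_on W (foldl (commutator_with \<O> \<F> red W) D fs) (foldl (commutator_with \<O> \<F> red W) D' fs)"
    using W by (intro agree_on_commutators) auto
  then show "foldl (commutator_with \<O> \<F> red W) D' fs V' s = \<zero>\<^bsub>sec red V'\<^esub>"
    using assms(2) W V' s unfolding agree_on_def order_le_def zero_on_def by metis
qed

text \<open>Multiplication by \<open>\<phi>\<close> has order zero: the iterated commutators of the
  composite are those of \<open>D\<close>, evaluated on \<open>\<phi> s\<close>.\<close>

lemma order_le_act:
  assumes \<phi>: "\<phi> \<in> carrier (sec \<O> \<Omega>)" and "order_le M \<O> \<F> red V D r"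
  shows "order_le M \<O> \<F> red V (\<lambda>V s. D V (act V \<phi> s)) r"
  unfolding order_le_def zero_on_def
proof (intro allI impI ballI)
  fix W fs V' s
  assume W: "openin M W \<and> W \<subseteq> V \<and> length fs = Suc r \<and> set fs \<subseteq> carrier (sec \<O> W)"
    and V': "openin M V' \<and> V' \<subseteq> W" and s: "s \<in> carrier (sec \<F> V')"
  have "agree_on W (foldl (commutator_with \<O> \<F> red W) (\<lambda>V s. D V (act V \<phi> s)) fs)
    (\<lambda>V s. foldl (commutator_with \<O> \<F> red W) D fs V (act V \<phi> s))"
    using W by (intro agree_on_commutators_act[OF _ \<phi>]) auto
  then have "foldl (commutator_with \<O> \<F> red W) (\<lambda>V s. D V (act V \<phi> s)) fs V' s =
      foldl (commutator_with \<O> \<F> red W) D fs V' (act V' \<phi> s)"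
    using V' s by (auto simp: agree_on_def)
  also have "\<dots> = \<zero>\<^bsub>sec red V'\<^esub>"
    using assms(2) W V' act_closed[OF _ \<phi> s] unfolding order_le_def zero_on_def by blast
  finally show "foldl (commutator_with \<O> \<F> red W) (\<lambda>V s. D V (act V \<phi> s)) fs V' s = \<zero>\<^bsub>sec red V'\<^esub>" .
qed

lemma diff_op_act:
  assumes \<phi>: "\<phi> \<in> carrier (sec \<O> \<Omega>)" and D: "diff_op U D"
  shows "diff_op U (\<lambda>V s. D V (act V \<phi> s))"
  unfolding differential_operator_def
proof (intro conjI ballI)
  have h: "linear_sheaf_hom M \<O> \<F> red U D" using D by (simp add: differential_operator_def)
  show "linear_sheaf_hom M \<O> \<F> red U (\<lambda>V s. D V (act V \<phi> s))"
  proof (rule linear_sheaf_homI)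
    fix W s assume W: "openin M W" "W \<subseteq> U" and s: "s \<in> carrier (sec \<F> W)"
    note as = act_closed[OF W(1) \<phi> s]
    show "D W (act W \<phi> s) \<in> carrier (sec red W)" by (rule hom_closed[OF h W as])
    show "D W (act W \<phi> (s \<oplus>\<^bsub>sec \<F> W\<^esub> t)) a = D W (act W \<phi> s) a + D W (act W \<phi> t) a"
      if "t \<in> carrier (sec \<F> W)" "a \<in> W" for t a
      using hom_add[OF h W as act_closed[OF W(1) \<phi> that(1)] that(2)] act_add[OF W(1) \<phi> s that(1)] by simp
    show "D W (act W \<phi> (const W c \<odot>\<^bsub>sec \<F> W\<^esub> s)) a = value_at M \<O> W (const W c) a * D W (act W \<phi> s) a"
      if "a \<in> W" for c a
      using hom_smult[OF h W as that] act_smult[OF W(1) \<phi> const_closed[OF W(1)] s] by simp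
    show "D V (act V \<phi> (res \<F> W V s)) a = D W (act W \<phi> s) a" if "openin M V" "V \<subseteq> W" "a \<in> V" for V a
      using hom_res[OF h W that(1,2) as that(3)] res_act[OF W(1) that(1,2) \<phi> s] by simp
  qed
  fix a assume "a \<in> U"
  then show "\<exists>V r. openin M V \<and> a \<in> V \<and> V \<subseteq> U \<and> order_le M \<O> \<F> red V (\<lambda>V s. D V (act V \<phi> s)) r"
    using D order_le_act[OF \<phi>] unfolding differential_operator_def by meson
qed

lemma diff_op_restrict:
  assumes "diff_op U D" "openin M V" "V \<subseteq> U"
  shows "diff_op V D"
  unfolding differential_operator_def
proof (intro conjI ballI)
  show "linear_sheaf_hom M \<O> \<F> red V D"
    using assms unfolding differential_operator_def linear_sheaf_hom_def by auto
  fix a assume a: "a \<in> V"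
  then obtain W r where W: "openin M W" "a \<in> W" "W \<subseteq> U" "order_le M \<O> \<F> red W D r"
    using assms unfolding differential_operator_def by blast
  then have "order_le M \<O> \<F> red (W \<inter> V) D r" unfolding order_le_def by auto
  then show "\<exists>W r. openin M W \<and> a \<in> W \<and> W \<subseteq> V \<and> order_le M \<O> \<F> red W D r"
    using W a assms by (intro exI[of _ "W \<inter> V"] exI[of _ r]) auto
qed

text \<open>\<open>D\<close> is zero on a neighbourhood of the point, and the value of
  \<open>D W s\<close> there may be computed after restriction to that neighbourhood.\<close>

lemma vanishes_off_operator_support:
  assumes h: "linear_sheaf_hom M \<O> \<F> red U D" and W: "openin M W" "W \<subseteq> U" and s: "s \<in> carrier (sec \<F> W)"
    and a: "a \<in> W" "a \<notin> operator_support M \<F> red U D"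
  shows "D W s a = 0"
proof -
  obtain V where V: "openin M V" "V \<subseteq> U" "zero_on M \<F> red V D" "a \<in> V"
    using a W by (auto simp: operator_support_def)
  have o: "openin M (W \<inter> V)" using W V by auto
  have "D (W \<inter> V) (res \<F> W (W \<inter> V) s) = \<zero>\<^bsub>sec red (W \<inter> V)\<^esub>"
    using V o res_F_closed[OF W(1) o _ s] by (auto simp: zero_on_def)
  then have "D (W \<inter> V) (res \<F> W (W \<inter> V) s) a = 0" using a V by simp
  then show ?thesis using hom_res[OF h W o _ s, of a] a V by simp
qed

text \<open>The support is the intersection of the compact set \<open>K\<close> with a closed set,
  the complement of all open sets on which \<open>D\<close> is zero.\<close>

lemma compact_operator_support:
  assumes U: "openin M U" and K: "compactin M K" "K \<subseteq> U" and z: "zero_on M \<F> red (U - K) D"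
  shows "compactin M (operator_support M \<F> red U D)"
proof -
  let ?G = "\<Union>{V. openin M V \<and> V \<subseteq> U \<and> zero_on M \<F> red V D}"
  have "U - K \<subseteq> ?G" using z openin_minus_compact[OF U K(1)] by (intro Union_upper) simp
  then have "operator_support M \<F> red U D = (\<Omega> - ?G) \<inter> K"
    using K subset_total[OF U] by (auto simp: operator_support_def)
  moreover have "compactin M ((\<Omega> - ?G) \<inter> K)"
    by (intro closed_Int_compactin K(1) closedin_diff closedin_topspace openin_Union) simp
  ultimately show ?thesis by simp
qed


abbreviation Dc :: "'a set \<Rightarrow> ('a set \<Rightarrow> 's \<Rightarrow> 'a \<Rightarrow> complex) set" where
  "Dc U \<equiv> Diff_c M \<O> \<F> red U"

lemma Diff_cD:
  assumes "D \<in> Dc U"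
  shows "diff_op U D" "linear_sheaf_hom M \<O> \<F> red U D" "compactin M (operator_support M \<F> red U D)"
    "operator_support M \<F> red U D \<subseteq> U"
  using assms by (auto simp: Diff_c_def differential_operator_def operator_support_def)

lemma Diff_cI:
  assumes "openin M U" "diff_op U D" "compactin M K" "K \<subseteq> U"
    and "\<And>W s a. openin M W \<Longrightarrow> W \<subseteq> U - K \<Longrightarrow> s \<in> carrier (sec \<F> W) \<Longrightarrow> a \<in> W \<Longrightarrow> D W s a = 0"
  shows "D \<in> Dc U"
proof -
  have h: "linear_sheaf_hom M \<O> \<F> red U D" using assms(2) by (simp add: differential_operator_def)
  have "zero_on M \<F> red (U - K) D"
    unfolding zero_on_def
  proof (intro allI impI ballI)
    fix W s assume W: "openin M W \<and> W \<subseteq> U - K" and s: "s \<in> carrier (sec \<F> W)"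
    then have "D W s \<in> extensional W" using hom_extensional[OF h] by blast
    then show "D W s = \<zero>\<^bsub>sec red W\<^esub>" using assms(5)[of W s] W s by (auto simp: fun_eq_iff extensional_def)
  qed
  then show ?thesis
    using assms(2) compact_operator_support[OF assms(1,3,4)] by (simp add: Diff_c_def)
qed

lemma Diff_c_act:
  assumes U: "openin M U" and \<phi>: "\<phi> \<in> carrier (sec \<O> \<Omega>)" and D: "D \<in> Dc U"
  shows "(\<lambda>W s. D W (act W \<phi> s)) \<in> Dc U"
proof (rule Diff_cI[OF U diff_op_act[OF \<phi> Diff_cD(1)[OF D]] Diff_cD(3,4)[OF D]])
  fix W s a assume W: "openin M W" "W \<subseteq> U - operator_support M \<F> red U D" and s: "s \<in> carrier (sec \<F> W)" and a: "a \<in> W"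
  then show "D W (act W \<phi> s) a = 0"
    by (intro vanishes_off_operator_support[OF Diff_cD(2)[OF D]] act_closed \<phi>) auto
qed

text \<open>The support of \<open>D\<close> may leave \<open>V\<close>, but after multiplication by
  \<open>\<phi>\<close> the operator is zero off the compact set \<open>C\<close> inside
  \<open>V\<close>.\<close>

lemma Diff_c_act_restrict:
  assumes U: "openin M U" and V: "openin M V" "V \<subseteq> U" and \<phi>: "cutoff_in M \<O> V \<phi>" and D: "D \<in> Dc U"
  shows "(\<lambda>W s. D W (act W \<phi> s)) \<in> Dc V"
proof -
  note c = cutoff_in_closed[OF \<phi>]
  obtain C where C: "compactin M C" "C \<subseteq> V" "res \<O> \<Omega> (\<Omega> - C) \<phi> = \<zero>\<^bsub>sec \<O> (\<Omega> - C)\<^esub>"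
    using \<phi> by (auto simp: cutoff_in_def)
  show ?thesis
  proof (rule Diff_cI[OF V(1) diff_op_restrict[OF diff_op_act[OF c Diff_cD(1)[OF D]] V] C(1,2)])
    fix W s a assume W: "openin M W" "W \<subseteq> V - C" and s: "s \<in> carrier (sec \<F> W)" and a: "a \<in> W"
    have "act W \<phi> s = \<zero>\<^bsub>sec \<F> W\<^esub>"
      by (rule act_eq_zero[OF W(1) res_total_vanish_mono[OF c C(1,3) W(1)] s]) (use W in auto)
    moreover have "W \<subseteq> U" using W V by auto
    ultimately show "D W (act W \<phi> s) a = 0" using hom_zero[OF Diff_cD(2)[OF D] W(1)] a by simp
  qed
qed

text \<open>Points outside \<open>V\<close> get the value \<open>0\<close> whatever the section does
  there. That the result takes values in the reduced sheaf depends on the support of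
  \<open>D\<close> being compact in \<open>V\<close>.\<close>

definition extend_op :: "'a set \<Rightarrow> ('a set \<Rightarrow> 's \<Rightarrow> 'a \<Rightarrow> complex) \<Rightarrow> ('a set \<Rightarrow> 's \<Rightarrow> 'a \<Rightarrow> complex)" where
  "extend_op V D = (\<lambda>W s. \<lambda>a\<in>W. if a \<in> V then D (W \<inter> V) (res \<F> W (W \<inter> V) s) a else 0)"

text \<open>The support \<open>K\<close> of \<open>D\<close> is compact, hence closed, so
  \<open>V\<close> and \<open>U - K\<close> are open and cover \<open>U\<close>. On \<open>V\<close>
  the extended operator is \<open>D\<close>, on \<open>U - K\<close> it is zero, and being a
  differential operator is a local property.\<close>

lemma Diff_c_extend:
  assumes U: "openin M U" and V: "openin M V" "V \<subseteq> U" and D: "D \<in> Dc V"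
  shows "extend_op V D \<in> Dc U"
proof -
  define K where "K = operator_support M \<F> red V D"
  note h = Diff_cD(2)[OF D]
  have K: "compactin M K" "K \<subseteq> V" using Diff_cD(3,4)[OF D] by (auto simp: K_def)
  \<comment> \<open>The value is zero also at points of \<open>V\<close> outside \<open>K\<close>,
    so the two descriptions agree on the overlap \<open>V - K\<close>.\<close>
  have off: "extend_op V D W s a = 0" if "openin M W" "W \<subseteq> U" "s \<in> carrier (sec \<F> W)" "a \<in> W" "a \<notin> K" for W s a
  proof (cases "a \<in> V")
    case True
    have o: "openin M (W \<inter> V)" using that V by auto
    show ?thesis
      using vanishes_off_operator_support[OF h o _ res_F_closed[OF that(1) o _ that(3)], of a] that True
      by (auto simp: extend_op_def K_def)
  qed (use that in \<open>simp add: extend_op_def\<close>)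
  have zero_fun: "extend_op V D W s = (\<lambda>a\<in>W. 0)" if "openin M W" "W \<subseteq> U - K" "s \<in> carrier (sec \<F> W)" for W s
  proof
    fix a
    have "a \<in> W \<Longrightarrow> a \<notin> K" "W \<subseteq> U" using that by auto
    then show "extend_op V D W s a = (\<lambda>a\<in>W. 0) a" using off[OF that(1) _ that(3), of a]
      by (cases "a \<in> W") (auto simp: extend_op_def)
  qed
  have UK: "openin M (U - K)" by (rule openin_minus_compact[OF U K(1)])
  have hom: "linear_sheaf_hom M \<O> \<F> red U (extend_op V D)"
  proof (rule linear_sheaf_homI)
    fix W s assume W: "openin M W" "W \<subseteq> U" and s: "s \<in> carrier (sec \<F> W)"
    have o: "openin M (W \<inter> V)" using W V by auto
    note rs = res_F_closed[OF W(1) o Int_lower1 s]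
    show "extend_op V D W s \<in> carrier (sec red W)"
    \<comment> \<open>At points of \<open>V\<close> the function is locally a value of
      \<open>D\<close>; the other points have the neighbourhood \<open>W - K\<close>, where it is
      zero.\<close>
    proof (rule red_localI)
      fix a assume a: "a \<in> W"
      show "\<exists>V'. openin M V' \<and> a \<in> V' \<and> V' \<subseteq> W \<and> restrict (extend_op V D W s) V' \<in> carrier (sec red V')"
      proof (cases "a \<in> V")
        case True
        have "restrict (extend_op V D W s) (W \<inter> V) = D (W \<inter> V) (res \<F> W (W \<inter> V) s)"
          using hom_extensional[OF h o Int_lower2 rs] by (auto simp: fun_eq_iff extend_op_def extensional_def)
        then show ?thesis using hom_closed[OF h o Int_lower2 rs] o a True by (intro exI[of _ "W \<inter> V"]) auto
      next
        case False
        have o': "openin M (W - K)" by (rule openin_minus_compact[OF W(1) K(1)])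
        have "restrict (extend_op V D W s) (W - K) = (\<lambda>a\<in>W - K. 0)"
          using off[OF W s] by (auto simp: fun_eq_iff)
        then show ?thesis using red_zero[OF o'] o' a False K by (intro exI[of _ "W - K"]) auto
      qed
    qed (simp add: extend_op_def)
    show "extend_op V D W (s \<oplus>\<^bsub>sec \<F> W\<^esub> t) a = extend_op V D W s a + extend_op V D W t a"
      if t: "t \<in> carrier (sec \<F> W)" and a: "a \<in> W" for t a
      using a hom_add[OF h o Int_lower2 rs res_F_closed[OF W(1) o Int_lower1 t], of a]
      by (simp add: extend_op_def res_F_add[OF W(1) o Int_lower1 s t])
    show "extend_op V D W (const W c \<odot>\<^bsub>sec \<F> W\<^esub> s) a = value_at M \<O> W (const W c) a * extend_op V D W s a"
      if a: "a \<in> W" for c a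
    proof (cases "a \<in> V")
      case True
      \<comment> \<open>Scalars act through constant sections of \<open>\<O>\<close>, whose values
        do not change when they are restricted to \<open>W \<inter> V\<close>.\<close>
      have "value_at M \<O> (W \<inter> V) (const (W \<inter> V) c) a = value_at M \<O> W (const W c) a"
        using value_at_restrict[OF algebras W(1) o Int_lower1 _ const_closed[OF W(1)], of a c] a True
        by (simp add: res_const[OF W(1) o])
      then show ?thesis
        using a True hom_smult[OF h o Int_lower2 rs, of a c] res_smult[OF W(1) o Int_lower1 const_closed[OF W(1)] s, of c]
        by (simp add: extend_op_def res_const[OF W(1) o])
    qed (simp add: extend_op_def a)
    show "extend_op V D W' (res \<F> W W' s) a = extend_op V D W s a" if W': "openin M W'" "W' \<subseteq> W" and a: "a \<in> W'" for W' a
    proof (cases "a \<in> V")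
      case True
      have o': "openin M (W' \<inter> V)" using W' V by auto
      have sub: "W' \<inter> V \<subseteq> W \<inter> V" using W' by auto
      have "res \<F> W' (W' \<inter> V) (res \<F> W W' s) = res \<F> (W \<inter> V) (W' \<inter> V) (res \<F> W (W \<inter> V) s)"
        using res_F_comp[OF W(1) W'(1) o' _ W'(2) s] res_F_comp[OF W(1) o o' sub _ s] by auto
      then show ?thesis
        using a W' True hom_res[OF h o Int_lower2 o' sub rs, of a] by (auto simp: extend_op_def)
    qed (use a W' in \<open>auto simp: extend_op_def\<close>)
  qed
  have "\<exists>W r. openin M W \<and> a \<in> W \<and> W \<subseteq> U \<and> order_le M \<O> \<F> red W (extend_op V D) r" if a: "a \<in> U" for a
  proof (cases "a \<in> V")
    case True
    then obtain W r where W: "openin M W" "a \<in> W" "W \<subseteq> V" "order_le M \<O> \<F> red W D r"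
      using Diff_cD(1)[OF D] unfolding differential_operator_def by blast
    have "agree_on W D (extend_op V D)"
      unfolding agree_on_def
    proof (intro allI impI)
      fix W' s assume W': "openin M W' \<and> W' \<subseteq> W \<and> s \<in> carrier (sec \<F> W')"
      then have "W' \<inter> V = W'" using W by auto
      moreover have "D W' s \<in> extensional W'" using hom_extensional[OF h] W' W by auto
      ultimately show "D W' s = extend_op V D W' s"
        using W' W by (auto simp: fun_eq_iff extend_op_def extensional_def res_F_id)
    qed
    from order_le_cong[OF this W(4)] show ?thesis using W V by (intro exI[of _ W] exI[of _ r]) auto
  next
    case False
    \<comment> \<open>Outside \<open>V\<close> the order is bounded trivially: all commutators of an
      operator that is zero on \<open>U - K\<close> are zero.\<close>
    have "order_le M \<O> \<F> red (U - K) (extend_op V D) 0"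
      unfolding order_le_def zero_on_def
    proof (intro allI impI ballI)
      fix W fs W' s
      assume W: "openin M W \<and> W \<subseteq> U - K \<and> length fs = Suc 0 \<and> set fs \<subseteq> carrier (sec \<O> W)"
        and W': "openin M W' \<and> W' \<subseteq> W" and s: "s \<in> carrier (sec \<F> W')"
      then obtain f where f: "fs = [f]" "f \<in> carrier (sec \<O> W)" by (cases fs) auto
      have o: "openin M W'" "W' \<subseteq> U - K" using W W' by auto
      have "res \<O> W W' f \<odot>\<^bsub>sec \<F> W'\<^esub> s \<in> carrier (sec \<F> W')"
        using smult_F[OF o(1) _ s] res_O_closed[OF _ o(1) _ f(2)] W W' by auto
      then have "extend_op V D W' (res \<O> W W' f \<odot>\<^bsub>sec \<F> W'\<^esub> s) = (\<lambda>a\<in>W'. 0)" "extend_op V D W' s = (\<lambda>a\<in>W'. 0)"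
        using zero_fun[OF o] s by auto
      moreover have "(\<lambda>a\<in>W'. value_at M \<O> W' (res \<O> W W' f) a * (\<lambda>a\<in>W'. 0) a) = (\<lambda>a\<in>W'. 0)" by auto
      ultimately show "foldl (commutator_with \<O> \<F> red W) (extend_op V D) fs W' s = \<zero>\<^bsub>sec red W'\<^esub>"
        using red_zero_minus_zero[OF o(1)] by (simp add: f(1) commutator_with_def)
    qed
    then show ?thesis using UK a False K by (intro exI[of _ "U - K"] exI[of _ 0]) auto
  qed
  then have "diff_op U (extend_op V D)" using hom by (simp add: differential_operator_def)
  then show ?thesis
  proof (rule Diff_cI[OF U _ K(1)])
    fix W s a assume "openin M W" "W \<subseteq> U - K" "s \<in> carrier (sec \<F> W)" "a \<in> W"
    moreover from this have "W \<subseteq> U" "a \<notin> K" by auto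
    ultimately show "extend_op V D W s a = 0" using off by simp
  qed (use K V in auto)
qed


section \<open>Continuity of multiplication, restriction and cut-off extension\<close>

section \<open>The smooth topology\<close>

abbreviation ss :: "'a set \<Rightarrow> 's tvs" where "ss U \<equiv> smooth_sections M \<O> \<F> U"

lemma smooth_sections_simps [simp]:
  "carrier (ss U) = carrier (sec \<F> U)" "ring.add (ss U) = ring.add (sec \<F> U)"
  "ring.zero (ss U) = ring.zero (sec \<F> U)" "c \<odot>\<^bsub>ss U\<^esub> s = const U c \<odot>\<^bsub>sec \<F> U\<^esub> s"
  "topspace (top_of (ss U)) = carrier (sec \<F> U)"
  by (simp_all add: smooth_sections_def)

lemma module_ss: "openin M U \<Longrightarrow> Module.module \<C> (ss U)"
  unfolding smooth_sections_def by (intro module_with_topology module_complex_sections)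

lemma continuous_map_ss:
  assumes U: "openin M U" and V: "openin M V"
    and g: "linear_map (complex_sections \<O> \<F> U) (complex_sections \<O> \<F> V) g"
    and D: "\<And>D. D \<in> Dc V \<Longrightarrow> \<exists>D'\<in>Dc U. \<forall>s\<in>carrier (sec \<F> U). diff_seminorm V D (g s) = diff_seminorm U D' s"
  shows "continuous_map (top_of (ss U)) (top_of (ss V)) g"
  unfolding smooth_sections_def with_topology_simps
proof (rule continuous_map_seminorm_topology[OF module_complex_sections[OF U] module_complex_sections[OF V] g])
  fix q assume "q \<in> diff_seminorm V ` Dc V"
  then show "\<exists>p\<in>diff_seminorm U ` Dc U. \<forall>x\<in>carrier (complex_sections \<O> \<F> U). q (g x) = p x" using D by auto
qed

text \<open>The seminorm of \<open>\<phi> s\<close> for \<open>D\<close> is the seminorm of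
  \<open>s\<close> for the composite of \<open>D\<close> with multiplication by
  \<open>\<phi>\<close>.\<close>

lemma continuous_map_act:
  assumes U: "openin M U" and \<phi>: "\<phi> \<in> carrier (sec \<O> \<Omega>)"
  shows "continuous_map (top_of (ss U)) (top_of (ss U)) (act U \<phi>)"
  by (rule continuous_map_ss[OF U U linear_map_act[OF U \<phi>]], rule bexI[OF _ Diff_c_act[OF U \<phi>]])
    (simp_all add: diff_seminorm_def)

text \<open>Passing from \<open>V\<close> to the larger \<open>U\<close> adds only the value
  \<open>0\<close> to the set whose supremum is taken, and \<open>diff_seminorm\<close> contains
  \<open>0\<close> from the start.\<close>

lemma diff_seminorm_eqI:
  assumes "V \<subseteq> U" "\<And>a. a \<in> V \<Longrightarrow> cmod (D V s a) = cmod (D' U t a)" "\<And>a. a \<in> U - V \<Longrightarrow> D' U t a = 0"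
  shows "diff_seminorm V D s = diff_seminorm U D' t"
proof -
  have "insert 0 ((\<lambda>a. cmod (D V s a)) ` V) = insert 0 ((\<lambda>a. cmod (D' U t a)) ` U)" (is "?A = ?B")
  proof (intro subset_antisym subsetI)
    fix x assume "x \<in> ?A"
    then show "x \<in> ?B" using assms(1,2) by (auto simp: image_iff)
  next
    fix x assume "x \<in> ?B"
    then consider "x = 0" | a where "a \<in> U" "x = cmod (D' U t a)" by blast
    then show "x \<in> ?A"
    proof cases
      case (2 a)
      show ?thesis
      proof (cases "a \<in> V")
        case True
        then have "x = cmod (D V s a)" using 2 assms(2) by simp
        then show ?thesis using True by blast
      qed (use 2 assms(3)[of a] in simp)
    qed simp
  qed
  then show ?thesis unfolding diff_seminorm_def by simp
qed

text \<open>The seminorm of the restriction for \<open>D\<close> is the seminorm of the full section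
  for \<open>extend_op V D\<close>, which is compactly supported again.\<close>

lemma continuous_map_res:
  assumes U: "openin M U" and V: "openin M V" "V \<subseteq> U"
  shows "continuous_map (top_of (ss U)) (top_of (ss V)) (res \<F> U V)"
proof (rule continuous_map_ss[OF U V(1) linear_map_res[OF U V]])
  fix D assume D: "D \<in> Dc V"
  have "diff_seminorm V D (res \<F> U V s) = diff_seminorm U (extend_op V D) s" for s
  proof -
    have "U \<inter> V = V" using V by auto
    then show ?thesis using V by (intro diff_seminorm_eqI) (auto simp: extend_op_def)
  qed
  then show "\<exists>D'\<in>Dc U. \<forall>s\<in>carrier (sec \<F> U). diff_seminorm V D (res \<F> U V s) = diff_seminorm U D' s"
    using Diff_c_extend[OF U V D] by (intro bexI) auto
qed

lemma ext_eqI: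
  assumes U: "openin M U" and V: "openin M V" "V \<subseteq> U" and K: "compactin M K" "K \<subseteq> V"
    and t: "t \<in> carrier (sec \<F> U)" "res \<F> U V t = s" "res \<F> U (U - K) t = \<zero>\<^bsub>sec \<F> (U - K)\<^esub>"
  shows "ext_by_zero M \<F> U V s = t"
  by (rule ext_by_zero_eqI[OF sheaf_F U V K(2) openin_minus_compact[OF U K(1)] t])

lemma ext_props:
  assumes U: "openin M U" and V: "openin M V" "V \<subseteq> U" and K: "compactin M K" "K \<subseteq> V"
    and s: "s \<in> carrier (sec \<F> V)" "res \<F> V (V - K) s = \<zero>\<^bsub>sec \<F> (V - K)\<^esub>"
  shows "ext_by_zero M \<F> U V s \<in> carrier (sec \<F> U)" "res \<F> U V (ext_by_zero M \<F> U V s) = s"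
    "res \<F> U (U - K) (ext_by_zero M \<F> U V s) = \<zero>\<^bsub>sec \<F> (U - K)\<^esub>"
  using ext_by_zero_props[OF sheaf_F U V K(2) openin_minus_compact[OF U K(1)] s] by auto

text \<open>Multiplying by a cutoff first makes extension by zero meaningful on all sections over
  \<open>V\<close>, not only on compactly supported ones. The seminorm of the result for
  \<open>D\<close> is the seminorm of \<open>s\<close> for \<open>D\<close> composed with
  multiplication by \<open>\<phi>\<close>, an operator compactly supported in
  \<open>V\<close>.\<close>

lemma ext_act:
  assumes U: "openin M U" and V: "openin M V" "V \<subseteq> U" and \<phi>: "cutoff_in M \<O> V \<phi>"
  shows linear_map_ext_act: "linear_map (complex_sections \<O> \<F> V) (complex_sections \<O> \<F> U)
      (\<lambda>s. ext_by_zero M \<F> U V (act V \<phi> s))"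
    and continuous_map_ext_act: "continuous_map (top_of (ss V)) (top_of (ss U)) (\<lambda>s. ext_by_zero M \<F> U V (act V \<phi> s))"
proof -
  note c = cutoff_in_closed[OF \<phi>]
  obtain C where C: "compactin M C" "C \<subseteq> V" "res \<O> \<Omega> (\<Omega> - C) \<phi> = \<zero>\<^bsub>sec \<O> (\<Omega> - C)\<^esub>"
    using \<phi> by (auto simp: cutoff_in_def)
  have UC: "openin M (U - C)" by (rule openin_minus_compact[OF U C(1)])
  note e = ext_props[OF U V C(1,2) act_closed[OF V(1) c] act_vanishes[OF V(1) c C(1,3)]]
  show lin: "linear_map (complex_sections \<O> \<F> V) (complex_sections \<O> \<F> U) (\<lambda>s. ext_by_zero M \<F> U V (act V \<phi> s))"
  proof (rule linear_mapI)
    fix s t assume "s \<in> carrier (complex_sections \<O> \<F> V)" "t \<in> carrier (complex_sections \<O> \<F> V)"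
    then have s: "s \<in> carrier (sec \<F> V)" and t: "t \<in> carrier (sec \<F> V)" by auto
    \<comment> \<open>A definite description is not visibly linear; the sum of the two extensions is
      recognised as the extension of the sum, with the same compact set \<open>C\<close>.\<close>
    have "ext_by_zero M \<F> U V (act V \<phi> (s \<oplus>\<^bsub>sec \<F> V\<^esub> t)) =
        ext_by_zero M \<F> U V (act V \<phi> s) \<oplus>\<^bsub>sec \<F> U\<^esub> ext_by_zero M \<F> U V (act V \<phi> t)"
      using e[OF s s] e[OF t t] add_F[OF U] zero_add_zero_F[OF UC]
      by (intro ext_eqI[OF U V C(1,2)])
        (auto simp: res_F_add[OF U V] res_F_add[OF U UC] act_add[OF V(1) c s t])
    then show "ext_by_zero M \<F> U V (act V \<phi> (s \<oplus>\<^bsub>complex_sections \<O> \<F> V\<^esub> t)) =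
        ext_by_zero M \<F> U V (act V \<phi> s) \<oplus>\<^bsub>complex_sections \<O> \<F> U\<^esub> ext_by_zero M \<F> U V (act V \<phi> t)" by simp
  next
    fix k s assume "s \<in> carrier (complex_sections \<O> \<F> V)"
    then have s: "s \<in> carrier (sec \<F> V)" by simp
    have z: "f \<odot>\<^bsub>sec \<F> (U - C)\<^esub> \<zero>\<^bsub>sec \<F> (U - C)\<^esub> = \<zero>\<^bsub>sec \<F> (U - C)\<^esub>" if "f \<in> carrier (sec \<O> (U - C))" for f
      using Module.module.smult_r_null[OF module_F[OF UC] that] .
    have "ext_by_zero M \<F> U V (act V \<phi> (const V k \<odot>\<^bsub>sec \<F> V\<^esub> s)) =
        const U k \<odot>\<^bsub>sec \<F> U\<^esub> ext_by_zero M \<F> U V (act V \<phi> s)"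
      using e[OF s s] smult_F[OF U const_closed[OF U]] z[OF const_closed[OF UC]]
      by (intro ext_eqI[OF U V C(1,2)])
        (auto simp: res_smult[OF U V const_closed[OF U]] res_smult[OF U UC _ const_closed[OF U]] res_const[OF U V] res_const[OF U UC]
          act_smult[OF V(1) c const_closed[OF V(1)] s])
    then show "ext_by_zero M \<F> U V (act V \<phi> (k \<odot>\<^bsub>complex_sections \<O> \<F> V\<^esub> s)) =
        k \<odot>\<^bsub>complex_sections \<O> \<F> U\<^esub> ext_by_zero M \<F> U V (act V \<phi> s)" by simp
  qed (use e in simp)
  show "continuous_map (top_of (ss V)) (top_of (ss U)) (\<lambda>s. ext_by_zero M \<F> U V (act V \<phi> s))"
  proof (rule continuous_map_ss[OF V(1) U lin])
    fix D assume D: "D \<in> Dc U"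
    note h = Diff_cD(2)[OF D]
    have "diff_seminorm U D (ext_by_zero M \<F> U V (act V \<phi> s)) = diff_seminorm V (\<lambda>W s. D W (act W \<phi> s)) s"
      if s: "s \<in> carrier (sec \<F> V)" for s
    proof (rule diff_seminorm_eqI[OF V(2), symmetric])
      note es = e[OF s s]
      show "cmod (D V (act V \<phi> s) a) = cmod (D U (ext_by_zero M \<F> U V (act V \<phi> s)) a)" if "a \<in> V" for a
        using hom_res[OF h U order_refl V es(1) that] es(2) by simp
      show "D U (ext_by_zero M \<F> U V (act V \<phi> s)) a = 0" if a: "a \<in> U - V" for a
      proof -
        have "a \<in> U - C" using a C by auto
        then show ?thesis
          using hom_res[OF h U order_refl UC Diff_subset es(1), of a] es(3) hom_zero[OF h UC Diff_subset] by simp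
      qed
    qed
    then show "\<exists>D'\<in>Dc V. \<forall>s\<in>carrier (sec \<F> V). diff_seminorm U D (ext_by_zero M \<F> U V (act V \<phi> s)) = diff_seminorm V D' s"
      using Diff_c_act_restrict[OF U V \<phi> D] by (intro bexI) auto
  qed
qed


section \<open>Spaces of test sections and the maps between them\<close>

section \<open>Compactly supported sections\<close>

abbreviation Fc :: "'a set \<Rightarrow> 's tvs" where "Fc U \<equiv> smooth_sections_c M \<O> \<F> U"

abbreviation compacts :: "'a set \<Rightarrow> 'a set set" where "compacts U \<equiv> {K. compactin M K \<and> K \<subseteq> U}"

lemma Fc_eq: "Fc U = tvs_union (ss U) (supported_in M \<F> U ` compacts U)"
proof -
  have "{supported_in M \<F> U K |K. compactin M K \<and> K \<subseteq> U} = supported_in M \<F> U ` compacts U" by auto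
  then show ?thesis by (simp add: smooth_sections_c_def compactly_supported_def)
qed

lemma Fc_simps [simp]:
  "ring.add (Fc U) = ring.add (sec \<F> U)" "ring.zero (Fc U) = ring.zero (sec \<F> U)"
  "c \<odot>\<^bsub>Fc U\<^esub> s = const U c \<odot>\<^bsub>sec \<F> U\<^esub> s"
  by (simp_all add: Fc_eq)

lemma mem_supported_in_F:
  assumes "openin M U" "compactin M K"
  shows "s \<in> supported_in M \<F> U K \<longleftrightarrow> s \<in> carrier (sec \<F> U) \<and> res \<F> U (U - K) s = \<zero>\<^bsub>sec \<F> (U - K)\<^esub>"
  by (rule mem_supported_in_iff[OF sheaf_F assms(1) openin_minus_compact[OF assms]])

lemma mem_Fc_iff:
  assumes "openin M U"
  shows "s \<in> carrier (Fc U) \<longleftrightarrow> s \<in> carrier (sec \<F> U) \<and>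
    (\<exists>K. compactin M K \<and> K \<subseteq> U \<and> res \<F> U (U - K) s = \<zero>\<^bsub>sec \<F> (U - K)\<^esub>)"
  using mem_supported_in_F[OF assms] by (auto simp: Fc_eq)

lemma FcI:
  assumes "openin M U" "s \<in> carrier (sec \<F> U)" "compactin M K" "K \<subseteq> U"
    "res \<F> U (U - K) s = \<zero>\<^bsub>sec \<F> (U - K)\<^esub>"
  shows "s \<in> carrier (Fc U)"
  using assms by (auto simp: mem_Fc_iff)

lemma FcE:
  assumes "openin M U" "s \<in> carrier (Fc U)"
  obtains K where "compactin M K" "K \<subseteq> U" "s \<in> carrier (sec \<F> U)" "res \<F> U (U - K) s = \<zero>\<^bsub>sec \<F> (U - K)\<^esub>"
  using assms by (auto simp: mem_Fc_iff)

lemma Fc_closed: "openin M U \<Longrightarrow> s \<in> carrier (Fc U) \<Longrightarrow> s \<in> carrier (sec \<F> U)"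
  by (simp add: mem_Fc_iff)

lemma smult_zero_F: "openin M U \<Longrightarrow> f \<in> carrier (sec \<O> U) \<Longrightarrow> f \<odot>\<^bsub>sec \<F> U\<^esub> \<zero>\<^bsub>sec \<F> U\<^esub> = \<zero>\<^bsub>sec \<F> U\<^esub>"
  by (rule Module.module.smult_r_null[OF module_F])

lemma module_Fc:
  assumes U: "openin M U"
  shows "Module.module \<C> (Fc U)"
  unfolding Fc_eq
proof (rule module_tvs_union[OF module_ss[OF U]])
  have eq: "\<Union> (supported_in M \<F> U ` compacts U) = carrier (Fc U)" by (simp add: Fc_eq)
  show "\<Union> (supported_in M \<F> U ` compacts U) \<subseteq> carrier (ss U)" using U by (auto simp: eq Fc_closed)
  show "\<zero>\<^bsub>ss U\<^esub> \<in> \<Union> (supported_in M \<F> U ` compacts U)"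
    unfolding eq using res_F_zero[OF U U order_refl] zero_F[OF U] by (auto intro!: FcI[OF U, of _ "{}"])
  fix x y assume xy: "x \<in> \<Union> (supported_in M \<F> U ` compacts U)" "y \<in> \<Union> (supported_in M \<F> U ` compacts U)"
  obtain K where K: "compactin M K" "K \<subseteq> U" "x \<in> carrier (sec \<F> U)" "res \<F> U (U - K) x = \<zero>\<^bsub>sec \<F> (U - K)\<^esub>"
    using xy(1) unfolding eq by (rule FcE[OF U])
  obtain L where L: "compactin M L" "L \<subseteq> U" "y \<in> carrier (sec \<F> U)" "res \<F> U (U - L) y = \<zero>\<^bsub>sec \<F> (U - L)\<^esub>"
    using xy(2) unfolding eq by (rule FcE[OF U])
  have KL: "compactin M (K \<union> L)" using K L by (simp add: compactin_Un)
  note o = openin_minus_compact[OF U KL]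
  have "res \<F> U (U - (K \<union> L)) x = \<zero>\<^bsub>sec \<F> (U - (K \<union> L))\<^esub>"
    by (rule res_F_vanish_mono[OF U openin_minus_compact[OF U K(1)] o _ _ K(3,4)]) auto
  moreover have "res \<F> U (U - (K \<union> L)) y = \<zero>\<^bsub>sec \<F> (U - (K \<union> L))\<^esub>"
    by (rule res_F_vanish_mono[OF U openin_minus_compact[OF U L(1)] o _ _ L(3,4)]) auto
  ultimately show "x \<oplus>\<^bsub>ss U\<^esub> y \<in> \<Union> (supported_in M \<F> U ` compacts U)"
    unfolding eq using K L KL zero_add_zero_F[OF o] res_F_add[OF U o _ K(3) L(3)] add_F[OF U]
    by (intro FcI[OF U, of _ "K \<union> L"]) auto
  fix c
  note o = openin_minus_compact[OF U K(1)]
  show "c \<odot>\<^bsub>ss U\<^esub> x \<in> \<Union> (supported_in M \<F> U ` compacts U)"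
    unfolding eq using K smult_F[OF U const_closed[OF U] K(3)] res_smult[OF U o Diff_subset const_closed[OF U] K(3)]
      smult_zero_F[OF o const_closed[OF o]] res_const[OF U o]
    by (intro FcI[OF U, of _ K]) auto
qed

lemma lcs_Fc: "openin M U \<Longrightarrow> lcs (Fc U)"
  unfolding Fc_eq by (rule lcs_tvs_union) (use module_Fc Fc_eq in simp)

lemma linear_map_Fc:
  assumes "openin M U" "linear_map (ss U) (ss V) g" "\<And>s. s \<in> carrier (Fc U) \<Longrightarrow> g s \<in> carrier (Fc V)"
  shows "linear_map (Fc U) (Fc V) g"
  by (rule linear_mapI) (use assms(3) linear_mapD[OF assms(2)] Fc_closed[OF assms(1)] in auto)

text \<open>Each compact \<open>K\<close> is tested separately, so on sections supported in
  \<open>K\<close> the map may be replaced by a \<open>G\<close> that is continuous on all sections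
  and depends on \<open>K\<close>, typically through a cutoff. The images must stay in one compact
  \<open>L\<close> to enter the limit on the other side.\<close>

lemma continuous_map_Fc:
  assumes U: "openin M U" and V: "openin M V" and g: "linear_map (Fc U) (Fc V) g"
    and K: "\<And>K. compactin M K \<Longrightarrow> K \<subseteq> U \<Longrightarrow> \<exists>L G. compactin M L \<and> L \<subseteq> V \<and>
      continuous_map (top_of (ss U)) (top_of (ss V)) G \<and>
      (\<forall>s\<in>supported_in M \<F> U K. G s = g s \<and> g s \<in> supported_in M \<F> V L)"
  shows "continuous_map (top_of (Fc U)) (top_of (Fc V)) g"
proof -
  have "continuous_map (top_of (tvs_union (ss U) (supported_in M \<F> U ` compacts U))) (top_of (Fc V)) g"
  proof (rule continuous_map_from_tvs_union)
    show "Module.module \<C> (tvs_union (ss U) (supported_in M \<F> U ` compacts U))"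
      using module_Fc[OF U] by (simp add: Fc_eq)
    show "lcs (Fc V)" by (rule lcs_Fc[OF V])
    show "linear_map (tvs_union (ss U) (supported_in M \<F> U ` compacts U)) (Fc V) g" using g by (simp add: Fc_eq)
    fix A assume "A \<in> supported_in M \<F> U ` compacts U"
    then obtain K where A: "A = supported_in M \<F> U K" and KU: "compactin M K" "K \<subseteq> U" by auto
    from K[OF KU] obtain L G where L: "compactin M L" "L \<subseteq> V"
      and G: "continuous_map (top_of (ss U)) (top_of (ss V)) G"
      "\<And>s. s \<in> A \<Longrightarrow> G s = g s" "\<And>s. s \<in> A \<Longrightarrow> g s \<in> supported_in M \<F> V L"
      unfolding A by blast
    have "continuous_map (subtopology (top_of (ss U)) A) (top_of (ss V)) g"
      by (rule continuous_map_eq[OF continuous_map_from_subtopology[OF G(1)]]) (use G(2) in auto)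
    then have "continuous_map (subtopology (top_of (ss U)) A) (top_of (tvs_union (ss V) (supported_in M \<F> V ` compacts V))) g"
    proof (rule continuous_map_into_tvs_union[rotated 2])
      show "supported_in M \<F> V L \<in> supported_in M \<F> V ` compacts V" using L by auto
      show "g \<in> topspace (subtopology (top_of (ss U)) A) \<rightarrow> supported_in M \<F> V L" using G(3) by auto
      show "Module.module \<C> (tvs_union (ss V) (supported_in M \<F> V ` compacts V))"
        using module_Fc[OF V] by (simp add: Fc_eq)
    qed
    then show "continuous_map (subtopology (top_of (ss U)) A) (top_of (Fc V)) g" by (simp add: Fc_eq)
  qed
  then show ?thesis by (simp add: Fc_eq)
qed

lemma linear_map_ss: "linear_map (complex_sections \<O> \<F> U) (complex_sections \<O> \<F> V) g \<Longrightarrow> linear_map (ss U) (ss V) g"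
  by (simp add: linear_map_def)

text \<open>For a cutoff \<open>\<phi>\<close> in \<open>V\<close> the result is compactly supported
  in \<open>V\<close> even when \<open>s\<close> is not compactly supported; this is the map whose
  transpose extends distributions from \<open>V\<close> to \<open>U\<close>.\<close>

definition act_res :: "'a set \<Rightarrow> 'a set \<Rightarrow> 'f \<Rightarrow> 's \<Rightarrow> 's" where
  "act_res U V \<phi> s = res \<F> U V (act U \<phi> s)"

lemma act_Fc:
  assumes U: "openin M U" and \<phi>: "\<phi> \<in> carrier (sec \<O> \<Omega>)"
  shows act_Fc_closed: "s \<in> carrier (Fc U) \<Longrightarrow> act U \<phi> s \<in> carrier (Fc U)"
    and linear_map_act_Fc: "linear_map (Fc U) (Fc U) (act U \<phi>)"
    and continuous_map_act_Fc: "continuous_map (top_of (Fc U)) (top_of (Fc U)) (act U \<phi>)"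
proof -
  show cl: "act U \<phi> s \<in> carrier (Fc U)" if "s \<in> carrier (Fc U)" for s
    using that
  proof (rule FcE[OF U])
    fix K assume K: "compactin M K" "K \<subseteq> U" "s \<in> carrier (sec \<F> U)" "res \<F> U (U - K) s = \<zero>\<^bsub>sec \<F> (U - K)\<^esub>"
    note o = openin_minus_compact[OF U K(1)]
    show ?thesis
      by (rule FcI[OF U act_closed[OF U \<phi> K(3)] K(1,2) act_preserves_vanishing[OF U o Diff_subset \<phi> K(3,4)]])
  qed
  show lin: "linear_map (Fc U) (Fc U) (act U \<phi>)"
    by (rule linear_map_Fc[OF U linear_map_ss[OF linear_map_act[OF U \<phi>]] cl])
  show "continuous_map (top_of (Fc U)) (top_of (Fc U)) (act U \<phi>)"
  proof (rule continuous_map_Fc[OF U U lin])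
    fix K assume K: "compactin M K" "K \<subseteq> U"
    note o = openin_minus_compact[OF U K(1)]
    have "act U \<phi> s \<in> supported_in M \<F> U K" if "s \<in> supported_in M \<F> U K" for s
      using that act_closed[OF U \<phi>] act_preserves_vanishing[OF U o Diff_subset \<phi>]
      by (simp add: mem_supported_in_F[OF U K(1)])
    then show "\<exists>L G. compactin M L \<and> L \<subseteq> U \<and> continuous_map (top_of (ss U)) (top_of (ss U)) G \<and>
        (\<forall>s\<in>supported_in M \<F> U K. G s = act U \<phi> s \<and> act U \<phi> s \<in> supported_in M \<F> U L)"
      using continuous_map_act[OF U \<phi>] K by (intro exI[of _ K] exI[of _ "act U \<phi>"]) auto
  qed
qed

lemma act_res_vanishes:
  assumes U: "openin M U" and V: "openin M V" "V \<subseteq> U" and \<phi>: "\<phi> \<in> carrier (sec \<O> \<Omega>)"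
    and C: "compactin M C" "res \<O> \<Omega> (\<Omega> - C) \<phi> = \<zero>\<^bsub>sec \<O> (\<Omega> - C)\<^esub>" and s: "s \<in> carrier (sec \<F> U)"
  shows "res \<F> V (V - C) (act_res U V \<phi> s) = \<zero>\<^bsub>sec \<F> (V - C)\<^esub>"
proof -
  have "act_res U V \<phi> s = act V \<phi> (res \<F> U V s)" unfolding act_res_def by (rule res_act[OF U V \<phi> s])
  then show ?thesis using act_vanishes[OF V(1) \<phi> C res_F_closed[OF U V s]] by simp
qed

lemma act_res_closed:
  assumes U: "openin M U" and V: "openin M V" "V \<subseteq> U" and \<phi>: "\<phi> \<in> carrier (sec \<O> \<Omega>)" and s: "s \<in> carrier (sec \<F> U)"
  shows "act_res U V \<phi> s \<in> carrier (sec \<F> V)"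
  unfolding act_res_def by (rule res_F_closed[OF U V act_closed[OF U \<phi> s]])

text \<open>The compact set carrying \<open>\<phi>\<close> serves for all \<open>s\<close> at once,
  so the images lie in one step of the inductive limit. Extending back by zero recovers
  \<open>\<phi> s\<close>, which vanishes off that set.\<close>

lemma act_res_Fc:
  assumes U: "openin M U" and V: "openin M V" "V \<subseteq> U" and \<phi>: "cutoff_in M \<O> V \<phi>"
  shows act_res_Fc_closed: "s \<in> carrier (sec \<F> U) \<Longrightarrow> act_res U V \<phi> s \<in> carrier (Fc V)"
    and linear_map_act_res: "linear_map (Fc U) (Fc V) (act_res U V \<phi>)"
    and continuous_map_act_res: "continuous_map (top_of (Fc U)) (top_of (Fc V)) (act_res U V \<phi>)"
    and ext_act_res: "s \<in> carrier (sec \<F> U) \<Longrightarrow> ext_by_zero M \<F> U V (act_res U V \<phi> s) = act U \<phi> s"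
proof -
  note c = cutoff_in_closed[OF \<phi>]
  obtain C where C: "compactin M C" "C \<subseteq> V" "res \<O> \<Omega> (\<Omega> - C) \<phi> = \<zero>\<^bsub>sec \<O> (\<Omega> - C)\<^esub>"
    using \<phi> by (auto simp: cutoff_in_def)
  note cl = act_res_closed[OF U V c] and van = act_res_vanishes[OF U V c C(1,3)]
  show clF: "act_res U V \<phi> s \<in> carrier (Fc V)" if "s \<in> carrier (sec \<F> U)" for s
    by (rule FcI[OF V(1) cl[OF that] C(1,2) van[OF that]])
  have "linear_map (ss U) (ss V) (act_res U V \<phi>)"
    unfolding act_res_def by (intro linear_map_ss linear_map_comp[OF linear_map_act[OF U c] linear_map_res[OF U V]])
  then show lin: "linear_map (Fc U) (Fc V) (act_res U V \<phi>)"
    by (rule linear_map_Fc[OF U]) (use clF Fc_closed[OF U] in blast)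
  show "continuous_map (top_of (Fc U)) (top_of (Fc V)) (act_res U V \<phi>)"
  proof (rule continuous_map_Fc[OF U V(1) lin])
    fix K assume K: "compactin M K" "K \<subseteq> U"
    have "continuous_map (top_of (ss U)) (top_of (ss V)) (act_res U V \<phi>)"
      using continuous_map_compose[OF continuous_map_act[OF U c] continuous_map_res[OF U V]]
      by (simp add: comp_def act_res_def[abs_def])
    moreover have "act_res U V \<phi> s \<in> supported_in M \<F> V C" if "s \<in> supported_in M \<F> U K" for s
      using that cl van mem_supported_in_F[OF U K(1)] mem_supported_in_F[OF V(1) C(1)] by simp
    ultimately show "\<exists>L G. compactin M L \<and> L \<subseteq> V \<and> continuous_map (top_of (ss U)) (top_of (ss V)) G \<and>
        (\<forall>s\<in>supported_in M \<F> U K. G s = act_res U V \<phi> s \<and> act_res U V \<phi> s \<in> supported_in M \<F> V L)"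
      using C by (intro exI[of _ C] exI[of _ "act_res U V \<phi>"]) auto
  qed
  show "ext_by_zero M \<F> U V (act_res U V \<phi> s) = act U \<phi> s" if s: "s \<in> carrier (sec \<F> U)"
    using ext_eqI[OF U V C(1,2) act_closed[OF U c s] refl act_vanishes[OF U c C(1,3) s]] by (simp add: act_res_def)
qed

abbreviation ext :: "'a set \<Rightarrow> 'a set \<Rightarrow> 's \<Rightarrow> 's" where "ext \<equiv> ext_by_zero M \<F>"

text \<open>Extension by zero is meaningful only on sections whose support is suitably closed, so
  there is no map on all sections to restrict. On sections supported in \<open>K\<close> it agrees
  with extension after multiplication by a cutoff that is \<open>1\<close> near \<open>K\<close>;
  linearity and continuity are inherited from that map.\<close>

lemma ext_Fc:
  assumes U: "openin M U" and V: "openin M V" "V \<subseteq> U"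
  shows ext_Fc_closed: "s \<in> carrier (Fc V) \<Longrightarrow> ext U V s \<in> carrier (Fc U)"
    and res_ext_Fc: "s \<in> carrier (Fc V) \<Longrightarrow> res \<F> U V (ext U V s) = s"
    and linear_map_ext: "linear_map (Fc V) (Fc U) (ext U V)"
    and continuous_map_ext: "continuous_map (top_of (Fc V)) (top_of (Fc U)) (ext U V)"
proof -
  show cl: "ext U V s \<in> carrier (Fc U)" if "s \<in> carrier (Fc V)" for s
    using that
  proof (rule FcE[OF V(1)])
    fix K assume K: "compactin M K" "K \<subseteq> V" "s \<in> carrier (sec \<F> V)" "res \<F> V (V - K) s = \<zero>\<^bsub>sec \<F> (V - K)\<^esub>"
    show ?thesis using ext_props[OF U V K] K V by (intro FcI[OF U, of _ K]) auto
  qed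
  show rs: "res \<F> U V (ext U V s) = s" if "s \<in> carrier (Fc V)" for s
    using that
  proof (rule FcE[OF V(1)])
    fix K assume K: "compactin M K" "K \<subseteq> V" "s \<in> carrier (sec \<F> V)" "res \<F> V (V - K) s = \<zero>\<^bsub>sec \<F> (V - K)\<^esub>"
    show ?thesis using ext_props[OF U V K] by simp
  qed
  have loc: "\<exists>G. continuous_map (top_of (ss V)) (top_of (ss U)) G \<and>
      linear_map (complex_sections \<O> \<F> V) (complex_sections \<O> \<F> U) G \<and> (\<forall>s\<in>supported_in M \<F> V K. G s = ext U V s)"
    if K: "compactin M K" "K \<subseteq> V" for K
  proof -
    obtain \<psi> W where \<psi>: "cutoff_in M \<O> V \<psi>" "openin M W" "K \<subseteq> W" "res \<O> \<Omega> W \<psi> = \<one>\<^bsub>sec \<O> W\<^esub>"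
      using cutoff[OF K(1) V(1) K(2)] by blast
    have "ext U V (act V \<psi> s) = ext U V s" if "s \<in> supported_in M \<F> V K" for s
      using act_eq_self[OF V(1) cutoff_in_closed[OF \<psi>(1)] \<psi>(2,4) K(1) \<psi>(3)] that mem_supported_in_F[OF V(1) K(1)] by simp
    then show ?thesis
      using continuous_map_ext_act[OF U V \<psi>(1)] linear_map_ext_act[OF U V \<psi>(1)] K by blast
  qed
  show lin: "linear_map (Fc V) (Fc U) (ext U V)"
  proof (rule linear_mapI[OF cl])
    fix s t assume st: "s \<in> carrier (Fc V)" "t \<in> carrier (Fc V)"
    interpret Module.module \<C> "Fc V" by (rule module_Fc[OF V(1)])
    obtain K where K: "compactin M K" "K \<subseteq> V" "s \<in> carrier (sec \<F> V)" "res \<F> V (V - K) s = \<zero>\<^bsub>sec \<F> (V - K)\<^esub>"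
      using st(1) by (rule FcE[OF V(1)])
    obtain L where L: "compactin M L" "L \<subseteq> V" "t \<in> carrier (sec \<F> V)" "res \<F> V (V - L) t = \<zero>\<^bsub>sec \<F> (V - L)\<^esub>"
      using st(2) by (rule FcE[OF V(1)])
    \<comment> \<open>One cutoff must serve \<open>s\<close>, \<open>t\<close> and their sum, hence
      a common compact set.\<close>
    have KL: "compactin M (K \<union> L)" "K \<union> L \<subseteq> V" using K L by (auto simp: compactin_Un)
    note o = openin_minus_compact[OF V(1) KL(1)]
    have s: "s \<in> supported_in M \<F> V (K \<union> L)"
      using K(3) res_F_vanish_mono[OF V(1) openin_minus_compact[OF V(1) K(1)] o _ _ K(3,4)]
      by (auto simp: mem_supported_in_F[OF V(1) KL(1)])
    have t: "t \<in> supported_in M \<F> V (K \<union> L)"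
      using L(3) res_F_vanish_mono[OF V(1) openin_minus_compact[OF V(1) L(1)] o _ _ L(3,4)]
      by (auto simp: mem_supported_in_F[OF V(1) KL(1)])
    have "s \<oplus>\<^bsub>sec \<F> V\<^esub> t \<in> supported_in M \<F> V (K \<union> L)"
      using s t add_F[OF V(1)] zero_add_zero_F[OF o] by (simp add: mem_supported_in_F[OF V(1) KL(1)] res_F_add[OF V(1) o Diff_subset])
    moreover from loc[OF KL] obtain G where G: "linear_map (complex_sections \<O> \<F> V) (complex_sections \<O> \<F> U) G"
      "\<And>s. s \<in> supported_in M \<F> V (K \<union> L) \<Longrightarrow> G s = ext U V s" by blast
    ultimately show "ext U V (s \<oplus>\<^bsub>Fc V\<^esub> t) = ext U V s \<oplus>\<^bsub>Fc U\<^esub> ext U V t"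
      using s t K L linear_mapD(2)[OF G(1), of s t] by simp
  next
    fix c s assume st: "s \<in> carrier (Fc V)"
    obtain K where K: "compactin M K" "K \<subseteq> V" "s \<in> carrier (sec \<F> V)" "res \<F> V (V - K) s = \<zero>\<^bsub>sec \<F> (V - K)\<^esub>"
      using st(1) by (rule FcE[OF V(1)])
    note o = openin_minus_compact[OF V(1) K(1)]
    have s: "s \<in> supported_in M \<F> V K" using K by (auto simp: mem_supported_in_F[OF V(1) K(1)])
    have "const V c \<odot>\<^bsub>sec \<F> V\<^esub> s \<in> supported_in M \<F> V K"
      using K smult_F[OF V(1) const_closed[OF V(1)]] smult_zero_F[OF o const_closed[OF o]]
      by (simp add: mem_supported_in_F[OF V(1) K(1)] res_smult[OF V(1) o Diff_subset const_closed[OF V(1)]] res_const[OF V(1) o])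
    moreover from loc[OF K(1,2)] obtain G where G: "linear_map (complex_sections \<O> \<F> V) (complex_sections \<O> \<F> U) G"
      "\<And>s. s \<in> supported_in M \<F> V K \<Longrightarrow> G s = ext U V s" by blast
    ultimately show "ext U V (c \<odot>\<^bsub>Fc V\<^esub> s) = c \<odot>\<^bsub>Fc U\<^esub> ext U V s"
      using s K linear_mapD(3)[OF G(1), of s c] by simp
  qed
  show "continuous_map (top_of (Fc V)) (top_of (Fc U)) (ext U V)"
  proof (rule continuous_map_Fc[OF V(1) U lin])
    fix K assume K: "compactin M K" "K \<subseteq> V"
    from loc[OF K] obtain G where G: "continuous_map (top_of (ss V)) (top_of (ss U)) G"
      "\<And>s. s \<in> supported_in M \<F> V K \<Longrightarrow> G s = ext U V s" by blast
    moreover have "ext U V s \<in> supported_in M \<F> U K" if "s \<in> supported_in M \<F> V K" for s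
      using that ext_props[OF U V K] by (simp add: mem_supported_in_F[OF V(1) K(1)] mem_supported_in_F[OF U K(1)])
    ultimately show "\<exists>L G. compactin M L \<and> L \<subseteq> U \<and> continuous_map (top_of (ss V)) (top_of (ss U)) G \<and>
        (\<forall>s\<in>supported_in M \<F> V K. G s = ext U V s \<and> ext U V s \<in> supported_in M \<F> U L)"
      using K V by (intro exI[of _ K] exI[of _ G]) auto
  qed
qed

lemma ext_Fc_vanishes:
  assumes U: "openin M U" and V: "openin M V" "V \<subseteq> U" and s: "s \<in> carrier (Fc V)"
  obtains K where "compactin M K" "K \<subseteq> V" "res \<F> U (U - K) (ext U V s) = \<zero>\<^bsub>sec \<F> (U - K)\<^esub>"
  using s
proof (rule FcE[OF V(1)])
  fix K assume K: "compactin M K" "K \<subseteq> V" "s \<in> carrier (sec \<F> V)" "res \<F> V (V - K) s = \<zero>\<^bsub>sec \<F> (V - K)\<^esub>"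
  then show thesis using ext_props[OF U V K] that by blast
qed

end


section \<open>Supports of distributions, described by pairings with test sections\<close>

section \<open>Distributions\<close>

locale distribution_space = section_space M \<O> \<F>
  for M :: "'a topology" and \<O> :: "('a, complex, 'f) presheaf" and \<F> :: "('a, 'f, 's) presheaf" +
  fixes E :: "'e tvs"
  assumes lcs_E: "lcs E"
begin

abbreviation Dist :: "'a set \<Rightarrow> ('s \<Rightarrow> 'e) tvs" where "Dist U \<equiv> distributions M \<O> \<F> E U"

abbreviation \<D> :: "('a, complex, 's \<Rightarrow> 'e) presheaf" where "\<D> \<equiv> distribution_sheaf M \<O> \<F> E"

lemma Dist_eq: "Dist U = Lb (Fc U) E" by (simp add: distributions_def)

lemma D_simps [simp]:
  "carrier (sec \<D> U) = carrier (Dist U)" "ring.add (sec \<D> U) = ring.add (Dist U)"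
  "ring.zero (sec \<D> U) = ring.zero (Dist U)" "res \<D> U V = transpose_map (Fc V) (ext U V)"
  by (simp_all add: distribution_sheaf_def module.truncate_def transpose_map_def fun_eq_iff)

lemma module_Dist: "openin M U \<Longrightarrow> Module.module \<C> (Dist U)"
  unfolding Dist_eq by (rule module_Lb[OF lcs_Fc lcs_E])

lemma topspace_Dist: "topspace (top_of (Dist U)) = carrier (Dist U)"
  by (simp add: Dist_eq topspace_Lb[OF lcs_E])

lemma Dist_linear: "\<eta> \<in> carrier (Dist U) \<Longrightarrow> linear_map (Fc U) E \<eta>"
  by (simp add: Dist_eq continuous_linear_maps_simps)

lemma Dist_add: "\<eta> \<in> carrier (Dist U) \<Longrightarrow> s \<in> carrier (Fc U) \<Longrightarrow> t \<in> carrier (Fc U) \<Longrightarrow>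
    \<eta> (s \<oplus>\<^bsub>sec \<F> U\<^esub> t) = \<eta> s \<oplus>\<^bsub>E\<^esub> \<eta> t"
  using linear_mapD(2)[OF Dist_linear] by fastforce

lemma Dist_zero: "openin M U \<Longrightarrow> \<eta> \<in> carrier (Dist U) \<Longrightarrow> \<eta> \<zero>\<^bsub>sec \<F> U\<^esub> = \<zero>\<^bsub>E\<^esub>"
  using linear_map_zero[OF module_Fc lcsD(1)[OF lcs_E] Dist_linear] by simp

lemma Dist_closed: "\<eta> \<in> carrier (Dist U) \<Longrightarrow> s \<in> carrier (Fc U) \<Longrightarrow> \<eta> s \<in> carrier E"
  by (rule linear_mapD(1)[OF Dist_linear])

lemma Dist_eqI:
  assumes "\<eta> \<in> carrier (Dist U)" "\<theta> \<in> carrier (Dist U)" "\<And>s. s \<in> carrier (Fc U) \<Longrightarrow> \<eta> s = \<theta> s"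
  shows "\<eta> = \<theta>"
  using assms by (auto simp: Dist_eq continuous_linear_maps_simps intro: extensionalityI)

lemma zero_E: "\<zero>\<^bsub>E\<^esub> \<in> carrier E" "\<zero>\<^bsub>E\<^esub> \<oplus>\<^bsub>E\<^esub> \<zero>\<^bsub>E\<^esub> = \<zero>\<^bsub>E\<^esub>" "x \<in> carrier E \<Longrightarrow> x \<oplus>\<^bsub>E\<^esub> \<zero>\<^bsub>E\<^esub> = x"
  "c \<odot>\<^bsub>E\<^esub> \<zero>\<^bsub>E\<^esub> = \<zero>\<^bsub>E\<^esub>"
proof -
  interpret Module.module \<C> E by (rule lcsD(1)[OF lcs_E])
  show "\<zero>\<^bsub>E\<^esub> \<in> carrier E" "\<zero>\<^bsub>E\<^esub> \<oplus>\<^bsub>E\<^esub> \<zero>\<^bsub>E\<^esub> = \<zero>\<^bsub>E\<^esub>" "x \<in> carrier E \<Longrightarrow> x \<oplus>\<^bsub>E\<^esub> \<zero>\<^bsub>E\<^esub> = x" "c \<odot>\<^bsub>E\<^esub> \<zero>\<^bsub>E\<^esub> = \<zero>\<^bsub>E\<^esub>"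
    using smult_r_null[of c] by auto
qed

lemma zero_Dist: "\<zero>\<^bsub>Dist U\<^esub> = (\<lambda>s\<in>carrier (Fc U). \<zero>\<^bsub>E\<^esub>)"
  by (simp add: Dist_eq continuous_linear_maps_simps)

lemma add_Dist: "\<eta> \<oplus>\<^bsub>Dist U\<^esub> \<theta> = (\<lambda>s\<in>carrier (Fc U). \<eta> s \<oplus>\<^bsub>E\<^esub> \<theta> s)"
  by (simp add: Dist_eq continuous_linear_maps_simps)

lemma smult_Dist: "c \<odot>\<^bsub>Dist U\<^esub> \<eta> = (\<lambda>s\<in>carrier (Fc U). c \<odot>\<^bsub>E\<^esub> \<eta> s)"
  by (simp add: Dist_eq continuous_linear_maps_simps)

text \<open>\<open>\<psi>\<close> is \<open>1 - \<phi>\<close>. The splitting separates the part of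
  a test section that is seen through \<open>\<phi>\<close> from a part that vanishes wherever
  \<open>\<phi>\<close> is \<open>1\<close>.\<close>

lemma act_split:
  assumes "\<phi> \<in> carrier (sec \<O> \<Omega>)"
  obtains \<psi> where "\<psi> \<in> carrier (sec \<O> \<Omega>)"
    "\<And>U s. openin M U \<Longrightarrow> s \<in> carrier (sec \<F> U) \<Longrightarrow> s = act U \<phi> s \<oplus>\<^bsub>sec \<F> U\<^esub> act U \<psi> s"
    "\<And>U s W. openin M U \<Longrightarrow> openin M W \<Longrightarrow> res \<O> \<Omega> W \<phi> = \<one>\<^bsub>sec \<O> W\<^esub> \<Longrightarrow> s \<in> carrier (sec \<F> U) \<Longrightarrow>
      res \<F> U (U \<inter> W) (act U \<psi> s) = \<zero>\<^bsub>sec \<F> (U \<inter> W)\<^esub>"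
proof
  interpret R: cring "sec \<O> \<Omega>" by (rule cring_O) simp
  let ?\<psi> = "\<one>\<^bsub>sec \<O> \<Omega>\<^esub> \<ominus>\<^bsub>sec \<O> \<Omega>\<^esub> \<phi>"
  show \<psi>: "?\<psi> \<in> carrier (sec \<O> \<Omega>)" using assms by simp
  have sum: "\<phi> \<oplus>\<^bsub>sec \<O> \<Omega>\<^esub> ?\<psi> = \<one>\<^bsub>sec \<O> \<Omega>\<^esub>"
    using assms R.a_lcomm[of \<phi> "\<one>\<^bsub>sec \<O> \<Omega>\<^esub>" "\<ominus>\<^bsub>sec \<O> \<Omega>\<^esub> \<phi>"] by (simp add: a_minus_def R.r_neg)
  show "s = act U \<phi> s \<oplus>\<^bsub>sec \<F> U\<^esub> act U ?\<psi> s" if U: "openin M U" and s: "s \<in> carrier (sec \<F> U)" for U s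
  proof -
    have "act U \<one>\<^bsub>sec \<O> \<Omega>\<^esub> s = s"
      unfolding act_def ring_hom_one[OF res_O_hom[OF openin_total U subset_total[OF U]]]
      by (rule Module.module.smult_one[OF module_F[OF U] s])
    then show ?thesis using act_add_left[OF U assms \<psi> s] sum by simp
  qed
  fix U s W assume U: "openin M U" and W: "openin M W" and one: "res \<O> \<Omega> W \<phi> = \<one>\<^bsub>sec \<O> W\<^esub>" and s: "s \<in> carrier (sec \<F> U)"
  have o: "openin M (U \<inter> W)" using U W by auto
  interpret W: cring "sec \<O> (U \<inter> W)" by (rule cring_O[OF o])
  interpret h: ring_hom_cring "sec \<O> \<Omega>" "sec \<O> (U \<inter> W)" "res \<O> \<Omega> (U \<inter> W)"
    by (intro ring_hom_cring.intro ring_hom_cring_axioms.intro res_O_hom R.is_cring W.is_cring openin_total o subset_total)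
  have "res \<O> \<Omega> (U \<inter> W) \<phi> = \<one>\<^bsub>sec \<O> (U \<inter> W)\<^esub>"
    using res_O_comp[OF openin_total W o Int_lower2 subset_total[OF W] assms] ring_hom_one[OF res_O_hom[OF W o Int_lower2]] one by simp
  then have "res \<O> \<Omega> (U \<inter> W) ?\<psi> = \<zero>\<^bsub>sec \<O> (U \<inter> W)\<^esub>"
    using assms by (simp add: a_minus_def W.r_neg)
  then show "res \<F> U (U \<inter> W) (act U ?\<psi> s) = \<zero>\<^bsub>sec \<F> (U \<inter> W)\<^esub>"
    using res_act[OF U o Int_lower1 \<psi> s] act_eq_zero[OF o _ res_F_closed[OF U o Int_lower1 s]] by simp
qed

text \<open>If \<open>K\<close> carries \<open>s\<close>, then \<open>K - W\<close> is still compact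
  because \<open>W\<close> is open, and it carries \<open>s\<close> as well. Vanishing on
  \<open>W\<close> thus becomes support in a compact set disjoint from \<open>W\<close>.\<close>

lemma Fc_minus_open:
  assumes U: "openin M U" and s: "s \<in> carrier (Fc U)" and W: "openin M W" "res \<F> U (U \<inter> W) s = \<zero>\<^bsub>sec \<F> (U \<inter> W)\<^esub>"
  obtains L where "compactin M L" "L \<subseteq> U" "L \<inter> W = {}" "res \<F> U (U - L) s = \<zero>\<^bsub>sec \<F> (U - L)\<^esub>"
proof -
  obtain K where K: "compactin M K" "K \<subseteq> U" "s \<in> carrier (sec \<F> U)" "res \<F> U (U - K) s = \<zero>\<^bsub>sec \<F> (U - K)\<^esub>"
    using s by (rule FcE[OF U])
  have c: "compactin M ((\<Omega> - W) \<inter> K)" by (intro closed_Int_compactin K(1)) (use W in auto)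
  let ?L = "(\<Omega> - W) \<inter> K"
  note o = openin_minus_compact[OF U c] and oK = openin_minus_compact[OF U K(1)]
  have oW: "openin M (U \<inter> W)" using U W by auto
  have eq: "U - ?L = (U - K) \<union> (U \<inter> W)" using subset_total[OF U] by auto
  have "res \<F> U (U - ?L) s = \<zero>\<^bsub>sec \<F> (U - ?L)\<^esub>"
  proof (rule sheaf_locality2[OF sheaf_F oK oW eq res_F_closed[OF U o Diff_subset K(3)] zero_F[OF o]])
    have sub: "U - K \<subseteq> U - ?L" "U \<inter> W \<subseteq> U - ?L" using eq by auto
    show "res \<F> (U - ?L) (U - K) (res \<F> U (U - ?L) s) = res \<F> (U - ?L) (U - K) \<zero>\<^bsub>sec \<F> (U - ?L)\<^esub>"
      using res_F_comp[OF U o oK sub(1) Diff_subset K(3)] res_F_zero[OF o oK sub(1)] K(4) by simp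
    show "res \<F> (U - ?L) (U \<inter> W) (res \<F> U (U - ?L) s) = res \<F> (U - ?L) (U \<inter> W) \<zero>\<^bsub>sec \<F> (U - ?L)\<^esub>"
      using res_F_comp[OF U o oW sub(2) Diff_subset K(3)] res_F_zero[OF o oW sub(2)] W(2) by simp
  qed
  then show thesis using that[of ?L] c K(2) by auto
qed

text \<open>For a cutoff \<open>\<phi>\<close> in some \<open>V\<close> on which
  \<open>\<eta>\<close> vanishes, \<open>\<phi> s\<close> is the extension by zero of a test section
  over \<open>V\<close>, so every summand pairs to zero.\<close>

lemma Dist_vanishes_subordinate:
  assumes U: "openin M U" and \<eta>: "\<eta> \<in> carrier (Dist U)"
    and \<V>: "\<And>V. V \<in> \<V> \<Longrightarrow> openin M V \<and> V \<subseteq> U \<and> res \<D> U V \<eta> = \<zero>\<^bsub>sec \<D> V\<^esub>"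
    and \<rho>: "subordinate_sum M \<O> \<V> \<rho>" and s: "s \<in> carrier (Fc U)"
  shows "\<eta> (act U \<rho> s) = \<zero>\<^bsub>E\<^esub>"
  using \<rho>
proof (induction rule: subordinate_sum.induct)
  case zero
  show ?case using act_zero_left[OF U Fc_closed[OF U s]] Dist_zero[OF U \<eta>] by simp
next
  case (add \<rho> V \<phi>)
  have V: "openin M V" "V \<subseteq> U" "transpose_map (Fc V) (ext U V) \<eta> = \<zero>\<^bsub>Dist V\<^esub>" using \<V>[OF add.hyps(2)] by auto
  note c = subordinate_sum_closed[OF add.hyps(1)] cutoff_in_closed[OF add.hyps(3)]
  note sF = Fc_closed[OF U s]
  note r = act_res_Fc_closed[OF U V(1,2) add.hyps(3) sF]
  have "\<eta> (act U \<phi> s) = transpose_map (Fc V) (ext U V) \<eta> (act_res U V \<phi> s)"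
    using r ext_act_res[OF U V(1,2) add.hyps(3) sF] by (simp add: transpose_map_def)
  also have "\<dots> = \<zero>\<^bsub>E\<^esub>" using V(3) r by (simp add: zero_Dist)
  finally show ?case
    using add.IH Dist_add[OF \<eta> act_Fc_closed[OF U c(1) s] act_Fc_closed[OF U c(2) s]] act_add_left[OF U c sF] zero_E by simp
qed

text \<open>The support is defined through open sets on which \<open>\<eta>\<close> vanishes; this
  local information reaches a given \<open>s\<close> through a partition of unity near a compact set
  carrying \<open>s\<close>. The lemma plays the role of locality for the presheaf of
  distributions.\<close>

lemma Dist_vanishes:
  assumes U: "openin M U" and \<eta>: "\<eta> \<in> carrier (Dist U)" and W: "openin M W" "support M \<D> U \<eta> \<subseteq> W"
    and s: "s \<in> carrier (Fc U)" "res \<F> U (U \<inter> W) s = \<zero>\<^bsub>sec \<F> (U \<inter> W)\<^esub>"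
  shows "\<eta> s = \<zero>\<^bsub>E\<^esub>"
proof -
  define \<V> where "\<V> = {V. openin M V \<and> V \<subseteq> U \<and> res \<D> U V \<eta> = \<zero>\<^bsub>sec \<D> V\<^esub>}"
  obtain L where L: "compactin M L" "L \<subseteq> U" "L \<inter> W = {}" "res \<F> U (U - L) s = \<zero>\<^bsub>sec \<F> (U - L)\<^esub>"
    by (rule Fc_minus_open[OF U s(1) W(1) s(2)])
  have "L \<subseteq> \<Union>\<V>" using L(2,3) W(2) unfolding support_def \<V>_def by blast
  then obtain \<rho> W' where \<rho>: "subordinate_sum M \<O> \<V> \<rho>" "openin M W'" "L \<subseteq> W'" "res \<O> \<Omega> W' \<rho> = \<one>\<^bsub>sec \<O> W'\<^esub>"
    using partition_of_unity_near_compact[OF L(1), of \<V>] unfolding \<V>_def by blast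
  have "act U \<rho> s = s"
    by (rule act_eq_self[OF U subordinate_sum_closed[OF \<rho>(1)] \<rho>(2,4) L(1) \<rho>(3) Fc_closed[OF U s(1)] L(4)])
  moreover have "\<eta> (act U \<rho> s) = \<zero>\<^bsub>E\<^esub>"
    by (rule Dist_vanishes_subordinate[OF U \<eta> _ \<rho>(1) s(1)]) (simp only: \<V>_def mem_Collect_eq)
  ultimately show ?thesis by simp
qed

text \<open>Support in \<open>K\<close> becomes a condition on pairings, free of restriction maps.
  The test section has to vanish on a whole neighbourhood of \<open>K\<close>: having value zero at
  the points of \<open>K\<close> would be too weak, since a distribution may see derivatives
  there.\<close>

lemma mem_supported_in_D_iff:
  assumes U: "openin M U" and K: "compactin M K"
  shows "\<eta> \<in> supported_in M \<D> U K \<longleftrightarrow> \<eta> \<in> carrier (Dist U) \<and>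
    (\<forall>W s. openin M W \<and> K \<subseteq> W \<and> s \<in> carrier (Fc U) \<and> res \<F> U (U \<inter> W) s = \<zero>\<^bsub>sec \<F> (U \<inter> W)\<^esub> \<longrightarrow> \<eta> s = \<zero>\<^bsub>E\<^esub>)"
proof (intro iffI conjI)
  assume a: "\<eta> \<in> supported_in M \<D> U K"
  then show "\<eta> \<in> carrier (Dist U)" by (simp add: supported_in_def)
  then show "\<forall>W s. openin M W \<and> K \<subseteq> W \<and> s \<in> carrier (Fc U) \<and> res \<F> U (U \<inter> W) s = \<zero>\<^bsub>sec \<F> (U \<inter> W)\<^esub> \<longrightarrow> \<eta> s = \<zero>\<^bsub>E\<^esub>"
    using a Dist_vanishes[OF U] by (auto simp: supported_in_def)
next
  assume a: "\<eta> \<in> carrier (Dist U) \<and>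
    (\<forall>W s. openin M W \<and> K \<subseteq> W \<and> s \<in> carrier (Fc U) \<and> res \<F> U (U \<inter> W) s = \<zero>\<^bsub>sec \<F> (U \<inter> W)\<^esub> \<longrightarrow> \<eta> s = \<zero>\<^bsub>E\<^esub>)"
  note UK = openin_minus_compact[OF U K]
  have "\<eta> (ext U (U - K) s) = \<zero>\<^bsub>E\<^esub>" if s: "s \<in> carrier (Fc (U - K))" for s
  proof -
    obtain L where L: "compactin M L" "L \<subseteq> U - K" "res \<F> U (U - L) (ext U (U - K) s) = \<zero>\<^bsub>sec \<F> (U - L)\<^esub>"
      by (rule ext_Fc_vanishes[OF U UK Diff_subset s])
    \<comment> \<open>The complement of \<open>L\<close> is an open neighbourhood of
      \<open>K\<close> on which the extended test section vanishes.\<close>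
    have "U \<inter> (\<Omega> - L) = U - L" using subset_total[OF U] by auto
    moreover have "K \<subseteq> \<Omega> - L" using L(2) compactin_subset_topspace[OF K] by auto
    ultimately show ?thesis
      using a L(3) openin_minus_compact[OF openin_total L(1)] ext_Fc_closed[OF U UK Diff_subset s] by metis
  qed
  then have "res \<D> U (U - K) \<eta> = \<zero>\<^bsub>sec \<D> (U - K)\<^esub>"
    by (auto simp: transpose_map_def zero_Dist)
  then show "\<eta> \<in> supported_in M \<D> U K" using a UK by (auto simp: supported_in_def support_def)
qed

lemma supported_in_DD:
  assumes "openin M U" "compactin M K" "\<eta> \<in> supported_in M \<D> U K"
  shows "\<eta> \<in> carrier (Dist U)"
    and "openin M W \<Longrightarrow> K \<subseteq> W \<Longrightarrow> s \<in> carrier (Fc U) \<Longrightarrow> res \<F> U (U \<inter> W) s = \<zero>\<^bsub>sec \<F> (U \<inter> W)\<^esub> \<Longrightarrow> \<eta> s = \<zero>\<^bsub>E\<^esub>"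
  using assms(3) unfolding mem_supported_in_D_iff[OF assms(1,2)] by blast+

abbreviation Dist_c :: "'a set \<Rightarrow> ('s \<Rightarrow> 'e) tvs" where "Dist_c U \<equiv> distributions_c M \<O> \<F> E U"

lemma Dist_c_eq: "Dist_c U = tvs_union (Dist U) (supported_in M \<D> U ` compacts U)"
proof -
  have "{supported_in M \<D> U K |K. compactin M K \<and> K \<subseteq> U} = supported_in M \<D> U ` compacts U" by auto
  then show ?thesis by (simp add: distributions_c_def compactly_supported_def)
qed

lemma Dist_c_simps [simp]:
  "ring.add (Dist_c U) = ring.add (Dist U)" "ring.zero (Dist_c U) = ring.zero (Dist U)"
  "module.smult (Dist_c U) = module.smult (Dist U)"
  by (simp_all add: Dist_c_eq)

lemma carrier_Dist_c: "carrier (Dist_c U) = \<Union> (supported_in M \<D> U ` compacts U)"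
  by (simp add: Dist_c_eq)

lemma Dist_cE:
  assumes "\<eta> \<in> carrier (Dist_c U)"
  obtains K where "compactin M K" "K \<subseteq> U" "\<eta> \<in> supported_in M \<D> U K"
  using assms by (auto simp: carrier_Dist_c)

lemma supported_in_mono: "K \<subseteq> L \<Longrightarrow> supported_in M \<D> U K \<subseteq> supported_in M \<D> U L"
  by (auto simp: supported_in_def)

lemma module_Dist_c:
  assumes U: "openin M U"
  shows "Module.module \<C> (Dist_c U)"
  unfolding Dist_c_eq
proof (rule module_tvs_union[OF module_Dist[OF U]])
  interpret D: Module.module \<C> "Dist U" by (rule module_Dist[OF U])
  show "\<Union> (supported_in M \<D> U ` compacts U) \<subseteq> carrier (Dist U)" by (auto simp: supported_in_def)
  have "\<zero>\<^bsub>Dist U\<^esub> \<in> supported_in M \<D> U {}"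
    using D.M.zero_closed by (auto simp: mem_supported_in_D_iff[OF U] zero_Dist)
  then show "\<zero>\<^bsub>Dist U\<^esub> \<in> \<Union> (supported_in M \<D> U ` compacts U)" by auto
  fix x y assume "x \<in> \<Union> (supported_in M \<D> U ` compacts U)" "y \<in> \<Union> (supported_in M \<D> U ` compacts U)"
  then obtain K L where K: "compactin M K" "K \<subseteq> U" "x \<in> supported_in M \<D> U K"
    and L: "compactin M L" "L \<subseteq> U" "y \<in> supported_in M \<D> U L" by auto
  have KL: "compactin M (K \<union> L)" using K L by (simp add: compactin_Un)
  have "x \<oplus>\<^bsub>Dist U\<^esub> y \<in> supported_in M \<D> U (K \<union> L)"
    using supported_in_DD[OF U K(1,3)] supported_in_DD[OF U L(1,3)] zero_E(2)
    by (auto simp: mem_supported_in_D_iff[OF U KL] add_Dist intro: D.M.add.m_closed[unfolded add_Dist])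
  then show "x \<oplus>\<^bsub>Dist U\<^esub> y \<in> \<Union> (supported_in M \<D> U ` compacts U)" using K L KL by auto
  fix c
  have "c \<odot>\<^bsub>Dist U\<^esub> x \<in> supported_in M \<D> U K"
    using supported_in_DD[OF U K(1,3)] zero_E(4) complex_smult_closed[OF module_Dist[OF U], of x c]
    by (auto simp: mem_supported_in_D_iff[OF U K(1)] smult_Dist)
  then show "c \<odot>\<^bsub>Dist U\<^esub> x \<in> \<Union> (supported_in M \<D> U ` compacts U)" using K by auto
qed

lemma lcs_Dist_c: "openin M U \<Longrightarrow> lcs (Dist_c U)"
  unfolding Dist_c_eq by (rule lcs_tvs_union) (use module_Dist_c Dist_c_eq in simp)

lemma continuous_map_into_Dist_c:
  assumes "openin M U" "compactin M K" "K \<subseteq> U" "continuous_map Z (top_of (Dist U)) f"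
    "f \<in> topspace Z \<rightarrow> supported_in M \<D> U K"
  shows "continuous_map Z (top_of (Dist_c U)) f"
  unfolding Dist_c_eq
  by (rule continuous_map_into_tvs_union[OF _ _ assms(4,5)]) (use assms module_Dist_c Dist_c_eq in auto)

section \<open>Extension of distributions by zero and multiplication by cutoffs, as
  transposes\<close>

section \<open>Extension of distributions by zero\<close>

lemma Dist_transpose:
  assumes "openin M U" "openin M V" "linear_map (Fc V) (Fc U) h" "continuous_map (top_of (Fc V)) (top_of (Fc U)) h"
  shows Dist_transpose_closed: "\<eta> \<in> carrier (Dist U) \<Longrightarrow> transpose_map (Fc V) h \<eta> \<in> carrier (Dist V)"
    and Dist_transpose_linear: "linear_map (Dist U) (Dist V) (transpose_map (Fc V) h)"
    and Dist_transpose_continuous: "continuous_map (top_of (Dist U)) (top_of (Dist V)) (transpose_map (Fc V) h)"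
  using transpose_map[OF lcs_Fc[OF assms(2)] lcs_Fc[OF assms(1)] lcs_E assms(3,4)] by (simp_all add: Dist_eq)

text \<open>The extension is computed by pairing \<open>\<eta>\<close> with \<open>\<phi> s\<close>
  restricted to \<open>V\<close>, for any cutoff \<open>\<phi>\<close> that is \<open>1\<close> near
  \<open>K\<close>. That this restricts to \<open>\<eta>\<close>, and that no other distribution
  qualifies, comes from splitting a test section into \<open>\<phi> s\<close> and
  \<open>(1 - \<phi>) s\<close>.\<close>

lemma ext_by_zero_Dist:
  assumes U: "openin M U" and V: "openin M V" "V \<subseteq> U" and K: "compactin M K" "K \<subseteq> V"
    and \<eta>: "\<eta> \<in> supported_in M \<D> V K"
    and \<phi>: "cutoff_in M \<O> V \<phi>" and W: "openin M W" "K \<subseteq> W" "res \<O> \<Omega> W \<phi> = \<one>\<^bsub>sec \<O> W\<^esub>"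
  shows "ext_by_zero M \<D> U V \<eta> = transpose_map (Fc U) (act_res U V \<phi>) \<eta>"
proof -
  \<comment> \<open>The definite description refers to the exact support \<open>S\<close>, while
    \<open>K\<close> may be larger; vanishing has to be shown on all of
    \<open>U - S\<close>.\<close>
  define S where "S = support M \<D> V \<eta>"
  note c = cutoff_in_closed[OF \<phi>]
  have \<eta>D: "\<eta> \<in> carrier (Dist V)" and SK: "S \<subseteq> K" using \<eta> by (auto simp: supported_in_def S_def)
  have "openin M (V - S)" unfolding S_def by (rule openin_complement_support)
  moreover have "U - S = (U - K) \<union> (V - S)" using SK K V by auto
  ultimately have US: "openin M (U - S)" using openin_minus_compact[OF U K(1)] by auto
  let ?t = "transpose_map (Fc U) (act_res U V \<phi>) \<eta>"
  have tD: "?t \<in> carrier (Dist U)"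
    by (rule Dist_transpose_closed[OF V(1) U linear_map_act_res[OF U V \<phi>] continuous_map_act_res[OF U V \<phi>] \<eta>D])
  obtain \<psi> where \<psi>: "\<psi> \<in> carrier (sec \<O> \<Omega>)"
    "\<And>U s. openin M U \<Longrightarrow> s \<in> carrier (sec \<F> U) \<Longrightarrow> s = act U \<phi> s \<oplus>\<^bsub>sec \<F> U\<^esub> act U \<psi> s"
    "\<And>U s. openin M U \<Longrightarrow> s \<in> carrier (sec \<F> U) \<Longrightarrow> res \<F> U (U \<inter> W) (act U \<psi> s) = \<zero>\<^bsub>sec \<F> (U \<inter> W)\<^esub>"
    using act_split[OF c] W by metis
  show ?thesis
    unfolding ext_by_zero_def S_def[symmetric]
  proof (rule the_equality, intro conjI)
    show "?t \<in> carrier (sec \<D> U)" using tD by simp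
    have "transpose_map (Fc V) (ext U V) ?t = \<eta>"
    proof (rule Dist_eqI[OF _ \<eta>D])
      show "transpose_map (Fc V) (ext U V) ?t \<in> carrier (Dist V)"
        by (rule Dist_transpose_closed[OF U V(1) linear_map_ext[OF U V] continuous_map_ext[OF U V] tD])
      fix s assume s: "s \<in> carrier (Fc V)"
      note sF = Fc_closed[OF V(1) s] and eF = ext_Fc_closed[OF U V s]
      have "act_res U V \<phi> (ext U V s) = act V \<phi> s"
        using res_act[OF U V c Fc_closed[OF U eF]] res_ext_Fc[OF U V s] by (simp add: act_res_def)
      then have "transpose_map (Fc V) (ext U V) ?t s = \<eta> (act V \<phi> s)"
        using s eF by (simp add: transpose_map_def)
      moreover have "\<eta> s = \<eta> (act V \<phi> s) \<oplus>\<^bsub>E\<^esub> \<eta> (act V \<psi> s)"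
        using Dist_add[OF \<eta>D act_Fc_closed[OF V(1) c s] act_Fc_closed[OF V(1) \<psi>(1) s]] \<psi>(2)[OF V(1) sF] by simp
      moreover have "\<eta> (act V \<psi> s) = \<zero>\<^bsub>E\<^esub>"
        by (rule supported_in_DD(2)[OF V(1) K(1) \<eta> W(1,2) act_Fc_closed[OF V(1) \<psi>(1) s] \<psi>(3)[OF V(1) sF]])
      ultimately show "transpose_map (Fc V) (ext U V) ?t s = \<eta> s"
        using zero_E(3) Dist_closed[OF \<eta>D act_Fc_closed[OF V(1) c s]] by simp
    qed
    then show "res \<D> U V ?t = \<eta>" by simp
    have "?t (ext U (U - S) s) = \<zero>\<^bsub>E\<^esub>" if s: "s \<in> carrier (Fc (U - S))" for s
    proof -
      obtain L where L: "compactin M L" "L \<subseteq> U - S" "res \<F> U (U - L) (ext U (U - S) s) = \<zero>\<^bsub>sec \<F> (U - L)\<^esub>"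
        by (rule ext_Fc_vanishes[OF U US Diff_subset s])
      note eF = ext_Fc_closed[OF U US Diff_subset s]
      note ecl = Fc_closed[OF U eF]
      note UL = openin_minus_compact[OF U L(1)] and VL = openin_minus_compact[OF V(1) L(1)]
      have "res \<F> V (V - L) (act_res U V \<phi> (ext U (U - S) s)) = res \<F> U (V - L) (act U \<phi> (ext U (U - S) s))"
        unfolding act_res_def by (rule res_F_comp[OF U V(1) VL Diff_subset V(2) act_closed[OF U c ecl]])
      also have "\<dots> = \<zero>\<^bsub>sec \<F> (V - L)\<^esub>"
        using V by (intro res_F_vanish_mono[OF U UL VL _ Diff_subset act_closed[OF U c ecl]]
            act_preserves_vanishing[OF U UL Diff_subset c ecl L(3)]) auto
      finally have "res \<F> V (V - L) (act_res U V \<phi> (ext U (U - S) s)) = \<zero>\<^bsub>sec \<F> (V - L)\<^esub>" .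
      moreover have "V \<inter> (\<Omega> - L) = V - L" using subset_total[OF V(1)] by auto
      ultimately have v: "res \<F> V (V \<inter> (\<Omega> - L)) (act_res U V \<phi> (ext U (U - S) s)) = \<zero>\<^bsub>sec \<F> (V \<inter> (\<Omega> - L))\<^esub>"
        by simp
      \<comment> \<open>\<open>L\<close> avoids \<open>S\<close> but may meet \<open>K\<close>, so
        vanishing is deduced from the exact support and not from the criterion for
        \<open>K\<close>.\<close>
      have "\<eta> (act_res U V \<phi> (ext U (U - S) s)) = \<zero>\<^bsub>E\<^esub>"
      proof (rule Dist_vanishes[OF V(1) \<eta>D openin_minus_compact[OF openin_total L(1)] _ act_res_Fc_closed[OF U V \<phi> ecl] v])
        show "support M \<D> V \<eta> \<subseteq> \<Omega> - L" using L(2) SK compactin_subset_topspace[OF K(1)] by (auto simp: S_def)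
      qed
      then show ?thesis using eF by (simp add: transpose_map_def)
    qed
    then show "res \<D> U (U - S) ?t = \<zero>\<^bsub>sec \<D> (U - S)\<^esub>" by (auto simp: transpose_map_def zero_Dist)
  next
    fix t' assume "t' \<in> carrier (sec \<D> U) \<and> res \<D> U V t' = \<eta> \<and> res \<D> U (U - S) t' = \<zero>\<^bsub>sec \<D> (U - S)\<^esub>"
    then have t': "t' \<in> carrier (Dist U)" "transpose_map (Fc V) (ext U V) t' = \<eta>"
      "transpose_map (Fc (U - S)) (ext U (U - S)) t' = \<zero>\<^bsub>Dist (U - S)\<^esub>" by auto
    show "t' = ?t"
    proof (rule Dist_eqI[OF t'(1) tD])
      fix s assume s: "s \<in> carrier (Fc U)"
      note sF = Fc_closed[OF U s]
      note r = act_res_Fc_closed[OF U V \<phi> sF]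
      \<comment> \<open>On \<open>\<phi> s\<close>, which comes from a test section over
        \<open>V\<close>, the competitor is determined by its restriction to
        \<open>V\<close>.\<close>
      have "t' (act U \<phi> s) = transpose_map (Fc V) (ext U V) t' (act_res U V \<phi> s)"
        using r ext_act_res[OF U V \<phi> sF] by (simp add: transpose_map_def)
      also have "\<dots> = ?t s" using t'(2) s by (simp add: transpose_map_def)
      finally have 1: "t' (act U \<phi> s) = ?t s" .
      note p = act_Fc_closed[OF U \<psi>(1) s]
      \<comment> \<open>\<open>\<psi> s\<close> vanishes near \<open>K\<close>, hence near
        \<open>S\<close>. It is therefore the extension of a test section \<open>q\<close> over
        \<open>U - S\<close>, where the competitor is zero.\<close>
      obtain L where L: "compactin M L" "L \<subseteq> U" "L \<inter> W = {}" "res \<F> U (U - L) (act U \<psi> s) = \<zero>\<^bsub>sec \<F> (U - L)\<^esub>"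
        by (rule Fc_minus_open[OF U p W(1) \<psi>(3)[OF U sF]])
      have LS: "L \<subseteq> U - S" using L(2,3) W(2) SK by auto
      note UL = openin_minus_compact[OF U L(1)]
      note pF = Fc_closed[OF U p]
      define q where "q = res \<F> U (U - S) (act U \<psi> s)"
      have o: "openin M (U - S - L)" by (rule openin_minus_compact[OF US L(1)])
      have "res \<F> (U - S) (U - S - L) q = \<zero>\<^bsub>sec \<F> (U - S - L)\<^esub>"
        unfolding q_def res_F_comp[OF U US o Diff_subset Diff_subset pF]
        by (rule res_F_vanish_mono[OF U UL o _ Diff_subset pF L(4)]) auto
      then have q: "q \<in> carrier (Fc (U - S))"
        using res_F_closed[OF U US Diff_subset pF] by (intro FcI[OF US _ L(1) LS]) (simp_all add: q_def)
      have "ext U (U - S) q = act U \<psi> s"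
        unfolding q_def by (rule ext_eqI[OF U US Diff_subset L(1) LS pF refl L(4)])
      then have "t' (act U \<psi> s) = transpose_map (Fc (U - S)) (ext U (U - S)) t' q" using q by (simp add: transpose_map_def)
      also have "\<dots> = \<zero>\<^bsub>E\<^esub>" using t'(3) q by (simp add: zero_Dist)
      finally have 2: "t' (act U \<psi> s) = \<zero>\<^bsub>E\<^esub>" .
      have "t' s = t' (act U \<phi> s) \<oplus>\<^bsub>E\<^esub> t' (act U \<psi> s)"
        using Dist_add[OF t'(1) act_Fc_closed[OF U c s] p] \<psi>(2)[OF U sF] by simp
      then show "t' s = ?t s" using 1 2 zero_E(3) Dist_closed[OF tD s] by simp
    qed
  qed
qed


abbreviation dext :: "'a set \<Rightarrow> ('s \<Rightarrow> 'e) \<Rightarrow> ('s \<Rightarrow> 'e)" where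
  "dext V \<equiv> dist_ext M \<O> \<F> E \<Omega> V"

text \<open>One cutoff serves all distributions supported in \<open>K\<close>, so on them
  \<open>dext V\<close> coincides with a single continuous linear transpose.\<close>

lemma dext_eq_transpose:
  assumes V: "openin M V" and K: "compactin M K" "K \<subseteq> V"
  obtains \<phi> where "cutoff_in M \<O> V \<phi>"
    "\<And>\<eta>. \<eta> \<in> supported_in M \<D> V K \<Longrightarrow> dext V \<eta> = transpose_map (Fc \<Omega>) (act_res \<Omega> V \<phi>) \<eta>"
proof -
  obtain \<phi> W where \<phi>: "cutoff_in M \<O> V \<phi>" "openin M W" "K \<subseteq> W" "res \<O> \<Omega> W \<phi> = \<one>\<^bsub>sec \<O> W\<^esub>"
    using cutoff[OF K(1) V K(2)] by blast
  have "dext V \<eta> = transpose_map (Fc \<Omega>) (act_res \<Omega> V \<phi>) \<eta>" if "\<eta> \<in> supported_in M \<D> V K" for \<eta>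
    unfolding dist_ext_def by (rule ext_by_zero_Dist[OF openin_total V subset_total[OF V] K that \<phi>])
  then show thesis using that \<phi>(1) by blast
qed

text \<open>If \<open>s\<close> vanishes near \<open>K\<close>, so does the restriction of
  \<open>\<phi> s\<close> to \<open>V\<close>, and \<open>\<eta>\<close> pairs it to zero.\<close>

lemma dext_supported:
  assumes V: "openin M V" and K: "compactin M K" "K \<subseteq> V" and \<eta>: "\<eta> \<in> supported_in M \<D> V K"
  shows "dext V \<eta> \<in> supported_in M \<D> \<Omega> K"
proof -
  note VX = subset_total[OF V]
  obtain \<phi> where \<phi>: "cutoff_in M \<O> V \<phi>"
    and eq: "\<And>\<eta>. \<eta> \<in> supported_in M \<D> V K \<Longrightarrow> dext V \<eta> = transpose_map (Fc \<Omega>) (act_res \<Omega> V \<phi>) \<eta>"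
    using dext_eq_transpose[OF V K] by blast
  note c = cutoff_in_closed[OF \<phi>]
  note \<eta>D = supported_in_DD(1)[OF V K(1) \<eta>]
  show ?thesis
    unfolding mem_supported_in_D_iff[OF openin_total K(1)] eq[OF \<eta>]
  proof (intro conjI allI impI)
    show "transpose_map (Fc \<Omega>) (act_res \<Omega> V \<phi>) \<eta> \<in> carrier (Dist \<Omega>)"
      by (rule Dist_transpose_closed[OF V openin_total linear_map_act_res[OF openin_total V VX \<phi>]
            continuous_map_act_res[OF openin_total V VX \<phi>] \<eta>D])
    fix W s assume a: "openin M W \<and> K \<subseteq> W \<and> s \<in> carrier (Fc \<Omega>) \<and> res \<F> \<Omega> (\<Omega> \<inter> W) s = \<zero>\<^bsub>sec \<F> (\<Omega> \<inter> W)\<^esub>"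
    then have W: "openin M W" "K \<subseteq> W" and s: "s \<in> carrier (Fc \<Omega>)" and z: "res \<F> \<Omega> W s = \<zero>\<^bsub>sec \<F> W\<^esub>"
      using subset_total[of W] by (auto simp: Int_absorb1)
    note sF = Fc_closed[OF openin_total s]
    have o: "openin M (V \<inter> W)" using V W by auto
    have "res \<F> V (V \<inter> W) (act_res \<Omega> V \<phi> s) = res \<F> \<Omega> (V \<inter> W) (act \<Omega> \<phi> s)"
      unfolding act_res_def by (rule res_F_comp[OF openin_total V o Int_lower1 VX act_closed[OF openin_total c sF]])
    also have "\<dots> = \<zero>\<^bsub>sec \<F> (V \<inter> W)\<^esub>"
      by (rule res_F_vanish_mono[OF openin_total W(1) o Int_lower2 subset_total[OF W(1)] act_closed[OF openin_total c sF]
            act_preserves_vanishing[OF openin_total W(1) subset_total[OF W(1)] c sF z]])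
    finally have "\<eta> (act_res \<Omega> V \<phi> s) = \<zero>\<^bsub>E\<^esub>"
      by (rule supported_in_DD(2)[OF V K(1) \<eta> W act_res_Fc_closed[OF openin_total V VX \<phi> sF]])
    then show "transpose_map (Fc \<Omega>) (act_res \<Omega> V \<phi>) \<eta> s = \<zero>\<^bsub>E\<^esub>" using s by (simp add: transpose_map_def)
  qed
qed

lemma dext_closed:
  assumes V: "openin M V" and \<eta>: "\<eta> \<in> carrier (Dist_c V)"
  shows "dext V \<eta> \<in> carrier (Dist_c \<Omega>)"
  using \<eta>
proof (rule Dist_cE)
  fix K assume K: "compactin M K" "K \<subseteq> V" "\<eta> \<in> supported_in M \<D> V K"
  have "K \<in> compacts \<Omega>" using K(1,2) subset_total[OF V] by auto
  then show ?thesis using dext_supported[OF V K] unfolding carrier_Dist_c by blast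
qed

lemma linear_map_dext:
  assumes V: "openin M V"
  shows "linear_map (Dist_c V) (Dist_c \<Omega>) (dext V)"
proof (rule linear_mapI[OF dext_closed[OF V]])
  note VX = subset_total[OF V]
  interpret D: Module.module \<C> "Dist_c V" by (rule module_Dist_c[OF V])
  fix x y assume x: "x \<in> carrier (Dist_c V)" and y: "y \<in> carrier (Dist_c V)"
  then have xy: "x \<oplus>\<^bsub>Dist_c V\<^esub> y \<in> carrier (Dist_c V)" by (rule D.M.a_closed)
  obtain K where K: "compactin M K" "K \<subseteq> V" "x \<in> supported_in M \<D> V K" using x by (rule Dist_cE)
  obtain L where L: "compactin M L" "L \<subseteq> V" "y \<in> supported_in M \<D> V L" using y by (rule Dist_cE)
  obtain N where N: "compactin M N" "N \<subseteq> V" "x \<oplus>\<^bsub>Dist_c V\<^esub> y \<in> supported_in M \<D> V N" using xy by (rule Dist_cE)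
  \<comment> \<open>The transpose formula depends on a compact set through its cutoff, so one
    compact set is taken for \<open>x\<close>, \<open>y\<close> and their sum.\<close>
  let ?K = "K \<union> L \<union> N"
  have KLN: "compactin M ?K" "?K \<subseteq> V" using K L N by (auto intro!: compactin_Un)
  obtain \<phi> where \<phi>: "cutoff_in M \<O> V \<phi>"
    and eq: "\<And>\<eta>. \<eta> \<in> supported_in M \<D> V ?K \<Longrightarrow> dext V \<eta> = transpose_map (Fc \<Omega>) (act_res \<Omega> V \<phi>) \<eta>"
    using dext_eq_transpose[OF V KLN] by blast
  have s: "x \<in> supported_in M \<D> V ?K" "y \<in> supported_in M \<D> V ?K" "x \<oplus>\<^bsub>Dist_c V\<^esub> y \<in> supported_in M \<D> V ?K"
    using K(3) L(3) N(3) supported_in_mono[of K ?K V] supported_in_mono[of L ?K V] supported_in_mono[of N ?K V] by auto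
  note lin = Dist_transpose_linear[OF V openin_total linear_map_act_res[OF openin_total V VX \<phi>]
            continuous_map_act_res[OF openin_total V VX \<phi>]]
  show "dext V (x \<oplus>\<^bsub>Dist_c V\<^esub> y) = dext V x \<oplus>\<^bsub>Dist_c \<Omega>\<^esub> dext V y"
    unfolding eq[OF s(1)] eq[OF s(2)] eq[OF s(3)]
    using linear_mapD(2)[OF lin supported_in_DD(1)[OF V K(1,3)] supported_in_DD(1)[OF V L(1,3)]] by simp
next
  note VX = subset_total[OF V]
  fix c x assume x: "x \<in> carrier (Dist_c V)"
  then have cx: "c \<odot>\<^bsub>Dist_c V\<^esub> x \<in> carrier (Dist_c V)" by (rule complex_smult_closed[OF module_Dist_c[OF V]])
  obtain K where K: "compactin M K" "K \<subseteq> V" "x \<in> supported_in M \<D> V K" using x by (rule Dist_cE)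
  obtain N where N: "compactin M N" "N \<subseteq> V" "c \<odot>\<^bsub>Dist_c V\<^esub> x \<in> supported_in M \<D> V N" using cx by (rule Dist_cE)
  let ?K = "K \<union> N"
  have KN: "compactin M ?K" "?K \<subseteq> V" using K N by (auto intro!: compactin_Un)
  obtain \<phi> where \<phi>: "cutoff_in M \<O> V \<phi>"
    and eq: "\<And>\<eta>. \<eta> \<in> supported_in M \<D> V ?K \<Longrightarrow> dext V \<eta> = transpose_map (Fc \<Omega>) (act_res \<Omega> V \<phi>) \<eta>"
    using dext_eq_transpose[OF V KN] by blast
  have s: "x \<in> supported_in M \<D> V ?K" "c \<odot>\<^bsub>Dist_c V\<^esub> x \<in> supported_in M \<D> V ?K"
    using K(3) N(3) supported_in_mono[of K ?K V] supported_in_mono[of N ?K V] by auto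
  note lin = Dist_transpose_linear[OF V openin_total linear_map_act_res[OF openin_total V VX \<phi>]
            continuous_map_act_res[OF openin_total V VX \<phi>]]
  show "dext V (c \<odot>\<^bsub>Dist_c V\<^esub> x) = c \<odot>\<^bsub>Dist_c \<Omega>\<^esub> dext V x"
    unfolding eq[OF s(1)] eq[OF s(2)]
    using linear_mapD(3)[OF lin supported_in_DD(1)[OF V K(1,3)]] by simp
qed

lemma continuous_map_dext:
  assumes V: "openin M V"
  shows "continuous_map (top_of (Dist_c V)) (top_of (Dist_c \<Omega>)) (dext V)"
proof -
  note VX = subset_total[OF V]
  have "continuous_map (top_of (tvs_union (Dist V) (supported_in M \<D> V ` compacts V))) (top_of (Dist_c \<Omega>)) (dext V)"
  proof (rule continuous_map_from_tvs_union)
    show "Module.module \<C> (tvs_union (Dist V) (supported_in M \<D> V ` compacts V))"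
      "linear_map (tvs_union (Dist V) (supported_in M \<D> V ` compacts V)) (Dist_c \<Omega>) (dext V)"
      using module_Dist_c[OF V] linear_map_dext[OF V] by (simp_all add: Dist_c_eq)
    show "lcs (Dist_c \<Omega>)" by (rule lcs_Dist_c) simp
    fix A assume "A \<in> supported_in M \<D> V ` compacts V"
    then obtain K where K: "compactin M K" "K \<subseteq> V" and A: "A = supported_in M \<D> V K" by auto
    obtain \<phi> where \<phi>: "cutoff_in M \<O> V \<phi>"
      and eq: "\<And>\<eta>. \<eta> \<in> A \<Longrightarrow> dext V \<eta> = transpose_map (Fc \<Omega>) (act_res \<Omega> V \<phi>) \<eta>"
      using dext_eq_transpose[OF V K] unfolding A by blast
    have "continuous_map (top_of (Dist V)) (top_of (Dist \<Omega>)) (transpose_map (Fc \<Omega>) (act_res \<Omega> V \<phi>))"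
      by (rule Dist_transpose_continuous[OF V openin_total linear_map_act_res[OF openin_total V VX \<phi>]
            continuous_map_act_res[OF openin_total V VX \<phi>]])
    then have c: "continuous_map (subtopology (top_of (Dist V)) A) (top_of (Dist \<Omega>)) (dext V)"
      by (rule continuous_map_eq[OF continuous_map_from_subtopology]) (use eq in auto)
    show "continuous_map (subtopology (top_of (Dist V)) A) (top_of (Dist_c \<Omega>)) (dext V)"
      by (rule continuous_map_into_Dist_c[OF openin_total K(1) _ c]) (use K VX dext_supported[OF V K] A in auto)
  qed
  then show ?thesis by (simp add: Dist_c_eq)
qed

text \<open>The product of \<open>\<phi>\<close> and a distribution over the whole space, regarded
  as a distribution over \<open>V\<close>; the factor is moved to the test section.\<close>

definition localize :: "'a set \<Rightarrow> 'f \<Rightarrow> ('s \<Rightarrow> 'e) \<Rightarrow> ('s \<Rightarrow> 'e)" where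
  "localize V \<phi> = transpose_map (Fc V) (\<lambda>s. act \<Omega> \<phi> (ext \<Omega> V s))"

text \<open>The compact set \<open>C\<close> carrying \<open>\<phi>\<close> supports every product,
  so the map reaches the inductive limit from all of \<open>Dist \<Omega>\<close>, without a
  condition on the support of \<open>\<eta>\<close>. Extending back uses a second cutoff
  \<open>\<psi>\<close> that is \<open>1\<close> near \<open>C\<close>, for which multiplication by
  \<open>\<psi>\<close> fixes \<open>\<phi> s\<close>.\<close>

lemma localize:
  assumes V: "openin M V" and \<phi>: "cutoff_in M \<O> V \<phi>"
  shows continuous_map_localize: "continuous_map (top_of (Dist \<Omega>)) (top_of (Dist_c V)) (localize V \<phi>)"
    and dext_localize: "\<eta> \<in> carrier (Dist \<Omega>) \<Longrightarrow> dext V (localize V \<phi> \<eta>) = transpose_map (Fc \<Omega>) (act \<Omega> \<phi>) \<eta>"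
proof -
  note VX = subset_total[OF V]
  note c = cutoff_in_closed[OF \<phi>]
  obtain C where C: "compactin M C" "C \<subseteq> V" "res \<O> \<Omega> (\<Omega> - C) \<phi> = \<zero>\<^bsub>sec \<O> (\<Omega> - C)\<^esub>"
    using \<phi> by (auto simp: cutoff_in_def)
  note XC = openin_minus_compact[OF openin_total C(1)]
  have h: "linear_map (Fc V) (Fc \<Omega>) (\<lambda>s. act \<Omega> \<phi> (ext \<Omega> V s))"
    by (rule linear_map_comp[OF linear_map_ext[OF openin_total V VX] linear_map_act_Fc[OF openin_total c]])
  have hc: "continuous_map (top_of (Fc V)) (top_of (Fc \<Omega>)) (\<lambda>s. act \<Omega> \<phi> (ext \<Omega> V s))"
    using continuous_map_compose[OF continuous_map_ext[OF openin_total V VX] continuous_map_act_Fc[OF openin_total c]]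
    by (simp add: comp_def)
  note tr = Dist_transpose[OF openin_total V h hc, folded localize_def]
  have supp: "localize V \<phi> \<eta> \<in> supported_in M \<D> V C" if \<eta>: "\<eta> \<in> carrier (Dist \<Omega>)" for \<eta>
    unfolding mem_supported_in_D_iff[OF V C(1)]
  proof (intro conjI allI impI)
    show "localize V \<phi> \<eta> \<in> carrier (Dist V)" by (rule tr(1)[OF \<eta>])
    fix W s assume a: "openin M W \<and> C \<subseteq> W \<and> s \<in> carrier (Fc V) \<and> res \<F> V (V \<inter> W) s = \<zero>\<^bsub>sec \<F> (V \<inter> W)\<^esub>"
    then have W: "openin M W" "C \<subseteq> W" and s: "s \<in> carrier (Fc V)" and z: "res \<F> V (V \<inter> W) s = \<zero>\<^bsub>sec \<F> (V \<inter> W)\<^esub>" by auto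
    have o: "openin M (V \<inter> W)" using V W by auto
    note eF = Fc_closed[OF openin_total ext_Fc_closed[OF openin_total V VX s]]
    note oX = subset_total[OF o]
    \<comment> \<open>The product is zero on \<open>V \<inter> W\<close>, where the section
      vanishes, and off \<open>C\<close>, where \<open>\<phi>\<close> vanishes; these sets cover the
      space because \<open>C\<close> lies in both \<open>V\<close> and \<open>W\<close>.\<close>
    have "act \<Omega> \<phi> (ext \<Omega> V s) = \<zero>\<^bsub>sec \<F> \<Omega>\<^esub>"
    proof (rule sheaf_locality2[OF sheaf_F o XC _ act_closed[OF openin_total c eF] zero_F[OF openin_total]])
      show "\<Omega> = V \<inter> W \<union> (\<Omega> - C)" using W C oX by auto
      have "res \<F> \<Omega> (V \<inter> W) (ext \<Omega> V s) = \<zero>\<^bsub>sec \<F> (V \<inter> W)\<^esub>"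
        using res_F_comp[OF openin_total V o Int_lower1 VX eF] res_ext_Fc[OF openin_total V VX s] z by simp
      then show "res \<F> \<Omega> (V \<inter> W) (act \<Omega> \<phi> (ext \<Omega> V s)) = res \<F> \<Omega> (V \<inter> W) \<zero>\<^bsub>sec \<F> \<Omega>\<^esub>"
        using act_preserves_vanishing[OF openin_total o oX c eF] res_F_zero[OF openin_total o oX] by simp
      show "res \<F> \<Omega> (\<Omega> - C) (act \<Omega> \<phi> (ext \<Omega> V s)) = res \<F> \<Omega> (\<Omega> - C) \<zero>\<^bsub>sec \<F> \<Omega>\<^esub>"
        using act_vanishes[OF openin_total c C(1,3) eF] res_F_zero[OF openin_total XC Diff_subset] by simp
    qed
    then show "localize V \<phi> \<eta> s = \<zero>\<^bsub>E\<^esub>"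
      using s Dist_zero[OF openin_total \<eta>] by (simp add: localize_def transpose_map_def)
  qed
  show "continuous_map (top_of (Dist \<Omega>)) (top_of (Dist_c V)) (localize V \<phi>)"
    by (rule continuous_map_into_Dist_c[OF V C(1,2) tr(3)]) (use supp topspace_Dist in auto)
  show "dext V (localize V \<phi> \<eta>) = transpose_map (Fc \<Omega>) (act \<Omega> \<phi>) \<eta>" if \<eta>: "\<eta> \<in> carrier (Dist \<Omega>)"
  proof -
    obtain \<psi> W where \<psi>: "cutoff_in M \<O> V \<psi>" "openin M W" "C \<subseteq> W" "res \<O> \<Omega> W \<psi> = \<one>\<^bsub>sec \<O> W\<^esub>"
      using cutoff[OF C(1) V C(2)] by blast
    note d = cutoff_in_closed[OF \<psi>(1)]
    have eq: "dext V (localize V \<phi> \<eta>) = transpose_map (Fc \<Omega>) (act_res \<Omega> V \<psi>) (localize V \<phi> \<eta>)"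
      unfolding dist_ext_def by (rule ext_by_zero_Dist[OF openin_total V VX C(1,2) supp[OF \<eta>] \<psi>])
    show ?thesis
      unfolding eq transpose_map_def
    proof (rule restrict_ext)
      fix s assume s: "s \<in> carrier (Fc \<Omega>)"
      note sF = Fc_closed[OF openin_total s]
      have "act \<Omega> \<phi> (act \<Omega> \<psi> s) = act \<Omega> \<psi> (act \<Omega> \<phi> s)"
        using act_smult[OF openin_total c res_\<Omega>[OF openin_total d] sF] by (simp add: act_def)
      also have "\<dots> = act \<Omega> \<phi> s"
        by (rule act_eq_self[OF openin_total d \<psi>(2,4) C(1) \<psi>(3) act_closed[OF openin_total c sF] act_vanishes[OF openin_total c C(1,3) sF]])
      finally show "localize V \<phi> \<eta> (act_res \<Omega> V \<psi> s) = \<eta> (act \<Omega> \<phi> s)"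
        using act_res_Fc_closed[OF openin_total V VX \<psi>(1) sF] ext_act_res[OF openin_total V VX \<psi>(1) sF]
        by (simp add: localize_def transpose_map_def)
    qed
  qed
qed

text \<open>The remainder \<open>(1 - \<rho>) s\<close> of a test section vanishes near
  \<open>K\<close>, so \<open>\<eta>\<close> does not see it.\<close>

lemma transpose_act_self:
  assumes K: "compactin M K" and \<eta>: "\<eta> \<in> supported_in M \<D> \<Omega> K" and \<rho>: "\<rho> \<in> carrier (sec \<O> \<Omega>)"
    and W: "openin M W" "K \<subseteq> W" "res \<O> \<Omega> W \<rho> = \<one>\<^bsub>sec \<O> W\<^esub>"
  shows "transpose_map (Fc \<Omega>) (act \<Omega> \<rho>) \<eta> = \<eta>"
proof -
  note \<eta>D = supported_in_DD(1)[OF openin_total K \<eta>]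
  obtain \<psi> where \<psi>: "\<psi> \<in> carrier (sec \<O> \<Omega>)"
    "\<And>U s. openin M U \<Longrightarrow> s \<in> carrier (sec \<F> U) \<Longrightarrow> s = act U \<rho> s \<oplus>\<^bsub>sec \<F> U\<^esub> act U \<psi> s"
    "\<And>U s. openin M U \<Longrightarrow> s \<in> carrier (sec \<F> U) \<Longrightarrow> res \<F> U (U \<inter> W) (act U \<psi> s) = \<zero>\<^bsub>sec \<F> (U \<inter> W)\<^esub>"
    using act_split[OF \<rho>] W by metis
  show ?thesis
  proof (rule Dist_eqI[OF _ \<eta>D])
    show "transpose_map (Fc \<Omega>) (act \<Omega> \<rho>) \<eta> \<in> carrier (Dist \<Omega>)"
      by (rule Dist_transpose_closed[OF openin_total openin_total linear_map_act_Fc[OF openin_total \<rho>] continuous_map_act_Fc[OF openin_total \<rho>] \<eta>D])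
    fix s assume s: "s \<in> carrier (Fc \<Omega>)"
    note sF = Fc_closed[OF openin_total s]
    note p = act_Fc_closed[OF openin_total \<rho> s] and q = act_Fc_closed[OF openin_total \<psi>(1) s]
    have "\<eta> s = \<eta> (act \<Omega> \<rho> s) \<oplus>\<^bsub>E\<^esub> \<eta> (act \<Omega> \<psi> s)"
      using Dist_add[OF \<eta>D p q] \<psi>(2)[OF openin_total sF] by simp
    moreover have "\<eta> (act \<Omega> \<psi> s) = \<zero>\<^bsub>E\<^esub>"
      by (rule supported_in_DD(2)[OF openin_total K \<eta> W(1,2) q \<psi>(3)[OF openin_total sF]])
    ultimately show "transpose_map (Fc \<Omega>) (act \<Omega> \<rho>) \<eta> s = \<eta> s"
      using s zero_E(3) Dist_closed[OF \<eta>D p] by (simp add: transpose_map_def)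
  qed
qed


section \<open>The sum map, its right inverses over compact sets, and its openness\<close>

section \<open>Sums of extensions\<close>

context
  fixes \<Gamma> :: "'i set" and U :: "'i \<Rightarrow> 'a set"
  assumes open_U: "\<And>\<gamma>. \<gamma> \<in> \<Gamma> \<Longrightarrow> openin M (U \<gamma>)"
begin

abbreviation "S \<equiv> direct_sum \<Gamma> (\<lambda>\<gamma>. Dist_c (U \<gamma>))"
abbreviation "T \<equiv> Dist_c \<Omega>"
abbreviation "\<Phi> \<equiv> sum_of_extensions M \<O> \<F> E \<Gamma> U"

lemma lcs_T: "lcs T" by (rule lcs_Dist_c) simp

lemma lcs_S: "lcs S" by (rule lcs_direct_sum) (rule lcs_Dist_c[OF open_U])

text \<open>The index set in \<open>sum_of_extensions\<close> depends on \<open>x\<close>. Any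
  finite \<open>G\<close> containing it adds only zero terms, so several elements can be summed over
  a common index set.\<close>

lemma sum_of_extensions_eq:
  assumes x: "x \<in> carrier S" and G: "finite G" "G \<subseteq> \<Gamma>" "\<And>\<gamma>. \<gamma> \<in> \<Gamma> \<Longrightarrow> \<gamma> \<notin> G \<Longrightarrow> x \<gamma> = \<zero>\<^bsub>Dist_c (U \<gamma>)\<^esub>"
  shows "\<Phi> x = (\<Oplus>\<^bsub>T\<^esub>\<gamma>\<in>G. dext (U \<gamma>) (x \<gamma>))"
  unfolding sum_of_extensions_def
proof -
  interpret T: Module.module \<C> T by (rule lcsD(1)[OF lcs_T])
  show "(\<Oplus>\<^bsub>T\<^esub>\<gamma>\<in>{\<gamma> \<in> \<Gamma>. x \<gamma> \<noteq> \<zero>\<^bsub>Dist_c (U \<gamma>)\<^esub>}. dext (U \<gamma>) (x \<gamma>)) = (\<Oplus>\<^bsub>T\<^esub>\<gamma>\<in>G. dext (U \<gamma>) (x \<gamma>))"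
  proof (rule T.M.add.finprod_mono_neutral_cong_left[OF G(1)])
    show "{\<gamma> \<in> \<Gamma>. x \<gamma> \<noteq> \<zero>\<^bsub>Dist_c (U \<gamma>)\<^esub>} \<subseteq> G" using G(3) by blast
    show "dext (U \<gamma>) (x \<gamma>) = \<zero>\<^bsub>T\<^esub>" if "\<gamma> \<in> G - {\<gamma> \<in> \<Gamma>. x \<gamma> \<noteq> \<zero>\<^bsub>Dist_c (U \<gamma>)\<^esub>}" for \<gamma>
    proof -
      have "\<gamma> \<in> \<Gamma>" "x \<gamma> = \<zero>\<^bsub>Dist_c (U \<gamma>)\<^esub>" using that G(2) by auto
      then show ?thesis
        using linear_map_zero[OF module_Dist_c[OF open_U] lcsD(1)[OF lcs_T] linear_map_dext[OF open_U]] by simp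
    qed
    show "(\<lambda>\<gamma>. dext (U \<gamma>) (x \<gamma>)) \<in> G \<rightarrow> carrier T"
      using x G(2) open_U by (auto intro!: dext_closed)
  qed simp
qed

lemma linear_map_sum_of_extensions: "linear_map S T \<Phi>"
proof -
  interpret T: Module.module \<C> T by (rule lcsD(1)[OF lcs_T])
  interpret S: Module.module \<C> S by (rule lcsD(1)[OF lcs_S])
  let ?supp = "\<lambda>x. {\<gamma> \<in> \<Gamma>. x \<gamma> \<noteq> \<zero>\<^bsub>Dist_c (U \<gamma>)\<^esub>}"
  have cl: "(\<lambda>\<gamma>. dext (U \<gamma>) (x \<gamma>)) \<in> G \<rightarrow> carrier T" if "x \<in> carrier S" "G \<subseteq> \<Gamma>" for x G
    using that open_U by (auto intro!: dext_closed)
  have fin: "finite (?supp x)" if "x \<in> carrier S" for x using that by simp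
  show ?thesis
  proof (rule linear_mapI)
    show "\<Phi> x \<in> carrier T" if x: "x \<in> carrier S" for x
      using T.M.finsum_closed[OF cl[OF x, of "?supp x"]] by (simp add: sum_of_extensions_def)
    show "\<Phi> (x \<oplus>\<^bsub>S\<^esub> y) = \<Phi> x \<oplus>\<^bsub>T\<^esub> \<Phi> y" if x: "x \<in> carrier S" and y: "y \<in> carrier S" for x y
    proof -
      have xy: "x \<oplus>\<^bsub>S\<^esub> y \<in> carrier S" using x y by (rule S.M.a_closed)
      \<comment> \<open>Including the indices of the sum as a third set spares a comparison with
        those of \<open>x\<close> and \<open>y\<close>.\<close>
      let ?G = "?supp x \<union> ?supp y \<union> ?supp (x \<oplus>\<^bsub>S\<^esub> y)"
      have G: "finite ?G" "?G \<subseteq> \<Gamma>" using fin[OF x] fin[OF y] fin[OF xy] by blast+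
      have eq: "\<Phi> x = (\<Oplus>\<^bsub>T\<^esub>\<gamma>\<in>?G. dext (U \<gamma>) (x \<gamma>))" "\<Phi> y = (\<Oplus>\<^bsub>T\<^esub>\<gamma>\<in>?G. dext (U \<gamma>) (y \<gamma>))"
        "\<Phi> (x \<oplus>\<^bsub>S\<^esub> y) = (\<Oplus>\<^bsub>T\<^esub>\<gamma>\<in>?G. dext (U \<gamma>) ((x \<oplus>\<^bsub>S\<^esub> y) \<gamma>))"
        by (rule sum_of_extensions_eq[OF _ G]; (fact x y xy | blast))+
      have "dext (U \<gamma>) ((x \<oplus>\<^bsub>S\<^esub> y) \<gamma>) = dext (U \<gamma>) (x \<gamma>) \<oplus>\<^bsub>T\<^esub> dext (U \<gamma>) (y \<gamma>)" if "\<gamma> \<in> ?G" for \<gamma>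
      proof -
        have \<gamma>: "\<gamma> \<in> \<Gamma>" using that by blast
        then have "x \<gamma> \<in> carrier (Dist_c (U \<gamma>))" "y \<gamma> \<in> carrier (Dist_c (U \<gamma>))" using x y by auto
        from linear_mapD(2)[OF linear_map_dext[OF open_U[OF \<gamma>]] this] \<gamma> show ?thesis by simp
      qed
      then have "\<Phi> (x \<oplus>\<^bsub>S\<^esub> y) = (\<Oplus>\<^bsub>T\<^esub>\<gamma>\<in>?G. dext (U \<gamma>) (x \<gamma>) \<oplus>\<^bsub>T\<^esub> dext (U \<gamma>) (y \<gamma>))"
        unfolding eq(3)
        using funcset_mem[OF cl[OF x G(2)]] funcset_mem[OF cl[OF y G(2)]]
        by (intro T.M.finsum_cong'[OF refl] Pi_I T.M.a_closed)
      also have "\<dots> = \<Phi> x \<oplus>\<^bsub>T\<^esub> \<Phi> y"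
        unfolding eq by (rule T.M.finsum_addf[OF cl[OF x G(2)] cl[OF y G(2)]])
      finally show ?thesis .
    qed
    show "\<Phi> (c \<odot>\<^bsub>S\<^esub> x) = c \<odot>\<^bsub>T\<^esub> \<Phi> x" if x: "x \<in> carrier S" for c x
    proof -
      have cx: "c \<odot>\<^bsub>S\<^esub> x \<in> carrier S" by (rule complex_smult_closed[OF lcsD(1)[OF lcs_S] x])
      let ?G = "?supp x \<union> ?supp (c \<odot>\<^bsub>S\<^esub> x)"
      have G: "finite ?G" "?G \<subseteq> \<Gamma>" using fin[OF x] fin[OF cx] by blast+
      have eq: "\<Phi> x = (\<Oplus>\<^bsub>T\<^esub>\<gamma>\<in>?G. dext (U \<gamma>) (x \<gamma>))" "\<Phi> (c \<odot>\<^bsub>S\<^esub> x) = (\<Oplus>\<^bsub>T\<^esub>\<gamma>\<in>?G. dext (U \<gamma>) ((c \<odot>\<^bsub>S\<^esub> x) \<gamma>))"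
        by (rule sum_of_extensions_eq[OF _ G]; (fact x cx | blast))+
      have "dext (U \<gamma>) ((c \<odot>\<^bsub>S\<^esub> x) \<gamma>) = c \<odot>\<^bsub>T\<^esub> dext (U \<gamma>) (x \<gamma>)" if "\<gamma> \<in> ?G" for \<gamma>
      proof -
        have \<gamma>: "\<gamma> \<in> \<Gamma>" using that by blast
        then have "x \<gamma> \<in> carrier (Dist_c (U \<gamma>))" using x by auto
        from linear_mapD(3)[OF linear_map_dext[OF open_U[OF \<gamma>]] this] \<gamma> show ?thesis by simp
      qed
      then have "\<Phi> (c \<odot>\<^bsub>S\<^esub> x) = (\<Oplus>\<^bsub>T\<^esub>\<gamma>\<in>?G. c \<odot>\<^bsub>T\<^esub> dext (U \<gamma>) (x \<gamma>))"
        unfolding eq(2)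
        using funcset_mem[OF cl[OF x G(2)]]
        by (intro T.M.finsum_cong'[OF refl] Pi_I complex_smult_closed[OF lcsD(1)[OF lcs_T]])
      also have "\<dots> = c \<odot>\<^bsub>T\<^esub> \<Phi> x"
        unfolding eq using T.finsum_smult_ldistr[OF G(1) _ cl[OF x G(2)], of c] by simp
      finally show ?thesis .
    qed
  qed
qed

lemma sum_of_extensions_inj:
  assumes \<gamma>: "\<gamma> \<in> \<Gamma>" and v: "v \<in> carrier (Dist_c (U \<gamma>))"
  shows "\<Phi> (direct_sum_inj \<Gamma> (\<lambda>\<gamma>. Dist_c (U \<gamma>)) \<gamma> v) = dext (U \<gamma>) v"
proof -
  interpret T: Module.module \<C> T by (rule lcsD(1)[OF lcs_T])
  have d: "dext (U \<gamma>) v \<in> carrier T" by (rule dext_closed[OF open_U[OF \<gamma>] v])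
  have "\<Phi> (direct_sum_inj \<Gamma> (\<lambda>\<gamma>. Dist_c (U \<gamma>)) \<gamma> v) =
      (\<Oplus>\<^bsub>T\<^esub>\<delta>\<in>{\<gamma>}. dext (U \<delta>) (direct_sum_inj \<Gamma> (\<lambda>\<gamma>. Dist_c (U \<gamma>)) \<gamma> v \<delta>))"
  proof (rule sum_of_extensions_eq)
    show "direct_sum_inj \<Gamma> (\<lambda>\<gamma>. Dist_c (U \<gamma>)) \<gamma> v \<in> carrier S"
      by (rule direct_sum_inj_closed[of \<Gamma> "\<lambda>\<gamma>. Dist_c (U \<gamma>)" \<gamma> v, OF module_Dist_c[OF open_U] \<gamma> v])
  qed (use \<gamma> in \<open>auto simp: direct_sum_inj_def\<close>)
  also have "\<dots> = dext (U \<gamma>) v"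
    using T.M.finsum_insert[of "{}" \<gamma> "\<lambda>\<delta>. dext (U \<delta>) (direct_sum_inj \<Gamma> (\<lambda>\<gamma>. Dist_c (U \<gamma>)) \<gamma> v \<delta>)"] d \<gamma> T.M.r_zero[OF d]
    by (simp add: direct_sum_inj_def)
  finally show ?thesis .
qed

lemma continuous_map_sum_of_extensions: "continuous_map (top_of S) (top_of T) \<Phi>"
proof (rule continuous_map_from_direct_sum[OF lcs_Dist_c[OF open_U] lcs_T linear_map_sum_of_extensions])
  fix \<gamma> assume \<gamma>: "\<gamma> \<in> \<Gamma>"
  show "continuous_map (top_of (Dist_c (U \<gamma>))) (top_of T) (\<lambda>v. \<Phi> (direct_sum_inj \<Gamma> (\<lambda>\<gamma>. Dist_c (U \<gamma>)) \<gamma> v))"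
    by (rule continuous_map_eq[OF continuous_map_dext[OF open_U[OF \<gamma>]]])
      (simp add: sum_of_extensions_inj[OF \<gamma>] lcsD(3)[OF lcs_Dist_c[OF open_U[OF \<gamma>]]])
qed

text \<open>Multiplication by \<open>\<rho>\<close> is lifted through \<open>\<Phi>\<close> one
  summand at a time, each contributing \<open>localize\<close> in the coordinate of its index.
  Repeated indices are harmless, since the contributions are added in \<open>S\<close>.\<close>

lemma continuous_lift:
  assumes "subordinate_sum M \<O> (U ` \<Gamma>) \<rho>"
  obtains \<Psi> where "continuous_map (top_of (Dist \<Omega>)) (top_of S) \<Psi>"
    "\<And>\<eta>. \<eta> \<in> carrier (Dist \<Omega>) \<Longrightarrow> \<Phi> (\<Psi> \<eta>) = transpose_map (Fc \<Omega>) (act \<Omega> \<rho>) \<eta>"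
proof -
  interpret S: Module.module \<C> S by (rule lcsD(1)[OF lcs_S])
  have "\<exists>\<Psi>. continuous_map (top_of (Dist \<Omega>)) (top_of S) \<Psi> \<and>
    (\<forall>\<eta>\<in>carrier (Dist \<Omega>). \<Phi> (\<Psi> \<eta>) = transpose_map (Fc \<Omega>) (act \<Omega> \<rho>) \<eta>)"
    using assms
  proof (induction rule: subordinate_sum.induct)
    case zero
    have "\<Phi> \<zero>\<^bsub>S\<^esub> = \<zero>\<^bsub>T\<^esub>"
      by (rule linear_map_zero[OF lcsD(1)[OF lcs_S] lcsD(1)[OF lcs_T] linear_map_sum_of_extensions])
    moreover have "transpose_map (Fc \<Omega>) (act \<Omega> \<zero>\<^bsub>sec \<O> \<Omega>\<^esub>) \<eta> = \<zero>\<^bsub>T\<^esub>" if "\<eta> \<in> carrier (Dist \<Omega>)" for \<eta>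
      using Dist_zero[OF openin_total that] act_zero_left[OF openin_total Fc_closed[OF openin_total]]
      by (auto simp: transpose_map_def zero_Dist fun_eq_iff)
    ultimately show ?case
      using S.M.zero_closed by (intro exI[of _ "\<lambda>_. \<zero>\<^bsub>S\<^esub>"]) (simp add: lcsD(3)[OF lcs_S] del: direct_sum_simps)
  next
    case (add \<rho> V \<phi>)
    then obtain \<gamma> \<Psi> where \<gamma>: "\<gamma> \<in> \<Gamma>" "V = U \<gamma>" and \<Psi>: "continuous_map (top_of (Dist \<Omega>)) (top_of S) \<Psi>"
      "\<And>\<eta>. \<eta> \<in> carrier (Dist \<Omega>) \<Longrightarrow> \<Phi> (\<Psi> \<eta>) = transpose_map (Fc \<Omega>) (act \<Omega> \<rho>) \<eta>" by blast
    have \<phi>: "cutoff_in M \<O> (U \<gamma>) \<phi>" using add \<gamma> by simp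
    note V = open_U[OF \<gamma>(1)]
    let ?inj = "direct_sum_inj \<Gamma> (\<lambda>\<gamma>. Dist_c (U \<gamma>)) \<gamma>"
    have c: "continuous_map (top_of (Dist \<Omega>)) (top_of S) (\<lambda>\<eta>. ?inj (localize (U \<gamma>) \<phi> \<eta>))"
      using continuous_map_compose[OF continuous_map_localize[OF V \<phi>]
          continuous_map_direct_sum_inj[of \<Gamma> "\<lambda>\<gamma>. Dist_c (U \<gamma>)" \<gamma>, OF lcs_Dist_c[OF open_U] \<gamma>(1)]]
      by (simp add: comp_def)
    have "\<Phi> (\<Psi> \<eta> \<oplus>\<^bsub>S\<^esub> ?inj (localize (U \<gamma>) \<phi> \<eta>)) = transpose_map (Fc \<Omega>) (act \<Omega> (\<rho> \<oplus>\<^bsub>sec \<O> \<Omega>\<^esub> \<phi>)) \<eta>"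
      if \<eta>: "\<eta> \<in> carrier (Dist \<Omega>)" for \<eta>
    proof -
      have cl: "\<Psi> \<eta> \<in> carrier S" "?inj (localize (U \<gamma>) \<phi> \<eta>) \<in> carrier S" "localize (U \<gamma>) \<phi> \<eta> \<in> carrier (Dist_c (U \<gamma>))"
        using continuous_map_funspace[OF \<Psi>(1)] continuous_map_funspace[OF c] continuous_map_funspace[OF continuous_map_localize[OF V \<phi>]]
          \<eta> unfolding topspace_Dist lcsD(3)[OF lcs_S] lcsD(3)[OF lcs_Dist_c[OF V]] by blast+
      have "\<Phi> (\<Psi> \<eta> \<oplus>\<^bsub>S\<^esub> ?inj (localize (U \<gamma>) \<phi> \<eta>)) = \<Phi> (\<Psi> \<eta>) \<oplus>\<^bsub>T\<^esub> \<Phi> (?inj (localize (U \<gamma>) \<phi> \<eta>))"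
        by (rule linear_mapD(2)[OF linear_map_sum_of_extensions cl(1,2)])
      also have "\<dots> = transpose_map (Fc \<Omega>) (act \<Omega> \<rho>) \<eta> \<oplus>\<^bsub>T\<^esub> transpose_map (Fc \<Omega>) (act \<Omega> \<phi>) \<eta>"
        by (simp only: \<Psi>(2)[OF \<eta>] sum_of_extensions_inj[OF \<gamma>(1) cl(3)] dext_localize[OF V \<phi> \<eta>])
      also have "\<dots> = transpose_map (Fc \<Omega>) (act \<Omega> (\<rho> \<oplus>\<^bsub>sec \<O> \<Omega>\<^esub> \<phi>)) \<eta>"
        unfolding transpose_map_def Dist_c_simps add_Dist
      proof (rule restrict_ext)
        fix s assume s: "s \<in> carrier (Fc \<Omega>)"
        note r = subordinate_sum_closed[OF add.hyps(1)] cutoff_in_closed[OF \<phi>]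
        show "(\<lambda>s\<in>carrier (Fc \<Omega>). \<eta> (act \<Omega> \<rho> s)) s \<oplus>\<^bsub>E\<^esub> (\<lambda>s\<in>carrier (Fc \<Omega>). \<eta> (act \<Omega> \<phi> s)) s =
            \<eta> (act \<Omega> (\<rho> \<oplus>\<^bsub>sec \<O> \<Omega>\<^esub> \<phi>) s)"
          using s Dist_add[OF \<eta> act_Fc_closed[OF openin_total r(1) s] act_Fc_closed[OF openin_total r(2) s]]
            act_add_left[OF openin_total r Fc_closed[OF openin_total s]] by simp
      qed
      finally show ?thesis .
    qed
    then show ?case
      using continuous_map_lc_add[OF lcsD(2)[OF lcs_S] \<Psi>(1) c]
      by (intro exI[of _ "\<lambda>\<eta>. \<Psi> \<eta> \<oplus>\<^bsub>S\<^esub> ?inj (localize (U \<gamma>) \<phi> \<eta>)"]) blast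
  qed
  then show thesis using that by blast
qed

text \<open>The covering property enters by putting \<open>K\<close> inside the union of the
  \<open>U \<gamma>\<close>; the lift of multiplication by a sum that is \<open>1\<close> near
  \<open>K\<close> is then a right inverse over \<open>K\<close>.\<close>

lemma continuous_section_on_compact:
  assumes cov: "(\<Union>\<gamma>\<in>\<Gamma>. U \<gamma>) = \<Omega>" and K: "compactin M K"
  obtains \<Psi> where "continuous_map (top_of (Dist \<Omega>)) (top_of S) \<Psi>"
    "\<And>\<eta>. \<eta> \<in> supported_in M \<D> \<Omega> K \<Longrightarrow> \<Phi> (\<Psi> \<eta>) = \<eta>"
proof -
  obtain \<rho> W where \<rho>: "subordinate_sum M \<O> (U ` \<Gamma>) \<rho>" "openin M W" "K \<subseteq> W" "res \<O> \<Omega> W \<rho> = \<one>\<^bsub>sec \<O> W\<^esub>"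
  proof (rule partition_of_unity_near_compact[OF K])
    show "K \<subseteq> \<Union>(U ` \<Gamma>)" using cov compactin_subset_topspace[OF K] by simp
  qed (use open_U in auto)
  obtain \<Psi> where \<Psi>: "continuous_map (top_of (Dist \<Omega>)) (top_of S) \<Psi>"
    "\<And>\<eta>. \<eta> \<in> carrier (Dist \<Omega>) \<Longrightarrow> \<Phi> (\<Psi> \<eta>) = transpose_map (Fc \<Omega>) (act \<Omega> \<rho>) \<eta>"
    using continuous_lift[OF \<rho>(1)] by blast
  have "\<Phi> (\<Psi> \<eta>) = \<eta>" if "\<eta> \<in> supported_in M \<D> \<Omega> K" for \<eta>
    using \<Psi>(2)[OF supported_in_DD(1)[OF openin_total K that]]
      transpose_act_self[OF K that subordinate_sum_closed[OF \<rho>(1)] \<rho>(2-4)] by simp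
  then show thesis using that \<Psi>(1) by blast
qed

lemma surj_sum_of_extensions:
  assumes cov: "(\<Union>\<gamma>\<in>\<Gamma>. U \<gamma>) = \<Omega>"
  shows "\<Phi> ` carrier S = carrier T"
proof (intro subset_antisym subsetI)
  fix y assume "y \<in> \<Phi> ` carrier S"
  then show "y \<in> carrier T" using linear_mapD(1)[OF linear_map_sum_of_extensions] by blast
next
  fix \<eta> assume "\<eta> \<in> carrier T"
  then obtain K where K: "compactin M K" "\<eta> \<in> supported_in M \<D> \<Omega> K" by (rule Dist_cE)
  obtain \<Psi> where \<Psi>: "continuous_map (top_of (Dist \<Omega>)) (top_of S) \<Psi>"
    "\<And>\<eta>. \<eta> \<in> supported_in M \<D> \<Omega> K \<Longrightarrow> \<Phi> (\<Psi> \<eta>) = \<eta>"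
    using continuous_section_on_compact[OF cov K(1)] by blast
  have "\<Psi> \<eta> \<in> carrier S"
    using continuous_map_funspace[OF \<Psi>(1)] supported_in_DD(1)[OF openin_total K]
    unfolding topspace_Dist lcsD(3)[OF lcs_S] by blast
  then show "\<eta> \<in> \<Phi> ` carrier S" using \<Psi>(2)[OF K(2)] by (metis imageI)
qed

text \<open>The quotient topology of \<open>\<Phi>\<close> is locally convex, and it makes all inclusions into \<open>T\<close> of
  the spaces of distributions supported in a fixed compact set continuous, since these inclusions
  lift continuously along \<open>\<Phi>\<close>. Hence it is coarser than the topology of \<open>T\<close>.\<close>

lemma open_map_sum_of_extensions:
  assumes cov: "(\<Union>\<gamma>\<in>\<Gamma>. U \<gamma>) = \<Omega>"
  shows "open_map (top_of S) (top_of T) \<Phi>"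
proof -
  note q = lcsD(1)[OF lcs_S] lcsD(1)[OF lcs_T] lcsD(2)[OF lcs_S] linear_map_sum_of_extensions surj_sum_of_extensions[OF cov]
  let ?\<tau> = "lc_quotient_topology S T (top_of S) \<Phi>"
  have "openin (top_of T) N" if N: "openin ?\<tau> N" for N
  proof -
    have T: "T = tvs_union (Dist \<Omega>) (supported_in M \<D> \<Omega> ` compacts \<Omega>)" by (rule Dist_c_eq)
    have "continuous_map (subtopology (top_of (Dist \<Omega>)) A) ?\<tau> (\<lambda>x. x)"
      if "A \<in> supported_in M \<D> \<Omega> ` compacts \<Omega>" for A
    proof -
      from that obtain K where K: "compactin M K" and A: "A = supported_in M \<D> \<Omega> K" by auto
      obtain \<Psi> where \<Psi>: "continuous_map (top_of (Dist \<Omega>)) (top_of S) \<Psi>"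
        "\<And>\<eta>. \<eta> \<in> supported_in M \<D> \<Omega> K \<Longrightarrow> \<Phi> (\<Psi> \<eta>) = \<eta>"
        using continuous_section_on_compact[OF cov K] by blast
      have "continuous_map (subtopology (top_of (Dist \<Omega>)) A) ?\<tau> (\<Phi> \<circ> \<Psi>)"
        by (intro continuous_map_from_subtopology continuous_map_compose[OF \<Psi>(1) continuous_map_lc_quotient[OF q]])
      then show ?thesis by (rule continuous_map_eq) (use \<Psi>(2) A in auto)
    qed
    then have "openin (lc_final_topology T (supported_in M \<D> \<Omega> ` compacts \<Omega>)
        (\<lambda>A. subtopology (top_of (Dist \<Omega>)) A) (\<lambda>A x. x)) N"
      by (rule openin_lc_final_topologyI[OF lc_topology_quotient[OF q] _ N])
    then show ?thesis by (simp only: Dist_c_eq top_of_tvs_union)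
  qed
  \<comment> \<open>Images of open sets are open in the quotient topology, hence in the finer
    topology of \<open>T\<close>.\<close>
  then show ?thesis using open_map_lc_quotient[OF q] unfolding open_map_def by blast
qed

end

end


section \<open>A smooth plateau function on the real line\<close>

section \<open>Smooth functions of one real variable\<close>

text \<open>Only existence of the derivatives is demanded, not continuity of the last one; requiring
  all orders in \<open>smooth\<close> makes the difference disappear.\<close>

fun smooth_upto :: "nat \<Rightarrow> (real \<Rightarrow> real) \<Rightarrow> bool" where
  "smooth_upto 0 f \<longleftrightarrow> True"
| "smooth_upto (Suc m) f \<longleftrightarrow> (\<exists>f'. (\<forall>x. (f has_real_derivative f' x) (at x)) \<and> smooth_upto m f')"

definition smooth :: "(real \<Rightarrow> real) \<Rightarrow> bool" where
  "smooth f \<longleftrightarrow> (\<forall>m. smooth_upto m f)"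

lemma smooth_upto_Suc: "smooth_upto (Suc m) f \<Longrightarrow> smooth_upto m f"
  by (induction m arbitrary: f) auto

lemma smooth_upto_const: "smooth_upto m (\<lambda>x. c)"
  by (induction m arbitrary: c) (auto intro!: exI[of _ "\<lambda>x. 0"])

lemma smooth_upto_id: "smooth_upto m (\<lambda>x. x)"
  by (cases m) (auto intro!: exI[of _ "\<lambda>x. 1"] smooth_upto_const)

lemma smooth_upto_add: "smooth_upto m f \<Longrightarrow> smooth_upto m g \<Longrightarrow> smooth_upto m (\<lambda>x. f x + g x)"
proof (induction m arbitrary: f g)
  case (Suc m)
  then obtain f' g' where "\<forall>x. (f has_real_derivative f' x) (at x)" "smooth_upto m f'"
    "\<forall>x. (g has_real_derivative g' x) (at x)" "smooth_upto m g'" by auto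
  then show ?case using Suc.IH[of f' g'] by (auto intro!: exI[of _ "\<lambda>x. f' x + g' x"] DERIV_add)
qed simp

lemma smooth_upto_mult: "smooth_upto m f \<Longrightarrow> smooth_upto m g \<Longrightarrow> smooth_upto m (\<lambda>x. f x * g x)"
proof (induction m arbitrary: f g)
  case (Suc m)
  then obtain f' g' where d: "\<forall>x. (f has_real_derivative f' x) (at x)" "smooth_upto m f'"
    "\<forall>x. (g has_real_derivative g' x) (at x)" "smooth_upto m g'" by auto
  note smooth_upto_Suc[OF Suc.prems(1)] smooth_upto_Suc[OF Suc.prems(2)]
  then have "smooth_upto m (\<lambda>x. f' x * g x + g' x * f x)"
    using Suc.IH d by (intro smooth_upto_add) auto
  then show ?case using d by (auto intro!: exI[of _ "\<lambda>x. f' x * g x + g' x * f x"] DERIV_mult)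
qed simp

lemma smooth_upto_compose: "smooth_upto m f \<Longrightarrow> smooth_upto m g \<Longrightarrow> smooth_upto m (\<lambda>x. f (g x))"
proof (induction m arbitrary: f g)
  case (Suc m)
  then obtain f' g' where d: "\<forall>x. (f has_real_derivative f' x) (at x)" "smooth_upto m f'"
    "\<forall>x. (g has_real_derivative g' x) (at x)" "smooth_upto m g'" by auto
  have "smooth_upto m g" by (rule smooth_upto_Suc[OF Suc.prems(2)])
  then have "smooth_upto m (\<lambda>x. f' (g x) * g' x)"
    using Suc.IH d by (intro smooth_upto_mult) auto
  moreover have "((\<lambda>x. f (g x)) has_real_derivative f' (g x) * g' x) (at x)" for x
    by (rule DERIV_chain2[of f]) (use d in blast)+
  ultimately show ?case
    unfolding smooth_upto.simps by (intro exI[of _ "\<lambda>x. f' (g x) * g' x"]) blast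
qed simp

lemma smooth_const: "smooth (\<lambda>x. c)"
  and smooth_id: "smooth (\<lambda>x. x)"
  and smooth_add: "smooth f \<Longrightarrow> smooth g \<Longrightarrow> smooth (\<lambda>x. f x + g x)"
  and smooth_mult: "smooth f \<Longrightarrow> smooth g \<Longrightarrow> smooth (\<lambda>x. f x * g x)"
  and smooth_compose: "smooth f \<Longrightarrow> smooth g \<Longrightarrow> smooth (\<lambda>x. f (g x))"
  by (simp_all add: smooth_def smooth_upto_const smooth_upto_id smooth_upto_add smooth_upto_mult smooth_upto_compose)

text \<open>The derivatives chosen for the various \<open>m\<close> all equal \<open>deriv f\<close>
  by uniqueness, so this one function is smooth to every order.\<close>

lemma smooth_deriv:
  assumes "smooth f"
  shows "smooth (deriv f)" "(f has_real_derivative deriv f x) (at x)"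
proof -
  have *: "\<exists>f'. (\<forall>x. (f has_real_derivative f' x) (at x)) \<and> smooth_upto m f'" for m
    using assms[unfolded smooth_def, rule_format, of "Suc m"] by simp
  have "f' = deriv f" if "\<forall>x. (f has_real_derivative f' x) (at x)" for f'
    using that DERIV_imp_deriv by (metis ext)
  then show "smooth (deriv f)" "(f has_real_derivative deriv f x) (at x)"
    using * unfolding smooth_def by metis+
qed

text \<open>The exponent \<open>k\<close> is general because the factor \<open>y\<close> in front of
  the tail of the polynomial is absorbed into the power.\<close>

lemma poly_div_exp_tendsto_0: "((\<lambda>y::real. poly q y * y ^ k / exp y) \<longlongrightarrow> 0) at_top"
proof (induction q arbitrary: k)
  case (pCons a p)
  have "((\<lambda>y. a * (y ^ k / exp y) + poly p y * y ^ Suc k / exp y) \<longlongrightarrow> a * 0 + 0) at_top"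
    by (intro tendsto_intros tendsto_power_div_exp_0 pCons.IH)
  then show ?case by (simp add: algebra_simps add_divide_distrib)
qed simp

text \<open>The derivatives of \<open>exp (- 1 / x)\<close> are of this form.\<close>

definition flat_fun :: "real poly \<Rightarrow> real \<Rightarrow> real" where
  "flat_fun q x = (if 0 < x then poly q (1 / x) * exp (- (1 / x)) else 0)"

lemma flat_fun_nonpos: "x \<le> 0 \<Longrightarrow> flat_fun q x = 0"
  by (simp add: flat_fun_def)

text \<open>With \<open>y = 1 / x\<close>, differentiating \<open>q(y) exp(- y)\<close> in
  \<open>x\<close> gives \<open>y^2 (q(y) - q'(y)) exp(- y)\<close>, and \<open>[:0, 0, 1:]\<close>
  is the polynomial \<open>y^2\<close>. At \<open>0\<close> the right difference quotient is
  \<open>y q(y) exp(- y)\<close>, which tends to zero as \<open>y\<close> grows.\<close>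

lemma DERIV_flat_fun:
  "(flat_fun q has_real_derivative flat_fun ([:0, 0, 1:] * (q - pderiv q)) x) (at x)"
proof -
  consider "x < 0" | "x = 0" | "x > 0" by linarith
  then show ?thesis
  proof cases
    case 1
    have "((\<lambda>x. 0) has_real_derivative 0) (at x)" by simp
    then have "(flat_fun q has_real_derivative 0) (at x)"
      by (rule has_field_derivative_transform_within_open[of _ _ _ "{..<0}"]) (use 1 in \<open>auto simp: flat_fun_def\<close>)
    then show ?thesis using 1 by (simp add: flat_fun_def)
  next
    case 3
    have "((\<lambda>x. poly q (1 / x) * exp (- (1 / x))) has_real_derivative
        (poly (pderiv q) (1 / x) * (- (1 / x ^ 2)) * exp (- (1 / x)) + poly q (1 / x) * (exp (- (1 / x)) * (1 / x ^ 2)))) (at x)"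
      using 3 by (auto intro!: derivative_eq_intros poly_DERIV simp: power2_eq_square field_simps)
    then have "(flat_fun q has_real_derivative
        (poly (pderiv q) (1 / x) * (- (1 / x ^ 2)) * exp (- (1 / x)) + poly q (1 / x) * (exp (- (1 / x)) * (1 / x ^ 2)))) (at x)"
      by (rule has_field_derivative_transform_within_open[of _ _ _ "{0<..}"]) (use 3 in \<open>auto simp: flat_fun_def\<close>)
    moreover have "poly (pderiv q) (1 / x) * (- (1 / x ^ 2)) * exp (- (1 / x)) + poly q (1 / x) * (exp (- (1 / x)) * (1 / x ^ 2)) =
        flat_fun ([:0, 0, 1:] * (q - pderiv q)) x"
      using 3 by (simp add: flat_fun_def power2_eq_square field_simps)
    ultimately show ?thesis by simp
  next
    case 2
    have "((\<lambda>y. flat_fun q y / y) \<longlongrightarrow> 0) (at 0)"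
      unfolding filterlim_at_split
    proof
      have "\<forall>\<^sub>F y in at_left (0::real). flat_fun q y / y = 0"
        by (rule eventually_at_leftI[of "-1"]) (auto simp: flat_fun_def)
      then show "((\<lambda>y. flat_fun q y / y) \<longlongrightarrow> 0) (at_left 0)" by (rule tendsto_eventually)
      have "((\<lambda>x. poly q (inverse x) * inverse x ^ 1 / exp (inverse x)) \<longlongrightarrow> 0) (at_right (0::real))"
        by (rule filterlim_compose[OF poly_div_exp_tendsto_0 filterlim_inverse_at_top_right])
      then show "((\<lambda>y. flat_fun q y / y) \<longlongrightarrow> 0) (at_right 0)"
      proof (rule Lim_transform_eventually)
        show "\<forall>\<^sub>F x in at_right (0::real). poly q (inverse x) * inverse x ^ 1 / exp (inverse x) = flat_fun q x / x"
          by (rule eventually_at_rightI[of _ 1]) (auto simp: flat_fun_def exp_minus field_simps)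
      qed
    qed
    then show ?thesis using 2 by (simp add: has_field_derivative_iff flat_fun_def)
  qed
qed

lemma smooth_flat_fun: "smooth (flat_fun q)"
proof -
  have "smooth_upto m (flat_fun q)" for m
    by (induction m arbitrary: q) (auto intro!: exI DERIV_flat_fun)
  then show ?thesis by (simp add: smooth_def)
qed

text \<open>Composing \<open>flat_fun 1\<close> with itself avoids quotients in the construction of the smooth step.\<close>

lemma smooth_bump:
  obtains \<beta> where "smooth \<beta>" "\<And>x. \<bar>x\<bar> \<le> 1 \<Longrightarrow> \<beta> x = 1" "\<And>x. 2 \<le> \<bar>x\<bar> \<Longrightarrow> \<beta> x = 0"
proof
  let ?e = "flat_fun 1"
  let ?c = "?e 1"
  \<comment> \<open>For \<open>x\<close> of modulus at most \<open>1\<close> the inner value is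
    \<open>0\<close> and the outer argument is \<open>?c\<close>. For modulus at least
    \<open>2\<close> one has \<open>x * x - 1 \<ge> 1\<close>, so the inner value is at least
    \<open>?c\<close> and the outer argument is not positive. The factor \<open>1 / ?e ?c\<close>
    normalizes the plateau to \<open>1\<close>.\<close>
  let ?\<beta> = "\<lambda>x. (1 / ?e ?c) * ?e (?c + (- 1) * ?e (x * x + (- 1)))"
  have c: "?c > 0" by (simp add: flat_fun_def)
  then have ec: "?e ?c > 0" by (simp add: flat_fun_def)
  show "smooth ?\<beta>"
    by (intro smooth_mult smooth_const smooth_compose[OF smooth_flat_fun] smooth_add smooth_id)
  show "?\<beta> x = 1" if "\<bar>x\<bar> \<le> 1" for x
  proof -
    have "x * x \<le> 1" using that by (metis abs_square_le_1 power2_eq_square)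
    then have "?e (x * x + (- 1)) = 0" by (simp add: flat_fun_def)
    then show ?thesis using ec by simp
  qed
  show "?\<beta> x = 0" if "2 \<le> \<bar>x\<bar>" for x
  proof -
    have "2 * 2 \<le> \<bar>x\<bar> * \<bar>x\<bar>" using that by (intro mult_mono) auto
    then have x: "1 \<le> x * x - 1" by (simp add: abs_mult_self_eq)
    have "?c \<le> ?e (x * x + (- 1))"
      using x by (simp add: flat_fun_def)
    then have "?c + (- 1) * ?e (x * x + (- 1)) \<le> 0" by simp
    then show ?thesis by (simp only: flat_fun_nonpos mult_zero_right)
  qed
qed


section \<open>Product bumps in charts and their transport to the manifold\<close>

section \<open>Bump functions on formal manifolds\<close>

lemma continuous_map_Euclidean_coordinate:
  "continuous_map (subtopology (Euclidean_space n) W) euclideanreal (\<lambda>x. x i)"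
  unfolding Euclidean_space_def
  by (intro continuous_map_from_subtopology continuous_map_product_projection) simp

text \<open>A partial derivative replaces one factor by its derivative, so products of functions of
  one coordinate each form a class closed under differentiation. The constant \<open>c\<close> gives
  the zero function the same form as the bump.\<close>

lemma C_diff_product:
  assumes "\<And>i. i < n \<Longrightarrow> smooth (\<beta> i)"
  shows "C_diff n W m (\<lambda>x. complex_of_real (c * (\<Prod>i<n. \<beta> i (x i))))"
  using assms
proof (induction m arbitrary: \<beta>)
  have cont: "continuous_map (subtopology (Euclidean_space n) W) euclidean (\<lambda>x. complex_of_real (c * (\<Prod>i<n. \<beta> i (x i))))"
    if \<beta>: "\<And>i. i < n \<Longrightarrow> smooth (\<beta> i)" for \<beta>
  proof -
    have "continuous_map (subtopology (Euclidean_space n) W) euclideanreal (\<lambda>x. \<beta> i (x i))" if "i < n" for i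
    proof -
      have "continuous_on UNIV (\<beta> i)"
        using smooth_deriv(2)[OF \<beta>[OF that]] DERIV_isCont by (blast intro: continuous_at_imp_continuous_on)
      then show ?thesis
        using continuous_map_compose[OF continuous_map_Euclidean_coordinate[of n W i], of euclideanreal "\<beta> i"] by (simp add: comp_def)
    qed
    then have r: "continuous_map (subtopology (Euclidean_space n) W) euclideanreal (\<lambda>x. c * (\<Prod>i<n. \<beta> i (x i)))"
      by (intro continuous_map_real_mult continuous_map_prod) auto
    have "continuous_map euclideanreal euclidean complex_of_real"
      by (simp add: continuous_on_of_real_id)
    from continuous_map_compose[OF r this] show ?thesis by (simp add: comp_def)
  qed
  case (0 \<beta>)
  then show ?case using cont by simp
  case (Suc m \<beta>)
  show ?case
    unfolding C_diff.simps
  proof (intro conjI allI impI ballI)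
    show "continuous_map (subtopology (Euclidean_space n) W) euclidean (\<lambda>x. complex_of_real (c * (\<Prod>i<n. \<beta> i (x i))))"
      by (rule cont) (rule Suc.prems)
    fix i assume i: "i < n"
    let ?\<beta>' = "\<beta>(i := deriv (\<beta> i))"
    have split: "(\<Prod>j<n. \<gamma> j (y j)) = \<gamma> i (y i) * (\<Prod>j\<in>{..<n} - {i}. \<gamma> j (y j))" for \<gamma> :: "nat \<Rightarrow> real \<Rightarrow> real" and y
      using i by (intro prod.remove) auto
    have d: "((\<lambda>t. complex_of_real (c * (\<Prod>j<n. \<beta> j ((x(i := t)) j)))) has_vector_derivative
        complex_of_real (c * (\<Prod>j<n. ?\<beta>' j (x j)))) (at (x i))" for x
    proof -
      have eq1: "(\<Prod>j<n. \<beta> j ((x(i := t)) j)) = \<beta> i t * (\<Prod>j\<in>{..<n} - {i}. \<beta> j (x j))" for t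
        unfolding split by simp
      have eq2: "(\<Prod>j<n. ?\<beta>' j (x j)) = deriv (\<beta> i) (x i) * (\<Prod>j\<in>{..<n} - {i}. \<beta> j (x j))"
        unfolding split by simp
      have "((\<lambda>t. c * (\<beta> i t * (\<Prod>j\<in>{..<n} - {i}. \<beta> j (x j)))) has_real_derivative
          c * (deriv (\<beta> i) (x i) * (\<Prod>j\<in>{..<n} - {i}. \<beta> j (x j)))) (at (x i))"
        by (intro DERIV_cmult DERIV_cmult_right smooth_deriv(2) Suc.prems i)
      then show ?thesis
        unfolding eq1 eq2 by (intro has_vector_derivative_of_real) (simp add: has_real_derivative_iff_has_vector_derivative)
    qed
    show "(\<lambda>t. complex_of_real (c * (\<Prod>j<n. \<beta> j ((x(i := t)) j)))) differentiable at (x i)" for x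
      using d[of x] by (auto simp: has_vector_derivative_def differentiable_def)
    have "partial_deriv i (\<lambda>x. complex_of_real (c * (\<Prod>i<n. \<beta> i (x i)))) =
        (\<lambda>x. complex_of_real (c * (\<Prod>j<n. ?\<beta>' j (x j))))"
      unfolding partial_deriv_def using vector_derivative_at[OF d] by (intro ext)
    moreover have "smooth (?\<beta>' j)" if "j < n" for j
      using Suc.prems[OF that] smooth_deriv(1) by (cases "j = i") auto
    ultimately show "C_diff n W m (partial_deriv i (\<lambda>x. complex_of_real (c * (\<Prod>i<n. \<beta> i (x i)))))"
      using Suc.IH[of ?\<beta>'] by simp
  qed
qed

text \<open>Smooth functions are extensional, so the product must be made undefined outside the
  space. This does not affect derivatives: a line in direction \<open>i < n\<close> never leaves the
  whole of \<open>Euclidean_space n\<close>.\<close>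

lemma C_diff_cong:
  assumes "\<And>x. x \<in> topspace (Euclidean_space n) \<Longrightarrow> f x = g x"
    and "C_diff n (topspace (Euclidean_space n)) m f"
  shows "C_diff n (topspace (Euclidean_space n)) m g"
  using assms
proof (induction m arbitrary: f g)
  case 0
  show ?case
    unfolding C_diff.simps
    by (rule continuous_map_eq[of _ _ f]) (use 0 in simp_all)
next
  case (Suc m)
  have upd: "(\<lambda>t. g (x(i := t))) = (\<lambda>t. f (x(i := t)))" if "x \<in> topspace (Euclidean_space n)" "i < n" for x i
  proof
    fix t
    have "x(i := t) \<in> topspace (Euclidean_space n)" using that by (auto simp: topspace_Euclidean_space)
    then show "g (x(i := t)) = f (x(i := t))" by (rule Suc.prems(1)[symmetric])
  qed
  show ?case
    unfolding C_diff.simps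
  proof (intro conjI allI impI ballI)
    show "continuous_map (subtopology (Euclidean_space n) (topspace (Euclidean_space n))) euclidean g"
      by (rule continuous_map_eq[of _ _ f]) (use Suc.prems in simp_all)
    fix i assume i: "i < n"
    show "(\<lambda>t. g (x(i := t))) differentiable at (x i)" if "x \<in> topspace (Euclidean_space n)" for x
      using Suc.prems(2) i that by (simp add: upd)
    show "C_diff n (topspace (Euclidean_space n)) m (partial_deriv i g)"
    proof (rule Suc.IH[of "partial_deriv i f"])
      show "partial_deriv i f x = partial_deriv i g x" if "x \<in> topspace (Euclidean_space n)" for x
        by (simp only: partial_deriv_def upd[OF that i])
    qed (use Suc.prems(2) i in simp)
  qed
qed

lemma smooth_functions_product:
  assumes "\<And>i. i < n \<Longrightarrow> smooth (\<beta> i)"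
  shows "(\<lambda>x\<in>topspace (Euclidean_space n). complex_of_real (c * (\<Prod>i<n. \<beta> i (x i)))) \<in>
    smooth_functions n (topspace (Euclidean_space n))"
proof -
  have "C_diff n (topspace (Euclidean_space n)) m
      (\<lambda>x\<in>topspace (Euclidean_space n). complex_of_real (c * (\<Prod>i<n. \<beta> i (x i))))" for m
    by (rule C_diff_cong[OF _ C_diff_product[of n \<beta> _ m c, OF assms]]) simp_all
  then show ?thesis by (simp add: smooth_functions_def)
qed

text \<open>Points of \<open>Euclidean_space n\<close> are sequences that vanish from index
  \<open>n\<close> on, so only finitely many coordinates have to be controlled.\<close>

lemma Euclidean_space_open_contains_box:
  assumes G: "openin (Euclidean_space n) G" and p: "p \<in> G"
  obtains \<epsilon> where "0 < \<epsilon>" "\<And>x. x \<in> topspace (Euclidean_space n) \<Longrightarrow> (\<And>i. i < n \<Longrightarrow> \<bar>x i - p i\<bar> < \<epsilon>) \<Longrightarrow> x \<in> G"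
proof -
  obtain G' where G': "openin (powertop_real UNIV) G'" "G = G' \<inter> {x. \<forall>i\<ge>n. x i = 0}"
    using G by (auto simp: Euclidean_space_def openin_subtopology)
  obtain Y where Y: "p \<in> Pi\<^sub>E UNIV Y" "\<And>i. openin euclideanreal (Y i)" "Pi\<^sub>E UNIV Y \<subseteq> G'"
    using product_topology_open_contains_basis[OF G'(1), of p] p G'(2) by blast
  have "\<exists>e>0. ball (p i) e \<subseteq> Y i" for i
  proof -
    have "open (Y i)" "p i \<in> Y i" using Y(1) Y(2)[of i] by (auto simp: PiE_iff)
    then show ?thesis unfolding open_contains_ball by blast
  qed
  then obtain e where e: "\<And>i. 0 < e i" "\<And>i. ball (p i) (e i) \<subseteq> Y i" by metis
  \<comment> \<open>Inserting \<open>1\<close> keeps the minimum defined for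
    \<open>n = 0\<close>.\<close>
  define \<epsilon> where "\<epsilon> = Min (insert 1 (e ` {..<n}))"
  have "0 < \<epsilon>" unfolding \<epsilon>_def using e(1) by (subst Min_gr_iff) auto
  moreover have "x \<in> G" if x: "x \<in> topspace (Euclidean_space n)" and b: "\<And>i. i < n \<Longrightarrow> \<bar>x i - p i\<bar> < \<epsilon>" for x
  proof -
    have "x i \<in> Y i" for i
    proof (cases "i < n")
      case True
      then have "\<epsilon> \<le> e i" unfolding \<epsilon>_def by (intro Min_le) auto
      then have "x i \<in> ball (p i) (e i)" using b[OF True] by (simp add: dist_real_def abs_minus_commute)
      then show ?thesis using e(2) by blast
    next
      case False
      then have "x i = p i" using x p G'(2) by (simp add: topspace_Euclidean_space)
      then show ?thesis using Y(1) by auto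
    qed
    then have "x \<in> G'" using Y(3) by auto
    then show ?thesis using x G'(2) by (simp add: topspace_Euclidean_space)
  qed
  ultimately show thesis using that by blast
qed

lemma openin_Euclidean_box:
  "openin (Euclidean_space n) {x \<in> topspace (Euclidean_space n). \<forall>i<n. \<bar>x i - p i\<bar> < \<epsilon>}"
proof -
  have "open {x :: nat \<Rightarrow> real. \<forall>i\<in>{..<n}. x i \<in> ball (p i) \<epsilon>}"
    using product_topology_basis'[of "{..<n}" "\<lambda>i. ball (p i) \<epsilon>" "\<lambda>i. i"] by simp
  then have "openin (Euclidean_space n) ({x. \<forall>i\<in>{..<n}. x i \<in> ball (p i) \<epsilon>} \<inter> {x. \<forall>i\<ge>n. x i = 0})"
    unfolding Euclidean_space_def euclidean_product_topology by (auto simp: openin_subtopology)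
  moreover have "{x. \<forall>i\<in>{..<n}. x i \<in> ball (p i) \<epsilon>} \<inter> {x. \<forall>i\<ge>n. x i = 0} =
      {x \<in> topspace (Euclidean_space n). \<forall>i<n. \<bar>x i - p i\<bar> < \<epsilon>}"
    by (auto simp: topspace_Euclidean_space dist_real_def abs_minus_commute)
  ultimately show ?thesis by simp
qed

text \<open>In the full product the box has the factor \<open>{0}\<close> in all coordinates from
  \<open>n\<close> on, and it is compact as a product of compact sets.\<close>

lemma compactin_Euclidean_box:
  "compactin (Euclidean_space n) {x \<in> topspace (Euclidean_space n). \<forall>i<n. \<bar>x i - p i\<bar> \<le> \<epsilon>}"
proof -
  let ?I = "\<lambda>i. if i < n then {p i - \<epsilon>..p i + \<epsilon>} else {0::real}"
  have "compactin (powertop_real UNIV) (Pi\<^sub>E UNIV ?I)"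
    unfolding compactin_PiE by auto
  moreover have "Pi\<^sub>E UNIV ?I = {x \<in> topspace (Euclidean_space n). \<forall>i<n. \<bar>x i - p i\<bar> \<le> \<epsilon>}"
  proof (intro subset_antisym subsetI)
    fix x assume x: "x \<in> Pi\<^sub>E UNIV ?I"
    have I: "x i \<in> ?I i" for i using x by (auto simp: PiE_iff)
    have "\<bar>x i - p i\<bar> \<le> \<epsilon>" if "i < n" for i using I[of i] that by (simp add: abs_le_iff)
    moreover have "x i = 0" if "i \<ge> n" for i using I[of i] that by simp
    ultimately show "x \<in> {x \<in> topspace (Euclidean_space n). \<forall>i<n. \<bar>x i - p i\<bar> \<le> \<epsilon>}"
      by (simp add: topspace_Euclidean_space)
  next
    fix x assume x: "x \<in> {x \<in> topspace (Euclidean_space n). \<forall>i<n. \<bar>x i - p i\<bar> \<le> \<epsilon>}"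
    have "x i \<in> ?I i" for i
    proof (cases "i < n")
      case True
      then have "\<bar>x i - p i\<bar> \<le> \<epsilon>" using x by blast
      then show ?thesis using True by (simp add: abs_le_iff)
    qed (use x in \<open>simp add: topspace_Euclidean_space\<close>)
    then show "x \<in> Pi\<^sub>E UNIV ?I" by (auto simp: PiE_iff)
  qed
  ultimately show ?thesis
    unfolding Euclidean_space_def by (auto simp: compactin_subtopology topspace_Euclidean_space)
qed

text \<open>The power series has a constant term only, so it equals the unit series, in the formal
  variables too, wherever the function is \<open>1\<close>.\<close>

lemma formal_model_product_section:
  assumes "\<And>i. i < n \<Longrightarrow> smooth (\<beta> i)"
  shows "coefficients k (topspace (Euclidean_space n))
      (\<lambda>J x. if J = {#} then complex_of_real (c * (\<Prod>i<n. \<beta> i (x i))) else 0)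
    \<in> carrier (sec (formal_model n k) (topspace (Euclidean_space n)))"
proof -
  have "(\<lambda>x\<in>topspace (Euclidean_space n). if J = {#} then complex_of_real (c * (\<Prod>i<n. \<beta> i (x i))) else 0)
      \<in> smooth_functions n (topspace (Euclidean_space n))" for J :: "nat multiset"
    using smooth_functions_product[of n \<beta> c, OF assms] smooth_functions_product[of n \<beta> 0, OF assms]
    by (cases "J = {#}") simp_all
  then show ?thesis by (auto simp: formal_model_def coefficients_def)
qed

lemma coefficients_cong:
  assumes "\<And>J x. x \<in> W \<Longrightarrow> F J x = G J x"
  shows "coefficients k W F = coefficients k W G"
  using assms by (auto simp: coefficients_def fun_eq_iff)

lemma coefficients_coefficients: "V \<subseteq> W \<Longrightarrow> coefficients k V (coefficients k W F) = coefficients k V F"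
  by (auto simp: coefficients_def fun_eq_iff)

text \<open>A product bump in a chart is carried to \<open>\<O>\<close> by the isomorphism and then
  extended by zero from the chart domain. The extension exists because the bump vanishes off a
  compact subset, which is closed in the Hausdorff space \<open>M\<close>.\<close>

lemma formal_manifold_bump:
  assumes M: "formal_manifold M \<O>" and U: "openin M U" "a \<in> U"
  obtains \<phi> W where "cutoff_in M \<O> U \<phi>" "openin M W" "a \<in> W" "res \<O> (topspace M) W \<phi> = \<one>\<^bsub>sec \<O> W\<^esub>"
proof -
  have alg: "sheaf_of_complex_algebras M \<O>" and haus: "Hausdorff_space M"
    using M by (auto simp: formal_manifold_def locally_ringed_space_def)
  then have P: "sheaf M \<O>" by (simp add: sheaf_of_complex_algebras_def)
  have aX: "a \<in> topspace M" using U openin_subset by blast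
  obtain U0 n k where U0: "openin M U0" "a \<in> U0"
    and iso: "isomorphic_ringed_spaces (subtopology M U0) \<O> (Euclidean_space n) (formal_model n k)"
    using M aX unfolding formal_manifold_def by blast
  define N where "N = topspace (Euclidean_space n)"
  have U0X: "U0 \<subseteq> topspace M" using U0 openin_subset by blast
  then have top: "topspace (subtopology M U0) = U0" by auto
  from iso obtain h \<psi> where h: "homeomorphic_map (subtopology M U0) (Euclidean_space n) h"
    and \<psi>_nat: "(\<forall>W. openin (Euclidean_space n) W \<longrightarrow>
           \<psi> W \<in> ring_iso (sec (formal_model n k) W) (sec \<O> {x \<in> U0. h x \<in> W}) \<and>
           linear_map (sec (formal_model n k) W) (sec \<O> {x \<in> U0. h x \<in> W}) (\<psi> W)) \<and>
        (\<forall>V W. openin (Euclidean_space n) V \<and> openin (Euclidean_space n) W \<and> V \<subseteq> W \<longrightarrow>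
           (\<forall>f\<in>carrier (sec (formal_model n k) W).
              \<psi> V (res (formal_model n k) W V f) =
              res \<O> {x \<in> U0. h x \<in> W} {x \<in> U0. h x \<in> V} (\<psi> W f)))"
    unfolding isomorphic_ringed_spaces_def top by (elim exE conjE) (rule that, assumption, rule conjI)
  have \<psi>: "\<psi> W \<in> ring_iso (sec (formal_model n k) W) (sec \<O> {x \<in> U0. h x \<in> W})"
    if "openin (Euclidean_space n) W" for W using \<psi>_nat that by simp
  have nat: "\<psi> V (res (formal_model n k) W V f) = res \<O> {x \<in> U0. h x \<in> W} {x \<in> U0. h x \<in> V} (\<psi> W f)"
    if "openin (Euclidean_space n) V" "openin (Euclidean_space n) W" "V \<subseteq> W"
      "f \<in> carrier (sec (formal_model n k) W)" for V W f
    using conjunct2[OF \<psi>_nat] that by simp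
  have hN: "h ` U0 = N" using homeomorphic_imp_surjective_map[OF h] unfolding top N_def .
  have inj: "inj_on h U0" using homeomorphic_imp_injective_map[OF h] unfolding top .
  have preN: "{x \<in> U0. h x \<in> N} = U0" using hN by auto
  have oN: "openin (Euclidean_space n) N" by (simp add: N_def)
  have open_pre: "openin M {x \<in> U0. h x \<in> W}" if "openin (Euclidean_space n) W" for W
  proof -
    have "openin (subtopology M U0) {x \<in> U0. h x \<in> W}"
      using homeomorphic_imp_continuous_map[OF h] that unfolding continuous_map_def top by blast
    then show ?thesis using U0(1) openin_trans_full by blast
  qed
  define p where "p = h a"
  have "openin (subtopology M U0) (U \<inter> U0)" using U by (auto simp: openin_subtopology)
  then have "openin (Euclidean_space n) (h ` (U \<inter> U0))"
    using homeomorphic_map_openness[OF h, of "U \<inter> U0", unfolded top] by simp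
  moreover have "p \<in> h ` (U \<inter> U0)" using U U0 by (auto simp: p_def)
  ultimately obtain \<epsilon> where \<epsilon>: "0 < \<epsilon>" "\<And>x. x \<in> N \<Longrightarrow> (\<And>i. i < n \<Longrightarrow> \<bar>x i - p i\<bar> < \<epsilon>) \<Longrightarrow> x \<in> h ` (U \<inter> U0)"
    unfolding N_def by (rule Euclidean_space_open_contains_box) blast
  \<comment> \<open>With a third of \<open>\<epsilon>\<close>, the closed box of radius
    \<open>2 * \<delta>\<close> that carries the bump fits inside the box of radius
    \<open>\<epsilon>\<close>, while the bump is \<open>1\<close> on the open box of radius
    \<open>\<delta>\<close>.\<close>
  define \<delta> where "\<delta> = \<epsilon> / 3"
  have \<delta>: "0 < \<delta>" "2 * \<delta> < \<epsilon>" using \<epsilon>(1) by (simp_all add: \<delta>_def)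
  define B where "B = {x \<in> N. \<forall>i<n. \<bar>x i - p i\<bar> \<le> 2 * \<delta>}"
  define C where "C = {x \<in> U0. h x \<in> B}"
  define V where "V = {x \<in> N. \<forall>i<n. \<bar>x i - p i\<bar> < \<delta>}"
  have "B \<subseteq> h ` (U \<inter> U0)"
  proof
    fix x assume x: "x \<in> B"
    show "x \<in> h ` (U \<inter> U0)"
    proof (rule \<epsilon>(2))
      fix i assume "i < n"
      then have "\<bar>x i - p i\<bar> \<le> 2 * \<delta>" using x by (simp add: B_def)
      then show "\<bar>x i - p i\<bar> < \<epsilon>" using \<delta>(2) by linarith
    qed (use x in \<open>simp add: B_def\<close>)
  qed
  then have CU: "C \<subseteq> U"
  proof (intro subsetI)
    fix x assume x: "x \<in> C"
    then obtain y where "y \<in> U \<inter> U0" "h x = h y" using \<open>B \<subseteq> h ` (U \<inter> U0)\<close> by (auto simp: C_def)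
    then show "x \<in> U" using inj x by (auto simp: C_def dest: inj_onD)
  qed
  have CU0: "C \<subseteq> U0" by (auto simp: C_def)
  have hC: "h ` C = B" using \<open>B \<subseteq> h ` (U \<inter> U0)\<close> by (auto simp: C_def)
  have "compactin (Euclidean_space n) B" unfolding B_def N_def by (rule compactin_Euclidean_box)
  then have "compactin (subtopology M U0) C"
    using homeomorphic_map_compactness[OF h, of C, unfolded top] CU0 by (simp add: hC)
  then have C: "compactin M C" by (simp add: compactin_subtopology)
  have oV: "openin (Euclidean_space n) V" unfolding V_def N_def by (rule openin_Euclidean_box)
  have "openin M (U0 - C)" using compactin_imp_closedin[OF haus C] U0(1) by (simp add: openin_diff)
  then have "openin (subtopology M U0) (U0 - C)" by (auto simp: openin_subtopology)
  then have "openin (Euclidean_space n) (h ` (U0 - C))"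
    using homeomorphic_map_openness[OF h, of "U0 - C", unfolded top] by simp
  moreover have "h ` (U0 - C) = N - B" using hN inj by (auto simp: C_def)
  ultimately have oNB: "openin (Euclidean_space n) (N - B)" by simp
  have preNB: "{x \<in> U0. h x \<in> N - B} = U0 - C" using hN by (auto simp: C_def)
  obtain \<beta> where \<beta>: "smooth \<beta>" "\<And>x. \<bar>x\<bar> \<le> 1 \<Longrightarrow> \<beta> x = 1" "\<And>x. 2 \<le> \<bar>x\<bar> \<Longrightarrow> \<beta> x = 0"
    using smooth_bump by blast
  define \<beta>i where "\<beta>i i x = \<beta> ((1 / \<delta>) * (x + (- p i)))" for i x
  have sm: "smooth (\<beta>i i)" for i
    unfolding \<beta>i_def[abs_def]
    by (intro smooth_compose[OF \<beta>(1)] smooth_mult smooth_const smooth_add smooth_id)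
  have \<beta>1: "\<beta>i i x = 1" if "\<bar>x - p i\<bar> < \<delta>" for i x
    unfolding \<beta>i_def using that \<delta>(1) by (intro \<beta>(2)) (simp add: abs_mult divide_simps)
  have \<beta>0: "\<beta>i i x = 0" if "2 * \<delta> < \<bar>x - p i\<bar>" for i x
    unfolding \<beta>i_def using that \<delta>(1) by (intro \<beta>(3)) (simp add: abs_mult divide_simps)
  \<comment> \<open>\<open>b 1\<close> is the bump and \<open>b 0\<close> the zero series; in this
    common form, vanishing is shown by comparing restrictions of the two.\<close>
  define b where "b c = (\<lambda>(J :: nat multiset) x. if J = {#} then complex_of_real (c * (\<Prod>i<n. \<beta>i i (x i))) else 0)"
    for c
  define F where "F c = coefficients k N (b c)" for c
  have F: "F c \<in> carrier (sec (formal_model n k) N)" for c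
    unfolding F_def b_def N_def by (rule formal_model_product_section[OF sm])
  define f0 z0 where "f0 = \<psi> N (F 1)" and "z0 = \<psi> N (F 0)"
  have hom: "\<psi> W \<in> ring_hom (sec (formal_model n k) W) (sec \<O> {x \<in> U0. h x \<in> W})" if "openin (Euclidean_space n) W" for W
    using \<psi>[OF that] by (simp add: ring_iso_def)
  have c0: "f0 \<in> carrier (sec \<O> U0)" "z0 \<in> carrier (sec \<O> U0)"
    using ring_hom_closed[OF hom[OF oN] F] by (simp_all add: f0_def z0_def preN)
  interpret U0: abelian_group "sec \<O> U0" by (rule sheafD(1)[OF P U0(1)])
  \<comment> \<open>The isomorphism is known to preserve sums, products and units; that it sends the
    zero series to zero is deduced from \<open>0 + 0 = 0\<close>.\<close>
  have "F 0 \<oplus>\<^bsub>sec (formal_model n k) N\<^esub> F 0 = F 0"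
    by (auto simp: formal_model_def F_def coefficients_def b_def fun_eq_iff)
  then have "z0 \<oplus>\<^bsub>sec \<O> U0\<^esub> z0 = z0"
    using ring_hom_add[OF hom[OF oN] F[of 0] F[of 0]] by (simp add: z0_def preN)
  then have z0: "z0 = \<zero>\<^bsub>sec \<O> U0\<^esub>" using c0(2) U0.add.r_cancel_one'[of z0 z0] by simp
  have res_model: "res (formal_model n k) N W (F c) = coefficients k W (b c)" if "W \<subseteq> N" for W c
    using that by (simp add: formal_model_def F_def coefficients_coefficients)
  have VN: "V \<subseteq> N" by (auto simp: V_def)
  have one: "res \<O> U0 {x \<in> U0. h x \<in> V} f0 = \<one>\<^bsub>sec \<O> {x \<in> U0. h x \<in> V}\<^esub>"
  proof -
    have "coefficients k V (b 1) = \<one>\<^bsub>sec (formal_model n k) V\<^esub>"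
    proof -
      have "coefficients k V (b 1) = coefficients k V (\<lambda>J x. if J = {#} then 1 else 0)"
        by (rule coefficients_cong) (auto simp: b_def V_def \<beta>1)
      then show ?thesis by (simp add: formal_model_def)
    qed
    then show ?thesis
      using nat[OF oV oN VN F[of 1]] ring_hom_one[OF hom[OF oV]] by (simp add: preN f0_def res_model[OF VN])
  qed
  have zero: "res \<O> U0 (U0 - C) f0 = \<zero>\<^bsub>sec \<O> (U0 - C)\<^esub>"
  proof -
    have eq: "coefficients k (N - B) (b 1) = coefficients k (N - B) (b 0)"
    proof (rule coefficients_cong)
      fix J x assume "x \<in> N - B"
      \<comment> \<open>Outside the closed box some coordinate is farther than
        \<open>2 * \<delta>\<close> from that of \<open>p\<close>, so the factor of the product at
        this coordinate is zero.\<close>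
      then obtain i where i: "i < n" "2 * \<delta> < \<bar>x i - p i\<bar>" by (auto simp: B_def not_le)
      then have "(\<Prod>i<n. \<beta>i i (x i)) = 0" using \<beta>0[OF i(2)] by (intro prod_zero) auto
      then show "b 1 J x = b 0 J x" by (simp add: b_def)
    qed
    have "res \<O> U0 (U0 - C) f0 = res \<O> U0 (U0 - C) z0"
      using nat[OF oNB oN Diff_subset F[of 1], unfolded preN preNB res_model[OF Diff_subset]]
        nat[OF oNB oN Diff_subset F[of 0], unfolded preN preNB res_model[OF Diff_subset]]
      by (simp only: f0_def z0_def eq)
    also have "\<dots> = \<zero>\<^bsub>sec \<O> (U0 - C)\<^esub>"
      unfolding z0 by (rule res_zero[OF P U0(1) \<open>openin M (U0 - C)\<close> Diff_subset])
    finally show ?thesis .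
  qed
  have XC: "openin M (topspace M - C)" using compactin_imp_closedin[OF haus C] by (simp add: openin_diff)
  define \<phi> where "\<phi> = ext_by_zero M \<O> (topspace M) U0 f0"
  note \<phi> = ext_by_zero_props[OF P openin_topspace U0(1) U0X CU0 XC c0(1) zero, folded \<phi>_def]
  show thesis
  proof (rule that)
    show "cutoff_in M \<O> U \<phi>" using \<phi>(1,3) C CU by (auto simp: cutoff_in_def)
    show o: "openin M {x \<in> U0. h x \<in> V}" by (rule open_pre[OF oV])
    show "a \<in> {x \<in> U0. h x \<in> V}" using U0(2) hN \<delta>(1) by (auto simp: V_def p_def)
    show "res \<O> (topspace M) {x \<in> U0. h x \<in> V} \<phi> = \<one>\<^bsub>sec \<O> {x \<in> U0. h x \<in> V}\<^esub>"
      using sheafD(4)[OF P openin_topspace U0(1) o _ U0X \<phi>(1)] \<phi>(2) one by auto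
  qed
qed

theorem proposition5p5:
  fixes M :: "'a topology"
    and \<O> :: "('a, complex, 'f) presheaf"
    and \<F> :: "('a, 'f, 's) presheaf"
    and E :: "'e tvs"
    and \<Gamma> :: "'i set"
    and U :: "'i \<Rightarrow> 'a set"
  assumes "formal_manifold M \<O>"
    and "sheaf_of_modules M \<O> \<F>"
    and "quasi_complete_lcs E"
    and "\<And>\<gamma>. \<gamma> \<in> \<Gamma> \<Longrightarrow> openin M (U \<gamma>)"
    and "(\<Union>\<gamma>\<in>\<Gamma>. U \<gamma>) = topspace M"
  shows "let S = direct_sum \<Gamma> (\<lambda>\<gamma>. distributions_c M \<O> \<F> E (U \<gamma>));
             T = distributions_c M \<O> \<F> E (topspace M);
             \<Phi> = sum_of_extensions M \<O> \<F> E \<Gamma> U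
         in linear_map S T \<Phi> \<and>
            continuous_map (top_of S) (top_of T) \<Phi> \<and>
            open_map (top_of S) (top_of T) \<Phi> \<and>
            \<Phi> ` carrier S = carrier T"
proof -
  have lrs: "locally_ringed_space M \<O>" using assms(1) by (simp add: formal_manifold_def)
  interpret distribution_space M \<O> \<F> E
  proof
    show "sheaf_of_complex_algebras M \<O>" using lrs by (simp add: locally_ringed_space_def)
    show "Hausdorff_space M" using assms(1) by (simp add: formal_manifold_def)
    show "\<exists>\<phi> W. cutoff_in M \<O> U \<phi> \<and> openin M W \<and> a \<in> W \<and> res \<O> (topspace M) W \<phi> = \<one>\<^bsub>sec \<O> W\<^esub>"
      if "openin M U" "a \<in> U" for U a
      using formal_manifold_bump[OF assms(1) that] by metis
    show "sheaf_of_modules M \<O> \<F>" by fact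
    show "value_at M \<O> U \<zero>\<^bsub>sec \<O> U\<^esub> a = 0" if "openin M U" "a \<in> U" for U a
      by (rule value_at_zero[OF lrs that])
    show "lcs E" using assms(3) by (simp add: quasi_complete_lcs_def)
  qed
  show ?thesis
    using linear_map_sum_of_extensions[of \<Gamma> U, OF assms(4)] continuous_map_sum_of_extensions[of \<Gamma> U, OF assms(4)]
      open_map_sum_of_extensions[of \<Gamma> U, OF assms(4,5)] surj_sum_of_extensions[of \<Gamma> U, OF assms(4,5)]
    by (simp add: Let_def del: direct_sum_simps)
qed

end
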